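(* Let $n\ge1$. For a left $M_n(\mathbb C)$-module $V$ write $L_{ij}(w)=E_{ij}\triangleright w$ for the action of the matrix unit $E_{ij}$ on $w\in V$. Consider the functor from left $M_n(\mathbb C)$-modules to right $M_n(\mathbb C)$-modules with right connection (universal calculus) sending $V$ to $F=V\otimes\mathrm{Row}^n(\mathbb C)$ with $\nabla_F(w\otimes r_i)=\sum_{p,j}L_{jp}(w)\otimes r_j\otimes\mathrm dE_{pi}$, followed by the functor $\otimes_{M_n(\mathbb C)}E$ to right $C^\infty(\mathbb{CP}^{n-1})$-modules with right connection, where $E=\mathrm{Col}^n(\mathbb C)\otimes C^\infty_{-1}(\mathbb{CP}^{n-1})$ carries the bimodule connection given in the context. This composition (taking the $\Omega^{0,1}$ part of the resulting connections) gives a functor from the category of left $M_n(\mathbb C)$-modules and module maps to holomorphic bundles on $\mathbb{CP}^{n-1}$. It sends $V$ to $V\otimes C^\infty_{-1}(\mathbb{CP}^{n-1})$ with the $\bar\partial$-connection $$\bar\partial_V(w\otimes\bar v_j)=\sum_q w\otimes\bar v_q\otimes v_q\,\mathrm d\bar v_j-\sum_{p,r}L_{pr}(w)\otimes\bar v_j\otimes v_r\,\mathrm d\bar v_p .$$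
   Context: $\mathbb{CP}^{n-1}$ is the unit sphere $S^{2n-1}\subset\mathbb C^n$ (coordinates $v_1,\dots,v_n$, $\sum v_i\bar v_i=1$) modulo $\underline v\sim z\underline v$, $|z|=1$, with its usual complex structure and smooth complex forms $\Omega^m=\bigoplus_{p+q=m}\Omega^{p,q}$, with projections $\pi^{p,q}$. $C^\infty_m(\mathbb{CP}^{n-1})$ is the space of smooth $f$ on $S^{2n-1}$ with $f(z\underline v)=z^mf(\underline v)$ for $|z|=1$; $C_0^\infty=C^\infty(\mathbb{CP}^{n-1})$. $C^\infty_{-1}$ is generated as a right $C^\infty(\mathbb{CP}^{n-1})$-module by $\bar v_1,\dots,\bar v_n$. Put $Q_{ij}=v_i\bar v_j$. The symbols $\mathrm dv_i$ (type $(1,0)$) and $\mathrm d\bar v_i$ (type $(0,1)$) satisfy $\sum\bar v_i\mathrm dv_i=0=\sum v_i\mathrm d\bar v_i$ and occur only in combinations of total grade zero ($v_i,\mathrm dv_i$ grade $1$; $\bar v_i,\mathrm d\bar v_i$ grade $-1$), which are forms on $\mathbb{CP}^{n-1}$: $v_q\mathrm d\bar v_s=\sum_kQ_{qk}\mathrm dQ_{ks}$, $\bar v_p\mathrm dv_r=\sum_k(\mathrm dQ_{rk})Q_{kp}$. $h_i\in\mathrm{Col}^n(\mathbb C)$ and $r_i\in\mathrm{Row}^n(\mathbb C)$ are the standard basis vectors, $E_{ij}$ the matrix units. $M_n(\mathbb C)$ has the universal calculus: $\Omega^1_{\mathrm{uni}}(M_n)=\ker(\cdot:M_n\otimes M_n\to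 M_n)$, $\mathrm da=1\otimes a-a\otimes1$. A right connection on a right $B$-module $G$ is a linear $\nabla_G:G\to G\otimes_B\Omega^1_B$ with $\nabla_G(gb)=g\otimes\mathrm db+\nabla_G(g)b$. Modules with right connection form a category $\mathcal E_B$; morphisms are right module maps $T$ with $\nabla T=(T\otimes\mathrm{id})\nabla$. On an $A$-$B$ bimodule $E$, a right bimodule connection is a right connection $\nabla_E$ with a bimodule map $\sigma_E:\Omega^1_A\otimes_AE\to E\otimes_B\Omega^1_B$ such that $\nabla_E(ae)=\sigma_E(\mathrm da\otimes e)+a\nabla_E(e)$. Then $\otimes_AE:\mathcal E_A\to\mathcal E_B$ sends $(F,\nabla_F)$ to $F\otimes_AE$ with $\nabla_{F\otimes E}(f\otimes e)=(\mathrm{id}\otimes\sigma_E)(\nabla_F(f)\otimes e)+f\otimes\nabla_E(e)$. The bimodule $E=\mathrm{Col}^n(\mathbb C)\otimes C^\infty_{-1}(\mathbb{CP}^{n-1})$ is an $M_n(\mathbb C)$-$C^\infty(\mathbb{CP}^{n-1})$ bimodule with right connection $\nabla_E(h_i\otimes\bar v_j)=\sum_{p,q}h_p\otimes\bar v_q\otimes\Gamma^{pq}{}_{ij}$, where $\Gamma^{pq}{}_{rs}=v_q(\delta_{pr}\mathrm d\bar v_s-\bar v_sv_r\mathrm d\bar v_p+\bar v_s\bar v_p\mathrm dv_r)$, and $\sigma_E$ is determined by $\sigma_E(\mathrm da\otimes e)=\nabla_E(ae)-a\nabla_E(e)$. One identifies $F\otimes_{M_n}E=V\otimes\mathrm{Row}^n(\mathbb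 C)\otimes_{M_n}\mathrm{Col}^n(\mathbb C)\otimes C^\infty_{-1}$ with $V\otimes C^\infty_{-1}$ by $r_a\otimes h_i\mapsto\delta_{ai}$. A holomorphic bundle (holomorphic right module) over $\mathbb{CP}^{n-1}$ is a right $C^\infty(\mathbb{CP}^{n-1})$-module $G$ with a right connection $\bar\partial_G:G\to G\otimes\Omega^{0,1}$ for the $\bar\partial$ calculus (i.e. $\bar\partial_G(gb)=g\otimes\bar\partial b+\bar\partial_G(g)b$) whose curvature $(\mathrm{id}\otimes\bar\partial+\bar\partial_G\wedge\mathrm{id})\bar\partial_G:G\to G\otimes\Omega^{0,2}$ vanishes; morphisms are right module maps commuting with the $\bar\partial$ operators. A right connection $\nabla_G$ gives $\bar\partial_G=(\mathrm{id}\otimes\pi^{0,1})\nabla_G$. *)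

theory Defs
  imports
    "HOL-Analysis.Analysis"
    "HOL-Algebra.Generated_Groups"
    "HOL-Algebra.Free_Abelian_Groups"
    "HOL-Algebra.Module"
begin

section \<open>One-sided modules, bimodules and tensor products over a ring with carrier\<close>

text \<open>
  As for the library record \<open>module\<close>, the fields \<open>mult\<close> and \<open>one\<close> inherited from \<open>ring\<close> are
  irrelevant for modules; they are filled with \<open>undefined\<close>.  The library record \<open>module\<close> is
  used for left modules, without the commutativity of the ring required by the library locale
  of the same name.
\<close>

record ('b, 'm) rmod = "'m ring" +
  ract :: "'m \<Rightarrow> 'b \<Rightarrow> 'm"

record ('a, 'b, 'm) bimod = "('b, 'm) rmod" +
  lact :: "'a \<Rightarrow> 'm \<Rightarrow> 'm"

definition left_module :: "('a, 'x) ring_scheme \<Rightarrow> ('a, 'm, 'y) module_scheme \<Rightarrow> bool" where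
  "left_module A V \<longleftrightarrow> ring A \<and> abelian_group V \<and>
     (\<forall>a\<in>carrier A. \<forall>v\<in>carrier V. a \<odot>\<^bsub>V\<^esub> v \<in> carrier V) \<and>
     (\<forall>a\<in>carrier A. \<forall>v\<in>carrier V. \<forall>w\<in>carrier V.
        a \<odot>\<^bsub>V\<^esub> (v \<oplus>\<^bsub>V\<^esub> w) = a \<odot>\<^bsub>V\<^esub> v \<oplus>\<^bsub>V\<^esub> a \<odot>\<^bsub>V\<^esub> w) \<and>
     (\<forall>a\<in>carrier A. \<forall>b\<in>carrier A. \<forall>v\<in>carrier V.
        (a \<oplus>\<^bsub>A\<^esub> b) \<odot>\<^bsub>V\<^esub> v = a \<odot>\<^bsub>V\<^esub> v \<oplus>\<^bsub>V\<^esub> b \<odot>\<^bsub>V\<^esub> v) \<and>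
     (\<forall>a\<in>carrier A. \<forall>b\<in>carrier A. \<forall>v\<in>carrier V.
        (a \<otimes>\<^bsub>A\<^esub> b) \<odot>\<^bsub>V\<^esub> v = a \<odot>\<^bsub>V\<^esub> (b \<odot>\<^bsub>V\<^esub> v)) \<and>
     (\<forall>v\<in>carrier V. \<one>\<^bsub>A\<^esub> \<odot>\<^bsub>V\<^esub> v = v)"

definition right_module :: "('b, 'x) ring_scheme \<Rightarrow> ('b, 'm, 'y) rmod_scheme \<Rightarrow> bool" where
  "right_module B G \<longleftrightarrow> ring B \<and> abelian_group G \<and>
     (\<forall>g\<in>carrier G. \<forall>b\<in>carrier B. ract G g b \<in> carrier G) \<and>
     (\<forall>g\<in>carrier G. \<forall>h\<in>carrier G. \<forall>b\<in>carrier B.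
        ract G (g \<oplus>\<^bsub>G\<^esub> h) b = ract G g b \<oplus>\<^bsub>G\<^esub> ract G h b) \<and>
     (\<forall>g\<in>carrier G. \<forall>b\<in>carrier B. \<forall>c\<in>carrier B.
        ract G g (b \<oplus>\<^bsub>B\<^esub> c) = ract G g b \<oplus>\<^bsub>G\<^esub> ract G g c) \<and>
     (\<forall>g\<in>carrier G. \<forall>b\<in>carrier B. \<forall>c\<in>carrier B.
        ract G g (b \<otimes>\<^bsub>B\<^esub> c) = ract G (ract G g b) c) \<and>
     (\<forall>g\<in>carrier G. ract G g \<one>\<^bsub>B\<^esub> = g)"

definition bimodule ::
  "('a, 'x) ring_scheme \<Rightarrow> ('b, 'y) ring_scheme \<Rightarrow> ('a, 'b, 'm, 'z) bimod_scheme \<Rightarrow> bool" where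
  "bimodule A B E \<longleftrightarrow> right_module B E \<and>
     left_module A \<lparr>carrier = carrier E, mult = mult E, one = one E, zero = zero E, add = add E,
       smult = lact E\<rparr> \<and>
     (\<forall>a\<in>carrier A. \<forall>b\<in>carrier B. \<forall>e\<in>carrier E.
        ract E (lact E a e) b = lact E a (ract E e b))"

definition left_module_hom ::
  "('a, 'x) ring_scheme \<Rightarrow> ('a, 'v, 'y) module_scheme \<Rightarrow> ('a, 'w, 'z) module_scheme \<Rightarrow> ('v \<Rightarrow> 'w) set"
  where
  "left_module_hom A V W = {T \<in> carrier V \<rightarrow>\<^sub>E carrier W.
     (\<forall>x\<in>carrier V. \<forall>y\<in>carrier V. T (x \<oplus>\<^bsub>V\<^esub> y) = T x \<oplus>\<^bsub>W\<^esub> T y) \<and>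
     (\<forall>a\<in>carrier A. \<forall>x\<in>carrier V. T (a \<odot>\<^bsub>V\<^esub> x) = a \<odot>\<^bsub>W\<^esub> T x)}"

definition right_module_hom ::
  "('b, 'x) ring_scheme \<Rightarrow> ('b, 'g, 'y) rmod_scheme \<Rightarrow> ('b, 'h, 'z) rmod_scheme \<Rightarrow> ('g \<Rightarrow> 'h) set"
  where
  "right_module_hom B G H = {T \<in> carrier G \<rightarrow>\<^sub>E carrier H.
     (\<forall>x\<in>carrier G. \<forall>y\<in>carrier G. T (x \<oplus>\<^bsub>G\<^esub> y) = T x \<oplus>\<^bsub>H\<^esub> T y) \<and>
     (\<forall>x\<in>carrier G. \<forall>b\<in>carrier B. T (ract G x b) = ract H (T x) b)}"

definition bimodule_hom ::
  "('a, 'u) ring_scheme \<Rightarrow> ('b, 'x) ring_scheme \<Rightarrow> ('a, 'b, 'g, 'y) bimod_scheme \<Rightarrow>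
   ('a, 'b, 'h, 'z) bimod_scheme \<Rightarrow> ('g \<Rightarrow> 'h) set" where
  "bimodule_hom A B G H = {T \<in> right_module_hom B G H.
     \<forall>a\<in>carrier A. \<forall>x\<in>carrier G. T (lact G a x) = lact H a (T x)}"

text \<open>
  \<open>M \<otimes>\<^sub>R N\<close> is the free abelian group on \<open>carrier M \<times> carrier N\<close> modulo the subgroup generated by
  the biadditivity relations and the balancing relations \<open>m r \<otimes> n = m \<otimes> r n\<close>.
\<close>

type_synonym ('m, 'n) tens = "(('m \<times> 'n) \<Rightarrow>\<^sub>0 int) set"

definition tensor_relators ::
  "('r, 'x) ring_scheme \<Rightarrow> ('r, 'm, 'y) rmod_scheme \<Rightarrow> ('r, 's, 'n, 'z) bimod_scheme \<Rightarrow>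
   (('m \<times> 'n) \<Rightarrow>\<^sub>0 int) set" where
  "tensor_relators R M N =
     {frag_of (m \<oplus>\<^bsub>M\<^esub> m', n) - frag_of (m, n) - frag_of (m', n) | m m' n.
        m \<in> carrier M \<and> m' \<in> carrier M \<and> n \<in> carrier N} \<union>
     {frag_of (m, n \<oplus>\<^bsub>N\<^esub> n') - frag_of (m, n) - frag_of (m, n') | m n n'.
        m \<in> carrier M \<and> n \<in> carrier N \<and> n' \<in> carrier N} \<union>
     {frag_of (ract M m r, n) - frag_of (m, lact N r n) | m r n.
        m \<in> carrier M \<and> r \<in> carrier R \<and> n \<in> carrier N}"

definition tensor_kernel ::
  "('r, 'x) ring_scheme \<Rightarrow> ('r, 'm, 'y) rmod_scheme \<Rightarrow> ('r, 's, 'n, 'z) bimod_scheme \<Rightarrow>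
   (('m \<times> 'n) \<Rightarrow>\<^sub>0 int) set" where
  "tensor_kernel R M N =
     generate (free_Abelian_group (carrier M \<times> carrier N)) (tensor_relators R M N)"

definition pure_tensor ::
  "('r, 'x) ring_scheme \<Rightarrow> ('r, 'm, 'y) rmod_scheme \<Rightarrow> ('r, 's, 'n, 'z) bimod_scheme \<Rightarrow>
   'm \<Rightarrow> 'n \<Rightarrow> ('m, 'n) tens" where
  "pure_tensor R M N m n =
     tensor_kernel R M N #>\<^bsub>free_Abelian_group (carrier M \<times> carrier N)\<^esub> frag_of (m, n)"

definition tensor_group ::
  "('r, 'x) ring_scheme \<Rightarrow> ('r, 'm, 'y) rmod_scheme \<Rightarrow> ('r, 's, 'n, 'z) bimod_scheme \<Rightarrow>
   ('m, 'n) tens ring" where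
  "tensor_group R M N =
     (let Q = free_Abelian_group (carrier M \<times> carrier N) Mod tensor_kernel R M N
      in \<lparr>carrier = carrier Q, mult = undefined, one = undefined, zero = one Q, add = mult Q\<rparr>)"

text \<open>
  The additive map \<open>m \<otimes> n \<mapsto> \<phi> m n\<close> from a tensor product to an abelian group \<open>X\<close>; meaningful
  when \<open>\<phi>\<close> is biadditive and balanced, so that the value does not depend on the representative.
\<close>

definition tensor_lift :: "('x, 'z) ring_scheme \<Rightarrow> ('m \<Rightarrow> 'n \<Rightarrow> 'x) \<Rightarrow> ('m, 'n) tens \<Rightarrow> 'x" where
  "tensor_lift X \<phi> t = (THE x. \<forall>c\<in>t.
     x = (\<Oplus>\<^bsub>X\<^esub>k\<in>Poly_Mapping.keys c. [Poly_Mapping.lookup c k] \<cdot>\<^bsub>X\<^esub> \<phi> (fst k) (snd k)))"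

definition rtensor ::
  "('r, 'x) ring_scheme \<Rightarrow> ('r, 'm, 'y) rmod_scheme \<Rightarrow> ('r, 's, 'n, 'z) bimod_scheme \<Rightarrow>
   ('s, ('m, 'n) tens) rmod" where
  "rtensor R M N =
     (let T = tensor_group R M N
      in \<lparr>carrier = carrier T, mult = undefined, one = undefined, zero = zero T, add = add T,
          ract = (\<lambda>t b. tensor_lift T (\<lambda>m n. pure_tensor R M N m (ract N n b)) t)\<rparr>)"

definition btensor ::
  "('r, 'x) ring_scheme \<Rightarrow> ('a, 'r, 'm, 'y) bimod_scheme \<Rightarrow> ('r, 's, 'n, 'z) bimod_scheme \<Rightarrow>
   ('a, 's, ('m, 'n) tens) bimod" where
  "btensor R M N =
     (let T = tensor_group R M N
      in \<lparr>carrier = carrier T, mult = undefined, one = undefined, zero = zero T, add = add T,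
          ract = (\<lambda>t b. tensor_lift T (\<lambda>m n. pure_tensor R M N m (ract N n b)) t),
          lact = (\<lambda>a t. tensor_lift T (\<lambda>m n. pure_tensor R M N (lact M a m) n) t)\<rparr>)"

definition map_tensor_id ::
  "('r, 'x) ring_scheme \<Rightarrow> ('r, 'm, 'y) rmod_scheme \<Rightarrow> ('r, 'm', 'y') rmod_scheme \<Rightarrow>
   ('r, 's, 'n, 'z) bimod_scheme \<Rightarrow> ('m \<Rightarrow> 'm') \<Rightarrow> ('m, 'n) tens \<Rightarrow> ('m', 'n) tens" where
  "map_tensor_id R M M' N T =
     restrict (tensor_lift (tensor_group R M' N) (\<lambda>m n. pure_tensor R M' N (T m) n))
       (carrier (tensor_group R M N))"

text \<open>\<open>F \<otimes>\<^sub>A (E \<otimes>\<^sub>B \<Omega>) \<rightarrow> (F \<otimes>\<^sub>A E) \<otimes>\<^sub>B \<Omega>\<close>, evaluated on \<open>f \<otimes> t\<close>.\<close>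

definition tensor_assoc ::
  "('a, 'x) ring_scheme \<Rightarrow> ('b, 'y) ring_scheme \<Rightarrow> ('a, 'f, 'z) rmod_scheme \<Rightarrow>
   ('a, 'b, 'e) bimod \<Rightarrow> ('b, 'b, 'w) bimod \<Rightarrow> 'f \<Rightarrow> ('e, 'w) tens \<Rightarrow> (('f, 'e) tens, 'w) tens" where
  "tensor_assoc A B F E \<Omega> f t =
     tensor_lift (tensor_group B (rtensor A F E) \<Omega>)
       (\<lambda>e \<xi>. pure_tensor B (rtensor A F E) \<Omega> (pure_tensor A F E f e) \<xi>) t"


section \<open>Categories and functors\<close>

text \<open>Composition \<open>cmp C X g f\<close> of \<open>f : X \<rightarrow> Y\<close> and \<open>g : Y \<rightarrow> Z\<close> takes the source object \<open>X\<close>,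
  so that set-theoretic composition can be restricted to the carrier of \<open>X\<close>.\<close>

record ('o, 'm) category =
  obj :: "'o set"
  mor :: "'o \<Rightarrow> 'o \<Rightarrow> 'm set"
  ident :: "'o \<Rightarrow> 'm"
  cmp :: "'o \<Rightarrow> 'm \<Rightarrow> 'm \<Rightarrow> 'm"

definition is_category :: "('o, 'm) category \<Rightarrow> bool" where
  "is_category C \<longleftrightarrow>
     (\<forall>X\<in>obj C. ident C X \<in> mor C X X) \<and>
     (\<forall>X\<in>obj C. \<forall>Y\<in>obj C. \<forall>Z\<in>obj C. \<forall>f\<in>mor C X Y. \<forall>g\<in>mor C Y Z. cmp C X g f \<in> mor C X Z) \<and>
     (\<forall>X\<in>obj C. \<forall>Y\<in>obj C. \<forall>f\<in>mor C X Y.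
        cmp C X f (ident C X) = f \<and> cmp C X (ident C Y) f = f) \<and>
     (\<forall>X\<in>obj C. \<forall>Y\<in>obj C. \<forall>Z\<in>obj C. \<forall>W\<in>obj C.
        \<forall>f\<in>mor C X Y. \<forall>g\<in>mor C Y Z. \<forall>h\<in>mor C Z W.
        cmp C X h (cmp C X g f) = cmp C X (cmp C Y h g) f)"

definition is_functor ::
  "('o, 'm) category \<Rightarrow> ('p, 'k) category \<Rightarrow> ('o \<Rightarrow> 'p) \<Rightarrow> ('o \<Rightarrow> 'o \<Rightarrow> 'm \<Rightarrow> 'k) \<Rightarrow> bool" where
  "is_functor C D Fo Fm \<longleftrightarrow> is_category C \<and> is_category D \<and>
     (\<forall>X\<in>obj C. Fo X \<in> obj D) \<and>
     (\<forall>X\<in>obj C. \<forall>Y\<in>obj C. \<forall>f\<in>mor C X Y. Fm X Y f \<in> mor D (Fo X) (Fo Y)) \<and>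
     (\<forall>X\<in>obj C. Fm X X (ident C X) = ident D (Fo X)) \<and>
     (\<forall>X\<in>obj C. \<forall>Y\<in>obj C. \<forall>Z\<in>obj C. \<forall>f\<in>mor C X Y. \<forall>g\<in>mor C Y Z.
        Fm X Z (cmp C X g f) = cmp D (Fo X) (Fm Y Z g) (Fm X Y f))"

definition left_module_category ::
  "('a, 'x) ring_scheme \<Rightarrow> (('a, 'v) module, 'v \<Rightarrow> 'v) category" where
  "left_module_category A =
     \<lparr>obj = {V. left_module A V}, mor = left_module_hom A,
      ident = (\<lambda>V. restrict id (carrier V)), cmp = (\<lambda>V T S. compose (carrier V) T S)\<rparr>"


section \<open>Right connections\<close>

text \<open>
  In the Leibniz rule the scalars are elements of \<open>B\<close>, which contains the complex numbers in all
  cases below, and differentials of scalars vanish; so additivity already gives complex linearity.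
\<close>

definition right_connection ::
  "('b, 'x) ring_scheme \<Rightarrow> ('b, 'b, 'w) bimod \<Rightarrow> ('b \<Rightarrow> 'w) \<Rightarrow> ('b, 'g, 'y) rmod_scheme \<Rightarrow>
   ('g \<Rightarrow> ('g, 'w) tens) \<Rightarrow> bool" where
  "right_connection B \<Omega> d G nab \<longleftrightarrow>
     right_module B G \<and> bimodule B B \<Omega> \<and>
     nab \<in> carrier G \<rightarrow>\<^sub>E carrier (rtensor B G \<Omega>) \<and>
     (\<forall>g\<in>carrier G. \<forall>h\<in>carrier G. nab (g \<oplus>\<^bsub>G\<^esub> h) = nab g \<oplus>\<^bsub>rtensor B G \<Omega>\<^esub> nab h) \<and>
     (\<forall>g\<in>carrier G. \<forall>b\<in>carrier B.
        nab (ract G g b) = pure_tensor B G \<Omega> g (d b) \<oplus>\<^bsub>rtensor B G \<Omega>\<^esub> ract (rtensor B G \<Omega>) (nab g) b)"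

definition right_bimodule_connection ::
  "('a, 'x) ring_scheme \<Rightarrow> ('a, 'a, 'u) bimod \<Rightarrow> ('a \<Rightarrow> 'u) \<Rightarrow>
   ('b, 'y) ring_scheme \<Rightarrow> ('b, 'b, 'w) bimod \<Rightarrow> ('b \<Rightarrow> 'w) \<Rightarrow>
   ('a, 'b, 'e) bimod \<Rightarrow> ('e \<Rightarrow> ('e, 'w) tens) \<Rightarrow> (('u, 'e) tens \<Rightarrow> ('e, 'w) tens) \<Rightarrow> bool" where
  "right_bimodule_connection A \<Omega>A dA B \<Omega>B dB E nab \<sigma> \<longleftrightarrow>
     bimodule A B E \<and> right_connection B \<Omega>B dB E nab \<and>
     \<sigma> \<in> bimodule_hom A B (btensor A \<Omega>A E) (btensor B E \<Omega>B) \<and>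
     (\<forall>a\<in>carrier A. \<forall>e\<in>carrier E.
        nab (lact E a e) =
          \<sigma> (pure_tensor A \<Omega>A E (dA a) e) \<oplus>\<^bsub>btensor B E \<Omega>B\<^esub> lact (btensor B E \<Omega>B) a (nab e))"

definition connection_category ::
  "('b, 'x) ring_scheme \<Rightarrow> ('b, 'b, 'w) bimod \<Rightarrow> ('b \<Rightarrow> 'w) \<Rightarrow>
   (('b, 'g) rmod \<times> ('g \<Rightarrow> ('g, 'w) tens), 'g \<Rightarrow> 'g) category" where
  "connection_category B \<Omega> d =
     \<lparr>obj = {(G, nab). right_connection B \<Omega> d G nab},
      mor = (\<lambda>(G, nab) (H, nab'). {T \<in> right_module_hom B G H.
               \<forall>g\<in>carrier G. nab' (T g) = map_tensor_id B G H \<Omega> T (nab g)}),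
      ident = (\<lambda>(G, nab). restrict id (carrier G)),
      cmp = (\<lambda>(G, nab) T S. compose (carrier G) T S)\<rparr>"

definition connection_iso ::
  "('b, 'x) ring_scheme \<Rightarrow> ('b, 'b, 'w) bimod \<Rightarrow> ('b, 'g) rmod \<times> ('g \<Rightarrow> ('g, 'w) tens) \<Rightarrow>
   ('b, 'h) rmod \<times> ('h \<Rightarrow> ('h, 'w) tens) \<Rightarrow> ('g \<Rightarrow> 'h) \<Rightarrow> bool" where
  "connection_iso B \<Omega> = (\<lambda>(G, nab) (H, nab') T. T \<in> right_module_hom B G H \<and>
     bij_betw T (carrier G) (carrier H) \<and>
     (\<forall>g\<in>carrier G. nab' (T g) = map_tensor_id B G H \<Omega> T (nab g)))"

text \<open>The functor \<open>\<otimes>\<^sub>A E\<close> on objects and on morphisms.\<close>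

definition tensor_bimodule_obj ::
  "('a, 'x) ring_scheme \<Rightarrow> ('a, 'a, 'u) bimod \<Rightarrow> ('b, 'y) ring_scheme \<Rightarrow> ('b, 'b, 'w) bimod \<Rightarrow>
   ('a, 'b, 'e) bimod \<Rightarrow> ('e \<Rightarrow> ('e, 'w) tens) \<Rightarrow> (('u, 'e) tens \<Rightarrow> ('e, 'w) tens) \<Rightarrow>
   ('a, 'f) rmod \<times> ('f \<Rightarrow> ('f, 'u) tens) \<Rightarrow>
   ('b, ('f, 'e) tens) rmod \<times> (('f, 'e) tens \<Rightarrow> (('f, 'e) tens, 'w) tens)" where
  "tensor_bimodule_obj A \<Omega>A B \<Omega>B E nabE \<sigma>E = (\<lambda>(F, nabF).
     (rtensor A F E,
      restrict
        (tensor_lift (tensor_group B (rtensor A F E) \<Omega>B)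
          (\<lambda>f e. tensor_lift (tensor_group B (rtensor A F E) \<Omega>B)
                   (\<lambda>f' \<omega>. tensor_assoc A B F E \<Omega>B f' (\<sigma>E (pure_tensor A \<Omega>A E \<omega> e))) (nabF f)
                 \<oplus>\<^bsub>tensor_group B (rtensor A F E) \<Omega>B\<^esub>
                 tensor_assoc A B F E \<Omega>B f (nabE e)))
        (carrier (rtensor A F E))))"

definition tensor_bimodule_mor ::
  "('a, 'x) ring_scheme \<Rightarrow> ('a, 'b, 'e) bimod \<Rightarrow>
   ('a, 'f) rmod \<times> ('f \<Rightarrow> ('f, 'u) tens) \<Rightarrow> ('a, 'f) rmod \<times> ('f \<Rightarrow> ('f, 'u) tens) \<Rightarrow>
   ('f \<Rightarrow> 'f) \<Rightarrow> ('f, 'e) tens \<Rightarrow> ('f, 'e) tens" where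
  "tensor_bimodule_mor A E X Y T = map_tensor_id A (fst X) (fst Y) E T"


section \<open>Matrices and their universal calculus\<close>

definition complex_ring :: "complex ring" where
  "complex_ring = \<lparr>carrier = UNIV, mult = (*), one = 1, zero = 0, add = (+)\<rparr>"

definition Mat :: "(complex^'n^'n) ring" where
  "Mat = \<lparr>carrier = UNIV, mult = (**), one = mat 1, zero = 0, add = (+)\<rparr>"

definition matrix_unit :: "'n \<Rightarrow> 'n \<Rightarrow> complex^'n^'n" where
  "matrix_unit i j = (\<chi> k l. if k = i \<and> l = j then 1 else 0)"

definition Mat_left :: "(complex^'n^'n, complex, complex^'n^'n) bimod" where
  "Mat_left = \<lparr>carrier = UNIV, mult = undefined, one = undefined, zero = 0, add = (+),
     ract = (\<lambda>a c. mat c ** a), lact = (**)\<rparr>"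

definition Mat_right :: "(complex, complex^'n^'n, complex^'n^'n) bimod" where
  "Mat_right = \<lparr>carrier = UNIV, mult = undefined, one = undefined, zero = 0, add = (+),
     ract = (**), lact = (\<lambda>c a. mat c ** a)\<rparr>"

type_synonym 'n uniform = "(complex^'n^'n, complex^'n^'n) tens"

definition Omega_uni :: "(complex^'n^'n, complex^'n^'n, 'n uniform) bimod" where
  "Omega_uni =
     (let T = btensor complex_ring Mat_left Mat_right
      in T\<lparr>carrier := {t \<in> carrier T. tensor_lift Mat (\<lambda>a b. a ** b) t = 0}\<rparr>)"

definition d_uni :: "complex^'n^'n \<Rightarrow> 'n uniform" where
  "d_uni a = pure_tensor complex_ring Mat_left Mat_right (mat 1) a
     \<ominus>\<^bsub>btensor complex_ring Mat_left Mat_right\<^esub> pure_tensor complex_ring Mat_left Mat_right a (mat 1)"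

definition Row :: "(complex, complex^'n^'n, complex^'n) bimod" where
  "Row = \<lparr>carrier = UNIV, mult = undefined, one = undefined, zero = 0, add = (+),
     ract = (v*), lact = (*s)\<rparr>"

definition Col :: "(complex^'n^'n, complex, complex^'n) bimod" where
  "Col = \<lparr>carrier = UNIV, mult = undefined, one = undefined, zero = 0, add = (+),
     ract = (\<lambda>h c. c *s h), lact = (*v)\<rparr>"

text \<open>A left module over the matrix algebra as a complex vector space, through scalar matrices.\<close>

definition underlying_space :: "(complex^'n^'n, 'v) module \<Rightarrow> (complex, 'v) rmod" where
  "underlying_space V = \<lparr>carrier = carrier V, mult = undefined, one = undefined,
     zero = zero V, add = add V, ract = (\<lambda>w c. mat c \<odot>\<^bsub>V\<^esub> w)\<rparr>"


section \<open>Functions and forms on complex projective space\<close>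

text \<open>
  Functions on the unit sphere are extensional functions; they are differentiated through their
  radial extension, which is constant along real rays.
\<close>

definition Sph :: "(complex^'n) set" where
  "Sph = sphere 0 1"

definition radial :: "(complex^'n \<Rightarrow> 'a) \<Rightarrow> complex^'n \<Rightarrow> 'a" where
  "radial f u = f ((1 / norm u) *\<^sub>R u)"

primrec Ck_on :: "nat \<Rightarrow> (complex^'n) set \<Rightarrow> (complex^'n \<Rightarrow> complex) \<Rightarrow> bool" where
  "Ck_on 0 U f \<longleftrightarrow> continuous_on U f"
| "Ck_on (Suc k) U f \<longleftrightarrow> (\<forall>u\<in>U. f differentiable (at u)) \<and>
     (\<forall>X. Ck_on k U (\<lambda>u. frechet_derivative f (at u) X))"

definition smooth_on_sphere :: "(complex^'n \<Rightarrow> complex) \<Rightarrow> bool" where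
  "smooth_on_sphere f \<longleftrightarrow> (\<forall>k. Ck_on k (- {0}) (radial f))"

definition Cinf :: "int \<Rightarrow> (complex^'n \<Rightarrow> complex) set" where
  "Cinf m = {f \<in> extensional Sph. smooth_on_sphere f \<and>
     (\<forall>z. \<forall>v\<in>Sph. cmod z = 1 \<longrightarrow> f (z *s v) = z powi m * f v)}"

definition CP :: "(complex^'n \<Rightarrow> complex) ring" where
  "CP = \<lparr>carrier = Cinf 0, mult = (\<lambda>f g. \<lambda>v\<in>Sph. f v * g v), one = (\<lambda>v\<in>Sph. 1),
     zero = (\<lambda>v\<in>Sph. 0), add = (\<lambda>f g. \<lambda>v\<in>Sph. f v + g v)\<rparr>"

definition Cinf_module :: "int \<Rightarrow> (complex, complex^'n \<Rightarrow> complex, complex^'n \<Rightarrow> complex) bimod" where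
  "Cinf_module m = \<lparr>carrier = Cinf m, mult = undefined, one = undefined,
     zero = (\<lambda>v\<in>Sph. 0), add = (\<lambda>f g. \<lambda>v\<in>Sph. f v + g v),
     ract = (\<lambda>f b. \<lambda>v\<in>Sph. f v * b v), lact = (\<lambda>c f. \<lambda>v\<in>Sph. c * f v)\<rparr>"

text \<open>
  For \<open>v \<in> Sph\<close> the differential of the quotient map identifies the tangent space of projective
  space at \<open>[v]\<close> with \<open>\<complex>\<^sup>n / \<complex>v\<close>, compatibly with the complex structures.  A form is thus a
  family of real multilinear alternating maps on \<open>\<complex>\<^sup>n\<close>, indexed by \<open>v \<in> Sph\<close>, which vanish as soon
  as one argument lies in \<open>\<complex>v\<close> and are invariant under \<open>(v, X) \<mapsto> (zv, zX)\<close> for \<open>|z| = 1\<close>.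
\<close>

type_synonym 'n form1 = "complex^'n \<Rightarrow> complex^'n \<Rightarrow> complex"
type_synonym 'n form2 = "complex^'n \<Rightarrow> complex^'n \<Rightarrow> complex^'n \<Rightarrow> complex"

definition forms1 :: "'n::finite form1 set" where
  "forms1 = {\<omega> \<in> extensional Sph.
     (\<forall>v\<in>Sph. linear (\<omega> v) \<and> (\<forall>c. \<omega> v (c *s v) = 0)) \<and>
     (\<forall>z. \<forall>v\<in>Sph. \<forall>X. cmod z = 1 \<longrightarrow> \<omega> (z *s v) (z *s X) = \<omega> v X) \<and>
     (\<forall>X. smooth_on_sphere (\<lambda>v. \<omega> v X))}"

definition forms2 :: "'n::finite form2 set" where
  "forms2 = {\<eta> \<in> extensional Sph.
     (\<forall>v\<in>Sph. bilinear (\<eta> v) \<and> (\<forall>X. \<eta> v X X = 0) \<and> (\<forall>c X. \<eta> v (c *s v) X = 0)) \<and>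
     (\<forall>z. \<forall>v\<in>Sph. \<forall>X Y. cmod z = 1 \<longrightarrow> \<eta> (z *s v) (z *s X) (z *s Y) = \<eta> v X Y) \<and>
     (\<forall>X Y. smooth_on_sphere (\<lambda>v. \<eta> v X Y))}"

definition forms01 :: "'n::finite form1 set" where
  "forms01 = {\<omega> \<in> forms1. \<forall>v\<in>Sph. \<forall>X. \<omega> v (\<i> *s X) = - \<i> * \<omega> v X}"

definition forms02 :: "'n::finite form2 set" where
  "forms02 = {\<eta> \<in> forms2. \<forall>v\<in>Sph. \<forall>X Y. \<eta> v (\<i> *s X) Y = - \<i> * \<eta> v X Y}"

definition proj01 :: "'n::finite form1 \<Rightarrow> 'n form1" where
  "proj01 \<omega> = (\<lambda>v\<in>Sph. \<lambda>X. (\<omega> v X + \<i> * \<omega> v (\<i> *s X)) / 2)"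

definition proj02 :: "'n::finite form2 \<Rightarrow> 'n form2" where
  "proj02 \<eta> = (\<lambda>v\<in>Sph. \<lambda>X Y.
     (\<eta> v X Y + \<i> * \<eta> v (\<i> *s X) Y + \<i> * \<eta> v X (\<i> *s Y) - \<eta> v (\<i> *s X) (\<i> *s Y)) / 4)"

definition form1_bimod ::
  "'n::finite form1 set \<Rightarrow> (complex^'n \<Rightarrow> complex, complex^'n \<Rightarrow> complex, 'n form1) bimod" where
  "form1_bimod W = \<lparr>carrier = W, mult = undefined, one = undefined,
     zero = (\<lambda>v\<in>Sph. \<lambda>X. 0), add = (\<lambda>\<omega> \<omega>'. \<lambda>v\<in>Sph. \<lambda>X. \<omega> v X + \<omega>' v X),
     ract = (\<lambda>\<omega> b. \<lambda>v\<in>Sph. \<lambda>X. \<omega> v X * b v), lact = (\<lambda>b \<omega>. \<lambda>v\<in>Sph. \<lambda>X. b v * \<omega> v X)\<rparr>"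

definition form2_bimod ::
  "'n::finite form2 set \<Rightarrow> (complex^'n \<Rightarrow> complex, complex^'n \<Rightarrow> complex, 'n form2) bimod" where
  "form2_bimod W = \<lparr>carrier = W, mult = undefined, one = undefined,
     zero = (\<lambda>v\<in>Sph. \<lambda>X Y. 0), add = (\<lambda>\<eta> \<eta>'. \<lambda>v\<in>Sph. \<lambda>X Y. \<eta> v X Y + \<eta>' v X Y),
     ract = (\<lambda>\<eta> b. \<lambda>v\<in>Sph. \<lambda>X Y. \<eta> v X Y * b v), lact = (\<lambda>b \<eta>. \<lambda>v\<in>Sph. \<lambda>X Y. b v * \<eta> v X Y)\<rparr>"

definition Omega1 :: "(complex^'n \<Rightarrow> complex, complex^'n \<Rightarrow> complex, 'n::finite form1) bimod" where
  "Omega1 = form1_bimod forms1"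

definition Omega01 :: "(complex^'n \<Rightarrow> complex, complex^'n \<Rightarrow> complex, 'n::finite form1) bimod" where
  "Omega01 = form1_bimod forms01"

definition Omega02 :: "(complex^'n \<Rightarrow> complex, complex^'n \<Rightarrow> complex, 'n::finite form2) bimod" where
  "Omega02 = form2_bimod forms02"

text \<open>
  In \<open>d1\<close> the 1-form is first extended to the punctured space by \<open>u \<mapsto> \<omega> (u/|u|) (X/|u|)\<close>, which
  is its pullback under the quotient map from the punctured space to projective space.
\<close>

definition d0 :: "(complex^'n \<Rightarrow> complex) \<Rightarrow> 'n::finite form1" where
  "d0 f = (\<lambda>v\<in>Sph. \<lambda>X. frechet_derivative (radial f) (at v) X)"

definition d1 :: "'n::finite form1 \<Rightarrow> 'n form2" where
  "d1 \<omega> = (\<lambda>v\<in>Sph. \<lambda>X Y.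
     frechet_derivative (\<lambda>u. radial \<omega> u ((1 / norm u) *\<^sub>R Y)) (at v) X
     - frechet_derivative (\<lambda>u. radial \<omega> u ((1 / norm u) *\<^sub>R X)) (at v) Y)"

definition wedge :: "'n::finite form1 \<Rightarrow> 'n form1 \<Rightarrow> 'n form2" where
  "wedge \<omega> \<omega>' = (\<lambda>v\<in>Sph. \<lambda>X Y. \<omega> v X * \<omega>' v Y - \<omega> v Y * \<omega>' v X)"

definition dbar0 :: "(complex^'n \<Rightarrow> complex) \<Rightarrow> 'n::finite form1" where
  "dbar0 f = proj01 (d0 f)"

definition dbar1 :: "'n::finite form1 \<Rightarrow> 'n form2" where
  "dbar1 \<omega> = proj02 (d1 \<omega>)"

text \<open>
  The symbols \<open>\<d>v\<^sub>i\<close> and \<open>\<d>\<bar>v\<^sub>i\<close>: components, and conjugated components, of the projection of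
  the tangent vector to the orthogonal complement of \<open>\<complex>v\<close>.
\<close>

definition horizontal :: "complex^'n \<Rightarrow> complex^'n \<Rightarrow> complex^'n" where
  "horizontal v X = X - (\<Sum>k\<in>UNIV. X $ k * cnj (v $ k)) *s v"

definition dv :: "'n \<Rightarrow> 'n::finite form1" where
  "dv i v X = horizontal v X $ i"

definition dvbar :: "'n \<Rightarrow> 'n::finite form1" where
  "dvbar i v X = cnj (horizontal v X $ i)"

definition vbar :: "'n \<Rightarrow> complex^'n \<Rightarrow> complex" where
  "vbar j = (\<lambda>v\<in>Sph. cnj (v $ j))"

definition v_dvbar :: "'n \<Rightarrow> 'n \<Rightarrow> 'n::finite form1" where
  "v_dvbar q s = (\<lambda>v\<in>Sph. \<lambda>X. v $ q * dvbar s v X)"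

definition Q :: "'n \<Rightarrow> 'n \<Rightarrow> complex^'n \<Rightarrow> complex" where
  "Q i j = (\<lambda>v\<in>Sph. v $ i * cnj (v $ j))"

lemma Q_apply: "v \<in> Sph \<Longrightarrow> Q i j v = v $ i * cnj (v $ j)"
  by (simp add: Q_def)

lemma sphere_sum: "v \<in> Sph \<Longrightarrow> (\<Sum>k\<in>UNIV. v $ k * cnj (v $ k)) = 1"
proof -
  assume "v \<in> Sph"
  then have "(\<Sum>k\<in>UNIV. (cmod (v $ k))\<^sup>2) = 1"
    by (simp add: Sph_def norm_vec_def L2_set_def)
  then have "complex_of_real (\<Sum>k\<in>UNIV. (cmod (v $ k))\<^sup>2) = 1"
    by simp
  then show ?thesis
    by (simp add: complex_norm_square[symmetric])
qed

lemma d0_Q: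
  assumes v: "v \<in> Sph"
  shows "d0 (Q k s) v X = dv k v X * cnj (v $ s) + v $ k * dvbar s v X"
proof -
  let ?c = "\<Sum>l\<in>UNIV. X $ l * cnj (v $ l)"
  let ?g = "\<lambda>u::complex^'a. u $ k * cnj (u $ s) / (\<Sum>l\<in>UNIV. u $ l * cnj (u $ l))"
  let ?D = "\<lambda>X. X $ k * cnj (v $ s) + v $ k * cnj (X $ s)
      - (\<Sum>l\<in>UNIV. X $ l * cnj (v $ l) + v $ l * cnj (X $ l)) * (v $ k * cnj (v $ s))"
  have sum1: "(\<Sum>l\<in>UNIV. v $ l * cnj (v $ l)) = 1"
    by (rule sphere_sum[OF v])
  have dk: "\<And>l. ((\<lambda>u::complex^'a. u $ l) has_derivative (\<lambda>X. X $ l)) (at v)"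
    by (rule bounded_linear_imp_has_derivative) (rule bounded_linear_vec_nth)
  have dc: "\<And>l. ((\<lambda>u::complex^'a. cnj (u $ l)) has_derivative (\<lambda>X. cnj (X $ l))) (at v)"
    by (rule bounded_linear_imp_has_derivative)
       (rule bounded_linear_compose[OF bounded_linear_cnj bounded_linear_vec_nth])
  have num: "((\<lambda>u::complex^'a. u $ k * cnj (u $ s)) has_derivative
      (\<lambda>X. v $ k * cnj (X $ s) + X $ k * cnj (v $ s))) (at v)"
    by (rule has_derivative_mult[OF dk dc])
  have den: "((\<lambda>u::complex^'a. \<Sum>l\<in>UNIV. u $ l * cnj (u $ l)) has_derivative
      (\<lambda>X. \<Sum>l\<in>UNIV. v $ l * cnj (X $ l) + X $ l * cnj (v $ l))) (at v)"
    by (rule has_derivative_sum) (rule has_derivative_mult[OF dk dc])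
  have g: "(?g has_derivative ?D) (at v)"
    using has_derivative_divide[OF num den] unfolding sum1
    by (simp add: algebra_simps)
  have eq: "?g u = radial (Q k s) u" if "u \<noteq> 0" for u :: "complex^'a"
  proof -
    have "(\<Sum>l\<in>UNIV. u $ l * cnj (u $ l)) = complex_of_real (\<Sum>l\<in>UNIV. (cmod (u $ l))\<^sup>2)"
      by (simp add: complex_norm_square[symmetric])
    also have "(\<Sum>l\<in>UNIV. (cmod (u $ l))\<^sup>2) = (norm u)\<^sup>2"
      by (simp add: norm_vec_def L2_set_def sum_nonneg)
    finally have n: "(\<Sum>l\<in>UNIV. u $ l * cnj (u $ l)) = complex_of_real (norm u) ^ 2"
      by simp
    have "(1 / norm u) *\<^sub>R u \<in> Sph"
      using that by (simp add: Sph_def)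
    then show ?thesis
      using that unfolding n radial_def Q_def
      by (simp only: restrict_apply if_True vector_scaleR_component)
         (simp add: scaleR_conv_of_real[where 'a = complex] power2_eq_square)
  qed
  have v0: "v \<noteq> 0"
    using v by (auto simp: Sph_def)
  have "(radial (Q k s) has_derivative ?D) (at v)"
    by (rule has_derivative_transform_within_open[OF g, of "- {0}"]) (use v0 eq in auto)
  then have "d0 (Q k s) v X = ?D X"
    unfolding d0_def using v by (simp add: frechet_derivative_at[symmetric])
  also have "\<dots> = X $ k * cnj (v $ s) + v $ k * cnj (X $ s) - (?c + cnj ?c) * (v $ k * cnj (v $ s))"
    by (simp add: sum.distrib mult.commute)
  also have "\<dots> = dv k v X * cnj (v $ s) + v $ k * dvbar s v X"
    by (simp add: dv_def dvbar_def horizontal_def algebra_simps)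
  finally show ?thesis .
qed

lemma sum_vbar_dv: "v \<in> Sph \<Longrightarrow> (\<Sum>k\<in>UNIV. cnj (v $ k) * dv k v X) = 0"
proof -
  assume v: "v \<in> Sph"
  let ?c = "\<Sum>l\<in>UNIV. X $ l * cnj (v $ l)"
  have "(\<Sum>k\<in>UNIV. cnj (v $ k) * dv k v X) = ?c - ?c * (\<Sum>k\<in>UNIV. v $ k * cnj (v $ k))"
    by (simp add: dv_def horizontal_def algebra_simps sum_subtractf sum_distrib_left)
  then show ?thesis
    using sphere_sum[OF v] by simp
qed

lemma sum_v_dvbar: "v \<in> Sph \<Longrightarrow> (\<Sum>k\<in>UNIV. v $ k * dvbar k v X) = 0"
  using arg_cong[OF sum_vbar_dv, of v cnj X] by (simp add: dv_def dvbar_def)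

lemma v_dvbar_Q:
  assumes "v \<in> Sph"
  shows "v_dvbar q s v X = (\<Sum>k\<in>UNIV. Q q k v * d0 (Q k s) v X)"
proof -
  have "(\<Sum>k\<in>UNIV. Q q k v * d0 (Q k s) v X) =
      (\<Sum>k\<in>UNIV. v $ q * cnj (v $ s) * (cnj (v $ k) * dv k v X)
        + v $ q * dvbar s v X * (v $ k * cnj (v $ k)))"
    by (rule sum.cong) (use assms in \<open>auto simp: d0_Q Q_apply algebra_simps\<close>)
  also have "\<dots> = v $ q * cnj (v $ s) * (\<Sum>k\<in>UNIV. cnj (v $ k) * dv k v X)
      + v $ q * dvbar s v X * (\<Sum>k\<in>UNIV. v $ k * cnj (v $ k))"
    by (simp add: sum.distrib sum_distrib_left)
  finally show ?thesis
    using assms by (simp add: sum_vbar_dv sphere_sum v_dvbar_def)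
qed

lemma vbar_dv_Q:
  assumes "v \<in> Sph"
  shows "cnj (v $ p) * dv r v X = (\<Sum>k\<in>UNIV. d0 (Q r k) v X * Q k p v)"
proof -
  have "(\<Sum>k\<in>UNIV. d0 (Q r k) v X * Q k p v) =
      (\<Sum>k\<in>UNIV. cnj (v $ p) * dv r v X * (v $ k * cnj (v $ k))
        + v $ r * cnj (v $ p) * (v $ k * dvbar k v X))"
    by (rule sum.cong) (use assms in \<open>auto simp: d0_Q Q_apply algebra_simps\<close>)
  also have "\<dots> = cnj (v $ p) * dv r v X * (\<Sum>k\<in>UNIV. v $ k * cnj (v $ k))
      + v $ r * cnj (v $ p) * (\<Sum>k\<in>UNIV. v $ k * dvbar k v X)"
    by (simp add: sum.distrib sum_distrib_left)
  finally show ?thesis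
    using assms by (simp add: sum_v_dvbar sphere_sum)
qed

definition Gamma :: "'n \<Rightarrow> 'n \<Rightarrow> 'n \<Rightarrow> 'n \<Rightarrow> 'n::finite form1" where
  "Gamma p q r s = (\<lambda>v\<in>Sph. \<lambda>X. v $ q *
     ((if p = r then 1 else 0) * dvbar s v X
      - cnj (v $ s) * v $ r * dvbar p v X
      + cnj (v $ s) * cnj (v $ p) * dv r v X))"


section \<open>Holomorphic bundles\<close>

text \<open>The curvature \<open>(id \<otimes> \<partial> + nab \<and> id) nab\<close>, where \<open>\<partial>\<close> is the Dolbeault operator, with values in \<open>G \<otimes> \<Omega>\<^sup>0\<^sup>,\<^sup>2\<close>.\<close>

definition curvature ::
  "(complex^'n \<Rightarrow> complex, 'g) rmod \<Rightarrow> ('g \<Rightarrow> ('g, 'n::finite form1) tens) \<Rightarrow> 'g \<Rightarrow> ('g, 'n form2) tens"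
  where
  "curvature G nab g =
     tensor_lift (tensor_group CP G Omega02)
       (\<lambda>g' \<xi>. pure_tensor CP G Omega02 g' (dbar1 \<xi>)
          \<oplus>\<^bsub>tensor_group CP G Omega02\<^esub>
          tensor_lift (tensor_group CP G Omega02)
            (\<lambda>g'' \<eta>. pure_tensor CP G Omega02 g'' (wedge \<eta> \<xi>)) (nab g'))
       (nab g)"

definition holomorphic_category ::
  "((complex^'n \<Rightarrow> complex, 'g) rmod \<times> ('g \<Rightarrow> ('g, 'n::finite form1) tens), 'g \<Rightarrow> 'g) category" where
  "holomorphic_category = (connection_category CP Omega01 dbar0)
     \<lparr>obj := {(G, nab). right_connection CP Omega01 dbar0 G nab \<and>
        (\<forall>g\<in>carrier G. curvature G nab g = \<zero>\<^bsub>rtensor CP G Omega02\<^esub>)}\<rparr>"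

definition dbar_part ::
  "(complex^'n \<Rightarrow> complex, 'g) rmod \<times> ('g \<Rightarrow> ('g, 'n::finite form1) tens) \<Rightarrow>
   (complex^'n \<Rightarrow> complex, 'g) rmod \<times> ('g \<Rightarrow> ('g, 'n form1) tens)" where
  "dbar_part = (\<lambda>(G, nab).
     (G, \<lambda>g\<in>carrier G. tensor_lift (tensor_group CP G Omega01)
           (\<lambda>g' \<xi>. pure_tensor CP G Omega01 g' (proj01 \<xi>)) (nab g)))"


section \<open>The two functors\<close>

definition F_mod :: "(complex^'n^'n, 'v) module \<Rightarrow> (complex^'n::finite^'n, ('v, complex^'n) tens) rmod" where
  "F_mod V = rtensor complex_ring (underlying_space V) Row"

definition F_tensor :: "(complex^'n^'n, 'v) module \<Rightarrow> 'v \<Rightarrow> complex^'n::finite \<Rightarrow> ('v, complex^'n) tens" where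
  "F_tensor V = pure_tensor complex_ring (underlying_space V) Row"

definition is_nabla_F ::
  "(complex^'n^'n, 'v) module \<Rightarrow>
   (('v, complex^'n::finite) tens \<Rightarrow> (('v, complex^'n) tens, 'n uniform) tens) \<Rightarrow> bool" where
  "is_nabla_F V nab \<longleftrightarrow> right_connection Mat Omega_uni d_uni (F_mod V) nab \<and>
     (\<forall>w\<in>carrier V. \<forall>i. nab (F_tensor V w (axis i 1)) =
        (\<Oplus>\<^bsub>rtensor Mat (F_mod V) Omega_uni\<^esub>p\<in>UNIV. \<Oplus>\<^bsub>rtensor Mat (F_mod V) Omega_uni\<^esub>j\<in>UNIV.
           pure_tensor Mat (F_mod V) Omega_uni
             (F_tensor V (matrix_unit j p \<odot>\<^bsub>V\<^esub> w) (axis j 1)) (d_uni (matrix_unit p i))))"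

definition F_obj ::
  "(complex^'n^'n, 'v) module \<Rightarrow>
   (complex^'n::finite^'n, ('v, complex^'n) tens) rmod \<times>
   (('v, complex^'n) tens \<Rightarrow> (('v, complex^'n) tens, 'n uniform) tens)" where
  "F_obj V = (F_mod V, THE nab. is_nabla_F V nab)"

definition F_mor ::
  "(complex^'n^'n, 'v) module \<Rightarrow> (complex^'n^'n, 'v) module \<Rightarrow> ('v \<Rightarrow> 'v) \<Rightarrow>
   ('v, complex^'n::finite) tens \<Rightarrow> ('v, complex^'n) tens" where
  "F_mor V W \<theta> = map_tensor_id complex_ring (underlying_space V) (underlying_space W) Row \<theta>"

type_synonym 'n E_type = "(complex^'n, complex^'n \<Rightarrow> complex) tens"

definition E_mod :: "(complex^'n^'n, complex^'n \<Rightarrow> complex, 'n::finite E_type) bimod" where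
  "E_mod = btensor complex_ring Col (Cinf_module (-1))"

definition E_tensor :: "complex^'n \<Rightarrow> (complex^'n \<Rightarrow> complex) \<Rightarrow> 'n::finite E_type" where
  "E_tensor = pure_tensor complex_ring Col (Cinf_module (-1))"

definition is_nabla_E :: "('n::finite E_type \<Rightarrow> ('n E_type, 'n form1) tens) \<Rightarrow> bool" where
  "is_nabla_E nab \<longleftrightarrow> right_connection CP Omega1 d0 E_mod nab \<and>
     (\<forall>i j. nab (E_tensor (axis i 1) (vbar j)) =
        (\<Oplus>\<^bsub>btensor CP E_mod Omega1\<^esub>p\<in>UNIV. \<Oplus>\<^bsub>btensor CP E_mod Omega1\<^esub>q\<in>UNIV.
           pure_tensor CP E_mod Omega1 (E_tensor (axis p 1) (vbar q)) (Gamma p q i j)))"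

definition nabla_E :: "'n::finite E_type \<Rightarrow> ('n E_type, 'n form1) tens" where
  "nabla_E = (THE nab. is_nabla_E nab)"

definition is_sigma_E :: "(('n::finite uniform, 'n E_type) tens \<Rightarrow> ('n E_type, 'n form1) tens) \<Rightarrow> bool" where
  "is_sigma_E \<sigma> \<longleftrightarrow>
     right_bimodule_connection Mat Omega_uni d_uni CP Omega1 d0 E_mod nabla_E \<sigma>"

definition sigma_E :: "('n::finite uniform, 'n E_type) tens \<Rightarrow> ('n E_type, 'n form1) tens" where
  "sigma_E = (THE \<sigma>. is_sigma_E \<sigma>)"

definition tensor_E_obj ::
  "(complex^'n^'n, 'f) rmod \<times> ('f \<Rightarrow> ('f, 'n::finite uniform) tens) \<Rightarrow>
   (complex^'n \<Rightarrow> complex, ('f, 'n E_type) tens) rmod \<times>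
   (('f, 'n E_type) tens \<Rightarrow> (('f, 'n E_type) tens, 'n form1) tens)" where
  "tensor_E_obj = tensor_bimodule_obj Mat Omega_uni CP Omega1 E_mod nabla_E sigma_E"

definition tensor_E_mor ::
  "(complex^'n^'n, 'f) rmod \<times> ('f \<Rightarrow> ('f, 'n::finite uniform) tens) \<Rightarrow>
   (complex^'n^'n, 'f) rmod \<times> ('f \<Rightarrow> ('f, 'n uniform) tens) \<Rightarrow>
   ('f \<Rightarrow> 'f) \<Rightarrow> ('f, 'n E_type) tens \<Rightarrow> ('f, 'n E_type) tens" where
  "tensor_E_mor = tensor_bimodule_mor Mat E_mod"

definition composite_obj ::
  "(complex^'n^'n, 'v) module \<Rightarrow>
   (complex^'n \<Rightarrow> complex, (('v, complex^'n) tens, 'n::finite E_type) tens) rmod \<times>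
   ((('v, complex^'n) tens, 'n E_type) tens \<Rightarrow> ((('v, complex^'n) tens, 'n E_type) tens, 'n form1) tens)"
  where
  "composite_obj V = dbar_part (tensor_E_obj (F_obj V))"

definition composite_mor ::
  "(complex^'n^'n, 'v) module \<Rightarrow> (complex^'n^'n, 'v) module \<Rightarrow> ('v \<Rightarrow> 'v) \<Rightarrow>
   (('v, complex^'n) tens, 'n::finite E_type) tens \<Rightarrow> (('v, complex^'n) tens, 'n E_type) tens" where
  "composite_mor V W \<theta> = tensor_E_mor (F_obj V) (F_obj W) (F_mor V W \<theta>)"


section \<open>The modules \<open>V \<otimes> C\<^sub>-\<^sub>1\<close>\<close>

definition VC_mod ::
  "(complex^'n^'n, 'v) module \<Rightarrow> (complex^'n::finite \<Rightarrow> complex, ('v, complex^'n \<Rightarrow> complex) tens) rmod" where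
  "VC_mod V = rtensor complex_ring (underlying_space V) (Cinf_module (-1))"

definition VC_tensor ::
  "(complex^'n^'n, 'v) module \<Rightarrow> 'v \<Rightarrow> (complex^'n::finite \<Rightarrow> complex) \<Rightarrow> ('v, complex^'n \<Rightarrow> complex) tens" where
  "VC_tensor V = pure_tensor complex_ring (underlying_space V) (Cinf_module (-1))"

definition VC_mor ::
  "(complex^'n^'n, 'v) module \<Rightarrow> (complex^'n^'n, 'v) module \<Rightarrow> ('v \<Rightarrow> 'v) \<Rightarrow>
   ('v, complex^'n::finite \<Rightarrow> complex) tens \<Rightarrow> ('v, complex^'n \<Rightarrow> complex) tens" where
  "VC_mor V W \<theta> = map_tensor_id complex_ring (underlying_space V) (underlying_space W) (Cinf_module (-1)) \<theta>"

text \<open>The identification \<open>F \<otimes> E \<rightarrow> V \<otimes> C\<^sub>-\<^sub>1\<close>, \<open>(w \<otimes> r) \<otimes> (h \<otimes> f) \<mapsto> w (r h) \<otimes> f\<close>.\<close>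

definition identification ::
  "(complex^'n^'n, 'v) module \<Rightarrow> (('v, complex^'n) tens, 'n::finite E_type) tens \<Rightarrow>
   ('v, complex^'n \<Rightarrow> complex) tens" where
  "identification V =
     restrict
       (tensor_lift (VC_mod V) (\<lambda>x e.
          tensor_lift (VC_mod V) (\<lambda>w r.
            tensor_lift (VC_mod V) (\<lambda>h f.
              VC_tensor V (mat (\<Sum>i\<in>UNIV. r $ i * h $ i) \<odot>\<^bsub>V\<^esub> w) f) e) x))
       (carrier (rtensor Mat (F_mod V) E_mod))"

end

theory Submission
  imports Defs
begin

text \<open>
  The connections \<open>\<nabla>\<^sub>E\<close> and \<open>\<nabla>\<^sub>F\<close> are constructed as lifts of balanced maps, the former from the
  horizontal derivative of functions of weight \<open>-1\<close>.  The \<open>(0,1)\<close>-part of \<open>\<Gamma>\<^sup>p\<^sup>q\<^sub>r\<^sub>s\<close> is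
  \<open>\<delta>\<^sub>p\<^sub>r \<beta>\<^sub>q\<^sub>s - Q\<^sub>q\<^sub>s \<beta>\<^sub>r\<^sub>p\<close> with \<open>\<beta>\<^sub>r\<^sub>p = v\<^sub>r \<d>\<bar>v\<^sub>p\<close>, and the relation \<open>\<Sum>\<^sub>q \<bar>v\<^sub>q Q\<^sub>q\<^sub>s = \<bar>v\<^sub>s\<close> then
  gives the formula for the connection on \<open>V \<otimes> C\<^sub>-\<^sub>1\<close>.

  The forms \<open>\<beta>\<^sub>r\<^sub>p\<close> are closed under the Dolbeault operator, and \<open>\<Sum>\<^sub>k \<beta>\<^sub>r\<^sub>k \<and> \<beta>\<^sub>k\<^sub>p = 0\<close> because
  \<open>\<Sum>\<^sub>k v\<^sub>k \<d>\<bar>v\<^sub>k = 0\<close>.  On the generators \<open>w \<otimes> \<bar>v\<^sub>j\<close> the curvature therefore consists of terms which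
  vanish by this contraction (for the square of the term involving \<open>L\<close>, after
  \<open>L\<^sub>i\<^sub>j L\<^sub>k\<^sub>l = \<delta>\<^sub>j\<^sub>k L\<^sub>i\<^sub>l\<close>) and of two mixed terms which cancel as the forms anticommute.  Curvature is
  linear over functions and natural, so it vanishes on \<open>V \<otimes> C\<^sub>-\<^sub>1\<close> and hence on \<open>F \<otimes> E\<close>.
\<close>

section \<open>Additive maps\<close>

text \<open>\<open>nabla_E\<close>, \<open>sigma_E\<close> and the connection in
  \<open>F_obj\<close> are definite descriptions, so each needs existence and uniqueness before it
  can be computed with. The obstacle for E is that the \<open>vbar j\<close> generate the functions
  of weight -1 but in general not freely: values on them cannot just be prescribed, and a formula
  intrinsic in the function is required. Elements of tensor products are cosets without normal form,
  so every identity is reduced to pure tensors by additivity of both sides.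

  The formula on V \<otimes> C_-1 rests on a cancellation. As \<sigma>(dE_pi \<otimes> e) =
  \<nabla>(E_pi e) - E_pi \<nabla>(e), the second terms, summed against L_kp(w) \<otimes> r_k,
  recombine to (w \<otimes> r_i) \<otimes> \<nabla>(e) and cancel the other half of the tensor
  product connection. Only \<nabla> on the elements h_p \<otimes> vbar_j remains.

  That curvature is linear over functions needs the Dolbeault operator to square to zero on
  functions. With forms given as families on the sphere this comes from pulling back to punctured
  space and the symmetry of second derivatives there.\<close>

definition additive_map :: "('a, 'x) ring_scheme \<Rightarrow> ('b, 'y) ring_scheme \<Rightarrow> ('a \<Rightarrow> 'b) \<Rightarrow> bool" where
  "additive_map G H f \<longleftrightarrow> f \<in> carrier G \<rightarrow> carrier H \<and>
     (\<forall>x\<in>carrier G. \<forall>y\<in>carrier G. f (x \<oplus>\<^bsub>G\<^esub> y) = f x \<oplus>\<^bsub>H\<^esub> f y)"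

lemma additive_mapI:
  assumes "\<And>x. x \<in> carrier G \<Longrightarrow> f x \<in> carrier H"
    and "\<And>x y. x \<in> carrier G \<Longrightarrow> y \<in> carrier G \<Longrightarrow> f (x \<oplus>\<^bsub>G\<^esub> y) = f x \<oplus>\<^bsub>H\<^esub> f y"
  shows "additive_map G H f"
  using assms by (auto simp: additive_map_def)

lemma additive_map_closed: "additive_map G H f \<Longrightarrow> x \<in> carrier G \<Longrightarrow> f x \<in> carrier H"
  by (auto simp: additive_map_def)

lemma additive_map_add:
  "additive_map G H f \<Longrightarrow> x \<in> carrier G \<Longrightarrow> y \<in> carrier G \<Longrightarrow> f (x \<oplus>\<^bsub>G\<^esub> y) = f x \<oplus>\<^bsub>H\<^esub> f y"
  by (auto simp: additive_map_def)

lemma additive_map_hom: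
  assumes "abelian_group G" "abelian_group H" "additive_map G H f"
  shows "group_hom (add_monoid G) (add_monoid H) f"
proof -
  have "group (add_monoid G)" "group (add_monoid H)"
    using abelian_group.a_group assms by blast+
  then show ?thesis
    using assms(3) by (auto simp: group_hom_def group_hom_axioms_def hom_def additive_map_def)
qed

lemma additive_map_zero:
  assumes "abelian_group G" "abelian_group H" "additive_map G H f"
  shows "f \<zero>\<^bsub>G\<^esub> = \<zero>\<^bsub>H\<^esub>"
  using group_hom.hom_one[OF additive_map_hom[OF assms]] by simp

lemma additive_map_inv:
  assumes "abelian_group G" "abelian_group H" "additive_map G H f" "x \<in> carrier G"
  shows "f (\<ominus>\<^bsub>G\<^esub> x) = \<ominus>\<^bsub>H\<^esub> f x"
  using group_hom.hom_inv[OF additive_map_hom[OF assms(1-3)], of x] assms(4) by (simp add: a_inv_def)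

lemma additive_map_minus:
  assumes "abelian_group G" "abelian_group H" "additive_map G H f" "x \<in> carrier G" "y \<in> carrier G"
  shows "f (x \<ominus>\<^bsub>G\<^esub> y) = f x \<ominus>\<^bsub>H\<^esub> f y"
  using assms additive_map_inv[OF assms(1-3)] additive_map_add[OF assms(3)]
  by (simp add: a_minus_def abelian_group.a_inv_closed)

lemma additive_map_finsum:
  assumes "abelian_group G" "abelian_group H" "additive_map G H f" and "g \<in> I \<rightarrow> carrier G"
  shows "f (finsum G g I) = finsum H (\<lambda>i. f (g i)) I"
proof -
  interpret G: abelian_group G by fact
  interpret H: abelian_group H by fact
  show ?thesis
    using assms(4)
  proof (induction I rule: infinite_finite_induct)
    case (insert x F)
    then have "g x \<in> carrier G" "g \<in> F \<rightarrow> carrier G" by auto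
    moreover have "(\<lambda>i. f (g i)) \<in> F \<rightarrow> carrier H" "f (g x) \<in> carrier H"
      using insert additive_map_closed[OF assms(3)] by auto
    ultimately show ?case
      using insert by (simp add: additive_map_add[OF assms(3)])
  qed (simp_all add: additive_map_zero[OF assms(1-3)])
qed

lemma additive_map_comp:
  "additive_map G H f \<Longrightarrow> additive_map H K g \<Longrightarrow> additive_map G K (\<lambda>x. g (f x))"
  by (auto simp: additive_map_def Pi_iff)

lemma additive_map_cong:
  assumes "abelian_group G" "additive_map G H f" "\<And>x. x \<in> carrier G \<Longrightarrow> g x = f x"
  shows "additive_map G H g"
  using assms abelian_monoid.a_closed[OF abelian_group.axioms(1)[OF assms(1)]]
  by (auto simp: additive_map_def)

lemma additive_map_plus:
  assumes "abelian_group H" "additive_map G H f" "additive_map G H g"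
  shows "additive_map G H (\<lambda>x. f x \<oplus>\<^bsub>H\<^esub> g x)"
proof -
  interpret H: abelian_group H by fact
  show ?thesis
    using assms(2,3) by (auto simp: additive_map_def Pi_iff H.a_ac)
qed

lemma additive_map_sum:
  assumes "abelian_group H" "\<And>i. i \<in> I \<Longrightarrow> additive_map G H (f i)"
  shows "additive_map G H (\<lambda>x. finsum H (\<lambda>i. f i x) I)"
proof -
  interpret H: abelian_group H by fact
  have *: "\<And>x. x \<in> carrier G \<Longrightarrow> (\<lambda>i. f i x) \<in> I \<rightarrow> carrier H"
    using additive_map_closed[OF assms(2)] by auto
  show ?thesis
  proof (rule additive_mapI)
    fix x y assume xy: "x \<in> carrier G" "y \<in> carrier G"
    have "finsum H (\<lambda>i. f i (x \<oplus>\<^bsub>G\<^esub> y)) I = finsum H (\<lambda>i. f i x \<oplus>\<^bsub>H\<^esub> f i y) I"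
      using * xy
      by (intro H.finsum_cong') (auto simp: additive_map_add[OF assms(2)] Pi_iff intro!: H.a_closed)
    also have "\<dots> = finsum H (\<lambda>i. f i x) I \<oplus>\<^bsub>H\<^esub> finsum H (\<lambda>i. f i y) I"
      using * xy by (intro H.finsum_addf) auto
    finally show "finsum H (\<lambda>i. f i (x \<oplus>\<^bsub>G\<^esub> y)) I = finsum H (\<lambda>i. f i x) I \<oplus>\<^bsub>H\<^esub> finsum H (\<lambda>i. f i y) I" .
  qed (use * in \<open>auto intro!: H.finsum_closed\<close>)
qed

text \<open>Being an abelian group depends only on carrier, zero and addition. The same additive
  group occurs in several record types here (\<open>tensor_group\<close>, \<open>rtensor\<close>,
  \<open>btensor\<close>, the left-module view of a bimodule), and this moves the property between
  them.\<close>

lemma abelian_group_record_cong: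
  assumes "abelian_group G" "carrier H = carrier G" "zero H = zero G" "add H = add G"
  shows "abelian_group H"
proof -
  interpret G: abelian_group G by fact
  show ?thesis
    by (rule abelian_groupI) (use assms G.l_neg in \<open>auto simp: G.a_ac\<close>)
qed


section \<open>One-sided modules\<close>

text \<open>Names the record that \<open>bimodule\<close> builds inline, so that the left half of a
  bimodule can be assumed or concluded on its own.\<close>

abbreviation left_mod :: "('a, 'x) ring_scheme \<Rightarrow> ('a, 'b, 'm, 'z) bimod_scheme \<Rightarrow> bool" where
  "left_mod A E \<equiv> left_module A \<lparr>carrier = carrier E, mult = mult E, one = one E, zero = zero E,
     add = add E, smult = lact E\<rparr>"

lemma left_modD:
  assumes "left_mod A N"
  shows "ring A" "abelian_group N"
    "\<And>a n. a \<in> carrier A \<Longrightarrow> n \<in> carrier N \<Longrightarrow> lact N a n \<in> carrier N"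
    "\<And>a. a \<in> carrier A \<Longrightarrow> additive_map N N (lact N a)"
    "\<And>n. n \<in> carrier N \<Longrightarrow> additive_map A N (\<lambda>a. lact N a n)"
    "\<And>a b n. a \<in> carrier A \<Longrightarrow> b \<in> carrier A \<Longrightarrow> n \<in> carrier N \<Longrightarrow>
       lact N (a \<otimes>\<^bsub>A\<^esub> b) n = lact N a (lact N b n)"
    "\<And>n. n \<in> carrier N \<Longrightarrow> lact N \<one>\<^bsub>A\<^esub> n = n"
  using assms by (auto simp: left_module_def additive_map_def intro: abelian_group_record_cong)

lemma right_moduleD:
  assumes "right_module B G"
  shows "ring B" "abelian_group G"
    "\<And>g b. g \<in> carrier G \<Longrightarrow> b \<in> carrier B \<Longrightarrow> ract G g b \<in> carrier G"
    "\<And>b. b \<in> carrier B \<Longrightarrow> additive_map G G (\<lambda>g. ract G g b)"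
    "\<And>g. g \<in> carrier G \<Longrightarrow> additive_map B G (ract G g)"
    "\<And>g b c. g \<in> carrier G \<Longrightarrow> b \<in> carrier B \<Longrightarrow> c \<in> carrier B \<Longrightarrow>
       ract G g (b \<otimes>\<^bsub>B\<^esub> c) = ract G (ract G g b) c"
    "\<And>g. g \<in> carrier G \<Longrightarrow> ract G g \<one>\<^bsub>B\<^esub> = g"
  using assms by (auto simp: right_module_def additive_map_def)

lemma bimoduleD:
  assumes "bimodule A B E"
  shows "right_module B E" "left_mod A E"
    "\<And>a b e. a \<in> carrier A \<Longrightarrow> b \<in> carrier B \<Longrightarrow> e \<in> carrier E \<Longrightarrow>
      ract E (lact E a e) b = lact E a (ract E e b)"
  using assms by (auto simp: bimodule_def)

lemma left_modI:
  assumes "ring A" "abelian_group N"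
    "\<And>a. a \<in> carrier A \<Longrightarrow> additive_map N N (lact N a)"
    "\<And>n. n \<in> carrier N \<Longrightarrow> additive_map A N (\<lambda>a. lact N a n)"
    "\<And>a b n. a \<in> carrier A \<Longrightarrow> b \<in> carrier A \<Longrightarrow> n \<in> carrier N \<Longrightarrow>
       lact N (a \<otimes>\<^bsub>A\<^esub> b) n = lact N a (lact N b n)"
    "\<And>n. n \<in> carrier N \<Longrightarrow> lact N \<one>\<^bsub>A\<^esub> n = n"
  shows "left_mod A N"
  unfolding left_module_def
  using assms abelian_group_record_cong[OF assms(2), of "\<lparr>carrier = carrier N, mult = mult N,
     one = one N, zero = zero N, add = add N, smult = lact N\<rparr>"]
  by (auto simp: additive_map_def Pi_iff)

lemma right_moduleI:
  assumes "ring B" "abelian_group G"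
    "\<And>b. b \<in> carrier B \<Longrightarrow> additive_map G G (\<lambda>g. ract G g b)"
    "\<And>g. g \<in> carrier G \<Longrightarrow> additive_map B G (ract G g)"
    "\<And>g b c. g \<in> carrier G \<Longrightarrow> b \<in> carrier B \<Longrightarrow> c \<in> carrier B \<Longrightarrow>
       ract G g (b \<otimes>\<^bsub>B\<^esub> c) = ract G (ract G g b) c"
    "\<And>g. g \<in> carrier G \<Longrightarrow> ract G g \<one>\<^bsub>B\<^esub> = g"
  shows "right_module B G"
  using assms by (auto simp: right_module_def additive_map_def Pi_iff)


section \<open>Tensor products\<close>

text \<open>The hypothesis of the universal property of M \<otimes> N over R: exactly these maps
  factor through \<open>tensor_lift\<close>.\<close>

definition balanced ::
  "('r, 'x) ring_scheme \<Rightarrow> ('r, 'm, 'y) rmod_scheme \<Rightarrow> ('r, 's, 'n, 'z) bimod_scheme \<Rightarrow>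
   ('q, 'w) ring_scheme \<Rightarrow> ('m \<Rightarrow> 'n \<Rightarrow> 'q) \<Rightarrow> bool" where
  "balanced R M N X \<phi> \<longleftrightarrow>
     (\<forall>m\<in>carrier M. additive_map N X (\<phi> m)) \<and>
     (\<forall>n\<in>carrier N. additive_map M X (\<lambda>m. \<phi> m n)) \<and>
     (\<forall>m\<in>carrier M. \<forall>r\<in>carrier R. \<forall>n\<in>carrier N. \<phi> (ract M m r) n = \<phi> m (lact N r n))"

lemma balancedI:
  assumes "\<And>m. m \<in> carrier M \<Longrightarrow> additive_map N X (\<phi> m)"
    "\<And>n. n \<in> carrier N \<Longrightarrow> additive_map M X (\<lambda>m. \<phi> m n)"
    "\<And>m r n. m \<in> carrier M \<Longrightarrow> r \<in> carrier R \<Longrightarrow> n \<in> carrier N \<Longrightarrow>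
      \<phi> (ract M m r) n = \<phi> m (lact N r n)"
  shows "balanced R M N X \<phi>"
  using assms by (auto simp: balanced_def)

lemma balancedD:
  assumes "balanced R M N X \<phi>"
  shows "m \<in> carrier M \<Longrightarrow> additive_map N X (\<phi> m)"
    "n \<in> carrier N \<Longrightarrow> additive_map M X (\<lambda>m. \<phi> m n)"
    "m \<in> carrier M \<Longrightarrow> r \<in> carrier R \<Longrightarrow> n \<in> carrier N \<Longrightarrow>
      \<phi> (ract M m r) n = \<phi> m (lact N r n)"
  using assms by (auto simp: balanced_def)

lemma balanced_closed:
  "balanced R M N X \<phi> \<Longrightarrow> m \<in> carrier M \<Longrightarrow> n \<in> carrier N \<Longrightarrow> \<phi> m n \<in> carrier X"
  by (auto simp: balanced_def additive_map_def)

lemma normal_free_abelian: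
  "subgroup K (free_Abelian_group S) \<Longrightarrow> K \<lhd> free_Abelian_group S"
  using comm_group.normal_iff_subgroup[OF abelian_free_Abelian_group] by blast

lemma (in abelian_group) add_int_pow:
  assumes "x \<in> carrier G"
  shows "[(k::int)] \<cdot>\<^bsub>G\<^esub> x \<in> carrier G" "[(k + l::int)] \<cdot>\<^bsub>G\<^esub> x = [k] \<cdot>\<^bsub>G\<^esub> x \<oplus> [l] \<cdot>\<^bsub>G\<^esub> x"
    "[(1::int)] \<cdot>\<^bsub>G\<^esub> x = x" "[(0::int)] \<cdot>\<^bsub>G\<^esub> x = \<zero>"
  using group.int_pow_closed[OF a_group, of x k] group.int_pow_mult[OF a_group, of x k l]
    group.int_pow_1[OF a_group, of x] assms
  by (simp_all add: add_pow_def)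

text \<open>Isolates the data on which the group M \<otimes> N depends. The right action on N enters
  in \<open>tensor_right\<close>, the left action on M in \<open>tensor_bimod\<close>.\<close>

locale tensor_pair =
  fixes R :: "('r, 'x) ring_scheme" and M :: "('r, 'm, 'y) rmod_scheme"
    and N :: "('r, 's, 'n, 'z) bimod_scheme"
  assumes right_M: "right_module R M" and left_N: "left_mod R N"
begin

sublocale R: ring R using right_moduleD(1)[OF right_M] .
sublocale M: abelian_group M using right_moduleD(2)[OF right_M] .
sublocale N: abelian_group N using left_modD(2)[OF left_N] .

lemma act_closed:
  "m \<in> carrier M \<Longrightarrow> r \<in> carrier R \<Longrightarrow> ract M m r \<in> carrier M"
  "n \<in> carrier N \<Longrightarrow> r \<in> carrier R \<Longrightarrow> lact N r n \<in> carrier N"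
  using right_moduleD(3)[OF right_M] left_modD(3)[OF left_N] by auto

abbreviation "S \<equiv> carrier M \<times> carrier N"
abbreviation "K \<equiv> tensor_kernel R M N"
abbreviation "FG \<equiv> free_Abelian_group S"
abbreviation "T \<equiv> tensor_group R M N"
abbreviation "pt \<equiv> pure_tensor R M N"

lemma keys_diff3:
  "a \<in> S \<Longrightarrow> b \<in> S \<Longrightarrow> c \<in> S \<Longrightarrow> Poly_Mapping.keys (frag_of a - frag_of b - frag_of c) \<subseteq> S"
  "a \<in> S \<Longrightarrow> b \<in> S \<Longrightarrow> Poly_Mapping.keys (frag_of a - frag_of b) \<subseteq> S"
  using keys_diff[of "frag_of a - frag_of b" "frag_of c"] keys_diff[of "frag_of a" "frag_of b"]
  by auto

lemma relators: "tensor_relators R M N \<subseteq> carrier FG"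
proof
  fix c assume "c \<in> tensor_relators R M N"
  then show "c \<in> carrier FG"
    unfolding tensor_relators_def carrier_free_Abelian_group_iff
  proof (elim UnE CollectE exE conjE)
    fix m m' n
    assume "c = frag_of (m \<oplus>\<^bsub>M\<^esub> m', n) - frag_of (m, n) - frag_of (m', n)"
      "m \<in> carrier M" "m' \<in> carrier M" "n \<in> carrier N"
    then show "Poly_Mapping.keys c \<subseteq> S"
      by (simp only:) (rule keys_diff3, simp_all)
  next
    fix m n n'
    assume "c = frag_of (m, n \<oplus>\<^bsub>N\<^esub> n') - frag_of (m, n) - frag_of (m, n')"
      "m \<in> carrier M" "n \<in> carrier N" "n' \<in> carrier N"
    then show "Poly_Mapping.keys c \<subseteq> S"
      by (simp only:) (rule keys_diff3, simp_all)
  next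
    fix m r n
    assume "c = frag_of (ract M m r, n) - frag_of (m, lact N r n)"
      "m \<in> carrier M" "r \<in> carrier R" "n \<in> carrier N"
    then show "Poly_Mapping.keys c \<subseteq> S"
      by (simp only:) (rule keys_diff3, simp_all add: act_closed)
  qed
qed

lemma K_subgroup: "subgroup K FG"
  unfolding tensor_kernel_def using relators by (rule group.generate_is_subgroup[OF group_free_Abelian_group])

lemma K_normal: "K \<lhd> FG"
  using K_subgroup by (rule normal_free_abelian)

lemma T_comm_group: "comm_group (FG Mod K)"
  using comm_group.abelian_FactGroup[OF abelian_free_Abelian_group K_subgroup] .

text \<open>The factor group is written multiplicatively in the library; here it is reread through
  the additive fields of a ring record.\<close>

lemma abelian_group_T: "abelian_group T"
proof -
  have "abelian_group \<lparr>carrier = carrier (FG Mod K), mult = undefined, one = undefined,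
    zero = one (FG Mod K), add = monoid.mult (FG Mod K)\<rparr>"
    by (rule abelian_group.intro)
       (use T_comm_group in \<open>auto simp: abelian_monoid_def abelian_group_axioms_def comm_group_def
          comm_monoid_def group_def comm_monoid_axioms_def monoid_def group_axioms_def Units_def\<close>)
  then show ?thesis
    by (simp add: tensor_group_def Let_def)
qed

sublocale T: abelian_group T by (rule abelian_group_T)

lemma carrier_T: "t \<in> carrier T \<longleftrightarrow> (\<exists>c. Poly_Mapping.keys c \<subseteq> S \<and> t = K #>\<^bsub>FG\<^esub> c)"
proof -
  have "carrier T = (\<lambda>c. K #>\<^bsub>FG\<^esub> c) ` {c. Poly_Mapping.keys c \<subseteq> S}"
    by (auto simp: tensor_group_def Let_def FactGroup_def RCOSETS_def)
  then show ?thesis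
    by (simp only: image_iff) blast
qed

lemma add_T:
  assumes "Poly_Mapping.keys c \<subseteq> S" "Poly_Mapping.keys d \<subseteq> S"
  shows "(K #>\<^bsub>FG\<^esub> c) \<oplus>\<^bsub>T\<^esub> (K #>\<^bsub>FG\<^esub> d) = K #>\<^bsub>FG\<^esub> (c + d)"
  using normal.rcos_sum[OF K_normal, of c d] assms
  by (simp add: tensor_group_def Let_def FactGroup_def)

lemma zero_T: "\<zero>\<^bsub>T\<^esub> = K #>\<^bsub>FG\<^esub> 0"
  using group.coset_mult_one[OF group_free_Abelian_group, of K S] K_subgroup
  by (simp add: tensor_group_def Let_def FactGroup_def subgroup_def)

lemma pure_closed [simp, intro]: "m \<in> carrier M \<Longrightarrow> n \<in> carrier N \<Longrightarrow> pt m n \<in> carrier T"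
  by (auto simp: carrier_T pure_tensor_def intro!: exI[of _ "frag_of (m, n)"])

lemma coset_eq:
  assumes "Poly_Mapping.keys c \<subseteq> S" "Poly_Mapping.keys d \<subseteq> S" "c - d \<in> K"
  shows "K #>\<^bsub>FG\<^esub> c = K #>\<^bsub>FG\<^esub> d"
proof -
  have "c \<in> K #>\<^bsub>FG\<^esub> d"
    using assms(3) by (force simp: r_coset_def)
  then show ?thesis
    using group.repr_independence[OF group_free_Abelian_group, of c S K d] assms K_subgroup by simp
qed

lemma relator_in_K: "c \<in> tensor_relators R M N \<Longrightarrow> c \<in> K"
  unfolding tensor_kernel_def by (rule generate.incl)

lemma keys_plus: "a \<in> S \<Longrightarrow> b \<in> S \<Longrightarrow> Poly_Mapping.keys (frag_of a + frag_of b) \<subseteq> S"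
  using keys_add[of "frag_of a" "frag_of b"] by auto

lemma pure_add_left:
  assumes "m \<in> carrier M" "m' \<in> carrier M" "n \<in> carrier N"
  shows "pt (m \<oplus>\<^bsub>M\<^esub> m') n = pt m n \<oplus>\<^bsub>T\<^esub> pt m' n"
proof -
  have "frag_of (m \<oplus>\<^bsub>M\<^esub> m', n) - frag_of (m, n) - frag_of (m', n) \<in> tensor_relators R M N"
    using assms by (force simp: tensor_relators_def)
  then have "frag_of (m \<oplus>\<^bsub>M\<^esub> m', n) - (frag_of (m, n) + frag_of (m', n)) \<in> K"
    by (simp add: relator_in_K diff_diff_eq)
  then show ?thesis
    unfolding pure_tensor_def using assms
    by (subst add_T) (simp_all add: coset_eq keys_plus)
qed

lemma pure_add_right:
  assumes "m \<in> carrier M" "n \<in> carrier N" "n' \<in> carrier N"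
  shows "pt m (n \<oplus>\<^bsub>N\<^esub> n') = pt m n \<oplus>\<^bsub>T\<^esub> pt m n'"
proof -
  have "frag_of (m, n \<oplus>\<^bsub>N\<^esub> n') - frag_of (m, n) - frag_of (m, n') \<in> tensor_relators R M N"
    using assms by (force simp: tensor_relators_def)
  then have "frag_of (m, n \<oplus>\<^bsub>N\<^esub> n') - (frag_of (m, n) + frag_of (m, n')) \<in> K"
    by (simp add: relator_in_K diff_diff_eq)
  then show ?thesis
    unfolding pure_tensor_def using assms
    by (subst add_T) (simp_all add: coset_eq keys_plus)
qed

lemma pure_balance:
  assumes "m \<in> carrier M" "r \<in> carrier R" "n \<in> carrier N"
  shows "pt (ract M m r) n = pt m (lact N r n)"
proof -
  have "frag_of (ract M m r, n) - frag_of (m, lact N r n) \<in> tensor_relators R M N"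
    using assms by (force simp: tensor_relators_def)
  then show ?thesis
    unfolding pure_tensor_def using assms by (intro coset_eq relator_in_K) (simp_all add: act_closed)
qed

lemma balanced_pure: "balanced R M N T pt"
  by (intro balancedI additive_mapI) (simp_all add: pure_add_left pure_add_right pure_balance)

lemma pure_additive:
  "m \<in> carrier M \<Longrightarrow> additive_map N T (pt m)" "n \<in> carrier N \<Longrightarrow> additive_map M T (\<lambda>m. pt m n)"
  using balanced_pure by (auto simp: balanced_def)

text \<open>Neither zero nor negatives need a case: 0 = 0 \<otimes> 0, and -(m \<otimes> n) = (-m)
  \<otimes> n is again pure.\<close>

lemma tensor_induct [consumes 1, case_names pure add]:
  assumes "t \<in> carrier T"
    and pure: "\<And>m n. m \<in> carrier M \<Longrightarrow> n \<in> carrier N \<Longrightarrow> P (pt m n)"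
    and add: "\<And>s t. s \<in> carrier T \<Longrightarrow> t \<in> carrier T \<Longrightarrow> P s \<Longrightarrow> P t \<Longrightarrow> P (s \<oplus>\<^bsub>T\<^esub> t)"
  shows "P t"
proof -
  obtain c where c: "Poly_Mapping.keys c \<subseteq> S" "t = K #>\<^bsub>FG\<^esub> c"
    using assms(1) by (auto simp: carrier_T)
  have z: "pt \<zero>\<^bsub>M\<^esub> \<zero>\<^bsub>N\<^esub> = \<zero>\<^bsub>T\<^esub>"
    using additive_map_zero[OF M.abelian_group_axioms T.abelian_group_axioms pure_additive(2)] by simp
  have P0: "P \<zero>\<^bsub>T\<^esub>"
    using pure[of "\<zero>\<^bsub>M\<^esub>" "\<zero>\<^bsub>N\<^esub>"] z by simp
  \<comment> \<open>The induction on free abelian groups closes under differences, so the claim for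
    a coset is carried together with the claim for its negative.\<close>
  have "P (K #>\<^bsub>FG\<^esub> c) \<and> P (\<ominus>\<^bsub>T\<^esub> (K #>\<^bsub>FG\<^esub> c))"
  proof (rule free_Abelian_group_induct[OF c(1)], goal_cases)
    case 1
    have "\<ominus>\<^bsub>T\<^esub> \<zero>\<^bsub>T\<^esub> = \<zero>\<^bsub>T\<^esub>"
      using T.r_neg[of "\<zero>\<^bsub>T\<^esub>"] by simp
    then have "P (\<ominus>\<^bsub>T\<^esub> \<zero>\<^bsub>T\<^esub>)" using P0 by (simp only:)
    then show ?case using P0 by (simp add: zero_T[symmetric])
  next
    case (2 x y)
    let ?x = "K #>\<^bsub>FG\<^esub> x" and ?y = "K #>\<^bsub>FG\<^esub> y"
    have xy: "?x \<in> carrier T" "?y \<in> carrier T"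
      using 2 by (auto simp: carrier_T)
    have k: "Poly_Mapping.keys (x - y) \<subseteq> S"
      using 2 keys_diff[of x y] by auto
    have "(K #>\<^bsub>FG\<^esub> (x - y)) \<oplus>\<^bsub>T\<^esub> ?y = ?x"
      using add_T[OF k 2(2)] by simp
    moreover have "K #>\<^bsub>FG\<^esub> (x - y) \<in> carrier T"
      using k by (auto simp: carrier_T)
    ultimately have e: "K #>\<^bsub>FG\<^esub> (x - y) = ?x \<oplus>\<^bsub>T\<^esub> \<ominus>\<^bsub>T\<^esub> ?y"
      using xy by (metis T.a_assoc T.a_inv_closed T.r_neg T.r_zero)
    moreover have "\<ominus>\<^bsub>T\<^esub> (?x \<oplus>\<^bsub>T\<^esub> \<ominus>\<^bsub>T\<^esub> ?y) = \<ominus>\<^bsub>T\<^esub> ?x \<oplus>\<^bsub>T\<^esub> ?y"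
      using xy by (simp add: T.minus_add)
    ultimately show ?case
      using 2 xy by (auto intro!: add)
  next
    case (3 a)
    then obtain m n where a: "a = (m, n)" "m \<in> carrier M" "n \<in> carrier N" by auto
    have "\<ominus>\<^bsub>T\<^esub> pt m n = pt (\<ominus>\<^bsub>M\<^esub> m) n"
      using additive_map_inv[OF M.abelian_group_axioms T.abelian_group_axioms pure_additive(2)] a by simp
    then show ?case
      using a pure by (auto simp: pure_tensor_def)
  qed
  then show ?thesis using c by simp
qed

text \<open>The standard way to prove equations below: both sides are exhibited as additive maps,
  usually by composing known ones, and then compared on pure tensors.\<close>

lemma tensor_ext:
  assumes "t \<in> carrier T" "additive_map T X f" "additive_map T X g"
    "\<And>m n. m \<in> carrier M \<Longrightarrow> n \<in> carrier N \<Longrightarrow> f (pt m n) = g (pt m n)"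
  shows "f t = g t"
  using assms(1) by (induction rule: tensor_induct) (simp_all add: assms additive_map_add[OF assms(2)] additive_map_add[OF assms(3)])

text \<open>The formula in the definition of \<^const>\<open>tensor_lift\<close> is additive in the representative, hence constant on cosets of the kernel.\<close>

lemma lift_aux:
  assumes X: "abelian_group X" and b: "balanced R M N X \<phi>"
  shows "\<exists>h. h \<in> hom FG (add_monoid X) \<and> (\<forall>m\<in>carrier M. \<forall>n\<in>carrier N. h (frag_of (m, n)) = \<phi> m n) \<and>
    (\<forall>c. Poly_Mapping.keys c \<subseteq> S \<longrightarrow>  h c =
      (\<Oplus>\<^bsub>X\<^esub>k\<in>Poly_Mapping.keys c. [Poly_Mapping.lookup c k] \<cdot>\<^bsub>X\<^esub> \<phi> (fst k) (snd k)))"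
proof -
  interpret X: abelian_group X by fact
  let ?f = "\<lambda>(c::('m \<times> 'n) \<Rightarrow>\<^sub>0 int) k. [Poly_Mapping.lookup c k] \<cdot>\<^bsub>X\<^esub> \<phi> (fst k) (snd k)"
  let ?h = "\<lambda>c::('m \<times> 'n) \<Rightarrow>\<^sub>0 int. \<Oplus>\<^bsub>X\<^esub>k\<in>Poly_Mapping.keys c. ?f c k"
  have \<phi>: "k \<in> S \<Longrightarrow> \<phi> (fst k) (snd k) \<in> carrier X" for k
    using balanced_closed[OF b] by auto
  have f: "?f c k \<in> carrier X" if "k \<in> S" for c k
    by (rule X.add_int_pow(1)[OF \<phi>[OF that]])
  \<comment> \<open>The sum may be taken over any finite set containing the support, since a zero
    coefficient contributes zero. This brings the three supports of \<open>c\<close>,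
    \<open>d\<close> and \<open>c + d\<close> to a common index set.\<close>
  have ext: "?h c = (\<Oplus>\<^bsub>X\<^esub>k\<in>L. ?f c k)"
    if "finite L" "Poly_Mapping.keys c \<subseteq> L" "L \<subseteq> S" for c L
  proof (rule X.add.finprod_mono_neutral_cong_left[OF that(1,2)])
    fix k assume "k \<in> L - Poly_Mapping.keys c"
    then have "k \<in> S" "Poly_Mapping.lookup c k = 0"
      using that(3) by (blast, simp add: in_keys_iff)
    then show "?f c k = \<zero>\<^bsub>X\<^esub>"
      using X.add_int_pow(4)[OF \<phi>] by (simp only:)
  next
    show "?f c \<in> L \<rightarrow> carrier X"
      using f that(3) by blast
  qed simp
  have add: "?h (c + d) = ?h c \<oplus>\<^bsub>X\<^esub> ?h d"
    if "Poly_Mapping.keys c \<subseteq> S" "Poly_Mapping.keys d \<subseteq> S" for c d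
  proof -
    let ?L = "Poly_Mapping.keys c \<union> Poly_Mapping.keys d"
    have L: "finite ?L" "?L \<subseteq> S" using that by auto
    have "?h (c + d) = (\<Oplus>\<^bsub>X\<^esub>k\<in>?L. ?f (c + d) k)"
      using L keys_add[of c d] by (intro ext) auto
    also have "\<dots> = (\<Oplus>\<^bsub>X\<^esub>k\<in>?L. ?f c k \<oplus>\<^bsub>X\<^esub> ?f d k)"
      by (rule X.finsum_cong') (use L f \<phi> in \<open>auto simp: Poly_Mapping.lookup_add X.add_int_pow\<close>)
    also have "\<dots> = (\<Oplus>\<^bsub>X\<^esub>k\<in>?L. ?f c k) \<oplus>\<^bsub>X\<^esub> (\<Oplus>\<^bsub>X\<^esub>k\<in>?L. ?f d k)"
      using L f by (intro X.finsum_addf) auto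
    finally show ?thesis
      using ext[of ?L c] ext[of ?L d] L by simp
  qed
  have "?h \<in> hom FG (add_monoid X)"
    using add f by (force simp: hom_def intro!: X.finsum_closed)
  moreover have "?h (frag_of (m, n)) = \<phi> m n" if "m \<in> carrier M" "n \<in> carrier N" for m n
    using \<phi>[of "(m, n)"] that by (simp add: X.add_int_pow)
  ultimately show ?thesis by (intro exI[of _ ?h]) auto
qed

lemma lift_coset:
  assumes X: "abelian_group X" and b: "balanced R M N X \<phi>"
  shows "\<exists>h. h \<in> hom FG (add_monoid X) \<and> (\<forall>m\<in>carrier M. \<forall>n\<in>carrier N. h (frag_of (m, n)) = \<phi> m n) \<and>
    (\<forall>c. Poly_Mapping.keys c \<subseteq> S \<longrightarrow> tensor_lift X \<phi> (K #>\<^bsub>FG\<^esub> c) = h c)"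
proof -
  interpret X: abelian_group X by fact
  obtain h where h: "h \<in> hom FG (add_monoid X)"
    "\<And>m n. m \<in> carrier M \<Longrightarrow> n \<in> carrier N \<Longrightarrow> h (frag_of (m, n)) = \<phi> m n"
    "\<And>c. Poly_Mapping.keys c \<subseteq> S \<Longrightarrow> h c =
      (\<Oplus>\<^bsub>X\<^esub>k\<in>Poly_Mapping.keys c. [Poly_Mapping.lookup c k] \<cdot>\<^bsub>X\<^esub> \<phi> (fst k) (snd k))"
    using lift_aux[OF assms] by blast
  have hg: "group_hom FG (add_monoid X) h"
    using h(1) X.a_group by (auto simp: group_hom_def group_hom_axioms_def)
  have hadd: "h (c + d) = h c \<oplus>\<^bsub>X\<^esub> h d" if "Poly_Mapping.keys c \<subseteq> S" "Poly_Mapping.keys d \<subseteq> S" for c d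
    using group_hom.hom_mult[OF hg, of c d] that by simp
  have hm: "h (c - d) = h c \<ominus>\<^bsub>X\<^esub> h d" if "Poly_Mapping.keys c \<subseteq> S" "Poly_Mapping.keys d \<subseteq> S" for c d
    using hadd[of c "- d"] group_hom.hom_inv[OF hg, of d] that by (simp add: X.minus_eq a_inv_def)
  have hS: "h (frag_of k) \<in> carrier X" if "k \<in> S" for k
    using group_hom.hom_closed[OF hg, of "frag_of k"] that by simp
  have rel: "h c = \<zero>\<^bsub>X\<^esub>" if "c \<in> tensor_relators R M N" for c
  proof -
    have 1: "h (frag_of a - frag_of b - frag_of d) = h (frag_of a) \<ominus>\<^bsub>X\<^esub> (h (frag_of b) \<oplus>\<^bsub>X\<^esub> h (frag_of d))"
      if "a \<in> S" "b \<in> S" "d \<in> S" for a b d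
      using that hm[of "frag_of a" "frag_of b + frag_of d"] hadd[of "frag_of b" "frag_of d"] keys_plus[of b d]
      by (simp add: diff_diff_eq)
    have 2: "h (frag_of a - frag_of b) = h (frag_of a) \<ominus>\<^bsub>X\<^esub> h (frag_of b)" if "a \<in> S" "b \<in> S" for a b
      using that hm by simp
    have \<phi>: "m \<in> carrier M \<Longrightarrow> n \<in> carrier N \<Longrightarrow> \<phi> m n \<in> carrier X" for m n
      using balanced_closed[OF b] by auto
    show ?thesis
      using that unfolding tensor_relators_def
    proof (elim UnE CollectE exE conjE)
      fix m m' n assume "c = frag_of (m \<oplus>\<^bsub>M\<^esub> m', n) - frag_of (m, n) - frag_of (m', n)"
        and *: "m \<in> carrier M" "m' \<in> carrier M" "n \<in> carrier N"
      then show ?thesis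
        by (simp add: 1 h(2) additive_map_add[OF balancedD(2)[OF b]] \<phi> X.minus_eq X.r_neg)
    next
      fix m n n' assume "c = frag_of (m, n \<oplus>\<^bsub>N\<^esub> n') - frag_of (m, n) - frag_of (m, n')"
        and *: "m \<in> carrier M" "n' \<in> carrier N" "n \<in> carrier N"
      then show ?thesis
        by (simp add: 1 h(2) additive_map_add[OF balancedD(1)[OF b]] \<phi> X.minus_eq X.r_neg)
    next
      fix m r n assume "c = frag_of (ract M m r, n) - frag_of (m, lact N r n)"
        and *: "m \<in> carrier M" "r \<in> carrier R" "n \<in> carrier N"
      then show ?thesis
        by (simp add: 2 h(2) balancedD(3)[OF b] \<phi> X.minus_eq X.r_neg act_closed)
    qed
  qed
  have "K \<subseteq> kernel FG (add_monoid X) h"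
    unfolding tensor_kernel_def
  proof (rule group.generate_subgroup_incl[OF group_free_Abelian_group])
    show "tensor_relators R M N \<subseteq> kernel FG (add_monoid X) h"
    proof
      fix c assume c: "c \<in> tensor_relators R M N"
      then have "c \<in> carrier FG" using relators by blast
      then show "c \<in> kernel FG (add_monoid X) h" by (simp add: kernel_def rel c)
    qed
  qed (rule group_hom.subgroup_kernel[OF hg])
  then have hK: "k \<in> K \<Longrightarrow> Poly_Mapping.keys k \<subseteq> S \<and> h k = \<zero>\<^bsub>X\<^esub>" for k
    by (auto simp: kernel_def)
  have "tensor_lift X \<phi> (K #>\<^bsub>FG\<^esub> c) = h c" if c: "Poly_Mapping.keys c \<subseteq> S" for c
    unfolding tensor_lift_def
  proof (rule the_equality)
    have hc: "h c \<in> carrier X" using group_hom.hom_closed[OF hg, of c] c by simp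
    show *: "\<forall>d\<in>K #>\<^bsub>FG\<^esub> c. h c =
      (\<Oplus>\<^bsub>X\<^esub>k\<in>Poly_Mapping.keys d. [Poly_Mapping.lookup d k] \<cdot>\<^bsub>X\<^esub> \<phi> (fst k) (snd k))"
    proof
      fix d assume "d \<in> K #>\<^bsub>FG\<^esub> c"
      then obtain k where k: "k \<in> K" "d = k + c" by (auto simp: r_coset_def)
      then have "Poly_Mapping.keys d \<subseteq> S" using hK c keys_add[of k c] by blast
      moreover have "h d = h c" using k hK hadd[of k c] c hc by simp
      ultimately show "h c = (\<Oplus>\<^bsub>X\<^esub>k\<in>Poly_Mapping.keys d. [Poly_Mapping.lookup d k] \<cdot>\<^bsub>X\<^esub> \<phi> (fst k) (snd k))"
        using h(3) by simp
    qed
    \<comment> \<open>The condition in \<open>THE\<close> quantifies over the coset, so uniqueness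
      needs the coset to be inhabited.\<close>
    have cc: "c \<in> K #>\<^bsub>FG\<^esub> c"
      using group.rcos_self[OF group_free_Abelian_group, of c S K] K_subgroup c by simp
    show "x = h c" if "\<forall>d\<in>K #>\<^bsub>FG\<^esub> c. x =
      (\<Oplus>\<^bsub>X\<^esub>k\<in>Poly_Mapping.keys d. [Poly_Mapping.lookup d k] \<cdot>\<^bsub>X\<^esub> \<phi> (fst k) (snd k))" for x
      using trans[OF bspec[OF that cc] sym[OF bspec[OF * cc]]] .
  qed
  then show ?thesis using h by blast
qed

lemma lift_additive:
  assumes X: "abelian_group X" and b: "balanced R M N X \<phi>"
  shows "additive_map T X (tensor_lift X \<phi>)"
proof -
  obtain h where h: "h \<in> hom FG (add_monoid X)"
    "\<And>c. Poly_Mapping.keys c \<subseteq> S \<Longrightarrow> tensor_lift X \<phi> (K #>\<^bsub>FG\<^esub> c) = h c"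
    using lift_coset[OF assms] by blast
  have k: "Poly_Mapping.keys (c + d) \<subseteq> S" if "Poly_Mapping.keys c \<subseteq> S" "Poly_Mapping.keys d \<subseteq> S" for c d :: "('m \<times> 'n) \<Rightarrow>\<^sub>0 int"
    using keys_add[of c d] that by blast
  have hc: "h c \<in> carrier X" if "Poly_Mapping.keys c \<subseteq> S" for c
    using hom_carrier[OF h(1)] that by force
  have ha: "h (c + d) = h c \<oplus>\<^bsub>X\<^esub> h d"
    if "Poly_Mapping.keys c \<subseteq> S" "Poly_Mapping.keys d \<subseteq> S" for c d
    using hom_mult[OF h(1), of c d] that by simp
  show ?thesis
  proof (rule additive_mapI)
    fix x y assume "x \<in> carrier T" "y \<in> carrier T"
    then obtain c d where *: "Poly_Mapping.keys c \<subseteq> S" "Poly_Mapping.keys d \<subseteq> S"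
      "x = K #>\<^bsub>FG\<^esub> c" "y = K #>\<^bsub>FG\<^esub> d"
      unfolding carrier_T by blast
    show "tensor_lift X \<phi> (x \<oplus>\<^bsub>T\<^esub> y) = tensor_lift X \<phi> x \<oplus>\<^bsub>X\<^esub> tensor_lift X \<phi> y"
      unfolding *(3,4) add_T[OF *(1,2)] h(2)[OF k[OF *(1,2)]] h(2)[OF *(1)] h(2)[OF *(2)]
      by (rule ha[OF *(1,2)])
  next
    fix x assume "x \<in> carrier T"
    then obtain c where *: "Poly_Mapping.keys c \<subseteq> S" "x = K #>\<^bsub>FG\<^esub> c"
      unfolding carrier_T by blast
    then show "tensor_lift X \<phi> x \<in> carrier X"
      using h(2) hc by simp
  qed
qed

lemma lift_pure:
  assumes X: "abelian_group X" and b: "balanced R M N X \<phi>" and "m \<in> carrier M" "n \<in> carrier N"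
  shows "tensor_lift X \<phi> (pt m n) = \<phi> m n"
  using lift_coset[OF X b] assms(3,4) by (force simp: pure_tensor_def)

lemma pure_zero:
  "m \<in> carrier M \<Longrightarrow> pt m \<zero>\<^bsub>N\<^esub> = \<zero>\<^bsub>T\<^esub>" "n \<in> carrier N \<Longrightarrow> pt \<zero>\<^bsub>M\<^esub> n = \<zero>\<^bsub>T\<^esub>"
  by (rule additive_map_zero[OF N.abelian_group_axioms T.abelian_group_axioms pure_additive(1)])
     (assumption, rule additive_map_zero[OF M.abelian_group_axioms T.abelian_group_axioms pure_additive(2)])

lemma pure_finsum_right:
  "m \<in> carrier M \<Longrightarrow> g \<in> I \<rightarrow> carrier N \<Longrightarrow> pt m (finsum N g I) = finsum T (\<lambda>i. pt m (g i)) I"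
  by (rule additive_map_finsum[OF N.abelian_group_axioms T.abelian_group_axioms pure_additive(1)])

lemma pure_finsum_left:
  "n \<in> carrier N \<Longrightarrow> h \<in> I \<rightarrow> carrier M \<Longrightarrow> pt (finsum M h I) n = finsum T (\<lambda>i. pt (h i) n) I"
  by (rule additive_map_finsum[OF M.abelian_group_axioms T.abelian_group_axioms pure_additive(2)])

end

text \<open>\<open>rtensor\<close> and \<open>btensor\<close> only add actions to
  \<open>tensor_group\<close>. Rewriting all additive structure to \<open>tensor_group\<close> gives
  one normal form, to which the lemmas of \<open>tensor_pair\<close> apply.\<close>

lemma rtensor_simps [simp]:
  "carrier (rtensor R M N) = carrier (tensor_group R M N)"
  "add (rtensor R M N) = add (tensor_group R M N)"
  "zero (rtensor R M N) = zero (tensor_group R M N)"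
  "carrier (btensor R M' N) = carrier (tensor_group R M' N)"
  "add (btensor R M' N) = add (tensor_group R M' N)"
  "zero (btensor R M' N) = zero (tensor_group R M' N)"
  "finsum (rtensor R M N) f I = finsum (tensor_group R M N) f I"
  "finsum (btensor R M' N) f I = finsum (tensor_group R M' N) f I"
  "a_inv (rtensor R M N) x = a_inv (tensor_group R M N) x"
  "a_inv (btensor R M' N) x = a_inv (tensor_group R M' N) x"
  "a_minus (rtensor R M N) x y = a_minus (tensor_group R M N) x y"
  "a_minus (btensor R M' N) x y = a_minus (tensor_group R M' N) x y"
  by (simp_all add: rtensor_def btensor_def Let_def finsum_def finprod_def a_minus_def a_inv_def m_inv_def)

lemma tensor_lift_group_cong [simp]:
  "tensor_lift (rtensor R M N) = tensor_lift (tensor_group R M N)"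
  "tensor_lift (btensor R M' N) = tensor_lift (tensor_group R M' N)"
  by (simp_all add: tensor_lift_def rtensor_def btensor_def Let_def finsum_def finprod_def add_pow_def
    int_pow_def nat_pow_def m_inv_def fun_eq_iff cong del: if_weak_cong)

lemma additive_map_rtensor [simp]:
  "additive_map (rtensor R M N) = (additive_map (tensor_group R M N) :: ('c, 'w) ring_scheme \<Rightarrow> _)"
  "additive_map (btensor R M' N) = (additive_map (tensor_group R M' N) :: ('c, 'w) ring_scheme \<Rightarrow> _)"
  "additive_map G (rtensor R M N) = additive_map G (tensor_group R M N)"
  "additive_map G (btensor R M' N) = additive_map G (tensor_group R M' N)"
  by (simp_all add: additive_map_def fun_eq_iff)

lemma balanced_rtensor [simp]:
  "balanced R' G H (rtensor R M N) = balanced R' G H (tensor_group R M N)"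
  "balanced R' G H (btensor R M' N) = balanced R' G H (tensor_group R M' N)"
  by (simp_all add: balanced_def fun_eq_iff)

lemma ract_rtensor:
  "ract (rtensor R M N) t b = tensor_lift (tensor_group R M N) (\<lambda>m n. pure_tensor R M N m (ract N n b)) t"
  "ract (btensor R M' N) t b = tensor_lift (tensor_group R M' N) (\<lambda>m n. pure_tensor R M' N m (ract N n b)) t"
  "lact (btensor R M' N) a t = tensor_lift (tensor_group R M' N) (\<lambda>m n. pure_tensor R M' N (lact M' a m) n) t"
  by (simp_all add: rtensor_def btensor_def Let_def)

lemma abelian_group_rtensor:
  assumes "tensor_pair R M N"
  shows "abelian_group (rtensor R M N)"
  by (rule abelian_group_record_cong[OF tensor_pair.abelian_group_T[OF assms]]) auto

lemma abelian_group_btensor: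
  assumes "tensor_pair R M' N"
  shows "abelian_group (btensor R M' N)"
  by (rule abelian_group_record_cong[OF tensor_pair.abelian_group_T[OF assms]]) auto

lemma right_module_record_cong:
  assumes "right_module B G" "carrier H = carrier G" "zero H = zero G" "add H = add G" "ract H = ract G"
  shows "right_module B H"
  using assms abelian_group_record_cong[of G H] by (simp add: right_module_def)

section \<open>Module and bimodule structures on tensor products\<close>

locale tensor_right = tensor_pair R M N
  for R :: "('r, 'x) ring_scheme" and M :: "('r, 'm, 'y) rmod_scheme"
    and N :: "('r, 's, 'n, 'z) bimod_scheme" +
  fixes S' :: "('s, 'w) ring_scheme"
  assumes bi_N: "bimodule R S' N"
begin

lemma right_N: "right_module S' N"
  using bimoduleD(1)[OF bi_N] .

sublocale S': ring S' using right_moduleD(1)[OF right_N] .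

abbreviation "act \<equiv> ract (rtensor R M N)"

lemma balanced_act:
  assumes b: "b \<in> carrier S'"
  shows "balanced R M N T (\<lambda>m n. pt m (ract N n b))"
proof (intro balancedI)
  show "additive_map N T (\<lambda>n. pt m (ract N n b))" if "m \<in> carrier M" for m
    by (rule additive_map_comp[OF right_moduleD(4)[OF right_N b] pure_additive(1)[OF that]])
  show "additive_map M T (\<lambda>m. pt m (ract N n b))" if "n \<in> carrier N" for n
    by (rule pure_additive(2)[OF right_moduleD(3)[OF right_N that b]])
  show "pt (ract M m r) (ract N n b) = pt m (ract N (lact N r n) b)"
    if "m \<in> carrier M" "r \<in> carrier R" "n \<in> carrier N" for m r n
    using that b by (simp only: bimoduleD(3)[OF bi_N] pure_balance right_moduleD(3)[OF right_N])
qed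

lemma act_additive: "b \<in> carrier S' \<Longrightarrow> additive_map T T (\<lambda>t. act t b)"
  unfolding ract_rtensor by (rule lift_additive[OF abelian_group_T balanced_act])

lemma act_T_closed: "t \<in> carrier T \<Longrightarrow> b \<in> carrier S' \<Longrightarrow> act t b \<in> carrier T"
  using additive_map_closed[OF act_additive] .

lemma act_pure:
  "m \<in> carrier M \<Longrightarrow> n \<in> carrier N \<Longrightarrow> b \<in> carrier S' \<Longrightarrow> act (pt m n) b = pt m (ract N n b)"
  unfolding ract_rtensor by (rule lift_pure[OF abelian_group_T balanced_act])

lemma act_add:
  "s \<in> carrier T \<Longrightarrow> t \<in> carrier T \<Longrightarrow> b \<in> carrier S' \<Longrightarrow> act (s \<oplus>\<^bsub>T\<^esub> t) b = act s b \<oplus>\<^bsub>T\<^esub> act t b"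
  by (rule additive_map_add[OF act_additive])

lemma act_additive_right:
  assumes t: "t \<in> carrier T"
  shows "additive_map S' T (act t)"
proof (rule additive_mapI)
  fix b c assume b: "b \<in> carrier S'" and c: "c \<in> carrier S'"
  show "act t (b \<oplus>\<^bsub>S'\<^esub> c) = act t b \<oplus>\<^bsub>T\<^esub> act t c"
  proof (rule tensor_ext[OF t])
    show "additive_map T T (\<lambda>t. act t (b \<oplus>\<^bsub>S'\<^esub> c))" by (rule act_additive) (simp add: b c)
    show "additive_map T T (\<lambda>t. act t b \<oplus>\<^bsub>T\<^esub> act t c)"
      by (rule additive_map_plus[OF abelian_group_T act_additive[OF b] act_additive[OF c]])
    show "act (pt m n) (b \<oplus>\<^bsub>S'\<^esub> c) = act (pt m n) b \<oplus>\<^bsub>T\<^esub> act (pt m n) c"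
      if "m \<in> carrier M" "n \<in> carrier N" for m n
      using that b c by (simp add: act_pure additive_map_add[OF right_moduleD(5)[OF right_N]]
          pure_add_right right_moduleD(3)[OF right_N])
  qed
qed (simp add: act_T_closed t)

lemma act_mult:
  assumes t: "t \<in> carrier T" and b: "b \<in> carrier S'" and c: "c \<in> carrier S'"
  shows "act t (b \<otimes>\<^bsub>S'\<^esub> c) = act (act t b) c"
proof (rule tensor_ext[OF t])
  show "additive_map T T (\<lambda>t. act t (b \<otimes>\<^bsub>S'\<^esub> c))" by (rule act_additive) (simp add: b c)
  show "additive_map T T (\<lambda>t. act (act t b) c)"
    by (rule additive_map_comp[OF act_additive[OF b] act_additive[OF c]])
  show "act (pt m n) (b \<otimes>\<^bsub>S'\<^esub> c) = act (act (pt m n) b) c"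
    if "m \<in> carrier M" "n \<in> carrier N" for m n
    using that b c by (simp add: act_pure right_moduleD(3,6)[OF right_N])
qed

lemma act_one:
  assumes t: "t \<in> carrier T"
  shows "act t \<one>\<^bsub>S'\<^esub> = t"
proof (rule tensor_ext[OF t])
  show "additive_map T T (\<lambda>t. act t \<one>\<^bsub>S'\<^esub>)" by (rule act_additive) simp
  show "additive_map T T (\<lambda>t. t)" by (simp add: additive_map_def)
  show "act (pt m n) \<one>\<^bsub>S'\<^esub> = pt m n" if "m \<in> carrier M" "n \<in> carrier N" for m n
    using that by (simp add: act_pure right_moduleD(7)[OF right_N])
qed

lemma right_module_T: "right_module S' (rtensor R M N)"
proof (rule right_moduleI)
  show "abelian_group (rtensor R M N)"
    by (rule abelian_group_rtensor) (rule tensor_pair_axioms)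
qed (simp_all add: S'.ring_axioms act_additive act_additive_right act_mult act_one)

end

lemma tensor_rightI:
  assumes "right_module R M" "bimodule R S' N"
  shows "tensor_right R M N S'"
  using assms bimoduleD(2)[OF assms(2)]
  by (auto simp: tensor_right_def tensor_pair_def tensor_right_axioms_def)

lemma ract_btensor [simp]: "ract (btensor R M N) = ract (rtensor R M N)"
  by (simp add: btensor_def rtensor_def Let_def)

locale tensor_bimod = tensor_right R M N S'
  for R :: "('r, 'x) ring_scheme" and M :: "('a, 'r, 'm, 'y) bimod_scheme"
    and N :: "('r, 's, 'n, 'z) bimod_scheme" and S' :: "('s, 'w) ring_scheme" +
  fixes A :: "('a, 'v) ring_scheme"
  assumes bi_M: "bimodule A R M"
begin

lemma left_M: "left_mod A M"
  using bimoduleD(2)[OF bi_M] .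

sublocale A: ring A using left_modD(1)[OF left_M] .

abbreviation "lac \<equiv> lact (btensor R M N)"

lemma balanced_lac:
  assumes a: "a \<in> carrier A"
  shows "balanced R M N T (\<lambda>m n. pt (lact M a m) n)"
proof (intro balancedI)
  show "additive_map M T (\<lambda>m. pt (lact M a m) n)" if "n \<in> carrier N" for n
    by (rule additive_map_comp[OF left_modD(4)[OF left_M a] pure_additive(2)[OF that]])
  show "additive_map N T (pt (lact M a m))" if "m \<in> carrier M" for m
    by (rule pure_additive(1)[OF left_modD(3)[OF left_M a that]])
  show "pt (lact M a (ract M m r)) n = pt (lact M a m) (lact N r n)"
    if "m \<in> carrier M" "r \<in> carrier R" "n \<in> carrier N" for m r n
    using that a by (simp only: bimoduleD(3)[OF bi_M, symmetric] pure_balance left_modD(3)[OF left_M])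
qed

lemma lac_additive: "a \<in> carrier A \<Longrightarrow> additive_map T T (lac a)"
  using lift_additive[OF abelian_group_T balanced_lac, of a] by (simp add: ract_rtensor(3)[abs_def])

lemma lac_closed: "t \<in> carrier T \<Longrightarrow> a \<in> carrier A \<Longrightarrow> lac a t \<in> carrier T"
  using additive_map_closed[OF lac_additive] .

lemma lac_pure:
  "m \<in> carrier M \<Longrightarrow> n \<in> carrier N \<Longrightarrow> a \<in> carrier A \<Longrightarrow> lac a (pt m n) = pt (lact M a m) n"
  unfolding ract_rtensor by (rule lift_pure[OF abelian_group_T balanced_lac])

lemma lac_add:
  "s \<in> carrier T \<Longrightarrow> t \<in> carrier T \<Longrightarrow> a \<in> carrier A \<Longrightarrow> lac a (s \<oplus>\<^bsub>T\<^esub> t) = lac a s \<oplus>\<^bsub>T\<^esub> lac a t"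
  by (rule additive_map_add[OF lac_additive])

lemma lac_additive_left:
  assumes t: "t \<in> carrier T"
  shows "additive_map A T (\<lambda>a. lac a t)"
proof (rule additive_mapI)
  fix b c assume b: "b \<in> carrier A" and c: "c \<in> carrier A"
  show "lac (b \<oplus>\<^bsub>A\<^esub> c) t = lac b t \<oplus>\<^bsub>T\<^esub> lac c t"
  proof (rule tensor_ext[OF t])
    show "additive_map T T (lac (b \<oplus>\<^bsub>A\<^esub> c))" by (rule lac_additive) (simp add: b c)
    show "additive_map T T (\<lambda>t. lac b t \<oplus>\<^bsub>T\<^esub> lac c t)"
      by (rule additive_map_plus[OF abelian_group_T lac_additive[OF b] lac_additive[OF c]])
    show "lac (b \<oplus>\<^bsub>A\<^esub> c) (pt m n) = lac b (pt m n) \<oplus>\<^bsub>T\<^esub> lac c (pt m n)"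
      if "m \<in> carrier M" "n \<in> carrier N" for m n
      using that b c by (simp add: lac_pure additive_map_add[OF left_modD(5)[OF left_M]]
          pure_add_left left_modD(3)[OF left_M])
  qed
qed (simp add: lac_closed t)

lemma lac_mult:
  assumes t: "t \<in> carrier T" and b: "b \<in> carrier A" and c: "c \<in> carrier A"
  shows "lac (b \<otimes>\<^bsub>A\<^esub> c) t = lac b (lac c t)"
proof (rule tensor_ext[OF t])
  show "additive_map T T (lac (b \<otimes>\<^bsub>A\<^esub> c))" by (rule lac_additive) (simp add: b c)
  show "additive_map T T (\<lambda>t. lac b (lac c t))"
    by (rule additive_map_comp[OF lac_additive[OF c] lac_additive[OF b]])
  show "lac (b \<otimes>\<^bsub>A\<^esub> c) (pt m n) = lac b (lac c (pt m n))"
    if "m \<in> carrier M" "n \<in> carrier N" for m n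
    using that b c by (simp add: lac_pure left_modD(3,6)[OF left_M])
qed

lemma lac_one:
  assumes t: "t \<in> carrier T"
  shows "lac \<one>\<^bsub>A\<^esub> t = t"
proof (rule tensor_ext[OF t])
  show "additive_map T T (lac \<one>\<^bsub>A\<^esub>)" by (rule lac_additive) simp
  show "additive_map T T (\<lambda>t. t)" by (simp add: additive_map_def)
  show "lac \<one>\<^bsub>A\<^esub> (pt m n) = pt m n" if "m \<in> carrier M" "n \<in> carrier N" for m n
    using that by (simp add: lac_pure left_modD(7)[OF left_M])
qed

lemma lac_act:
  assumes t: "t \<in> carrier T" and a: "a \<in> carrier A" and b: "b \<in> carrier S'"
  shows "act (lac a t) b = lac a (act t b)"
proof (rule tensor_ext[OF t])
  show "additive_map T T (\<lambda>t. act (lac a t) b)"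
    by (rule additive_map_comp[OF lac_additive[OF a] act_additive[OF b]])
  show "additive_map T T (\<lambda>t. lac a (act t b))"
    by (rule additive_map_comp[OF act_additive[OF b] lac_additive[OF a]])
  show "act (lac a (pt m n)) b = lac a (act (pt m n) b)"
    if "m \<in> carrier M" "n \<in> carrier N" for m n
    using that a b by (simp add: lac_pure act_pure left_modD(3)[OF left_M] right_moduleD(3)[OF right_N])
qed

lemma bimodule_T: "bimodule A S' (btensor R M N)"
  unfolding bimodule_def
proof (intro conjI ballI)
  show "right_module S' (btensor R M N)"
    by (rule right_module_record_cong[OF right_module_T]) simp_all
  show "left_mod A (btensor R M N)"
  proof (rule left_modI)
    show "abelian_group (btensor R M N)"
      by (rule abelian_group_btensor) (rule tensor_pair_axioms)
  qed (simp_all add: A.ring_axioms lac_additive lac_additive_left lac_mult lac_one)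
qed (simp add: lac_act)

end

lemma tensor_bimodI:
  assumes "bimodule A R M" "bimodule R S' N"
  shows "tensor_bimod R M N S' A"
  using tensor_rightI[OF bimoduleD(1)[OF assms(1)] assms(2)] assms
  by (auto simp: tensor_bimod_def tensor_bimod_axioms_def)


section \<open>Module maps\<close>

lemma right_module_homD:
  assumes "T \<in> right_module_hom B G H"
  shows "T \<in> extensional (carrier G)" "additive_map G H T" "x \<in> carrier G \<Longrightarrow> T x \<in> carrier H"
    "x \<in> carrier G \<Longrightarrow> b \<in> carrier B \<Longrightarrow> T (ract G x b) = ract H (T x) b"
  using assms by (auto simp: right_module_hom_def additive_map_def PiE_def)

lemma right_module_homI:
  assumes "T \<in> extensional (carrier G)" "additive_map G H T"
    "\<And>x b. x \<in> carrier G \<Longrightarrow> b \<in> carrier B \<Longrightarrow> T (ract G x b) = ract H (T x) b"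
  shows "T \<in> right_module_hom B G H"
  using assms by (auto simp: right_module_hom_def additive_map_def PiE_def)

lemma right_module_hom_id:
  assumes "right_module B G"
  shows "restrict id (carrier G) \<in> right_module_hom B G G"
proof -
  interpret abelian_group G by (rule right_moduleD(2)[OF assms])
  show ?thesis
    by (rule right_module_homI) (auto intro!: additive_mapI simp: right_moduleD(3)[OF assms])
qed

lemma right_module_hom_comp:
  assumes "right_module B G" "T \<in> right_module_hom B G H" "U \<in> right_module_hom B H L"
  shows "compose (carrier G) U T \<in> right_module_hom B G L"
proof -
  interpret abelian_group G by (rule right_moduleD(2)[OF assms(1)])
  note T = right_module_homD[OF assms(2)] and U = right_module_homD[OF assms(3)]
  show ?thesis
  proof (rule right_module_homI)
    show "additive_map G L (compose (carrier G) U T)"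
      by (rule additive_map_cong[OF abelian_group_axioms additive_map_comp[OF T(2) U(2)]])
         (simp add: compose_eq)
  qed (simp_all add: compose_eq T(3,4) U(4) right_moduleD(3)[OF assms(1)])
qed

locale tensor_map = tensor_pair R M N + M': tensor_pair R M' N
  for R :: "('r, 'x) ring_scheme" and M :: "('r, 'm, 'y) rmod_scheme"
    and N :: "('r, 's, 'n, 'z) bimod_scheme" and M' :: "('r, 'm', 'y') rmod_scheme" +
  fixes U :: "'m \<Rightarrow> 'm'"
  assumes hom_U: "U \<in> right_module_hom R M M'"
begin

abbreviation "Uid \<equiv> map_tensor_id R M M' N U"

lemma balanced_map: "balanced R M N M'.T (\<lambda>m n. M'.pt (U m) n)"
proof (intro balancedI)
  show "additive_map M M'.T (\<lambda>m. M'.pt (U m) n)" if "n \<in> carrier N" for n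
    by (rule additive_map_comp[OF right_module_homD(2)[OF hom_U] M'.pure_additive(2)[OF that]])
  show "additive_map N M'.T (M'.pt (U m))" if "m \<in> carrier M" for m
    by (rule M'.pure_additive(1)[OF right_module_homD(3)[OF hom_U that]])
qed (simp add: right_module_homD[OF hom_U] M'.pure_balance)

lemma Uid_eq: "t \<in> carrier T \<Longrightarrow> Uid t = tensor_lift M'.T (\<lambda>m n. M'.pt (U m) n) t"
  by (simp add: map_tensor_id_def)

lemma Uid_additive: "additive_map T M'.T Uid"
  by (rule additive_map_cong[OF abelian_group_T lift_additive[OF M'.abelian_group_T balanced_map] Uid_eq])

lemma Uid_pure: "m \<in> carrier M \<Longrightarrow> n \<in> carrier N \<Longrightarrow> Uid (pt m n) = M'.pt (U m) n"
  by (simp add: Uid_eq lift_pure[OF M'.abelian_group_T balanced_map])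

lemma Uid_ext: "Uid \<in> extensional (carrier T)"
  by (simp add: map_tensor_id_def)

lemma Uid_hom:
  assumes bi: "bimodule R S' N"
  shows "Uid \<in> right_module_hom S' (rtensor R M N) (rtensor R M' N)"
proof -
  interpret L: tensor_right R M N S' by (rule tensor_rightI[OF right_M bi])
  interpret L': tensor_right R M' N S' by (rule tensor_rightI[OF M'.right_M bi])
  show ?thesis
  proof (rule right_module_homI)
    fix x b assume x: "x \<in> carrier (rtensor R M N)" and b: "b \<in> carrier S'"
    from x have x: "x \<in> carrier T" by simp
    show "Uid (L.act x b) = L'.act (Uid x) b"
    proof (rule tensor_ext[OF x])
      show "additive_map T M'.T (\<lambda>x. Uid (L.act x b))"
        by (rule additive_map_comp[OF L.act_additive[OF b] Uid_additive])
      show "additive_map T M'.T (\<lambda>x. L'.act (Uid x) b)"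
        by (rule additive_map_comp[OF Uid_additive L'.act_additive[OF b]])
      show "Uid (L.act (pt m n) b) = L'.act (Uid (pt m n)) b" if "m \<in> carrier M" "n \<in> carrier N" for m n
        using that b by (simp add: L.act_pure L'.act_pure Uid_pure right_module_homD[OF hom_U]
            right_moduleD(3)[OF L.right_N])
    qed
  qed (simp_all add: Uid_ext Uid_additive)
qed

end

lemma tensor_mapI:
  assumes "right_module R M" "right_module R M'" "left_mod R N" "U \<in> right_module_hom R M M'"
  shows "tensor_map R M N M' U"
  using assms by (simp add: tensor_map_def tensor_pair_def tensor_map_axioms_def)

lemma map_tensor_id_id:
  assumes "right_module R M" "left_mod R N" and t: "t \<in> carrier (tensor_group R M N)"
  shows "map_tensor_id R M M N (restrict id (carrier M)) t = t"
proof -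
  interpret tensor_map R M N M "restrict id (carrier M)"
    by (rule tensor_mapI[OF assms(1,1,2) right_module_hom_id[OF assms(1)]])
  show ?thesis
    by (rule tensor_ext[OF t Uid_additive]) (simp_all add: additive_map_def Uid_pure)
qed

lemma map_tensor_id_comp:
  assumes M: "right_module R M" "right_module R M'" "right_module R M''" and N: "left_mod R N"
    and U: "U \<in> right_module_hom R M M'" and V: "V \<in> right_module_hom R M' M''"
    and t: "t \<in> carrier (tensor_group R M N)"
  shows "map_tensor_id R M M'' N (compose (carrier M) V U) t =
    map_tensor_id R M' M'' N V (map_tensor_id R M M' N U t)"
proof -
  interpret U: tensor_map R M N M' U by (rule tensor_mapI[OF M(1,2) N U])
  interpret V: tensor_map R M' N M'' V by (rule tensor_mapI[OF M(2,3) N V])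
  interpret VU: tensor_map R M N M'' "compose (carrier M) V U"
    by (rule tensor_mapI[OF M(1,3) N right_module_hom_comp[OF M(1) U V]])
  show ?thesis
    by (rule U.tensor_ext[OF t VU.Uid_additive additive_map_comp[OF U.Uid_additive V.Uid_additive]])
       (simp add: U.Uid_pure V.Uid_pure VU.Uid_pure compose_eq right_module_homD(3)[OF U])
qed

section \<open>Right connections\<close>

lemma right_connectionD:
  assumes "right_connection B \<Omega> d G nab"
  shows "right_module B G" "bimodule B B \<Omega>" "additive_map G (tensor_group B G \<Omega>) nab"
    "nab \<in> extensional (carrier G)"
    "g \<in> carrier G \<Longrightarrow> nab g \<in> carrier (tensor_group B G \<Omega>)"
    "g \<in> carrier G \<Longrightarrow> b \<in> carrier B \<Longrightarrow>
      nab (ract G g b) = pure_tensor B G \<Omega> g (d b) \<oplus>\<^bsub>tensor_group B G \<Omega>\<^esub> ract (rtensor B G \<Omega>) (nab g) b"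
  using assms by (auto simp: right_connection_def additive_map_def PiE_def)

lemma right_connectionI:
  assumes "right_module B G" "bimodule B B \<Omega>" "additive_map G (tensor_group B G \<Omega>) nab"
    "nab \<in> extensional (carrier G)"
    "\<And>g b. g \<in> carrier G \<Longrightarrow> b \<in> carrier B \<Longrightarrow>
      nab (ract G g b) = pure_tensor B G \<Omega> g (d b) \<oplus>\<^bsub>tensor_group B G \<Omega>\<^esub> ract (rtensor B G \<Omega>) (nab g) b"
  shows "right_connection B \<Omega> d G nab"
  using assms by (simp add: right_connection_def additive_map_def PiE_def)

lemma connection_category_simps:
  "obj (connection_category B \<Omega> d) = {(G, nab). right_connection B \<Omega> d G nab}"
  "mor (connection_category B \<Omega> d) (G, nab) (H, nab') = {T \<in> right_module_hom B G H.
               \<forall>g\<in>carrier G. nab' (T g) = map_tensor_id B G H \<Omega> T (nab g)}"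
  "ident (connection_category B \<Omega> d) (G, nab) = restrict id (carrier G)"
  "cmp (connection_category B \<Omega> d) (G, nab) T S = compose (carrier G) T S"
  by (simp_all add: connection_category_def)

lemma connection_mor_id:
  assumes "right_connection B \<Omega> d G nab"
  shows "restrict id (carrier G) \<in> mor (connection_category B \<Omega> d) (G, nab) (G, nab)"
  using right_connectionD[OF assms]
  by (simp add: connection_category_simps right_module_hom_id map_tensor_id_id bimoduleD(2))

lemma connection_mor_comp:
  assumes G: "right_connection B \<Omega> d G nab" and H: "right_connection B \<Omega> d H nab'"
    and L: "right_connection B \<Omega> d L nab''"
    and T: "T \<in> mor (connection_category B \<Omega> d) (G, nab) (H, nab')"
    and U: "U \<in> mor (connection_category B \<Omega> d) (H, nab') (L, nab'')"
  shows "compose (carrier G) U T \<in> mor (connection_category B \<Omega> d) (G, nab) (L, nab'')"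
proof -
  note G = right_connectionD[OF G] and H = right_connectionD[OF H] and L = right_connectionD[OF L]
  from T have T: "T \<in> right_module_hom B G H"
    "\<And>g. g \<in> carrier G \<Longrightarrow> nab' (T g) = map_tensor_id B G H \<Omega> T (nab g)"
    by (auto simp: connection_category_simps)
  from U have U: "U \<in> right_module_hom B H L"
    "\<And>g. g \<in> carrier H \<Longrightarrow> nab'' (U g) = map_tensor_id B H L \<Omega> U (nab' g)"
    by (auto simp: connection_category_simps)
  show ?thesis
    using right_module_hom_comp[OF G(1) T(1) U(1)]
    by (simp add: connection_category_simps compose_eq U(2) T(2) right_module_homD(3)[OF T(1)] G(5)
        map_tensor_id_comp[OF G(1) H(1) L(1) bimoduleD(2)[OF G(2)] T(1) U(1)])
qed

text \<open>Holomorphic bundles form a full subcategory of modules with connection, whence the generality.\<close>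

lemma is_category_connection_subcategory:
  assumes "P \<subseteq> {(G, nab). right_connection B \<Omega> d G nab}"
  shows "is_category ((connection_category B \<Omega> d)\<lparr>obj := P\<rparr>)"
proof -
  have conn: "right_connection B \<Omega> d (fst X) (snd X)" if "X \<in> P" for X
    using assms that by auto
  have ext: "f \<in> extensional (carrier (fst X))" "f \<in> carrier (fst X) \<rightarrow> carrier (fst Y)"
    if "f \<in> mor (connection_category B \<Omega> d) X Y" for f X Y
    using that by (cases X; cases Y; auto simp: connection_category_simps right_module_hom_def PiE_def)+
  have id: "ident (connection_category B \<Omega> d) X = restrict id (carrier (fst X))" for X
    by (cases X) (simp add: connection_category_simps)
  have cmp: "cmp (connection_category B \<Omega> d) X T S = compose (carrier (fst X)) T S" for X T S
    by (cases X) (simp add: connection_category_simps)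
  show ?thesis
    unfolding is_category_def
  proof (intro conjI ballI)
    fix X assume "X \<in> obj ((connection_category B \<Omega> d)\<lparr>obj := P\<rparr>)"
    then have X: "X \<in> P" by simp
    show "ident ((connection_category B \<Omega> d)\<lparr>obj := P\<rparr>) X \<in> mor ((connection_category B \<Omega> d)\<lparr>obj := P\<rparr>) X X"
      using connection_mor_id[OF conn[OF X]] by (simp add: id)
    fix Y assume "Y \<in> obj ((connection_category B \<Omega> d)\<lparr>obj := P\<rparr>)"
    then have Y: "Y \<in> P" by simp
    {
      fix f assume "f \<in> mor ((connection_category B \<Omega> d)\<lparr>obj := P\<rparr>) X Y"
      then have f: "f \<in> mor (connection_category B \<Omega> d) X Y" by simp
      show "cmp ((connection_category B \<Omega> d)\<lparr>obj := P\<rparr>) X f (ident ((connection_category B \<Omega> d)\<lparr>obj := P\<rparr>) X) = f"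
        using ext[OF f] by (simp add: id cmp compose_def fun_eq_iff extensional_def)
      show "cmp ((connection_category B \<Omega> d)\<lparr>obj := P\<rparr>) X (ident ((connection_category B \<Omega> d)\<lparr>obj := P\<rparr>) Y) f = f"
        using ext[OF f] by (auto simp add: id cmp compose_def fun_eq_iff extensional_def)
    }
    fix Z assume "Z \<in> obj ((connection_category B \<Omega> d)\<lparr>obj := P\<rparr>)"
    then have Z: "Z \<in> P" by simp
    fix f g assume "f \<in> mor ((connection_category B \<Omega> d)\<lparr>obj := P\<rparr>) X Y"
      "g \<in> mor ((connection_category B \<Omega> d)\<lparr>obj := P\<rparr>) Y Z"
    then have f: "f \<in> mor (connection_category B \<Omega> d) X Y" and g: "g \<in> mor (connection_category B \<Omega> d) Y Z"
      by simp_all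
    show "cmp ((connection_category B \<Omega> d)\<lparr>obj := P\<rparr>) X g f \<in> mor ((connection_category B \<Omega> d)\<lparr>obj := P\<rparr>) X Z"
      using connection_mor_comp[OF conn[OF X] conn[OF Y] conn[OF Z], of f g] f g by (simp add: cmp)
    fix W h assume h: "h \<in> mor ((connection_category B \<Omega> d)\<lparr>obj := P\<rparr>) Z W"
    show "cmp ((connection_category B \<Omega> d)\<lparr>obj := P\<rparr>) X h (cmp ((connection_category B \<Omega> d)\<lparr>obj := P\<rparr>) X g f) =
      cmp ((connection_category B \<Omega> d)\<lparr>obj := P\<rparr>) X (cmp ((connection_category B \<Omega> d)\<lparr>obj := P\<rparr>) Y h g) f"
      using ext(2)[OF f] by (auto simp: cmp compose_def fun_eq_iff)
  qed
qed

lemma is_category_connection: "is_category (connection_category B \<Omega> d)"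
  using is_category_connection_subcategory[OF order_refl, of B \<Omega> d]
  by (simp add: connection_category_def)

section \<open>Tensoring with a bimodule connection\<close>

lemma bimodule_homD:
  assumes "T \<in> bimodule_hom A B G H"
  shows "T \<in> right_module_hom B G H" "additive_map G H T" "x \<in> carrier G \<Longrightarrow> T x \<in> carrier H"
    "x \<in> carrier G \<Longrightarrow> b \<in> carrier B \<Longrightarrow> T (ract G x b) = ract H (T x) b"
    "x \<in> carrier G \<Longrightarrow> a \<in> carrier A \<Longrightarrow> T (lact G a x) = lact H a (T x)"
  using assms right_module_homD[of T B G H] by (auto simp: bimodule_hom_def)

locale bimodule_connection =
  fixes A :: "('a, 'x) ring_scheme" and \<Omega>A :: "('a, 'a, 'u) bimod" and dA :: "'a \<Rightarrow> 'u"
    and B :: "('b, 'y) ring_scheme" and \<Omega>B :: "('b, 'b, 'w) bimod" and dB :: "'b \<Rightarrow> 'w"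
    and E :: "('a, 'b, 'e) bimod" and nabE :: "'e \<Rightarrow> ('e, 'w) tens" and \<sigma> :: "('u, 'e) tens \<Rightarrow> ('e, 'w) tens"
  assumes conn: "right_bimodule_connection A \<Omega>A dA B \<Omega>B dB E nabE \<sigma>"
    and bi_\<Omega>A: "bimodule A A \<Omega>A"
    and dA_closed: "a \<in> carrier A \<Longrightarrow> dA a \<in> carrier \<Omega>A"
    and dB_closed: "b \<in> carrier B \<Longrightarrow> dB b \<in> carrier \<Omega>B"
begin

lemma bi_E: "bimodule A B E" and conn_E: "right_connection B \<Omega>B dB E nabE"
  and \<sigma>_hom: "\<sigma> \<in> bimodule_hom A B (btensor A \<Omega>A E) (btensor B E \<Omega>B)"
  and nabE_left: "a \<in> carrier A \<Longrightarrow> e \<in> carrier E \<Longrightarrow> nabE (lact E a e) =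
          \<sigma> (pure_tensor A \<Omega>A E (dA a) e) \<oplus>\<^bsub>tensor_group B E \<Omega>B\<^esub> lact (btensor B E \<Omega>B) a (nabE e)"
  using conn by (simp_all add: right_bimodule_connection_def)

lemma bi_\<Omega>B: "bimodule B B \<Omega>B" using right_connectionD(2)[OF conn_E] .

sublocale OE: tensor_bimod A \<Omega>A E B A by (rule tensor_bimodI[OF bi_\<Omega>A bi_E])
sublocale EO: tensor_bimod B E \<Omega>B B A by (rule tensor_bimodI[OF bi_E bi_\<Omega>B])

lemma \<sigma>_additive: "additive_map OE.T EO.T \<sigma>"
  using bimodule_homD(2)[OF \<sigma>_hom] by simp

lemma \<sigma>_closed: "t \<in> carrier OE.T \<Longrightarrow> \<sigma> t \<in> carrier EO.T"
  by (rule additive_map_closed[OF \<sigma>_additive])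

lemma \<sigma>_act: "t \<in> carrier OE.T \<Longrightarrow> b \<in> carrier B \<Longrightarrow> \<sigma> (OE.act t b) = EO.act (\<sigma> t) b"
  and \<sigma>_lac: "t \<in> carrier OE.T \<Longrightarrow> a \<in> carrier A \<Longrightarrow> \<sigma> (OE.lac a t) = EO.lac a (\<sigma> t)"
  using bimodule_homD(4,5)[OF \<sigma>_hom] by simp_all

lemmas nabE = right_connectionD(3,5,6)[OF conn_E]

end

locale connection_tensor = bimodule_connection A \<Omega>A dA B \<Omega>B dB E nabE \<sigma>
  for A :: "('a, 'x) ring_scheme" and \<Omega>A :: "('a, 'a, 'u) bimod" and dA :: "'a \<Rightarrow> 'u"
    and B :: "('b, 'y) ring_scheme" and \<Omega>B :: "('b, 'b, 'w) bimod" and dB :: "'b \<Rightarrow> 'w"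
    and E :: "('a, 'b, 'e) bimod" and nabE :: "'e \<Rightarrow> ('e, 'w) tens" and \<sigma> :: "('u, 'e) tens \<Rightarrow> ('e, 'w) tens" +
  fixes F :: "('a, 'f) rmod" and nabF :: "'f \<Rightarrow> ('f, 'u) tens"
  assumes conn_F: "right_connection A \<Omega>A dA F nabF"
begin

lemma right_F: "right_module A F" by (rule right_connectionD(1)[OF conn_F])

sublocale FE: tensor_right A F E B by (rule tensor_rightI[OF right_F bi_E])
sublocale FO: tensor_right A F \<Omega>A A by (rule tensor_rightI[OF right_F bi_\<Omega>A])
sublocale FEO: tensor_right B "rtensor A F E" \<Omega>B B by (rule tensor_rightI[OF FE.right_module_T bi_\<Omega>B])

abbreviation "assoc f t \<equiv> tensor_assoc A B F E \<Omega>B f t"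

lemmas nabF = right_connectionD(3,5,6)[OF conn_F]

lemma balanced_assoc:
  assumes f: "f \<in> carrier F"
  shows "balanced B E \<Omega>B FEO.T (\<lambda>e \<xi>. FEO.pt (FE.pt f e) \<xi>)"
proof (intro balancedI)
  show "additive_map \<Omega>B FEO.T (FEO.pt (FE.pt f e))" if "e \<in> carrier E" for e
    by (rule FEO.pure_additive) (simp add: f that)
  show "additive_map E FEO.T (\<lambda>e. FEO.pt (FE.pt f e) \<xi>)" if "\<xi> \<in> carrier \<Omega>B" for \<xi>
    using additive_map_comp[OF FE.pure_additive(1)[OF f], of FEO.T "\<lambda>x. FEO.pt x \<xi>"] FEO.pure_additive(2)[OF that]
    by simp
  show "FEO.pt (FE.pt f (ract E e b)) \<xi> = FEO.pt (FE.pt f e) (lact \<Omega>B b \<xi>)"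
    if "e \<in> carrier E" "b \<in> carrier B" "\<xi> \<in> carrier \<Omega>B" for e b \<xi>
    using that f FEO.pure_balance[of "FE.pt f e" b \<xi>] by (simp add: FE.act_pure)
qed

lemma assoc_additive: "f \<in> carrier F \<Longrightarrow> additive_map EO.T FEO.T (assoc f)"
  unfolding tensor_assoc_def[abs_def] by (rule EO.lift_additive[OF FEO.abelian_group_T balanced_assoc])

lemma assoc_closed: "f \<in> carrier F \<Longrightarrow> t \<in> carrier EO.T \<Longrightarrow> assoc f t \<in> carrier FEO.T"
  using additive_map_closed[OF assoc_additive] .

lemma assoc_add: "f \<in> carrier F \<Longrightarrow> s \<in> carrier EO.T \<Longrightarrow> t \<in> carrier EO.T \<Longrightarrow>
    assoc f (s \<oplus>\<^bsub>EO.T\<^esub> t) = assoc f s \<oplus>\<^bsub>FEO.T\<^esub> assoc f t"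
  using additive_map_add[OF assoc_additive] .

lemma assoc_pure: "f \<in> carrier F \<Longrightarrow> e \<in> carrier E \<Longrightarrow> \<xi> \<in> carrier \<Omega>B \<Longrightarrow>
    assoc f (EO.pt e \<xi>) = FEO.pt (FE.pt f e) \<xi>"
  unfolding tensor_assoc_def by (rule EO.lift_pure[OF FEO.abelian_group_T balanced_assoc])

lemma assoc_add_left:
  assumes f: "f \<in> carrier F" and g: "g \<in> carrier F" and t: "t \<in> carrier EO.T"
  shows "assoc (f \<oplus>\<^bsub>F\<^esub> g) t = assoc f t \<oplus>\<^bsub>FEO.T\<^esub> assoc g t"
proof (rule EO.tensor_ext[OF t])
  show "additive_map EO.T FEO.T (assoc (f \<oplus>\<^bsub>F\<^esub> g))"
    by (rule assoc_additive) (simp add: f g)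
  show "additive_map EO.T FEO.T (\<lambda>t. assoc f t \<oplus>\<^bsub>FEO.T\<^esub> assoc g t)"
    by (rule additive_map_plus[OF FEO.abelian_group_T assoc_additive[OF f] assoc_additive[OF g]])
  show "assoc (f \<oplus>\<^bsub>F\<^esub> g) (EO.pt e \<xi>) = assoc f (EO.pt e \<xi>) \<oplus>\<^bsub>FEO.T\<^esub> assoc g (EO.pt e \<xi>)"
    if "e \<in> carrier E" "\<xi> \<in> carrier \<Omega>B" for e \<xi>
    using that f g FEO.pure_add_left[of "FE.pt f e" "FE.pt g e" \<xi>] by (simp add: assoc_pure FE.pure_add_left)
qed

text \<open>Balance over A survives the reassociation of F \<otimes> (E \<otimes> \<Omega>). This is
  what lets scalars of A in \<open>phi\<close> be moved from F onto E.\<close>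

lemma assoc_balance:
  assumes f: "f \<in> carrier F" and a: "a \<in> carrier A" and t: "t \<in> carrier EO.T"
  shows "assoc (ract F f a) t = assoc f (EO.lac a t)"
proof (rule EO.tensor_ext[OF t])
  show "additive_map EO.T FEO.T (assoc (ract F f a))"
    by (rule assoc_additive[OF FE.act_closed(1)[OF f a]])
  show "additive_map EO.T FEO.T (\<lambda>t. assoc f (EO.lac a t))"
    by (rule additive_map_comp[OF EO.lac_additive[OF a] assoc_additive[OF f]])
  show "assoc (ract F f a) (EO.pt e \<xi>) = assoc f (EO.lac a (EO.pt e \<xi>))"
    if "e \<in> carrier E" "\<xi> \<in> carrier \<Omega>B" for e \<xi>
    using that f a by (simp add: assoc_pure FE.act_closed EO.lac_pure FE.pure_balance)
qed

lemma assoc_act: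
  assumes f: "f \<in> carrier F" and b: "b \<in> carrier B" and t: "t \<in> carrier EO.T"
  shows "assoc f (EO.act t b) = FEO.act (assoc f t) b"
proof (rule EO.tensor_ext[OF t])
  show "additive_map EO.T FEO.T (\<lambda>t. assoc f (EO.act t b))"
    by (rule additive_map_comp[OF EO.act_additive[OF b] assoc_additive[OF f]])
  show "additive_map EO.T FEO.T (\<lambda>t. FEO.act (assoc f t) b)"
    by (rule additive_map_comp[OF assoc_additive[OF f] FEO.act_additive[OF b]])
  show "assoc f (EO.act (EO.pt e \<xi>) b) = FEO.act (assoc f (EO.pt e \<xi>)) b"
    if "e \<in> carrier E" "\<xi> \<in> carrier \<Omega>B" for e \<xi>
    using that f b by (simp add: assoc_pure EO.act_pure FEO.act_pure right_moduleD(3)[OF EO.right_N])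
qed

text \<open>The term (id \<otimes> \<sigma>)(f' \<otimes> \<omega> \<otimes> e), reassociated. The
  argument e comes first because the lift over F \<otimes> \<Omega>A is taken with e fixed, which
  gives \<open>gg e\<close>.\<close>

definition "psi e f' \<omega> = assoc f' (\<sigma> (OE.pt \<omega> e))"

lemma psi_additive_left: "e \<in> carrier E \<Longrightarrow> \<omega> \<in> carrier \<Omega>A \<Longrightarrow> additive_map F FEO.T (\<lambda>f. psi e f \<omega>)"
  unfolding psi_def by (rule additive_mapI) (simp_all add: assoc_closed assoc_add_left \<sigma>_closed)

lemma psi_additive_mid: "e \<in> carrier E \<Longrightarrow> f \<in> carrier F \<Longrightarrow> additive_map \<Omega>A FEO.T (psi e f)"
  unfolding psi_def[abs_def]
  by (rule additive_map_comp[OF additive_map_comp[OF OE.pure_additive(2) \<sigma>_additive] assoc_additive])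

lemma psi_additive: "\<omega> \<in> carrier \<Omega>A \<Longrightarrow> f \<in> carrier F \<Longrightarrow> additive_map E FEO.T (\<lambda>e. psi e f \<omega>)"
  unfolding psi_def[abs_def]
  by (rule additive_map_comp[OF additive_map_comp[OF OE.pure_additive(1) \<sigma>_additive] assoc_additive])

lemma balanced_psi: "e \<in> carrier E \<Longrightarrow> balanced A F \<Omega>A FEO.T (psi e)"
proof (intro balancedI psi_additive_mid psi_additive_left)
  show "psi e (ract F f a) \<omega> = psi e f (lact \<Omega>A a \<omega>)"
    if "e \<in> carrier E" "f \<in> carrier F" "a \<in> carrier A" "\<omega> \<in> carrier \<Omega>A" for f a \<omega>
    using that by (simp add: psi_def assoc_balance \<sigma>_closed OE.lac_pure[symmetric] \<sigma>_lac)
qed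

definition "gg e t = tensor_lift FEO.T (psi e) t"

lemma gg_additive: "e \<in> carrier E \<Longrightarrow> additive_map FO.T FEO.T (gg e)"
  unfolding gg_def[abs_def] by (rule FO.lift_additive[OF FEO.abelian_group_T balanced_psi])

lemma gg_closed: "e \<in> carrier E \<Longrightarrow> t \<in> carrier FO.T \<Longrightarrow> gg e t \<in> carrier FEO.T"
  by (rule additive_map_closed[OF gg_additive])

lemma gg_pure: "e \<in> carrier E \<Longrightarrow> f \<in> carrier F \<Longrightarrow> \<omega> \<in> carrier \<Omega>A \<Longrightarrow> gg e (FO.pt f \<omega>) = psi e f \<omega>"
  unfolding gg_def by (rule FO.lift_pure[OF FEO.abelian_group_T balanced_psi])

lemma gg_additive_left:
  assumes t: "t \<in> carrier FO.T"
  shows "additive_map E FEO.T (\<lambda>e. gg e t)"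
proof (rule additive_mapI)
  fix x y assume x: "x \<in> carrier E" and y: "y \<in> carrier E"
  have xy: "x \<oplus>\<^bsub>E\<^esub> y \<in> carrier E" using x y by simp
  show "gg (x \<oplus>\<^bsub>E\<^esub> y) t = gg x t \<oplus>\<^bsub>FEO.T\<^esub> gg y t"
    by (rule FO.tensor_ext[OF t gg_additive[OF xy]
          additive_map_plus[OF FEO.abelian_group_T gg_additive[OF x] gg_additive[OF y]]])
       (simp add: gg_pure x y xy additive_map_add[OF psi_additive])
qed (simp add: gg_closed t)

lemma gg_balance:
  assumes t: "t \<in> carrier FO.T" and a: "a \<in> carrier A" and e: "e \<in> carrier E"
  shows "gg (lact E a e) t = gg e (FO.act t a)"
proof -
  have ae: "lact E a e \<in> carrier E" using FE.act_closed a e by blast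
  show ?thesis
    by (rule FO.tensor_ext[OF t gg_additive[OF ae] additive_map_comp[OF FO.act_additive[OF a] gg_additive[OF e]]])
       (simp add: gg_pure a e ae FO.act_pure right_moduleD(3)[OF FO.right_N] psi_def OE.pure_balance)
qed

lemma gg_act:
  assumes t: "t \<in> carrier FO.T" and b: "b \<in> carrier B" and e: "e \<in> carrier E"
  shows "gg (ract E e b) t = FEO.act (gg e t) b"
proof -
  have eb: "ract E e b \<in> carrier E" using right_moduleD(3)[OF FE.right_N] b e by blast
  show ?thesis
    by (rule FO.tensor_ext[OF t gg_additive[OF eb] additive_map_comp[OF gg_additive[OF e] FEO.act_additive[OF b]]])
       (simp add: gg_pure b e eb psi_def assoc_act[symmetric] \<sigma>_closed \<sigma>_act[symmetric] OE.act_pure)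
qed

definition "phi f e = gg e (nabF f) \<oplus>\<^bsub>FEO.T\<^esub> assoc f (nabE e)"

text \<open>Neither summand of \<open>phi\<close> is balanced alone. The Leibniz term f \<otimes> da
  of \<nabla>(f a) becomes \<sigma>(da \<otimes> e) under \<open>gg\<close>, and this is precisely
  the extra term in \<nabla>(a e) = \<sigma>(da \<otimes> e) + a \<nabla>(e).\<close>

lemma balanced_phi: "balanced A F E FEO.T phi"
proof (intro balancedI)
  fix f assume f: "f \<in> carrier F"
  show "additive_map E FEO.T (phi f)"
    unfolding phi_def[abs_def]
    by (rule additive_map_plus[OF FEO.abelian_group_T gg_additive_left[OF nabF(2)[OF f]]
          additive_map_comp[OF nabE(1) assoc_additive[OF f]]])
next
  fix e assume e: "e \<in> carrier E"
  have "additive_map F FEO.T (\<lambda>f. assoc f (nabE e))"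
    by (rule additive_mapI) (simp_all add: e nabE(2) assoc_closed assoc_add_left)
  then show "additive_map F FEO.T (\<lambda>f. phi f e)"
    unfolding phi_def
    by (rule additive_map_plus[OF FEO.abelian_group_T additive_map_comp[OF nabF(1) gg_additive[OF e]]])
next
  fix f a e assume f: "f \<in> carrier F" and a: "a \<in> carrier A" and e: "e \<in> carrier E"
  have "phi (ract F f a) e = gg e (FO.pt f (dA a)) \<oplus>\<^bsub>FEO.T\<^esub> gg e (FO.act (nabF f) a)
      \<oplus>\<^bsub>FEO.T\<^esub> assoc f (EO.lac a (nabE e))"
    using f a e by (simp add: phi_def nabF dA_closed FO.act_T_closed additive_map_add[OF gg_additive]
        assoc_balance nabE)
  also have "\<dots> = gg e (FO.act (nabF f) a) \<oplus>\<^bsub>FEO.T\<^esub> (gg e (FO.pt f (dA a))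
      \<oplus>\<^bsub>FEO.T\<^esub> assoc f (EO.lac a (nabE e)))"
    using f a e by (simp add: FEO.T.a_ac gg_closed nabF dA_closed FO.act_T_closed assoc_closed EO.lac_closed nabE)
  also have "gg e (FO.pt f (dA a)) \<oplus>\<^bsub>FEO.T\<^esub> assoc f (EO.lac a (nabE e)) = assoc f (nabE (lact E a e))"
    using f a e by (simp add: gg_pure dA_closed psi_def nabE_left assoc_add \<sigma>_closed EO.lac_closed nabE)
  also have "gg e (FO.act (nabF f) a) = gg (lact E a e) (nabF f)"
    using f a e by (simp add: gg_balance nabF)
  finally show "phi (ract F f a) e = phi f (lact E a e)"
    by (simp only: phi_def)
qed

definition "nabFE = restrict (tensor_lift FEO.T phi) (carrier FE.T)"

lemma tensor_bimodule_obj_eq: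
  "tensor_bimodule_obj A \<Omega>A B \<Omega>B E nabE \<sigma> (F, nabF) = (rtensor A F E, nabFE)"
  by (simp add: tensor_bimodule_obj_def nabFE_def phi_def[abs_def] gg_def psi_def[abs_def])

lemma nabFE_additive: "additive_map FE.T FEO.T nabFE"
  by (rule additive_map_cong[OF FE.abelian_group_T FE.lift_additive[OF FEO.abelian_group_T balanced_phi]])
     (simp add: nabFE_def)

lemma nabFE_pure: "f \<in> carrier F \<Longrightarrow> e \<in> carrier E \<Longrightarrow> nabFE (FE.pt f e) = phi f e"
  by (simp add: nabFE_def FE.lift_pure[OF FEO.abelian_group_T balanced_phi])

text \<open>The Leibniz term comes from the summand with \<open>nabE\<close> only; the summand
  \<open>gg\<close> is linear over B because \<sigma> is a right module map.\<close>

lemma conn_FE: "right_connection B \<Omega>B dB (rtensor A F E) nabFE"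
proof (rule right_connectionI)
  show "nabFE \<in> extensional (carrier (rtensor A F E))" by (simp add: nabFE_def)
  fix t b assume "t \<in> carrier (rtensor A F E)" and b: "b \<in> carrier B"
  then have t: "t \<in> carrier FE.T" by simp
  have db: "dB b \<in> carrier \<Omega>B" by (rule dB_closed[OF b])
  show "nabFE (FE.act t b) = FEO.pt t (dB b) \<oplus>\<^bsub>FEO.T\<^esub> FEO.act (nabFE t) b"
  proof (rule FE.tensor_ext[OF t])
    show "additive_map FE.T FEO.T (\<lambda>t. nabFE (FE.act t b))"
      by (rule additive_map_comp[OF FE.act_additive[OF b] nabFE_additive])
    show "additive_map FE.T FEO.T (\<lambda>t. FEO.pt t (dB b) \<oplus>\<^bsub>FEO.T\<^esub> FEO.act (nabFE t) b)"
      using additive_map_plus[OF FEO.abelian_group_T _ additive_map_comp[OF nabFE_additive FEO.act_additive[OF b]]]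
        FEO.pure_additive(2)[OF db] by simp
  next
    fix f e assume f: "f \<in> carrier F" and e: "e \<in> carrier E"
    have eb: "ract E e b \<in> carrier E" using right_moduleD(3)[OF FE.right_N e b] .
    have "nabFE (FE.act (FE.pt f e) b) = gg (ract E e b) (nabF f) \<oplus>\<^bsub>FEO.T\<^esub> assoc f (nabE (ract E e b))"
      using f e b eb by (simp add: FE.act_pure nabFE_pure phi_def)
    also have "\<dots> = FEO.act (gg e (nabF f)) b \<oplus>\<^bsub>FEO.T\<^esub> (FEO.pt (FE.pt f e) (dB b) \<oplus>\<^bsub>FEO.T\<^esub> FEO.act (assoc f (nabE e)) b)"
      using f e b db by (simp add: gg_act nabF nabE assoc_add EO.act_T_closed assoc_pure assoc_act)
    also have "\<dots> = FEO.pt (FE.pt f e) (dB b) \<oplus>\<^bsub>FEO.T\<^esub> (FEO.act (gg e (nabF f)) b \<oplus>\<^bsub>FEO.T\<^esub> FEO.act (assoc f (nabE e)) b)"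
      using f e b db FEO.pure_closed[of "FE.pt f e" "dB b"]
      by (simp add: FEO.T.a_lcomm gg_closed nabF nabE assoc_closed FEO.act_T_closed)
    also have "\<dots> = FEO.pt (FE.pt f e) (dB b) \<oplus>\<^bsub>FEO.T\<^esub> FEO.act (nabFE (FE.pt f e)) b"
      using f e b by (simp add: nabFE_pure phi_def FEO.act_add gg_closed nabF nabE assoc_closed)
    finally show "nabFE (FE.act (FE.pt f e) b) = FEO.pt (FE.pt f e) (dB b) \<oplus>\<^bsub>FEO.T\<^esub> FEO.act (nabFE (FE.pt f e)) b" .
  qed
qed (simp_all add: FE.right_module_T bi_\<Omega>B nabFE_additive)

end

locale connection_tensor_map = X: connection_tensor A \<Omega>A dA B \<Omega>B dB E nabE \<sigma> F nabF +
  Y: connection_tensor A \<Omega>A dA B \<Omega>B dB E nabE \<sigma> G nabG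
  for A :: "('a, 'x) ring_scheme" and \<Omega>A :: "('a, 'a, 'u) bimod" and dA :: "'a \<Rightarrow> 'u"
    and B :: "('b, 'y) ring_scheme" and \<Omega>B :: "('b, 'b, 'w) bimod" and dB :: "'b \<Rightarrow> 'w"
    and E :: "('a, 'b, 'e) bimod" and nabE :: "'e \<Rightarrow> ('e, 'w) tens" and \<sigma> :: "('u, 'e) tens \<Rightarrow> ('e, 'w) tens"
    and F :: "('a, 'f) rmod" and nabF :: "'f \<Rightarrow> ('f, 'u) tens"
    and G :: "('a, 'g) rmod" and nabG :: "'g \<Rightarrow> ('g, 'u) tens" +
  fixes U :: "'f \<Rightarrow> 'g"
  assumes hom_U: "U \<in> right_module_hom A F G"
    and nab_U: "f \<in> carrier F \<Longrightarrow> nabG (U f) = map_tensor_id A F G \<Omega>A U (nabF f)"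
begin

sublocale UE: tensor_map A F E G U
  by (rule tensor_mapI[OF X.right_F Y.right_F bimoduleD(2)[OF X.bi_E] hom_U])
sublocale UO: tensor_map A F \<Omega>A G U
  by (rule tensor_mapI[OF X.right_F Y.right_F bimoduleD(2)[OF X.bi_\<Omega>A] hom_U])
lemma UE_hom: "UE.Uid \<in> right_module_hom B (rtensor A F E) (rtensor A G E)"
  by (rule UE.Uid_hom[OF X.bi_E])
sublocale UEO: tensor_map B "rtensor A F E" \<Omega>B "rtensor A G E" UE.Uid
  by (rule tensor_mapI[OF X.FE.right_module_T Y.FE.right_module_T bimoduleD(2)[OF X.bi_\<Omega>B] UE_hom])

lemma U_closed: "f \<in> carrier F \<Longrightarrow> U f \<in> carrier G"
  by (rule right_module_homD(3)[OF hom_U])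

lemma assoc_nat:
  assumes f: "f \<in> carrier F" and t: "t \<in> carrier X.EO.T"
  shows "UEO.Uid (X.assoc f t) = Y.assoc (U f) t"
  by (rule X.EO.tensor_ext[OF t additive_map_comp[OF X.assoc_additive[OF f] UEO.Uid_additive]
        Y.assoc_additive[OF U_closed[OF f]]])
     (use f U_closed[OF f] in \<open>simp add: X.assoc_pure Y.assoc_pure UEO.Uid_pure UE.Uid_pure\<close>)

lemma gg_nat:
  assumes e: "e \<in> carrier E" and t: "t \<in> carrier X.FO.T"
  shows "UEO.Uid (X.gg e t) = Y.gg e (UO.Uid t)"
  by (rule X.FO.tensor_ext[OF t additive_map_comp[OF X.gg_additive[OF e] UEO.Uid_additive]
        additive_map_comp[OF UO.Uid_additive Y.gg_additive[OF e]]])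
     (use e in \<open>simp add: X.gg_pure Y.gg_pure UO.Uid_pure U_closed X.psi_def Y.psi_def assoc_nat X.\<sigma>_closed\<close>)

lemma nabFE_nat:
  assumes t: "t \<in> carrier X.FE.T"
  shows "Y.nabFE (UE.Uid t) = UEO.Uid (X.nabFE t)"
  by (rule X.FE.tensor_ext[OF t additive_map_comp[OF UE.Uid_additive Y.nabFE_additive]
        additive_map_comp[OF X.nabFE_additive UEO.Uid_additive]])
     (simp add: UE.Uid_pure X.nabFE_pure Y.nabFE_pure U_closed X.phi_def Y.phi_def assoc_nat gg_nat
       X.nabF X.nabE X.gg_closed X.assoc_closed nab_U additive_map_add[OF UEO.Uid_additive])

end

context bimodule_connection
begin

theorem tensor_bimodule_functor:
  "is_functor (connection_category A \<Omega>A dA :: (('a, 'f) rmod \<times> ('f \<Rightarrow> ('f, 'u) tens), 'f \<Rightarrow> 'f) category)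
    (connection_category B \<Omega>B dB)
    (tensor_bimodule_obj A \<Omega>A B \<Omega>B E nabE \<sigma>) (tensor_bimodule_mor A E)"
proof -
  let ?C = "connection_category A \<Omega>A dA :: (('a, 'f) rmod \<times> ('f \<Rightarrow> ('f, 'u) tens), 'f \<Rightarrow> 'f) category"
  let ?D = "connection_category B \<Omega>B dB :: (('b, ('f, 'e) tens) rmod \<times> (('f, 'e) tens \<Rightarrow> (('f, 'e) tens, 'w) tens), ('f, 'e) tens \<Rightarrow> ('f, 'e) tens) category"
  let ?O = "tensor_bimodule_obj A \<Omega>A B \<Omega>B E nabE \<sigma> ::
    ('a, 'f) rmod \<times> ('f \<Rightarrow> ('f, 'u) tens) \<Rightarrow> _"
  have CT: "connection_tensor A \<Omega>A dA B \<Omega>B dB E nabE \<sigma> (fst X) (snd X)" if "X \<in> obj ?C" for X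
    using that bimodule_connection_axioms
    by (auto simp: connection_category_simps connection_tensor_def connection_tensor_axioms_def)
  have right: "right_module A (fst X)" if "X \<in> obj ?C" for X
    using connection_tensor.right_F[OF CT[OF that]] .
  have O: "?O X = (rtensor A (fst X) E, connection_tensor.nabFE A \<Omega>A B \<Omega>B E nabE \<sigma> (fst X) (snd X))"
    if "X \<in> obj ?C" for X
    using connection_tensor.tensor_bimodule_obj_eq[OF CT[OF that]] by simp
  have mor: "f \<in> right_module_hom A (fst X) (fst Y)"
    "g \<in> carrier (fst X) \<Longrightarrow> snd Y (f g) = map_tensor_id A (fst X) (fst Y) \<Omega>A f (snd X g)"
    if "f \<in> mor ?C X Y" for X Y f g
    using that by (cases X; cases Y; simp add: connection_category_simps)+
  show ?thesis
    unfolding is_functor_def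
  proof (intro conjI ballI is_category_connection)
    fix X assume X: "X \<in> obj ?C"
    interpret X: connection_tensor A \<Omega>A dA B \<Omega>B dB E nabE \<sigma> "fst X" "snd X" by (rule CT[OF X])
    show "?O X \<in> obj ?D"
      using X.conn_FE by (simp add: O[OF X] connection_category_simps)
    show "tensor_bimodule_mor A E X X (ident ?C X) = ident ?D (?O X)"
    proof
      fix t
      have "ident ?C X = restrict id (carrier (fst X))"
        by (cases X) (simp add: connection_category_simps)
      then show "tensor_bimodule_mor A E X X (ident ?C X) t = ident ?D (?O X) t"
        using map_tensor_id_id[OF X.right_F bimoduleD(2)[OF bi_E], of t]
        by (cases "t \<in> carrier X.FE.T")
           (simp_all add: tensor_bimodule_mor_def O[OF X] connection_category_simps, simp add: map_tensor_id_def)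
    qed
    fix Y assume Y: "Y \<in> obj ?C"
    interpret Y: connection_tensor A \<Omega>A dA B \<Omega>B dB E nabE \<sigma> "fst Y" "snd Y" by (rule CT[OF Y])
    fix f assume f: "f \<in> mor ?C X Y"
    interpret XY: connection_tensor_map A \<Omega>A dA B \<Omega>B dB E nabE \<sigma> "fst X" "snd X" "fst Y" "snd Y" f
      by unfold_locales (use mor[OF f] in auto)
    show "tensor_bimodule_mor A E X Y f \<in> mor ?D (?O X) (?O Y)"
      using XY.UE_hom XY.nabFE_nat
      by (simp add: O[OF X] O[OF Y] connection_category_simps tensor_bimodule_mor_def)
    fix Z assume Z: "Z \<in> obj ?C"
    fix g assume g: "g \<in> mor ?C Y Z"
    show "tensor_bimodule_mor A E X Z (cmp ?C X g f) =
      cmp ?D (?O X) (tensor_bimodule_mor A E Y Z g) (tensor_bimodule_mor A E X Y f)"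
    proof
      fix t
      have "cmp ?C X g f = compose (carrier (fst X)) g f"
        by (cases X) (simp add: connection_category_simps)
      then show "tensor_bimodule_mor A E X Z (cmp ?C X g f) t =
        cmp ?D (?O X) (tensor_bimodule_mor A E Y Z g) (tensor_bimodule_mor A E X Y f) t"
        using map_tensor_id_comp[OF X.right_F Y.right_F right[OF Z] bimoduleD(2)[OF bi_E] mor(1)[OF f] mor(1)[OF g], of t]
        by (cases "t \<in> carrier X.FE.T")
           (simp_all add: tensor_bimodule_mor_def O[OF X] connection_category_simps compose_def, simp add: map_tensor_id_def)
    qed
  qed
qed

end

section \<open>Smooth functions on punctured space\<close>

text \<open>Radial extensions have explicit formulas only away from the origin, so derivatives are
  compared through agreement on an open set.\<close>

lemma frechet_derivative_cong_open:
  assumes "open U" "u \<in> U" "\<And>x. x \<in> U \<Longrightarrow> f x = g x"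
  shows "frechet_derivative f (at u) = frechet_derivative g (at u)"
    "f differentiable (at u) \<longleftrightarrow> g differentiable (at u)"
proof -
  have "(f has_derivative D) (at u) \<longleftrightarrow> (g has_derivative D) (at u)" for D
    using has_derivative_transform_within_open[of f D u UNIV U g]
      has_derivative_transform_within_open[of g D u UNIV U f] assms by auto
  then show "frechet_derivative f (at u) = frechet_derivative g (at u)"
    "f differentiable (at u) \<longleftrightarrow> g differentiable (at u)"
    by (auto simp: frechet_derivative_def differentiable_def)
qed

lemma Ck_on_cong:
  fixes U :: "(complex^'n::finite) set"
  assumes "open U" "\<And>x. x \<in> U \<Longrightarrow> f x = g x" "Ck_on k U f"
  shows "Ck_on k U g"
  using assms(2,3)
proof (induction k arbitrary: f g)
  case 0
  then show ?case using continuous_on_cong[of U U f g] by simp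
next
  case (Suc k)
  have "Ck_on k U (\<lambda>u. frechet_derivative g (at u) X)" for X
    by (rule Suc.IH[of "\<lambda>u. frechet_derivative f (at u) X"])
       (use Suc.prems frechet_derivative_cong_open(1)[OF assms(1) _ Suc.prems(1)] in auto)
  then show ?case
    using Suc.prems frechet_derivative_cong_open(2)[OF assms(1) _ Suc.prems(1)] by auto
qed

text \<open>Needed for the product rule, where one factor stays undifferentiated and must be known
  one order lower.\<close>

lemma Ck_on_Suc_imp:
  fixes U :: "(complex^'n::finite) set"
  assumes "open U"
  shows "Ck_on (Suc k) U f \<Longrightarrow> Ck_on k U f"
proof (induction k arbitrary: f)
  case 0
  then have "f differentiable_on U"
    by (auto simp: differentiable_on_def intro: differentiable_at_withinI)
  then show ?case by (simp add: differentiable_imp_continuous_on)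
next
  case (Suc k)
  have "Ck_on k U (\<lambda>u. frechet_derivative f (at u) X)" for X
  proof (rule Suc.IH)
    show "Ck_on (Suc k) U (\<lambda>u. frechet_derivative f (at u) X)"
      using Suc.prems unfolding Ck_on.simps(2)[of "Suc k"] by blast
  qed
  moreover have "\<forall>u\<in>U. f differentiable (at u)"
    using Suc.prems unfolding Ck_on.simps(2)[of "Suc k"] by blast
  ultimately show ?case by simp
qed

lemma Ck_on_const: "Ck_on k U (\<lambda>u. c)"
  by (induction k arbitrary: c) simp_all

lemma Ck_on_linear: "bounded_linear f \<Longrightarrow> Ck_on k U f"
proof (cases k)
  case (Suc m)
  assume f: "bounded_linear f"
  have "(f has_derivative f) (at u)" for u
    by (rule bounded_linear_imp_has_derivative[OF f])
  then have "frechet_derivative f (at u) = f" "f differentiable (at u)" for u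
    by (metis frechet_derivative_at, metis differentiableI)
  then show ?thesis by (simp add: Suc Ck_on_const)
qed (simp add: linear_continuous_on)

lemma frechet_derivative_add:
  assumes "f differentiable (at u)" "g differentiable (at u)"
  shows "frechet_derivative (\<lambda>x. f x + g x) (at u) X = frechet_derivative f (at u) X + frechet_derivative g (at u) X"
  using frechet_derivative_at[OF has_derivative_add[OF assms[unfolded frechet_derivative_works]]]
  by metis

lemma frechet_derivative_mult:
  fixes f g :: "_ \<Rightarrow> 'a::real_normed_algebra"
  assumes "f differentiable (at u)" "g differentiable (at u)"
  shows "frechet_derivative (\<lambda>x. f x * g x) (at u) X = f u * frechet_derivative g (at u) X + frechet_derivative f (at u) X * g u"
  using frechet_derivative_at[OF has_derivative_mult[OF assms[unfolded frechet_derivative_works]]]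
  by metis

lemma frechet_derivative_linear_arg:
  assumes "f differentiable (at u)"
  shows "linear (frechet_derivative f (at u))"
  using assms unfolding frechet_derivative_works by (rule has_derivative_linear)

lemma Ck_on_add:
  fixes U :: "(complex^'n::finite) set"
  assumes "open U"
  shows "Ck_on k U f \<Longrightarrow> Ck_on k U g \<Longrightarrow> Ck_on k U (\<lambda>u. f u + g u)"
proof (induction k arbitrary: f g)
  case (Suc k)
  have "Ck_on k U (\<lambda>u. frechet_derivative (\<lambda>u. f u + g u) (at u) X)" for X
    by (rule Ck_on_cong[OF assms _ Suc.IH[of "\<lambda>u. frechet_derivative f (at u) X" "\<lambda>u. frechet_derivative g (at u) X"]])
       (use Suc.prems in \<open>auto simp: frechet_derivative_add\<close>)
  then show ?case using Suc.prems by auto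
qed (simp add: continuous_on_add)

lemma Ck_on_mult:
  fixes U :: "(complex^'n::finite) set"
  assumes "open U"
  shows "Ck_on k U f \<Longrightarrow> Ck_on k U g \<Longrightarrow> Ck_on k U (\<lambda>u. f u * g u)"
proof (induction k arbitrary: f g)
  case (Suc k)
  have fg: "Ck_on k U f" "Ck_on k U g"
    using Suc.prems Ck_on_Suc_imp[OF assms] by blast+
  have fg': "Ck_on k U (\<lambda>u. frechet_derivative f (at u) X)" "Ck_on k U (\<lambda>u. frechet_derivative g (at u) X)" for X
    using Suc.prems by auto
  have "Ck_on k U (\<lambda>u. frechet_derivative (\<lambda>u. f u * g u) (at u) X)" for X
    by (rule Ck_on_cong[OF assms _ Ck_on_add[OF assms Suc.IH[OF fg(1) fg'(2)[of X]] Suc.IH[OF fg'(1)[of X] fg(2)]]])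
       (use Suc.prems in \<open>simp add: frechet_derivative_mult\<close>)
  then show ?case using Suc.prems by auto
qed (simp add: continuous_on_mult)

section \<open>Smoothness of the norm away from the origin\<close>

definition inv_norm :: "complex^'n \<Rightarrow> complex" where
  "inv_norm u = complex_of_real (1 / norm u)"

lemma inv_norm_has_derivative:
  fixes u :: "complex^'n::finite"
  assumes "u \<noteq> 0"
  shows "(inv_norm has_derivative (\<lambda>X. - complex_of_real (X \<bullet> u) * (inv_norm u * inv_norm u * inv_norm u))) (at u)"
proof -
  have "((\<lambda>u. 1 / norm u) has_derivative (\<lambda>X. - (X \<bullet> u) * ((1 / norm u) * (1 / norm u) * (1 / norm u)))) (at u)"
    by (rule derivative_eq_intros has_derivative_norm refl assms)+
       (use assms in \<open>simp_all add: sgn_div_norm fun_eq_iff divide_simps inner_commute\<close>)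
  moreover have "bounded_linear complex_of_real" by (rule bounded_linear_of_real)
  ultimately show ?thesis
    using bounded_linear.has_derivative
    by (fastforce simp add: inv_norm_def[abs_def])
qed

lemma open_punctured: "open (- {0 :: complex^'n::finite})"
  by (rule open_Compl) simp

text \<open>The derivative of 1/|u| in direction X is a real linear function of u times the cube of
  1/|u|. So the derivative is a product of functions already covered by the induction
  hypothesis.\<close>

lemma Ck_on_inv_norm: "Ck_on k (- {0}) (inv_norm :: complex^'n::finite \<Rightarrow> complex)"
proof (induction k)
  case 0
  show ?case by (auto simp: inv_norm_def[abs_def] intro!: continuous_intros)
next
  case (Suc k)
  have D: "frechet_derivative inv_norm (at u) = (\<lambda>X. - complex_of_real (X \<bullet> u) * (inv_norm u * inv_norm u * inv_norm u))"
    "inv_norm differentiable (at u)" if "u \<noteq> 0" for u :: "complex^'n"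
    using frechet_derivative_at[OF inv_norm_has_derivative[OF that]] inv_norm_has_derivative[OF that]
    by (auto simp: differentiable_def)
  have "bounded_linear (\<lambda>u::complex^'n. - complex_of_real (X \<bullet> u))" for X
    by (intro bounded_linear_minus bounded_linear_compose[OF bounded_linear_of_real] bounded_linear_inner_right)
  then have C: "Ck_on k (- {0}) (\<lambda>u::complex^'n. - complex_of_real (X \<bullet> u) * (inv_norm u * inv_norm u * inv_norm u))" for X
    by (rule Ck_on_mult[OF open_punctured Ck_on_linear
          Ck_on_mult[OF open_punctured Ck_on_mult[OF open_punctured Suc Suc] Suc]])
  have "Ck_on k (- {0}) (\<lambda>u::complex^'n. frechet_derivative inv_norm (at u) X)" for X
    by (rule Ck_on_cong[OF open_punctured _ C[of X]]) (simp add: D)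
  then show ?case using D by simp
qed

definition smooth :: "(complex^'n::finite \<Rightarrow> complex) \<Rightarrow> bool" where
  "smooth f \<longleftrightarrow> (\<forall>k. Ck_on k (- {0}) f)"

lemma smooth_on_sphere_iff: "smooth_on_sphere f \<longleftrightarrow> smooth (radial f)"
  by (simp add: smooth_on_sphere_def smooth_def)

lemma smooth_cong: "smooth f \<Longrightarrow> (\<And>u. u \<noteq> 0 \<Longrightarrow> f u = g u) \<Longrightarrow> smooth g"
  unfolding smooth_def by (metis Ck_on_cong[OF open_punctured] ComplD insertI1 singletonD)

lemma smooth_const: "smooth (\<lambda>u. c)"
  by (simp add: smooth_def Ck_on_const)

lemma smooth_linear: "bounded_linear f \<Longrightarrow> smooth f"
  by (simp add: smooth_def Ck_on_linear)

lemma smooth_add: "smooth f \<Longrightarrow> smooth g \<Longrightarrow> smooth (\<lambda>u. f u + g u)"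
  by (simp add: smooth_def Ck_on_add[OF open_punctured])

lemma smooth_mult: "smooth f \<Longrightarrow> smooth g \<Longrightarrow> smooth (\<lambda>u. f u * g u)"
  by (simp add: smooth_def Ck_on_mult[OF open_punctured])

lemma smooth_minus: "smooth f \<Longrightarrow> smooth (\<lambda>u. - f u)"
  using smooth_mult[OF smooth_const[of "-1"], of f] by simp

lemma smooth_diff: "smooth f \<Longrightarrow> smooth g \<Longrightarrow> smooth (\<lambda>u. f u - g u)"
  using smooth_add[OF _ smooth_minus, of f g] by simp

lemma smooth_sum: "(\<And>i. i \<in> I \<Longrightarrow> smooth (f i)) \<Longrightarrow> smooth (\<lambda>u. \<Sum>i\<in>I. f i u)"
  by (induction I rule: infinite_finite_induct) (simp_all add: smooth_const smooth_add)

lemma smooth_inv_norm: "smooth inv_norm"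
  by (simp add: smooth_def Ck_on_inv_norm)

lemma smooth_nth: "smooth (\<lambda>u. u $ i)"
  by (rule smooth_linear) (rule bounded_linear_vec_nth)

lemma smooth_cnj_nth: "smooth (\<lambda>u. cnj (u $ i))"
  by (rule smooth_linear) (rule bounded_linear_compose[OF bounded_linear_cnj bounded_linear_vec_nth])

lemma norm_square: "complex_of_real (norm u * norm u) = (\<Sum>k\<in>UNIV. u $ k * cnj (u $ k))"
  for u :: "complex^'n::finite"
  by (simp add: complex_norm_square[symmetric] norm_vec_def L2_set_def sum_nonneg flip: power2_eq_square of_real_power)

text \<open>Written as |u|^2 times 1/|u|, where |u|^2 is a polynomial in the coordinates and their
  conjugates.\<close>

lemma smooth_norm: "smooth (\<lambda>u::complex^'n::finite. complex_of_real (norm u))"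
proof -
  have "smooth (\<lambda>u::complex^'n. (\<Sum>k\<in>UNIV. u $ k * cnj (u $ k)) * inv_norm u)"
    by (intro smooth_mult smooth_sum smooth_nth smooth_cnj_nth smooth_inv_norm)
  then show ?thesis
    by (rule smooth_cong) (simp add: norm_square[symmetric] inv_norm_def)
qed

lemma smooth_differentiable: "smooth f \<Longrightarrow> u \<noteq> 0 \<Longrightarrow> f differentiable (at u)"
  unfolding smooth_def using Ck_on.simps(2)[of 0 "- {0}" f] by blast

lemma smooth_derivative: "smooth f \<Longrightarrow> smooth (\<lambda>u. frechet_derivative f (at u) X)"
  unfolding smooth_def using Ck_on.simps(2)[of _ "- {0}" f] by blast

text \<open>Chain rule for multiplication by a complex scalar. It is applied to pullbacks from
  projective space, for which g and h coincide; a phase c yields invariance on the sphere, a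
  positive real c yields the degree of homogeneity.\<close>

lemma frechet_derivative_scale:
  fixes h g :: "complex^'n::finite \<Rightarrow> complex"
  assumes c: "c \<noteq> 0" and u: "u \<noteq> 0" and g: "g differentiable (at (c *s u))"
    and hg: "\<And>x. x \<noteq> 0 \<Longrightarrow> g (c *s x) = h x"
  shows "frechet_derivative h (at u) X = frechet_derivative g (at (c *s u)) (c *s X)"
proof -
  have l: "bounded_linear (\<lambda>x::complex^'n. c *s x)"
    by (rule linear_conv_bounded_linear[THEN iffD1]) (simp add: linear_iff vec_eq_iff algebra_simps)
  have "((\<lambda>x. g (c *s x)) has_derivative (\<lambda>X. frechet_derivative g (at (c *s u)) (c *s X))) (at u)"
    by (rule has_derivative_compose[OF bounded_linear_imp_has_derivative[OF l]])
       (use g in \<open>simp add: frechet_derivative_works\<close>)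
  then have "(h has_derivative (\<lambda>X. frechet_derivative g (at (c *s u)) (c *s X))) (at u)"
    by (rule has_derivative_transform_within_open[OF _ open_punctured]) (use u hg in auto)
  then show ?thesis by (simp add: frechet_derivative_at[symmetric])
qed

text \<open>Computes one directional derivative from an explicit curve. Agreement is asked for small
  t only, since the line through v may hit the origin.\<close>

lemma frechet_derivative_direction:
  fixes g :: "complex^'n::finite \<Rightarrow> complex"
  assumes g: "g differentiable (at v)" and \<psi>: "(\<psi> has_vector_derivative w) (at (0::real))"
    and e: "0 < e" "\<And>t::real. \<bar>t\<bar> < e \<Longrightarrow> g (v + t *\<^sub>R X) = \<psi> t"
  shows "frechet_derivative g (at v) X = w"
proof -
  have "((\<lambda>t. v + t *\<^sub>R X) has_derivative (\<lambda>t. t *\<^sub>R X)) (at (0::real))"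
    by (auto intro!: derivative_eq_intros)
  then have "((\<lambda>t. g (v + t *\<^sub>R X)) has_derivative (\<lambda>t. frechet_derivative g (at v) (t *\<^sub>R X))) (at (0::real))"
    by (rule has_derivative_compose) (use g in \<open>simp add: frechet_derivative_works\<close>)
  then have "((\<lambda>t. g (v + t *\<^sub>R X)) has_vector_derivative frechet_derivative g (at v) X) (at (0::real))"
    by (simp add: has_vector_derivative_def linear_scale[OF frechet_derivative_linear_arg[OF g]])
  then have "(\<psi> has_vector_derivative frechet_derivative g (at v) X) (at (0::real))"
    by (rule has_vector_derivative_transform_within_open[of _ _ _ "{-e<..<e}"]) (use e in auto)
  then show ?thesis using \<psi> by (rule vector_derivative_unique_at)
qed

section \<open>Normalisation and smooth functions on the sphere\<close>

lemma normalize_Sph: "u \<noteq> 0 \<Longrightarrow> (1 / norm u) *\<^sub>R u \<in> Sph"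
  by (simp add: Sph_def)

lemma radial_Sph: "v \<in> Sph \<Longrightarrow> radial f v = f v"
  by (simp add: radial_def Sph_def)

lemma Sph_nonzero: "v \<in> Sph \<Longrightarrow> v \<noteq> 0"
  by (auto simp: Sph_def)

lemma norm_smult: "norm (c *s u) = cmod c * norm u" for u :: "complex^'n::finite"
  by (simp add: norm_vec_def norm_mult L2_set_right_distrib)

lemma smult_Sph: "cmod z = 1 \<Longrightarrow> v \<in> Sph \<Longrightarrow> z *s v \<in> Sph"
  by (simp add: Sph_def norm_smult)

lemma scaleR_nth: "(r *\<^sub>R u) $ i = complex_of_real r * u $ i"
  by (simp only: vector_scaleR_component) (rule scaleR_conv_of_real)

lemma scaleR_smult: "r *\<^sub>R u = complex_of_real r *s u" for u :: "complex^'n"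
  by (simp add: vec_eq_iff scaleR_nth del: vector_scaleR_component)

text \<open>Scaling by c changes the normalised vector by the phase c/|c| alone, which reduces
  invariance under all nonzero scalars to invariance under the circle.\<close>

lemma normalize_smult:
  fixes u :: "complex^'n::finite"
  assumes "c \<noteq> 0"
  shows "(1 / norm (c *s u)) *\<^sub>R (c *s x) = (c / of_real (cmod c)) *s ((1 / norm u) *\<^sub>R x)"
  using assms by (simp add: scaleR_smult norm_smult mult.commute)

lemma smooth_on_sphere_cong: "smooth_on_sphere f \<Longrightarrow> (\<And>v. v \<in> Sph \<Longrightarrow> f v = g v) \<Longrightarrow> smooth_on_sphere g"
  unfolding smooth_on_sphere_iff
  by (rule smooth_cong[of "radial f" "radial g"]) (auto simp: radial_def normalize_Sph)

lemma smooth_on_sphere_const: "smooth_on_sphere (\<lambda>v. c)"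
  unfolding smooth_on_sphere_iff radial_def by (rule smooth_const)

lemma smooth_on_sphere_add: "smooth_on_sphere f \<Longrightarrow> smooth_on_sphere g \<Longrightarrow> smooth_on_sphere (\<lambda>v. f v + g v)"
  unfolding smooth_on_sphere_iff radial_def by (rule smooth_add)

lemma smooth_on_sphere_diff: "smooth_on_sphere f \<Longrightarrow> smooth_on_sphere g \<Longrightarrow> smooth_on_sphere (\<lambda>v. f v - g v)"
  unfolding smooth_on_sphere_iff radial_def by (rule smooth_diff)

lemma smooth_on_sphere_mult: "smooth_on_sphere f \<Longrightarrow> smooth_on_sphere g \<Longrightarrow> smooth_on_sphere (\<lambda>v. f v * g v)"
  unfolding smooth_on_sphere_iff radial_def by (rule smooth_mult)

lemma smooth_on_sphere_nth: "smooth_on_sphere (\<lambda>v::complex^'n::finite. v $ i)"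
proof -
  have "smooth (\<lambda>u::complex^'n. inv_norm u * u $ i)"
    by (intro smooth_mult smooth_nth smooth_inv_norm)
  then show ?thesis
    unfolding smooth_on_sphere_iff by (rule smooth_cong) (simp add: radial_def inv_norm_def scaleR_nth del: vector_scaleR_component)
qed

lemma smooth_on_sphere_cnj_nth: "smooth_on_sphere (\<lambda>v::complex^'n::finite. cnj (v $ i))"
proof -
  have "smooth (\<lambda>u::complex^'n. inv_norm u * cnj (u $ i))"
    by (intro smooth_mult smooth_cnj_nth smooth_inv_norm)
  then show ?thesis
    unfolding smooth_on_sphere_iff by (rule smooth_cong) (simp add: radial_def inv_norm_def scaleR_nth del: vector_scaleR_component)
qed


section \<open>Functions on projective space\<close>

lemma CinfD:
  assumes "f \<in> Cinf m"
  shows "f \<in> extensional Sph" "smooth_on_sphere f"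
    "cmod z = 1 \<Longrightarrow> v \<in> Sph \<Longrightarrow> f (z *s v) = z powi m * f v"
  using assms by (auto simp: Cinf_def)

lemma CinfI:
  assumes "smooth_on_sphere f" "\<And>z v. cmod z = 1 \<Longrightarrow> v \<in> Sph \<Longrightarrow> f (z *s v) = z powi m * f v"
  shows "restrict f Sph \<in> Cinf m"
  using assms smooth_on_sphere_cong[OF assms(1), of "restrict f Sph"] by (auto simp: Cinf_def smult_Sph)

lemma Cinf_add: "f \<in> Cinf m \<Longrightarrow> g \<in> Cinf m \<Longrightarrow> (\<lambda>v\<in>Sph. f v + g v) \<in> Cinf m"
  by (rule CinfI) (auto simp: smooth_on_sphere_add CinfD algebra_simps)

lemma Cinf_mult:
  assumes "f \<in> Cinf l" "g \<in> Cinf m" "k = l + m"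
  shows "(\<lambda>v\<in>Sph. f v * g v) \<in> Cinf k"
proof (rule CinfI)
  fix z :: complex and v :: "complex^'a" assume "cmod z = 1" "v \<in> Sph"
  moreover from this have "z \<noteq> 0" by auto
  ultimately show "f (z *s v) * g (z *s v) = z powi k * (f v * g v)"
    using assms by (simp add: CinfD power_int_add)
qed (use assms in \<open>auto simp: smooth_on_sphere_mult CinfD\<close>)

lemma Cinf_const: "(\<lambda>v\<in>Sph. c) \<in> Cinf 0"
  by (rule CinfI) (auto simp: smooth_on_sphere_const)

lemma Cinf_scale: "f \<in> Cinf m \<Longrightarrow> (\<lambda>v\<in>Sph. c * f v) \<in> Cinf m"
  by (rule CinfI) (auto simp: smooth_on_sphere_mult smooth_on_sphere_const CinfD)

lemma Cinf_zero: "(\<lambda>v\<in>Sph. 0) \<in> Cinf m"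
  by (rule CinfI) (auto simp: smooth_on_sphere_const)

lemma Cinf_nth: "(\<lambda>v\<in>Sph. v $ i) \<in> Cinf 1"
  by (rule CinfI) (auto simp: smooth_on_sphere_nth)

lemma Cinf_vbar: "vbar i \<in> Cinf (-1)"
proof -
  have *: "cnj z = inverse z" if "cmod z = 1" for z
    using that complex_norm_square[of z] by (metis inverse_unique of_real_1 power_one mult.commute)
  show ?thesis
    unfolding vbar_def by (rule CinfI) (auto simp: smooth_on_sphere_cnj_nth power_int_minus *)
qed

lemma Cinf_Q: "Q i j \<in> Cinf 0"
  using Cinf_mult[OF Cinf_nth Cinf_vbar, of 0 i j] by (simp add: Q_def vbar_def restrict_def cong: if_cong)

text \<open>The radial extension of a function of weight zero is its pullback from projective space
  to punctured space, hence invariant under all nonzero complex scalars.\<close>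

lemma radial_invariant:
  fixes f :: "complex^'n::finite \<Rightarrow> complex"
  assumes "f \<in> Cinf 0" "c \<noteq> 0" "u \<noteq> 0"
  shows "radial f (c *s u) = radial f u"
proof -
  have "cmod (c / of_real (cmod c)) = 1"
    using assms by (simp add: norm_divide)
  then show ?thesis
    unfolding radial_def normalize_smult[OF assms(2)]
    using CinfD(3)[OF assms(1), of "c / of_real (cmod c)" "(1 / norm u) *\<^sub>R u"] normalize_Sph[OF assms(3)]
    by simp
qed

lemma radial_differentiable: "f \<in> Cinf m \<Longrightarrow> u \<noteq> 0 \<Longrightarrow> radial f differentiable (at u)"
  using smooth_differentiable CinfD(2) smooth_on_sphere_iff by blast

lemma complex_ring_simps [simp]:
  "carrier complex_ring = UNIV" "mult complex_ring = (*)" "one complex_ring = 1"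
  "zero complex_ring = 0" "add complex_ring = (+)"
  by (simp_all add: complex_ring_def)

lemma ring_complex_ring: "ring complex_ring"
proof (rule ringI)
  show "abelian_group complex_ring"
    by (rule abelian_groupI) (auto simp: algebra_simps intro: exI[of _ "- x" for x])
  show "monoid complex_ring"
    by (rule monoidI) (auto simp: algebra_simps)
qed (auto simp: algebra_simps)

lemma CP_simps [simp]:
  "carrier CP = Cinf 0" "mult CP = (\<lambda>f g. \<lambda>v\<in>Sph. f v * g v)" "one CP = (\<lambda>v\<in>Sph. 1)"
  "zero CP = (\<lambda>v\<in>Sph. 0)" "add CP = (\<lambda>f g. \<lambda>v\<in>Sph. f v + g v)"
  by (simp_all add: CP_def)

lemma Cinf_module_simps [simp]:
  "carrier (Cinf_module m) = Cinf m" "zero (Cinf_module m) = (\<lambda>v\<in>Sph. 0)"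
  "add (Cinf_module m) = (\<lambda>f g. \<lambda>v\<in>Sph. f v + g v)"
  "ract (Cinf_module m) = (\<lambda>f b. \<lambda>v\<in>Sph. f v * b v)"
  "lact (Cinf_module m) = (\<lambda>c f. \<lambda>v\<in>Sph. c * f v)"
  by (simp_all add: Cinf_module_def)

lemma Cinf_arb: "f \<in> Cinf m \<Longrightarrow> v \<notin> Sph \<Longrightarrow> f v = undefined"
  using CinfD(1) extensional_arb by metis

lemma abelian_group_Cinf: "abelian_group (Cinf_module m :: (complex, complex^'n::finite \<Rightarrow> complex, complex^'n \<Rightarrow> complex) bimod)"
proof (rule abelian_groupI)
  fix f :: "complex^'n \<Rightarrow> complex" assume "f \<in> carrier (Cinf_module m)"
  then show "\<exists>g\<in>carrier (Cinf_module m). g \<oplus>\<^bsub>Cinf_module m\<^esub> f = \<zero>\<^bsub>Cinf_module m\<^esub>"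
    using Cinf_scale[of f m "-1"]
    by (intro bexI[of _ "\<lambda>v\<in>Sph. - f v"]) auto
qed (auto simp: Cinf_add Cinf_zero fun_eq_iff Cinf_arb algebra_simps)

lemma ring_CP: "ring (CP :: (complex^'n::finite \<Rightarrow> complex) ring)"
proof (rule ringI)
  show "abelian_group (CP :: (complex^'n \<Rightarrow> complex) ring)"
    by (rule abelian_group_record_cong[OF abelian_group_Cinf[of 0]]) simp_all
  show "monoid (CP :: (complex^'n \<Rightarrow> complex) ring)"
    by (rule monoidI) (auto simp: Cinf_mult Cinf_const fun_eq_iff Cinf_arb algebra_simps)
qed (auto simp: fun_eq_iff Cinf_arb algebra_simps)

lemma bimodule_Cinf: "bimodule complex_ring CP (Cinf_module m :: (complex, complex^'n::finite \<Rightarrow> complex, complex^'n \<Rightarrow> complex) bimod)"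
  unfolding bimodule_def
proof (intro conjI ballI)
  show "right_module CP (Cinf_module m :: (complex, complex^'n \<Rightarrow> complex, complex^'n \<Rightarrow> complex) bimod)"
    by (rule right_moduleI)
       (auto simp: ring_CP abelian_group_Cinf additive_map_def Cinf_mult Cinf_arb fun_eq_iff algebra_simps
        )
  show "left_mod complex_ring (Cinf_module m :: (complex, complex^'n \<Rightarrow> complex, complex^'n \<Rightarrow> complex) bimod)"
    by (rule left_modI)
       (auto simp: ring_complex_ring abelian_group_Cinf additive_map_def Cinf_scale Cinf_arb fun_eq_iff algebra_simps
        )
qed (auto simp: fun_eq_iff)


section \<open>Differential forms on projective space\<close>

lemma form1_bimod_simps [simp]:
  "carrier (form1_bimod W) = W" "zero (form1_bimod W) = (\<lambda>v\<in>Sph. \<lambda>X. 0)"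
  "add (form1_bimod W) = (\<lambda>\<omega> \<omega>'. \<lambda>v\<in>Sph. \<lambda>X. \<omega> v X + \<omega>' v X)"
  "ract (form1_bimod W) = (\<lambda>\<omega> b. \<lambda>v\<in>Sph. \<lambda>X. \<omega> v X * b v)"
  "lact (form1_bimod W) = (\<lambda>b \<omega>. \<lambda>v\<in>Sph. \<lambda>X. b v * \<omega> v X)"
  by (simp_all add: form1_bimod_def)

lemma form2_bimod_simps [simp]:
  "carrier (form2_bimod W) = W" "zero (form2_bimod W) = (\<lambda>v\<in>Sph. \<lambda>X Y. 0)"
  "add (form2_bimod W) = (\<lambda>\<eta> \<eta>'. \<lambda>v\<in>Sph. \<lambda>X Y. \<eta> v X Y + \<eta>' v X Y)"
  "ract (form2_bimod W) = (\<lambda>\<eta> b. \<lambda>v\<in>Sph. \<lambda>X Y. \<eta> v X Y * b v)"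
  "lact (form2_bimod W) = (\<lambda>b \<eta>. \<lambda>v\<in>Sph. \<lambda>X Y. b v * \<eta> v X Y)"
  by (simp_all add: form2_bimod_def)

text \<open>Stated for any set of forms with these closure properties, so that all 1-forms and the
  (0,1)-forms are handled at once. Negatives come from scaling by the constant function -1.\<close>

lemma bimodule_form1:
  fixes W :: "'n::finite form1 set"
  assumes ext: "W \<subseteq> extensional Sph" and z: "(\<lambda>v\<in>Sph. \<lambda>X. 0) \<in> W"
    and add: "\<And>\<omega> \<omega>'. \<omega> \<in> W \<Longrightarrow> \<omega>' \<in> W \<Longrightarrow> (\<lambda>v\<in>Sph. \<lambda>X. \<omega> v X + \<omega>' v X) \<in> W"
    and sc: "\<And>b \<omega>. b \<in> Cinf 0 \<Longrightarrow> \<omega> \<in> W \<Longrightarrow> (\<lambda>v\<in>Sph. \<lambda>X. b v * \<omega> v X) \<in> W"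
  shows "bimodule CP CP (form1_bimod W)"
proof -
  have arb: "\<omega> v = undefined" if "\<omega> \<in> W" "v \<notin> Sph" for \<omega> v
    using ext that extensional_arb by (metis subsetD)
  have sc': "(\<lambda>v\<in>Sph. \<lambda>X. \<omega> v X * b v) \<in> W" if "b \<in> Cinf 0" "\<omega> \<in> W" for b \<omega>
    using sc[OF that] by (simp add: mult.commute)
  have ab: "abelian_group (form1_bimod W)"
  proof (rule abelian_groupI)
    fix f assume f: "f \<in> carrier (form1_bimod W)"
    show "\<exists>g\<in>carrier (form1_bimod W). g \<oplus>\<^bsub>form1_bimod W\<^esub> f = \<zero>\<^bsub>form1_bimod W\<^esub>"
      by (rule bexI[of _ "\<lambda>v\<in>Sph. \<lambda>X. (\<lambda>v\<in>Sph. - 1) v * f v X"])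
         (use f sc[OF Cinf_const, of f "-1"] in \<open>auto simp: fun_eq_iff\<close>)
  qed (auto simp: add z fun_eq_iff arb algebra_simps)
  show ?thesis
    unfolding bimodule_def
  proof (intro conjI ballI)
    show "right_module CP (form1_bimod W)"
      by (rule right_moduleI)
         (auto simp: ring_CP ab additive_map_def sc sc' arb fun_eq_iff algebra_simps)
    show "left_mod CP (form1_bimod W)"
      by (rule left_modI)
         (auto simp: ring_CP ab additive_map_def sc arb fun_eq_iff algebra_simps)
  qed (auto simp: fun_eq_iff)
qed

lemma bimodule_form2:
  fixes W :: "'n::finite form2 set"
  assumes ext: "W \<subseteq> extensional Sph" and z: "(\<lambda>v\<in>Sph. \<lambda>X Y. 0) \<in> W"
    and add: "\<And>\<omega> \<omega>'. \<omega> \<in> W \<Longrightarrow> \<omega>' \<in> W \<Longrightarrow> (\<lambda>v\<in>Sph. \<lambda>X Y. \<omega> v X Y + \<omega>' v X Y) \<in> W"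
    and sc: "\<And>b \<omega>. b \<in> Cinf 0 \<Longrightarrow> \<omega> \<in> W \<Longrightarrow> (\<lambda>v\<in>Sph. \<lambda>X Y. b v * \<omega> v X Y) \<in> W"
  shows "bimodule CP CP (form2_bimod W)"
proof -
  have arb: "\<omega> v = undefined" if "\<omega> \<in> W" "v \<notin> Sph" for \<omega> v
    using ext that extensional_arb by (metis subsetD)
  have sc': "(\<lambda>v\<in>Sph. \<lambda>X Y. \<omega> v X Y * b v) \<in> W" if "b \<in> Cinf 0" "\<omega> \<in> W" for b \<omega>
    using sc[OF that] by (simp add: mult.commute)
  have ab: "abelian_group (form2_bimod W)"
  proof (rule abelian_groupI)
    fix f assume f: "f \<in> carrier (form2_bimod W)"
    show "\<exists>g\<in>carrier (form2_bimod W). g \<oplus>\<^bsub>form2_bimod W\<^esub> f = \<zero>\<^bsub>form2_bimod W\<^esub>"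
      by (rule bexI[of _ "\<lambda>v\<in>Sph. \<lambda>X Y. (\<lambda>v\<in>Sph. - 1) v * f v X Y"])
         (use f sc[OF Cinf_const, of f "-1"] in \<open>auto simp: fun_eq_iff\<close>)
  qed (auto simp: add z fun_eq_iff arb algebra_simps)
  show ?thesis
    unfolding bimodule_def
  proof (intro conjI ballI)
    show "right_module CP (form2_bimod W)"
      by (rule right_moduleI)
         (auto simp: ring_CP ab additive_map_def sc sc' arb fun_eq_iff algebra_simps)
    show "left_mod CP (form2_bimod W)"
      by (rule left_modI)
         (auto simp: ring_CP ab additive_map_def sc arb fun_eq_iff algebra_simps)
  qed (auto simp: fun_eq_iff)
qed

lemma forms1D:
  assumes "\<omega> \<in> forms1"
  shows "\<omega> \<in> extensional Sph" "v \<in> Sph \<Longrightarrow> linear (\<omega> v)" "v \<in> Sph \<Longrightarrow> \<omega> v (c *s v) = 0"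
    "cmod z = 1 \<Longrightarrow> v \<in> Sph \<Longrightarrow> \<omega> (z *s v) (z *s X) = \<omega> v X"
    "smooth_on_sphere (\<lambda>v. \<omega> v X)"
  using assms by (auto simp: forms1_def)

lemma forms1I:
  assumes "\<And>v. v \<in> Sph \<Longrightarrow> linear (\<omega> v)" "\<And>v c. v \<in> Sph \<Longrightarrow> \<omega> v (c *s v) = 0"
    "\<And>z v X. cmod z = 1 \<Longrightarrow> v \<in> Sph \<Longrightarrow> \<omega> (z *s v) (z *s X) = \<omega> v X"
    "\<And>X. smooth_on_sphere (\<lambda>v. \<omega> v X)"
  shows "restrict \<omega> Sph \<in> forms1"
  using assms smooth_on_sphere_cong[OF assms(4), where g = "\<lambda>v. restrict \<omega> Sph v X" for X]
  by (auto simp: forms1_def smult_Sph)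

lemma forms2D:
  assumes "\<eta> \<in> forms2"
  shows "\<eta> \<in> extensional Sph" "v \<in> Sph \<Longrightarrow> linear (\<eta> v X)" "v \<in> Sph \<Longrightarrow> linear (\<lambda>X. \<eta> v X Y)"
    "v \<in> Sph \<Longrightarrow> \<eta> v X X = 0" "v \<in> Sph \<Longrightarrow> \<eta> v (c *s v) X = 0"
    "cmod z = 1 \<Longrightarrow> v \<in> Sph \<Longrightarrow> \<eta> (z *s v) (z *s X) (z *s Y) = \<eta> v X Y"
    "smooth_on_sphere (\<lambda>v. \<eta> v X Y)"
  using assms by (auto simp: forms2_def bilinear_def)

lemma forms2_swap: "\<eta> \<in> forms2 \<Longrightarrow> v \<in> Sph \<Longrightarrow> \<eta> v Y X = - \<eta> v X Y"
  using forms2D(4)[of \<eta> v "X + Y"] forms2D(4)[of \<eta> v X] forms2D(4)[of \<eta> v Y]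
  by (simp add: linear_add[OF forms2D(2)] linear_add[OF forms2D(3)] eq_neg_iff_add_eq_0 add.commute)

lemma forms2I:
  assumes "\<And>v X. v \<in> Sph \<Longrightarrow> linear (\<eta> v X)" "\<And>v Y. v \<in> Sph \<Longrightarrow> linear (\<lambda>X. \<eta> v X Y)"
    "\<And>v X. v \<in> Sph \<Longrightarrow> \<eta> v X X = 0" "\<And>v c X. v \<in> Sph \<Longrightarrow> \<eta> v (c *s v) X = 0"
    "\<And>z v X Y. cmod z = 1 \<Longrightarrow> v \<in> Sph \<Longrightarrow> \<eta> (z *s v) (z *s X) (z *s Y) = \<eta> v X Y"
    "\<And>X Y. smooth_on_sphere (\<lambda>v. \<eta> v X Y)"
  shows "restrict \<eta> Sph \<in> forms2"
  using assms smooth_on_sphere_cong[OF assms(6), where g = "\<lambda>v. restrict \<eta> Sph v X Y" for X Y]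
  by (auto simp: forms2_def smult_Sph bilinear_def)

lemma linear_times: "linear f \<Longrightarrow> linear (\<lambda>x. c * f x)" for c :: complex
  by (rule linear_compose[of f "\<lambda>x. c * x", unfolded o_def])
     (auto intro: bounded_linear.linear bounded_linear_mult_right)

lemma linear_smult_arg:
  fixes f :: "complex^'n::finite \<Rightarrow> complex"
  assumes "linear f"
  shows "linear (\<lambda>X. f (c *s X))"
proof -
  have "linear (\<lambda>X::complex^'n. c *s X)" by (simp add: linear_iff vec_eq_iff algebra_simps)
  from linear_compose[OF this assms] show ?thesis by (simp add: o_def)
qed

lemma forms1_zero: "(\<lambda>v\<in>Sph. \<lambda>X. 0) \<in> forms1"
  by (rule forms1I) (auto simp: smooth_on_sphere_const linear_iff)

lemma forms1_add: "\<omega> \<in> forms1 \<Longrightarrow> \<omega>' \<in> forms1 \<Longrightarrow> (\<lambda>v\<in>Sph. \<lambda>X. \<omega> v X + \<omega>' v X) \<in> forms1"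
  by (rule forms1I) (auto simp: forms1D smooth_on_sphere_add linear_compose_add)

lemma forms1_scale: "b \<in> Cinf 0 \<Longrightarrow> \<omega> \<in> forms1 \<Longrightarrow> (\<lambda>v\<in>Sph. \<lambda>X. b v * \<omega> v X) \<in> forms1"
  by (rule forms1I) (auto simp: forms1D CinfD smooth_on_sphere_mult linear_times)

lemma forms2_zero: "(\<lambda>v\<in>Sph. \<lambda>X Y. 0) \<in> forms2"
  by (rule forms2I) (auto simp: smooth_on_sphere_const linear_iff)

lemma forms2_add: "\<omega> \<in> forms2 \<Longrightarrow> \<omega>' \<in> forms2 \<Longrightarrow> (\<lambda>v\<in>Sph. \<lambda>X Y. \<omega> v X Y + \<omega>' v X Y) \<in> forms2"
  by (rule forms2I) (auto simp: forms2D smooth_on_sphere_add linear_compose_add)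

lemma forms2_scale: "b \<in> Cinf 0 \<Longrightarrow> \<omega> \<in> forms2 \<Longrightarrow> (\<lambda>v\<in>Sph. \<lambda>X Y. b v * \<omega> v X Y) \<in> forms2"
  by (rule forms2I) (auto simp: forms2D CinfD smooth_on_sphere_mult linear_times)

lemma forms01D: "\<omega> \<in> forms01 \<Longrightarrow> \<omega> \<in> forms1" "\<omega> \<in> forms01 \<Longrightarrow> v \<in> Sph \<Longrightarrow> \<omega> v (\<i> *s X) = - \<i> * \<omega> v X"
  by (auto simp: forms01_def)

lemma bimodule_Omega1: "bimodule CP CP Omega1"
  unfolding Omega1_def by (rule bimodule_form1) (auto simp: forms1D forms1_zero forms1_add forms1_scale)

lemma bimodule_Omega01: "bimodule CP CP Omega01"
  unfolding Omega01_def
  by (rule bimodule_form1)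
     (auto simp: forms01_def forms1D forms1_zero forms1_add forms1_scale algebra_simps)

lemma bimodule_Omega02: "bimodule CP CP Omega02"
  unfolding Omega02_def
  by (rule bimodule_form2)
     (auto simp: forms02_def forms2D forms2_zero forms2_add forms2_scale algebra_simps)

lemma proj01_closed:
  fixes \<omega> :: "'n::finite form1"
  assumes \<omega>: "\<omega> \<in> forms1"
  shows "proj01 \<omega> \<in> forms01"
proof -
  have l: "linear (\<lambda>X. \<omega> v (\<i> *s X))" if "v \<in> Sph" for v
    by (rule linear_smult_arg[OF forms1D(2)[OF \<omega> that]])
  have "proj01 \<omega> \<in> forms1"
    unfolding proj01_def
  proof (rule forms1I)
    fix v :: "complex^'n" assume v: "v \<in> Sph"
    show "linear (\<lambda>X. (\<omega> v X + \<i> * \<omega> v (\<i> *s X)) / 2)"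
      using linear_times[OF linear_compose_add[OF forms1D(2)[OF \<omega> v] linear_times[OF l[OF v], of \<i>]], of "1/2"] by simp
    show "(\<omega> v (c *s v) + \<i> * \<omega> v (\<i> *s (c *s v))) / 2 = 0" for c
      using forms1D(3)[OF \<omega> v] by simp
    show "(\<omega> (z *s v) (z *s X) + \<i> * \<omega> (z *s v) (\<i> *s (z *s X))) / 2 = (\<omega> v X + \<i> * \<omega> v (\<i> *s X)) / 2"
      if "cmod z = 1" for z X
      using forms1D(4)[OF \<omega> that v, of X] forms1D(4)[OF \<omega> that v, of "\<i> *s X"] by (simp add: mult.commute)
  next
    fix X
    have "smooth_on_sphere (\<lambda>v. (1/2) * (\<omega> v X + \<i> * \<omega> v (\<i> *s X)))"
      by (intro smooth_on_sphere_mult smooth_on_sphere_add smooth_on_sphere_const forms1D(5)[OF \<omega>])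
    then show "smooth_on_sphere (\<lambda>v. (\<omega> v X + \<i> * \<omega> v (\<i> *s X)) / 2)" by simp
  qed
  moreover have "proj01 \<omega> v (\<i> *s X) = - \<i> * proj01 \<omega> v X" if "v \<in> Sph" for v X
    using that linear_neg[OF forms1D(2)[OF \<omega> that], of X] by (simp add: proj01_def field_simps)
  ultimately show ?thesis by (simp add: forms01_def)
qed

lemma proj02_closed:
  fixes \<eta> :: "'n::finite form2"
  assumes \<eta>: "\<eta> \<in> forms2"
  shows "proj02 \<eta> \<in> forms02"
proof -
  note L = forms2D(2)[OF \<eta>] and M = forms2D(3)[OF \<eta>]
  note comp = linear_smult_arg[where c = \<i>]
  have "proj02 \<eta> \<in> forms2"
    unfolding proj02_def
  proof (rule forms2I)
    fix v :: "complex^'n" assume v: "v \<in> Sph"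
    fix X
    show "linear (\<lambda>Y. (\<eta> v X Y + \<i> * \<eta> v (\<i> *s X) Y + \<i> * \<eta> v X (\<i> *s Y) - \<eta> v (\<i> *s X) (\<i> *s Y)) / 4)"
      using linear_times[OF linear_compose_sub[OF linear_compose_add[OF linear_compose_add[OF L[OF v, of X]
         linear_times[OF L[OF v, of "\<i> *s X"], of \<i>]] linear_times[OF comp[OF L[OF v, of X]], of \<i>]]
         comp[OF L[OF v, of "\<i> *s X"]]], of "1/4"] by simp
    show "linear (\<lambda>Y. (\<eta> v Y X + \<i> * \<eta> v (\<i> *s Y) X + \<i> * \<eta> v Y (\<i> *s X) - \<eta> v (\<i> *s Y) (\<i> *s X)) / 4)"
      using linear_times[OF linear_compose_sub[OF linear_compose_add[OF linear_compose_add[OF M[OF v, of X]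
         linear_times[OF comp[OF M[OF v, of X]], of \<i>]] linear_times[OF M[OF v, of "\<i> *s X"], of \<i>]]
         comp[OF M[OF v, of "\<i> *s X"]]], of "1/4"] by simp
    show "(\<eta> v X X + \<i> * \<eta> v (\<i> *s X) X + \<i> * \<eta> v X (\<i> *s X) - \<eta> v (\<i> *s X) (\<i> *s X)) / 4 = 0"
      using forms2_swap[OF \<eta> v, of "\<i> *s X" X] forms2D(4)[OF \<eta> v] by simp
    show "(\<eta> v (c *s v) X + \<i> * \<eta> v (\<i> *s (c *s v)) X + \<i> * \<eta> v (c *s v) (\<i> *s X) - \<eta> v (\<i> *s (c *s v)) (\<i> *s X)) / 4 = 0" for c
      using forms2D(5)[OF \<eta> v] by simp
    show "(\<eta> (z *s v) (z *s X) (z *s Y) + \<i> * \<eta> (z *s v) (\<i> *s (z *s X)) (z *s Y) + \<i> * \<eta> (z *s v) (z *s X) (\<i> *s (z *s Y))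
        - \<eta> (z *s v) (\<i> *s (z *s X)) (\<i> *s (z *s Y))) / 4 =
      (\<eta> v X Y + \<i> * \<eta> v (\<i> *s X) Y + \<i> * \<eta> v X (\<i> *s Y) - \<eta> v (\<i> *s X) (\<i> *s Y)) / 4"
      if "cmod z = 1" for z Y
    proof -
      have c: "\<i> *s (z *s W) = z *s (\<i> *s W)" for W :: "complex^'n" by (simp add: mult.commute)
      show ?thesis unfolding c forms2D(6)[OF \<eta> that v] ..
    qed
  next
    fix X Y
    have "smooth_on_sphere (\<lambda>v. (1/4) * (\<eta> v X Y + \<i> * \<eta> v (\<i> *s X) Y + \<i> * \<eta> v X (\<i> *s Y) - \<eta> v (\<i> *s X) (\<i> *s Y)))"
      by (intro smooth_on_sphere_mult smooth_on_sphere_diff smooth_on_sphere_add smooth_on_sphere_const forms2D(7)[OF \<eta>])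
    then show "smooth_on_sphere (\<lambda>v. (\<eta> v X Y + \<i> * \<eta> v (\<i> *s X) Y + \<i> * \<eta> v X (\<i> *s Y) - \<eta> v (\<i> *s X) (\<i> *s Y)) / 4)"
      by simp
  qed
  moreover have "proj02 \<eta> v (\<i> *s X) Y = - \<i> * proj02 \<eta> v X Y" if v: "v \<in> Sph" for v X Y
    using v linear_neg[OF M[OF v], of X] by (simp add: proj02_def field_simps)
  ultimately show ?thesis by (simp add: forms02_def)
qed

text \<open>All conditions come from \<open>radial_invariant\<close>: \<open>radial f\<close> is
  constant along complex lines, so its derivative kills vertical vectors, is invariant under the
  circle, and is homogeneous of degree -1 under positive scaling.\<close>

lemma d0_closed:
  fixes f :: "complex^'n::finite \<Rightarrow> complex"
  assumes f: "f \<in> Cinf 0"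
  shows "d0 f \<in> forms1"
  unfolding d0_def
proof (rule forms1I)
  note df = radial_differentiable[OF f]
  have sc: "frechet_derivative (radial f) (at u) X = frechet_derivative (radial f) (at (c *s u)) (c *s X)"
    if "c \<noteq> 0" "u \<noteq> 0" for c u X
    by (rule frechet_derivative_scale[OF that df]) (use that radial_invariant[OF f that(1)] in auto)
  fix v :: "complex^'n" assume v: "v \<in> Sph"
  show "linear (frechet_derivative (radial f) (at v))"
    by (rule frechet_derivative_linear_arg[OF df[OF Sph_nonzero[OF v]]])
  show "frechet_derivative (radial f) (at (z *s v)) (z *s X) = frechet_derivative (radial f) (at v) X" if "cmod z = 1" for z X
    using sc[of z v X] that Sph_nonzero[OF v] by (cases "z = 0") auto
  fix c
  show "frechet_derivative (radial f) (at v) (c *s v) = 0"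
  proof (rule frechet_derivative_direction[OF df[OF Sph_nonzero[OF v]]])
    show "((\<lambda>t. radial f v) has_vector_derivative 0) (at (0::real))" by simp
    \<comment> \<open>With |t| below this bound |t c| < 1, so v + t c v = (1 + t c) v is a nonzero
      multiple of v. The added 1 also covers c = 0.\<close>
    show "0 < 1 / (cmod c + 1)" by (simp add: add_nonneg_pos)
    fix t :: real assume t: "\<bar>t\<bar> < 1 / (cmod c + 1)"
    have "1 + complex_of_real t * c \<noteq> 0"
    proof
      assume "1 + complex_of_real t * c = 0"
      then have "complex_of_real t * c = - 1" by (simp add: add_eq_0_iff)
      then have "\<bar>t\<bar> * cmod c = 1" by (metis norm_minus_cancel norm_mult norm_of_real norm_one)
      moreover have "\<bar>t\<bar> * (cmod c + 1) < 1"
        using t pos_less_divide_eq[of "cmod c + 1" "\<bar>t\<bar>" 1] by (simp add: add_nonneg_pos)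
      ultimately show False by (simp add: algebra_simps)
    qed
    moreover have "v + t *\<^sub>R (c *s v) = (1 + complex_of_real t * c) *s v"
      by (simp add: scaleR_smult vec_eq_iff algebra_simps)
    ultimately show "radial f (v + t *\<^sub>R (c *s v)) = radial f v"
      using radial_invariant[OF f _ Sph_nonzero[OF v]] by metis
  qed
next
  fix X :: "complex^'n"
  note df = radial_differentiable[OF f]
  \<comment> \<open>The derivative has degree -1; the factor |u| turns it into a function of degree
    0, which is the radial extension whose smoothness is wanted.\<close>
  have "smooth (\<lambda>u. complex_of_real (norm u) * frechet_derivative (radial f) (at u) X)"
    using CinfD(2)[OF f] by (intro smooth_mult smooth_norm smooth_derivative) (simp add: smooth_on_sphere_iff)
  then show "smooth_on_sphere (\<lambda>v. frechet_derivative (radial f) (at v) X)"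
    unfolding smooth_on_sphere_iff
  proof (rule smooth_cong)
    fix u :: "complex^'n" assume u: "u \<noteq> 0"
    let ?r = "1 / norm u"
    have r: "?r *\<^sub>R u \<noteq> 0" using u by simp
    have "frechet_derivative (radial f) (at u) X = frechet_derivative (radial f) (at (?r *\<^sub>R u)) (?r *\<^sub>R X)"
      unfolding scaleR_smult
      by (rule frechet_derivative_scale[OF _ u])
         (use u df[OF r] radial_invariant[OF f] in \<open>auto simp: scaleR_smult\<close>)
    also have "\<dots> = ?r *\<^sub>R frechet_derivative (radial f) (at (?r *\<^sub>R u)) X"
      by (rule linear_scale[OF frechet_derivative_linear_arg[OF df[OF r]]])
    finally show "complex_of_real (norm u) * frechet_derivative (radial f) (at u) X =
        radial (\<lambda>v. frechet_derivative (radial f) (at v) X) u"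
      using u by (simp add: radial_def scaleR_conv_of_real)
  qed
qed

lemma radial_eq:
  "u \<noteq> 0 \<Longrightarrow> radial (\<lambda>v\<in>Sph. F v) u = F ((1 / norm u) *\<^sub>R u)"
  by (simp add: radial_def normalize_Sph)

lemma d0_add:
  assumes f: "f \<in> Cinf 0" and g: "g \<in> Cinf 0" and v: "v \<in> Sph"
  shows "d0 (\<lambda>v\<in>Sph. f v + g v) v X = d0 f v X + d0 g v X"
proof -
  have "frechet_derivative (radial (\<lambda>v\<in>Sph. f v + g v)) (at v) =
      frechet_derivative (\<lambda>u. radial f u + radial g u) (at v)"
    by (rule frechet_derivative_cong_open(1)[OF open_punctured])
       (use Sph_nonzero[OF v] normalize_Sph in \<open>auto simp: radial_def\<close>)
  then show ?thesis
    using v by (simp add: d0_def frechet_derivative_add radial_differentiable[OF f] radial_differentiable[OF g] Sph_nonzero)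
qed

lemma d0_mult:
  assumes f: "f \<in> Cinf 0" and g: "g \<in> Cinf 0" and v: "v \<in> Sph"
  shows "d0 (\<lambda>v\<in>Sph. f v * g v) v X = f v * d0 g v X + d0 f v X * g v"
proof -
  have "frechet_derivative (radial (\<lambda>v\<in>Sph. f v * g v)) (at v) =
      frechet_derivative (\<lambda>u. radial f u * radial g u) (at v)"
    by (rule frechet_derivative_cong_open(1)[OF open_punctured])
       (use Sph_nonzero[OF v] normalize_Sph in \<open>auto simp: radial_def\<close>)
  then show ?thesis
    using v by (simp add: d0_def frechet_derivative_mult radial_differentiable[OF f] radial_differentiable[OF g] Sph_nonzero radial_Sph)
qed

lemma d0_const: "v \<in> Sph \<Longrightarrow> d0 (\<lambda>v\<in>Sph. c) v X = 0"
proof -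
  assume v: "v \<in> Sph"
  have "frechet_derivative (radial (\<lambda>v\<in>Sph. c)) (at v) = frechet_derivative (\<lambda>u. c) (at v)"
    by (rule frechet_derivative_cong_open(1)[OF open_punctured])
       (use Sph_nonzero[OF v] radial_eq in \<open>auto simp: radial_def normalize_Sph\<close>)
  then show ?thesis using v by (simp add: d0_def)
qed

lemma Omega_simps [simp]:
  "carrier Omega1 = forms1" "zero Omega1 = (\<lambda>v\<in>Sph. \<lambda>X. 0)"
  "add Omega1 = (\<lambda>\<omega> \<omega>'. \<lambda>v\<in>Sph. \<lambda>X. \<omega> v X + \<omega>' v X)"
  "ract Omega1 = (\<lambda>\<omega> b. \<lambda>v\<in>Sph. \<lambda>X. \<omega> v X * b v)"
  "lact Omega1 = (\<lambda>b \<omega>. \<lambda>v\<in>Sph. \<lambda>X. b v * \<omega> v X)"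
  "carrier Omega01 = forms01" "zero Omega01 = (\<lambda>v\<in>Sph. \<lambda>X. 0)"
  "add Omega01 = (\<lambda>\<omega> \<omega>'. \<lambda>v\<in>Sph. \<lambda>X. \<omega> v X + \<omega>' v X)"
  "ract Omega01 = (\<lambda>\<omega> b. \<lambda>v\<in>Sph. \<lambda>X. \<omega> v X * b v)"
  "lact Omega01 = (\<lambda>b \<omega>. \<lambda>v\<in>Sph. \<lambda>X. b v * \<omega> v X)"
  "carrier Omega02 = forms02" "zero Omega02 = (\<lambda>v\<in>Sph. \<lambda>X Y. 0)"
  "add Omega02 = (\<lambda>\<omega> \<omega>'. \<lambda>v\<in>Sph. \<lambda>X Y. \<omega> v X Y + \<omega>' v X Y)"
  "ract Omega02 = (\<lambda>\<omega> b. \<lambda>v\<in>Sph. \<lambda>X Y. \<omega> v X Y * b v)"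
  "lact Omega02 = (\<lambda>b \<omega>. \<lambda>v\<in>Sph. \<lambda>X Y. b v * \<omega> v X Y)"
  by (simp_all add: Omega1_def Omega01_def Omega02_def)

text \<open>The pullback hidden in \<open>d1\<close>, with the vector argument before the base
  point: for constant Y it is a scalar function on punctured space, ready to be
  differentiated.\<close>

definition ext_form :: "'n::finite form1 \<Rightarrow> complex^'n \<Rightarrow> complex^'n \<Rightarrow> complex" where
  "ext_form \<omega> Y u = radial \<omega> u ((1 / norm u) *\<^sub>R Y)"

lemma d1_eq: "v \<in> Sph \<Longrightarrow> d1 \<omega> v X Y =
    frechet_derivative (ext_form \<omega> Y) (at v) X - frechet_derivative (ext_form \<omega> X) (at v) Y"
  by (simp add: d1_def ext_form_def[abs_def])

lemma ext_form_Sph: "v \<in> Sph \<Longrightarrow> ext_form \<omega> Y v = \<omega> v Y"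
  by (simp add: ext_form_def radial_Sph) (simp add: Sph_def)

context
  fixes \<omega> :: "'n::finite form1"
  assumes \<omega>: "\<omega> \<in> forms1"
begin

lemma ext_form_radial:
  assumes "u \<noteq> 0"
  shows "ext_form \<omega> Y u = inv_norm u * radial (\<lambda>v. \<omega> v Y) u"
  using linear_scale[OF forms1D(2)[OF \<omega> normalize_Sph[OF assms]]]
  by (simp add: ext_form_def radial_def inv_norm_def scaleR_conv_of_real)

lemma smooth_ext_form: "smooth (ext_form \<omega> Y)"
proof -
  have "smooth (\<lambda>u. inv_norm u * radial (\<lambda>v. \<omega> v Y) u)"
    using forms1D(5)[OF \<omega>] by (intro smooth_mult smooth_inv_norm) (simp add: smooth_on_sphere_iff)
  then show ?thesis by (rule smooth_cong) (simp add: ext_form_radial)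
qed

lemma ext_form_differentiable: "u \<noteq> 0 \<Longrightarrow> ext_form \<omega> Y differentiable (at u)"
  by (rule smooth_differentiable[OF smooth_ext_form])

lemma ext_form_linear: "u \<noteq> 0 \<Longrightarrow> linear (\<lambda>Y. ext_form \<omega> Y u)"
  using forms1D(2)[OF \<omega> normalize_Sph[of u]]
  by (simp add: ext_form_def radial_def linear_iff scaleR_add_right mult.commute flip: scaleR_scaleR)
     (metis scaleR_left_commute)

lemma ext_form_scale:
  assumes c: "c \<noteq> 0" and u: "u \<noteq> 0"
  shows "ext_form \<omega> (c *s Y) (c *s u) = ext_form \<omega> Y u"
proof -
  have "cmod (c / of_real (cmod c)) = 1" using c by (simp add: norm_divide)
  then show ?thesis
    using forms1D(4)[OF \<omega> _ normalize_Sph[OF u]]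
    by (simp add: ext_form_def radial_def normalize_smult[OF c])
qed

lemma ext_form_radial_direction:
  assumes u: "u \<noteq> 0"
  shows "ext_form \<omega> (c *s u) u = 0"
proof -
  have "(1 / norm u) *\<^sub>R (c *s u) = c *s ((1 / norm u) *\<^sub>R u)"
    by (simp add: scaleR_smult mult.commute)
  then show ?thesis
    using forms1D(3)[OF \<omega> normalize_Sph[OF u]] by (simp add: ext_form_def radial_def)
qed

lemma derivative_ext_form_linear:
  assumes u: "u \<noteq> 0"
  shows "linear (\<lambda>Y. frechet_derivative (ext_form \<omega> Y) (at u) X)"
proof (rule linearI)
  fix Y Z
  have "frechet_derivative (ext_form \<omega> (Y + Z)) (at u) = frechet_derivative (\<lambda>u. ext_form \<omega> Y u + ext_form \<omega> Z u) (at u)"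
    by (rule frechet_derivative_cong_open(1)[OF open_punctured]) (use u linear_add[OF ext_form_linear] in auto)
  then show "frechet_derivative (ext_form \<omega> (Y + Z)) (at u) X =
      frechet_derivative (ext_form \<omega> Y) (at u) X + frechet_derivative (ext_form \<omega> Z) (at u) X"
    by (simp add: frechet_derivative_add ext_form_differentiable u)
next
  fix r :: real and Y
  have "frechet_derivative (ext_form \<omega> (r *\<^sub>R Y)) (at u) = frechet_derivative (\<lambda>u. complex_of_real r * ext_form \<omega> Y u) (at u)"
    by (rule frechet_derivative_cong_open(1)[OF open_punctured])
       (use u linear_scale[OF ext_form_linear] in \<open>auto simp: scaleR_conv_of_real\<close>)
  then show "frechet_derivative (ext_form \<omega> (r *\<^sub>R Y)) (at u) X = r *\<^sub>R frechet_derivative (ext_form \<omega> Y) (at u) X"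
    by (simp add: frechet_derivative_mult ext_form_differentiable u scaleR_conv_of_real)
qed

lemma derivative_ext_form_scale:
  assumes c: "c \<noteq> 0" and u: "u \<noteq> 0"
  shows "frechet_derivative (ext_form \<omega> (c *s Y)) (at (c *s u)) (c *s X) = frechet_derivative (ext_form \<omega> Y) (at u) X"
  by (rule frechet_derivative_scale[OF c u, symmetric])
     (use c u in \<open>auto simp: ext_form_scale intro!: ext_form_differentiable\<close>)

text \<open>The two contributions to \<open>d1 \<omega>\<close> on a vertical vector \<open>c v\<close> and \<open>X\<close> cancel.\<close>

lemma derivative_ext_form_vertical:
  assumes v: "v \<in> Sph"
  shows "frechet_derivative (ext_form \<omega> Y) (at v) (c *s v) = - \<omega> v (c *s Y)"
proof (rule frechet_derivative_direction)
  have v0: "v \<noteq> 0" using Sph_nonzero[OF v] .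
  show "ext_form \<omega> Y differentiable (at v)" by (rule ext_form_differentiable[OF v0])
  \<comment> \<open>Along the complex line of v the base point is l v with l = 1 + t c. By
    homogeneity Y at l v counts as Y/l at v, and the derivative of 1/l at t = 0 is -c.\<close>
  have 1: "((\<lambda>t. inverse (1 + complex_of_real t * c)) has_vector_derivative - c) (at (0::real))"
    by (auto intro!: derivative_eq_intros simp: has_vector_derivative_def scaleR_conv_of_real fun_eq_iff)
  have "linear (\<lambda>z. \<omega> v (z *s Y))"
    using forms1D(2)[OF \<omega> v] by (simp add: linear_iff scaleR_smult scaleR_conv_of_real vector_sadd_rdistrib)
       (metis scaleR_smult scaleR_conv_of_real vector_smult_assoc)
  then have "bounded_linear (\<lambda>z. \<omega> v (z *s Y))" by (simp add: linear_conv_bounded_linear)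
  from bounded_linear.has_vector_derivative[OF this 1]
  show "((\<lambda>t. \<omega> v (inverse (1 + complex_of_real t * c) *s Y)) has_vector_derivative - \<omega> v (c *s Y)) (at (0::real))"
    using linear_neg[OF forms1D(2)[OF \<omega> v], of "c *s Y"] by (simp add: vector_smult_lneg)
  show "0 < 1 / (cmod c + 1)" by (simp add: add_nonneg_pos)
  fix t :: real assume t: "\<bar>t\<bar> < 1 / (cmod c + 1)"
  let ?l = "1 + complex_of_real t * c"
  have l: "?l \<noteq> 0"
  proof
    assume "1 + complex_of_real t * c = 0"
    then have "complex_of_real t * c = - 1" by (simp add: add_eq_0_iff)
    then have "\<bar>t\<bar> * cmod c = 1" by (metis norm_minus_cancel norm_mult norm_of_real norm_one)
    moreover have "\<bar>t\<bar> * (cmod c + 1) < 1" using t pos_less_divide_eq[of "cmod c + 1" "\<bar>t\<bar>" 1] by (simp add: add_nonneg_pos)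
    ultimately show False by (simp add: algebra_simps)
  qed
  have "v + t *\<^sub>R (c *s v) = ?l *s v"
    by (simp add: scaleR_smult vec_eq_iff algebra_simps)
  moreover have "Y = ?l *s (inverse ?l *s Y)" using l by simp
  ultimately have "ext_form \<omega> Y (v + t *\<^sub>R (c *s v)) = ext_form \<omega> (?l *s (inverse ?l *s Y)) (?l *s v)"
    by simp
  also have "\<dots> = \<omega> v (inverse ?l *s Y)"
    by (simp only: ext_form_scale[OF l v0] ext_form_Sph[OF v])
  finally show "ext_form \<omega> Y (v + t *\<^sub>R (c *s v)) = \<omega> v (inverse ?l *s Y)" .
qed

lemma derivative_ext_form_of_vertical:
  assumes v: "v \<in> Sph"
  shows "frechet_derivative (ext_form \<omega> (c *s v)) (at v) X = - \<omega> v (c *s X)"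
proof (rule frechet_derivative_direction)
  have v0: "v \<noteq> 0" using Sph_nonzero[OF v] .
  show "ext_form \<omega> (c *s v) differentiable (at v)" by (rule ext_form_differentiable[OF v0])
  have "((\<lambda>t. v + t *\<^sub>R X) has_derivative (\<lambda>t. t *\<^sub>R X)) (at (0::real))"
    by (auto intro!: derivative_eq_intros)
  then have "((\<lambda>t. ext_form \<omega> (c *s X) (v + t *\<^sub>R X)) has_derivative
      (\<lambda>t. frechet_derivative (ext_form \<omega> (c *s X)) (at v) (t *\<^sub>R X))) (at (0::real))"
    by (rule has_derivative_compose) (use ext_form_differentiable[OF v0] in \<open>simp add: frechet_derivative_works\<close>)
  then have "((\<lambda>t. - (t *\<^sub>R ext_form \<omega> (c *s X) (v + t *\<^sub>R X))) has_derivative (\<lambda>t. - (t *\<^sub>R ext_form \<omega> (c *s X) v))) (at (0::real))"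
    by (auto intro!: derivative_eq_intros)
  then show "((\<lambda>t. - (t *\<^sub>R ext_form \<omega> (c *s X) (v + t *\<^sub>R X))) has_vector_derivative - \<omega> v (c *s X)) (at (0::real))"
    by (simp add: has_vector_derivative_def ext_form_Sph[OF v])
  show "0 < 1 / (norm X + 1)" by (simp add: add_nonneg_pos)
  fix t :: real assume t: "\<bar>t\<bar> < 1 / (norm X + 1)"
  let ?u = "v + t *\<^sub>R X"
  have u: "?u \<noteq> 0"
  proof
    assume "?u = 0"
    then have "t *\<^sub>R X = - v" by (simp add: add_eq_0_iff)
    then have "\<bar>t\<bar> * norm X = 1" using v by (metis norm_minus_cancel norm_scaleR Sph_def mem_sphere_0)
    moreover have "\<bar>t\<bar> * (norm X + 1) < 1" using t pos_less_divide_eq[of "norm X + 1" "\<bar>t\<bar>" 1] by (simp add: add_nonneg_pos)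
    ultimately show False by (simp add: algebra_simps)
  qed
  \<comment> \<open>The fixed vector c v is no longer vertical at the moved point u = v + t X, but c
    u is. The difference -t c X is linear in t and alone contributes.\<close>
  have "c *s v = c *s ?u - t *\<^sub>R (c *s X)"
    by (simp add: scaleR_smult vec_eq_iff algebra_simps)
  then have "ext_form \<omega> (c *s v) ?u = ext_form \<omega> (c *s ?u) ?u - t *\<^sub>R ext_form \<omega> (c *s X) ?u"
    by (simp only: linear_diff[OF ext_form_linear[OF u]] linear_scale[OF ext_form_linear[OF u]])
  then show "ext_form \<omega> (c *s v) ?u = - (t *\<^sub>R ext_form \<omega> (c *s X) ?u)"
    by (simp only: ext_form_radial_direction[OF u])  simp
qed

lemma d1_closed: "d1 \<omega> \<in> forms2"
proof -
  have "(\<lambda>v\<in>Sph. \<lambda>X Y. frechet_derivative (ext_form \<omega> Y) (at v) X - frechet_derivative (ext_form \<omega> X) (at v) Y) \<in> forms2"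
  proof (rule forms2I)
    fix v :: "complex^'n" assume v: "v \<in> Sph"
    note v0 = Sph_nonzero[OF v]
    note 1 = derivative_ext_form_linear[OF v0] and 2 = frechet_derivative_linear_arg[OF ext_form_differentiable[OF v0]]
    show "linear (\<lambda>Y. frechet_derivative (ext_form \<omega> Y) (at v) X - frechet_derivative (ext_form \<omega> X) (at v) Y)" for X
      by (rule linear_compose_sub[OF 1 2])
    show "linear (\<lambda>X. frechet_derivative (ext_form \<omega> Y) (at v) X - frechet_derivative (ext_form \<omega> X) (at v) Y)" for Y
      by (rule linear_compose_sub[OF 2 1])
    show "frechet_derivative (ext_form \<omega> X) (at v) X - frechet_derivative (ext_form \<omega> X) (at v) X = 0" for X
      by simp
    show "frechet_derivative (ext_form \<omega> X) (at v) (c *s v) - frechet_derivative (ext_form \<omega> (c *s v)) (at v) X = 0" for c X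
      by (simp add: derivative_ext_form_vertical[OF v] derivative_ext_form_of_vertical[OF v])
    fix z :: complex assume z: "cmod z = 1"
    then have "z \<noteq> 0" by auto
    then show "frechet_derivative (ext_form \<omega> (z *s Y)) (at (z *s v)) (z *s X) - frechet_derivative (ext_form \<omega> (z *s X)) (at (z *s v)) (z *s Y) =
      frechet_derivative (ext_form \<omega> Y) (at v) X - frechet_derivative (ext_form \<omega> X) (at v) Y" for X Y
      by (simp add: derivative_ext_form_scale v0)
  next
    fix X Y :: "complex^'n"
    \<comment> \<open>The pulled back 2-form has degree -2, one power for each vector argument, so
      |u|^2 makes it a radial extension.\<close>
    have "smooth (\<lambda>u. complex_of_real (norm u) * complex_of_real (norm u) *
        (frechet_derivative (ext_form \<omega> Y) (at u) X - frechet_derivative (ext_form \<omega> X) (at u) Y))"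
      by (intro smooth_mult smooth_norm smooth_diff smooth_derivative smooth_ext_form)
    then show "smooth_on_sphere (\<lambda>v. frechet_derivative (ext_form \<omega> Y) (at v) X - frechet_derivative (ext_form \<omega> X) (at v) Y)"
      unfolding smooth_on_sphere_iff
    proof (rule smooth_cong)
      fix u :: "complex^'n" assume u: "u \<noteq> 0"
      let ?r = "1 / norm u"
      have r: "?r *\<^sub>R u \<noteq> 0" using u by simp
      have "frechet_derivative (ext_form \<omega> Y) (at u) X = ?r *\<^sub>R ?r *\<^sub>R frechet_derivative (ext_form \<omega> Y) (at (?r *\<^sub>R u)) X" for X Y
      proof -
        have "frechet_derivative (ext_form \<omega> Y) (at u) X = frechet_derivative (ext_form \<omega> (?r *\<^sub>R Y)) (at (?r *\<^sub>R u)) (?r *\<^sub>R X)"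
          unfolding scaleR_smult by (rule derivative_ext_form_scale[symmetric]) (use u in auto)
        also have "\<dots> = ?r *\<^sub>R ?r *\<^sub>R frechet_derivative (ext_form \<omega> Y) (at (?r *\<^sub>R u)) X"
          by (simp only: linear_scale[OF derivative_ext_form_linear[OF r]]
              linear_scale[OF frechet_derivative_linear_arg[OF ext_form_differentiable[OF r]]])
        finally show ?thesis .
      qed
      then show "complex_of_real (norm u) * complex_of_real (norm u) *
          (frechet_derivative (ext_form \<omega> Y) (at u) X - frechet_derivative (ext_form \<omega> X) (at u) Y) =
        radial (\<lambda>v. frechet_derivative (ext_form \<omega> Y) (at v) X - frechet_derivative (ext_form \<omega> X) (at v) Y) u"
        using u by (simp add: radial_def scaleR_conv_of_real field_simps)
    qed
  qed
  then show ?thesis by (simp add: d1_def ext_form_def[abs_def] radial_def)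
qed

lemma d1_scale:
  assumes b: "b \<in> Cinf 0" and v: "v \<in> Sph"
  shows "d1 (\<lambda>v\<in>Sph. \<lambda>X. b v * \<omega> v X) v X Y = wedge (d0 b) \<omega> v X Y + b v * d1 \<omega> v X Y"
proof -
  have "frechet_derivative (ext_form (\<lambda>v\<in>Sph. \<lambda>X. b v * \<omega> v X) Y) (at v) X =
      b v * frechet_derivative (ext_form \<omega> Y) (at v) X + frechet_derivative (radial b) (at v) X * \<omega> v Y" for X Y
  proof -
    have "frechet_derivative (ext_form (\<lambda>v\<in>Sph. \<lambda>X. b v * \<omega> v X) Y) (at v) =
        frechet_derivative (\<lambda>u. radial b u * ext_form \<omega> Y u) (at v)"
      by (rule frechet_derivative_cong_open(1)[OF open_punctured])
         (use Sph_nonzero[OF v] normalize_Sph in \<open>auto simp: ext_form_def radial_def\<close>)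
    then show ?thesis
      by (simp add: frechet_derivative_mult radial_differentiable[OF b] ext_form_differentiable Sph_nonzero[OF v]
          radial_Sph[OF v] ext_form_Sph[OF v])
  qed
  then show ?thesis
    using v by (simp add: d1_eq wedge_def d0_def algebra_simps)
qed

end

lemma d1_add:
  assumes \<omega>: "\<omega> \<in> forms1" and \<omega>': "\<omega>' \<in> forms1" and v: "v \<in> Sph"
  shows "d1 (\<lambda>v\<in>Sph. \<lambda>X. \<omega> v X + \<omega>' v X) v X Y = d1 \<omega> v X Y + d1 \<omega>' v X Y"
proof -
  have "frechet_derivative (ext_form (\<lambda>v\<in>Sph. \<lambda>X. \<omega> v X + \<omega>' v X) Y) (at v) X =
      frechet_derivative (ext_form \<omega> Y) (at v) X + frechet_derivative (ext_form \<omega>' Y) (at v) X" for X Y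
  proof -
    have "frechet_derivative (ext_form (\<lambda>v\<in>Sph. \<lambda>X. \<omega> v X + \<omega>' v X) Y) (at v) =
        frechet_derivative (\<lambda>u. ext_form \<omega> Y u + ext_form \<omega>' Y u) (at v)"
      by (rule frechet_derivative_cong_open(1)[OF open_punctured])
         (use Sph_nonzero[OF v] normalize_Sph in \<open>auto simp: ext_form_def radial_def\<close>)
    then show ?thesis
      by (simp add: frechet_derivative_add ext_form_differentiable[OF \<omega>] ext_form_differentiable[OF \<omega>'] Sph_nonzero[OF v])
  qed
  then show ?thesis
    using v by (simp add: d1_eq)
qed

lemma dbar1_closed: "\<omega> \<in> forms1 \<Longrightarrow> dbar1 \<omega> \<in> forms02"
  unfolding dbar1_def by (intro proj02_closed d1_closed)

lemma dbar1_add: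
  assumes "\<omega> \<in> forms1" "\<omega>' \<in> forms1"
  shows "dbar1 (\<lambda>v\<in>Sph. \<lambda>X. \<omega> v X + \<omega>' v X) = (\<lambda>v\<in>Sph. \<lambda>X Y. dbar1 \<omega> v X Y + dbar1 \<omega>' v X Y)"
  using d1_add[OF assms] by (auto simp: dbar1_def proj02_def fun_eq_iff field_simps)

text \<open>From the Leibniz rule of \<open>d1\<close>: the (1,0)-part of db wedged with a
  (0,1)-form has type (1,1), so the (0,2)-projection leaves only the (0,1)-part of db.\<close>

lemma dbar1_scale:
  assumes b: "b \<in> Cinf 0" and \<omega>: "\<omega> \<in> forms01"
  shows "dbar1 (\<lambda>v\<in>Sph. \<lambda>X. b v * \<omega> v X) =
    (\<lambda>v\<in>Sph. \<lambda>X Y. wedge (dbar0 b) \<omega> v X Y + b v * dbar1 \<omega> v X Y)"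
proof (intro ext)
  fix v X Y
  show "dbar1 (\<lambda>v\<in>Sph. \<lambda>X. b v * \<omega> v X) v X Y =
    (\<lambda>v\<in>Sph. \<lambda>X Y. wedge (dbar0 b) \<omega> v X Y + b v * dbar1 \<omega> v X Y) v X Y"
  proof (cases "v \<in> Sph")
    case True
    then show ?thesis
      by (simp add: dbar1_def proj02_def d1_scale[OF forms01D(1)[OF \<omega>] b] wedge_def dbar0_def proj01_def
          forms01D(2)[OF \<omega> True] field_simps)
  qed (simp add: dbar1_def proj02_def)
qed

lemma wedge_closed:
  fixes \<omega> \<omega>' :: "'n::finite form1"
  assumes \<omega>: "\<omega> \<in> forms01" and \<omega>': "\<omega>' \<in> forms01"
  shows "wedge \<omega> \<omega>' \<in> forms02"
proof -
  note f = forms01D(1)[OF \<omega>] and f' = forms01D(1)[OF \<omega>']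
  have "wedge \<omega> \<omega>' \<in> forms2"
    unfolding wedge_def
  proof (rule forms2I)
    fix v :: "complex^'n" assume v: "v \<in> Sph"
    note l = forms1D(2)[OF f v] and l' = forms1D(2)[OF f' v]
    show "linear (\<lambda>Y. \<omega> v X * \<omega>' v Y - \<omega> v Y * \<omega>' v X)" for X
      using linear_compose_sub[OF linear_times[OF l', of "\<omega> v X"] linear_times[OF l, of "\<omega>' v X"]] by (simp add: mult.commute)
    show "linear (\<lambda>X. \<omega> v X * \<omega>' v Y - \<omega> v Y * \<omega>' v X)" for Y
      using linear_compose_sub[OF linear_times[OF l, of "\<omega>' v Y"] linear_times[OF l', of "\<omega> v Y"]] by (simp add: mult.commute)
  qed (auto simp: forms1D f f' intro!: smooth_on_sphere_diff smooth_on_sphere_mult)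
  then show ?thesis
    by (auto simp: forms02_def wedge_def forms01D(2)[OF \<omega>] forms01D(2)[OF \<omega>'] algebra_simps)
qed

section \<open>The basic forms of grade zero and the coefficients of the connection\<close>

lemma forms1_sum:
  assumes "finite I" "\<And>i. i \<in> I \<Longrightarrow> \<omega> i \<in> forms1"
  shows "(\<lambda>v\<in>Sph. \<lambda>X. \<Sum>i\<in>I. \<omega> i v X) \<in> forms1"
  using assms
proof (induction I)
  case (insert i I)
  then have "(\<lambda>v\<in>Sph. \<lambda>X. \<omega> i v X + (\<lambda>v\<in>Sph. \<lambda>X. \<Sum>i\<in>I. \<omega> i v X) v X) \<in> forms1"
    by (intro forms1_add) auto
  also have "(\<lambda>v\<in>Sph. \<lambda>X. \<omega> i v X + (\<lambda>v\<in>Sph. \<lambda>X. \<Sum>i\<in>I. \<omega> i v X) v X) =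
      (\<lambda>v\<in>Sph. \<lambda>X. \<Sum>i\<in>insert i I. \<omega> i v X)"
    using insert by (auto simp: fun_eq_iff)
  finally show ?case .
qed (simp add: forms1_zero)

text \<open>Neither factor is a form on projective space by itself. Rewriting the product as the sum
  of the Q_qk dQ_ks reduces smoothness and invariance to those of \<open>d0\<close> on functions of
  weight zero.\<close>

lemma v_dvbar_forms1: "v_dvbar q s \<in> forms1"
proof -
  have "(\<lambda>v\<in>Sph. \<lambda>X. \<Sum>k\<in>UNIV. (\<lambda>v\<in>Sph. \<lambda>X. Q q k v * d0 (Q k s) v X) v X) \<in> forms1"
    (is "?w \<in> _")
    by (intro forms1_sum forms1_scale Cinf_Q d0_closed) simp
  moreover have "?w = v_dvbar q s"
    by (auto simp: fun_eq_iff v_dvbar_Q) (simp add: v_dvbar_def)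
  ultimately show ?thesis by (simp only:)
qed

lemma v_dvbar_closed: "v_dvbar q s \<in> forms01"
  using v_dvbar_forms1[of q s]
  by (auto simp: forms01_def v_dvbar_def dvbar_def horizontal_def sum_distrib_left sum_negf algebra_simps)

definition vbar_dv :: "'n \<Rightarrow> 'n \<Rightarrow> 'n::finite form1" where
  "vbar_dv p r = (\<lambda>v\<in>Sph. \<lambda>X. cnj (v $ p) * dv r v X)"

lemma vbar_dv_closed: "vbar_dv p r \<in> forms1"
proof -
  have "(\<lambda>v\<in>Sph. \<lambda>X. \<Sum>k\<in>UNIV. (\<lambda>v\<in>Sph. \<lambda>X. Q k p v * d0 (Q r k) v X) v X) \<in> forms1"
    (is "?w \<in> _")
    by (intro forms1_sum forms1_scale Cinf_Q d0_closed) simp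
  moreover have "?w = vbar_dv p r"
    by (auto simp: fun_eq_iff vbar_dv_def vbar_dv_Q mult.commute)
  ultimately show ?thesis by (simp only:)
qed

lemma proj01_v_dvbar: "proj01 (v_dvbar q s) = v_dvbar q s"
  using forms01D(2)[OF v_dvbar_closed[of q s]]
  by (auto simp: proj01_def fun_eq_iff) (simp add: v_dvbar_def)

lemma proj01_vbar_dv: "v \<in> Sph \<Longrightarrow> proj01 (vbar_dv p r) v X = 0"
  by (simp add: proj01_def vbar_dv_def dv_def horizontal_def sum_distrib_left sum_negf algebra_simps)

text \<open>Regroups \<open>Gamma\<close> into pieces of grade zero: in the last two terms the
  prefactor v_q and the conjugate of v_s pair up to Q_qs, and what remains are forms on projective
  space.\<close>

lemma Gamma_eq:
  "v \<in> Sph \<Longrightarrow> Gamma p q r s v X = (if p = r then 1 else 0) * v_dvbar q s v X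
     + Q q s v * (vbar_dv p r v X - v_dvbar r p v X)"
  by (simp add: Gamma_def v_dvbar_def vbar_dv_def Q_def algebra_simps)

section \<open>The Dolbeault operator on \<open>v\<^sub>q \<d>\<bar>v\<^sub>s\<close>\<close>

definition herm :: "complex^'n \<Rightarrow> complex^'n \<Rightarrow> complex" where
  "herm X Y = (\<Sum>k\<in>UNIV. X $ k * cnj (Y $ k))"

lemma herm_scale: "herm (c *s X) Y = c * herm X Y" "herm X (c *s Y) = cnj c * herm X Y"
  by (simp_all add: herm_def sum_distrib_left algebra_simps)

lemma herm_cnj: "cnj (herm X Y) = herm Y X"
  by (simp add: herm_def mult.commute)

lemma inner_herm: "complex_of_real (X \<bullet> v) = (herm X v + herm v X) / 2" for X v :: "complex^'n::finite"
proof -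
  have "complex_of_real (a \<bullet> b) = (a * cnj b + b * cnj a) / 2" for a b :: complex
    by (simp add: complex_eq_iff inner_complex_def)
  then show ?thesis
    by (simp add: inner_vec_def herm_def sum.distrib add_divide_distrib flip: sum_divide_distrib)
qed

text \<open>The pullback in closed form. The first term carries |u|^-2; the second, from the
  horizontal projection, carries |u|^-4. Written with powers of \<open>inv_norm\<close> so that the
  product rule applies.\<close>

lemma ext_form_v_dvbar:
  assumes "u \<noteq> 0"
  shows "ext_form (v_dvbar q s) Y u =
    inv_norm u * inv_norm u * (u $ q * cnj (Y $ s)) -
    inv_norm u * inv_norm u * (inv_norm u * inv_norm u) * (u $ q * cnj (u $ s) * herm u Y)"
proof -
  let ?r = "1 / norm u"
  have h: "horizontal (?r *\<^sub>R u) (?r *\<^sub>R Y) $ s = inv_norm u * Y $ s -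
      inv_norm u * inv_norm u * inv_norm u * herm Y u * u $ s"
    by (simp add: horizontal_def herm_def inv_norm_def scaleR_nth sum_distrib_left sum_distrib_right
      sum_divide_distrib mult_ac del: vector_scaleR_component)
  have n: "cnj (inv_norm u) = inv_norm u" by (simp add: inv_norm_def)
  have i: "(?r *\<^sub>R u) $ q = inv_norm u * u $ q" by (simp add: inv_norm_def scaleR_nth del: vector_scaleR_component)
  have "ext_form (v_dvbar q s) Y u = inv_norm u * u $ q * cnj (horizontal (?r *\<^sub>R u) (?r *\<^sub>R Y) $ s)"
    unfolding i[symmetric] using normalize_Sph[OF assms]
    by (simp add: ext_form_def radial_def v_dvbar_def dvbar_def)
  also have "\<dots> = inv_norm u * inv_norm u * (u $ q * cnj (Y $ s)) -
    inv_norm u * inv_norm u * (inv_norm u * inv_norm u) * (u $ q * cnj (u $ s) * herm u Y)"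
    unfolding h by (simp add: n herm_cnj algebra_simps)
  finally show ?thesis .
qed

text \<open>On the sphere each factor \<open>inv_norm\<close> differentiates to minus the real inner
  product of X and v, that is half of -(herm X v + herm v X). Two factors thus give coefficient 1,
  four give coefficient 2.\<close>

lemma derivative_v_dvbar:
  fixes v :: "complex^'n::finite"
  assumes v: "v \<in> Sph"
  shows "frechet_derivative (ext_form (v_dvbar q s) Y) (at v) X =
    X $ q * cnj (Y $ s) - (herm X v + herm v X) * (v $ q * cnj (Y $ s))
    + 2 * (herm X v + herm v X) * (v $ q * cnj (v $ s) * herm v Y)
    - (X $ q * cnj (v $ s) * herm v Y + v $ q * cnj (X $ s) * herm v Y + v $ q * cnj (v $ s) * herm X Y)"
proof -
  have N: "inv_norm v = 1" using v by (simp add: inv_norm_def Sph_def)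
  note dn = inv_norm_has_derivative[OF Sph_nonzero[OF v], unfolded N]
  have dk: "((\<lambda>u::complex^'n. u $ l) has_derivative (\<lambda>X. X $ l)) (at v)" for l
    by (rule bounded_linear_imp_has_derivative) (rule bounded_linear_vec_nth)
  have dc: "((\<lambda>u::complex^'n. cnj (u $ l)) has_derivative (\<lambda>X. cnj (X $ l))) (at v)" for l
    by (rule bounded_linear_imp_has_derivative)
       (rule bounded_linear_compose[OF bounded_linear_cnj bounded_linear_vec_nth])
  have dh: "((\<lambda>u::complex^'n. herm u Y) has_derivative (\<lambda>X. herm X Y)) (at v)"
    unfolding herm_def by (intro has_derivative_sum has_derivative_mult_left dk)
  note d2 = has_derivative_mult[OF dn dn]
  note d4 = has_derivative_mult[OF d2 d2]
  note D = has_derivative_diff[OF has_derivative_mult[OF d2 has_derivative_mult_left[OF dk[of q], of "cnj (Y $ s)"]]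
    has_derivative_mult[OF d4 has_derivative_mult[OF has_derivative_mult[OF dk[of q] dc[of s]] dh]]]
  have "frechet_derivative (ext_form (v_dvbar q s) Y) (at v) =
    frechet_derivative (\<lambda>u. inv_norm u * inv_norm u * (u $ q * cnj (Y $ s)) -
    inv_norm u * inv_norm u * (inv_norm u * inv_norm u) * (u $ q * cnj (u $ s) * herm u Y)) (at v)"
    by (rule frechet_derivative_cong_open(1)[OF open_punctured])
       (use Sph_nonzero[OF v] in \<open>auto simp: ext_form_v_dvbar\<close>)
  also note frechet_derivative_at[OF D, symmetric]
  finally show ?thesis
    by (simp add: N inner_herm field_simps)
qed

text \<open>The (0,2)-projection keeps only the terms conjugate linear in both X and Y. In the
  formula of \<open>derivative_v_dvbar\<close> these terms together are symmetric in X and Y, so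
  antisymmetrisation kills them.\<close>

lemma dbar1_v_dvbar: "dbar1 (v_dvbar q s) = (\<lambda>v\<in>Sph. \<lambda>X Y. 0)"
proof (intro ext)
  fix v X Y
  show "dbar1 (v_dvbar q s) v X Y = (\<lambda>v\<in>Sph. \<lambda>X Y. 0) v X Y"
  proof (cases "v \<in> Sph")
    case True
    show ?thesis
      using True by (simp add: dbar1_def proj02_def d1_eq derivative_v_dvbar herm_scale algebra_simps)
  qed (simp add: dbar1_def proj02_def)
qed

lemma wedge_contract:
  assumes "v \<in> Sph"
  shows "(\<Sum>k\<in>UNIV. wedge (v_dvbar r k) (v_dvbar k p) v X Y) = 0"
proof -
  have "(\<Sum>k\<in>UNIV. wedge (v_dvbar r k) (v_dvbar k p) v X Y) =
      v $ r * dvbar p v Y * (\<Sum>k\<in>UNIV. v $ k * dvbar k v X) - v $ r * dvbar p v X * (\<Sum>k\<in>UNIV. v $ k * dvbar k v Y)"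
    using assms by (simp add: wedge_def v_dvbar_def sum_distrib_left sum_subtractf mult_ac)
  then show ?thesis using assms by (simp add: sum_v_dvbar)
qed

section \<open>The Dolbeault operator on functions\<close>

lemma dbar0_closed: "f \<in> Cinf 0 \<Longrightarrow> dbar0 f \<in> forms01"
  unfolding dbar0_def by (intro proj01_closed d0_closed)

lemma finsum_Cinf:
  assumes "finite I" "\<And>i. i \<in> I \<Longrightarrow> f i \<in> Cinf m"
  shows "finsum (Cinf_module m :: (complex, complex^'n::finite \<Rightarrow> complex, complex^'n \<Rightarrow> complex) bimod) f I =
    (\<lambda>v\<in>Sph. \<Sum>i\<in>I. f i v)"
proof -
  interpret abelian_group "Cinf_module m :: (complex, complex^'n \<Rightarrow> complex, complex^'n \<Rightarrow> complex) bimod"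
    by (rule abelian_group_Cinf)
  show ?thesis
    using assms by (induction I) (auto simp: Pi_iff fun_eq_iff)
qed

definition coord :: "'n::finite \<Rightarrow> (complex^'n \<Rightarrow> complex) \<Rightarrow> complex^'n \<Rightarrow> complex" where
  "coord j f = (\<lambda>v\<in>Sph. v $ j * f v)"

lemma coord_closed: "f \<in> Cinf (-1) \<Longrightarrow> coord j f \<in> Cinf 0"
  using Cinf_mult[OF Cinf_nth, of f "-1" 0 j] by (simp add: coord_def cong: restrict_cong)

text \<open>Holds because the v_j vbar_j sum to 1 on the sphere. It is the explicit form of the
  statement that the \<open>vbar j\<close> generate; the coefficients are canonical though in
  general not the only ones.\<close>

lemma vbar_expansion:
  assumes f: "f \<in> Cinf (-1)"
  shows "f = finsum (Cinf_module (-1)) (\<lambda>j. ract (Cinf_module (-1)) (vbar j) (coord j f)) UNIV"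
proof -
  have c: "(\<lambda>v\<in>Sph. vbar j v * coord j f v) \<in> Cinf (-1)" for j
    by (rule Cinf_mult[OF Cinf_vbar coord_closed[OF f]]) simp
  have "(\<lambda>v\<in>Sph. \<Sum>j\<in>UNIV. (\<lambda>v\<in>Sph. vbar j v * coord j f v) v) = f"
  proof
    fix v
    show "(\<lambda>v\<in>Sph. \<Sum>j\<in>UNIV. (\<lambda>v\<in>Sph. vbar j v * coord j f v) v) v = f v"
    proof (cases "v \<in> Sph")
      case True
      then have "(\<Sum>j\<in>UNIV. vbar j v * coord j f v) = (\<Sum>j\<in>UNIV. v $ j * cnj (v $ j)) * f v"
        by (simp add: vbar_def coord_def sum_distrib_left sum_distrib_right mult_ac)
      then show ?thesis using True sphere_sum[OF True] by simp
    qed (simp add: Cinf_arb[OF f])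
  qed
  then show ?thesis
    using finsum_Cinf[of UNIV "\<lambda>j. (\<lambda>v\<in>Sph. vbar j v * coord j f v)" "-1"] c by simp
qed

section \<open>The universal calculus on matrices\<close>

lemma additive_map_diff:
  assumes H: "abelian_group H" and f: "additive_map G H f" and g: "additive_map G H g"
  shows "additive_map G H (\<lambda>x. f x \<ominus>\<^bsub>H\<^esub> g x)"
proof -
  interpret H: abelian_group H by fact
  show ?thesis
    using additive_map_closed[OF f] additive_map_closed[OF g]
    by (auto intro!: additive_mapI simp: additive_map_add[OF f] additive_map_add[OF g] H.minus_eq H.minus_add H.a_ac)
qed

lemma additive_map_id: "additive_map G G (\<lambda>x. x)"
  by (simp add: additive_map_def)

lemma abelian_group_UNIV:
  assumes "carrier G = (UNIV :: 'a::ab_group_add set)" "zero G = 0" "add G = (+)"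
  shows "abelian_group G"
  by (rule abelian_groupI) (auto simp: assms algebra_simps intro: exI[of _ "- x" for x])

lemma Mat_simps [simp]:
  "carrier Mat = UNIV" "mult Mat = (**)" "one Mat = mat 1" "zero Mat = 0" "add Mat = (+)"
  by (simp_all add: Mat_def)

lemma matrix_add_rdistrib: "(A + B) ** C = A ** C + B ** C" for A B :: "complex^'n::finite^'m::finite"
  by (simp add: vec_eq_iff matrix_matrix_mult_def distrib_right sum.distrib)

lemma ring_Mat: "ring (Mat :: (complex^'n::finite^'n) ring)"
proof (rule ringI)
  show "abelian_group (Mat :: (complex^'n^'n) ring)" by (rule abelian_group_UNIV) simp_all
  show "monoid (Mat :: (complex^'n^'n) ring)" by (rule monoidI) (auto simp: matrix_mul_assoc)
qed (auto simp: matrix_add_ldistrib matrix_add_rdistrib)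

lemma mat_mult_left: "mat c ** A = (\<chi> i j. c * A $ i $ j)" for A :: "complex^'n::finite^'m::finite"
  by (simp add: vec_eq_iff matrix_matrix_mult_def mat_def if_distrib[of "\<lambda>x. x * _"] cong: if_cong)

lemma mat_mult_right: "A ** mat c = (\<chi> i j. c * A $ i $ j)" for A :: "complex^'n::finite^'m::finite"
  by (simp add: vec_eq_iff matrix_matrix_mult_def mat_def if_distrib[of "\<lambda>x. _ * x"] mult.commute cong: if_cong)

lemma mat_commute: "mat c ** A = A ** mat c" for A :: "complex^'n::finite^'n"
  by (simp add: mat_mult_left mat_mult_right)

lemma mat_mat: "mat (a + b) = mat a + (mat b :: complex^'n::finite^'n)" "mat (a * b) = mat a ** (mat b :: complex^'n::finite^'n)"
  by (simp_all add: vec_eq_iff mat_mult_left) (simp_all add: mat_def)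

lemma mat_mult_mat: "mat (a * b) ** A = mat b ** (mat a ** A)" for A :: "complex^'n::finite^'m::finite"
  by (simp add: vec_eq_iff mat_mult_left)

lemma Mat_left_right_simps [simp]:
  "carrier Mat_left = UNIV" "zero Mat_left = 0" "add Mat_left = (+)"
  "ract Mat_left = (\<lambda>a c. mat c ** a)" "lact Mat_left = (**)"
  "carrier Mat_right = UNIV" "zero Mat_right = 0" "add Mat_right = (+)"
  "ract Mat_right = (**)" "lact Mat_right = (\<lambda>c a. mat c ** a)"
  by (simp_all add: Mat_left_def Mat_right_def)

lemma bimodule_Mat_left: "bimodule Mat complex_ring (Mat_left :: (complex^'n::finite^'n, complex, complex^'n^'n) bimod)"
  unfolding bimodule_def
proof (intro conjI ballI)
  have ab: "abelian_group (Mat_left :: (complex^'n^'n, complex, complex^'n^'n) bimod)"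
    by (rule abelian_group_UNIV) simp_all
  show "right_module complex_ring (Mat_left :: (complex^'n^'n, complex, complex^'n^'n) bimod)"
    by (rule right_moduleI)
       (auto simp: ab ring_complex_ring additive_map_def matrix_add_ldistrib mat_mat(1) matrix_add_rdistrib mat_mult_mat)
  show "left_mod Mat (Mat_left :: (complex^'n^'n, complex, complex^'n^'n) bimod)"
    by (rule left_modI)
       (auto simp: ab ring_Mat additive_map_def matrix_add_ldistrib matrix_add_rdistrib matrix_mul_assoc)
  show "ract Mat_left (lact Mat_left a e) b = lact Mat_left a (ract Mat_left e b)" for a b and e :: "complex^'n^'n"
    by (simp add: matrix_mul_assoc mat_commute[of b a])
qed

lemma bimodule_Mat_right: "bimodule complex_ring Mat (Mat_right :: (complex, complex^'n::finite^'n, complex^'n^'n) bimod)"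
  unfolding bimodule_def
proof (intro conjI ballI)
  have ab: "abelian_group (Mat_right :: (complex, complex^'n^'n, complex^'n^'n) bimod)"
    by (rule abelian_group_UNIV) simp_all
  show "right_module Mat (Mat_right :: (complex, complex^'n^'n, complex^'n^'n) bimod)"
    by (rule right_moduleI)
       (auto simp: ab ring_Mat additive_map_def matrix_add_ldistrib matrix_add_rdistrib matrix_mul_assoc)
  show "left_mod complex_ring (Mat_right :: (complex, complex^'n^'n, complex^'n^'n) bimod)"
    by (rule left_modI)
       (auto simp: ab ring_complex_ring additive_map_def matrix_add_ldistrib matrix_add_rdistrib mat_mat matrix_mul_assoc)
qed (simp add: matrix_mul_assoc)

section \<open>The tensor square of the matrix algebra and its one-forms\<close>

interpretation MM: tensor_bimod complex_ring "Mat_left :: (complex^'n::finite^'n, complex, complex^'n^'n) bimod"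
  "Mat_right :: (complex, complex^'n^'n, complex^'n^'n) bimod" Mat Mat
  by (rule tensor_bimodI[OF bimodule_Mat_left bimodule_Mat_right])

abbreviation matmul :: "'n::finite uniform \<Rightarrow> complex^'n^'n" where
  "matmul \<equiv> tensor_lift Mat (\<lambda>a b. a ** b)"

lemma abelian_Mat: "abelian_group (Mat :: (complex^'n::finite^'n) ring)"
  by (rule abelian_group_UNIV) simp_all

lemma balanced_matmul: "balanced complex_ring Mat_left Mat_right Mat (\<lambda>a b. a ** (b :: complex^'n::finite^'n))"
  by (rule balancedI) (auto simp: additive_map_def matrix_add_ldistrib matrix_add_rdistrib,
    metis matrix_mul_assoc mat_commute)

lemma matmul_additive: "additive_map MM.T Mat matmul"
  by (rule MM.lift_additive[OF abelian_Mat balanced_matmul])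

lemma matmul_pure: "matmul (MM.pt a b) = a ** b" for a b :: "complex^'n::finite^'n"
  by (rule MM.lift_pure[OF abelian_Mat balanced_matmul]) simp_all

lemma matmul_add: "s \<in> carrier MM.T \<Longrightarrow> t \<in> carrier MM.T \<Longrightarrow> matmul (s \<oplus>\<^bsub>MM.T\<^esub> t) = matmul s + matmul t"
  using additive_map_add[OF matmul_additive] by simp

lemma Mat_minus: "a \<ominus>\<^bsub>Mat\<^esub> b = a - (b :: complex^'n::finite^'n)"
proof -
  have "\<ominus>\<^bsub>Mat\<^esub> b = - b"
    using abelian_group.l_neg[OF abelian_Mat, of b] by (simp add: eq_neg_iff_add_eq_0)
  then show ?thesis by (simp add: a_minus_def)
qed

lemma matmul_act: "t \<in> carrier MM.T \<Longrightarrow> matmul (MM.act t a) = matmul t ** a"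
proof (rule MM.tensor_ext[of t Mat])
  show "additive_map MM.T Mat (\<lambda>t. matmul (MM.act t a))"
    by (rule additive_map_comp[OF MM.act_additive matmul_additive]) simp
  show "additive_map MM.T Mat (\<lambda>t. matmul t ** a)"
    by (rule additive_map_comp[OF matmul_additive]) (simp add: additive_map_def matrix_add_rdistrib)
qed (simp_all add: MM.act_pure matmul_pure matrix_mul_assoc)

lemma matmul_lac: "t \<in> carrier MM.T \<Longrightarrow> matmul (MM.lac a t) = a ** matmul t"
proof (rule MM.tensor_ext[of t Mat])
  show "additive_map MM.T Mat (\<lambda>t. matmul (MM.lac a t))"
    by (rule additive_map_comp[OF MM.lac_additive matmul_additive]) simp
  show "additive_map MM.T Mat (\<lambda>t. a ** matmul t)"
    by (rule additive_map_comp[OF matmul_additive]) (simp add: additive_map_def matrix_add_ldistrib)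
qed (simp_all add: MM.lac_pure matmul_pure matrix_mul_assoc)

lemma Omega_uni_simps [simp]:
  "carrier Omega_uni = {t \<in> carrier MM.T. matmul t = 0}"
  "zero Omega_uni = \<zero>\<^bsub>MM.T\<^esub>" "add Omega_uni = add MM.T"
  "ract Omega_uni = ract (rtensor complex_ring Mat_left Mat_right)"
  "lact Omega_uni = lact (btensor complex_ring Mat_left Mat_right)"
  unfolding Omega_uni_def Let_def
  by (simp_all flip: ract_btensor)

lemma bimodule_sub:
  assumes bi: "bimodule A B E" and U: "U \<subseteq> carrier E" "\<zero>\<^bsub>E\<^esub> \<in> U"
    "\<And>x y. x \<in> U \<Longrightarrow> y \<in> U \<Longrightarrow> x \<oplus>\<^bsub>E\<^esub> y \<in> U" "\<And>x. x \<in> U \<Longrightarrow> \<ominus>\<^bsub>E\<^esub> x \<in> U"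
    "\<And>a x. a \<in> carrier A \<Longrightarrow> x \<in> U \<Longrightarrow> lact E a x \<in> U"
    "\<And>b x. b \<in> carrier B \<Longrightarrow> x \<in> U \<Longrightarrow> ract E x b \<in> U"
  shows "bimodule A B (E\<lparr>carrier := U\<rparr>)"
proof -
  note R = right_moduleD[OF bimoduleD(1)[OF bi]] and L = left_modD[OF bimoduleD(2)[OF bi]]
  interpret E: abelian_group E by (rule R(2))
  have c: "x \<in> U \<Longrightarrow> x \<in> carrier E" for x using U(1) by blast
  have ab: "abelian_group (E\<lparr>carrier := U\<rparr>)"
  proof (rule abelian_groupI)
    fix x assume x: "x \<in> carrier (E\<lparr>carrier := U\<rparr>)"
    show "\<exists>y\<in>carrier (E\<lparr>carrier := U\<rparr>). y \<oplus>\<^bsub>E\<lparr>carrier := U\<rparr>\<^esub> x = \<zero>\<^bsub>E\<lparr>carrier := U\<rparr>\<^esub>"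
      by (rule bexI[of _ "\<ominus>\<^bsub>E\<^esub> x"]) (use x c U(4) E.l_neg in auto)
  qed (use U(2,3) c in \<open>simp_all add: E.a_ac\<close>)
  show ?thesis
    unfolding bimodule_def
  proof (intro conjI ballI)
    show "right_module B (E\<lparr>carrier := U\<rparr>)"
      by (rule right_moduleI)
         (use U(3,6) c R in \<open>simp_all add: ab additive_map_def Pi_iff\<close>)
    show "left_mod A (E\<lparr>carrier := U\<rparr>)"
      by (rule left_modI)
         (use U(3,5) c L in \<open>simp_all add: ab additive_map_def Pi_iff\<close>)
  qed (use c bimoduleD(3)[OF bi] in simp)
qed

lemma bimodule_Omega_uni: "bimodule Mat Mat (Omega_uni :: (complex^'n::finite^'n, complex^'n^'n, 'n uniform) bimod)"
  unfolding Omega_uni_def Let_def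
proof (rule bimodule_sub[OF MM.bimodule_T])
  show "\<ominus>\<^bsub>btensor complex_ring Mat_left Mat_right\<^esub> x \<in> {t \<in> carrier (btensor complex_ring Mat_left Mat_right). matmul t = 0}"
    if "x \<in> {t \<in> carrier (btensor complex_ring Mat_left Mat_right). matmul t = 0}" for x :: "'n uniform"
    using that additive_map_inv[OF MM.abelian_group_T abelian_Mat matmul_additive, of x]
      abelian_group.minus_minus[OF abelian_Mat] Mat_minus[of 0 0] by (simp add: a_minus_def)
qed (use additive_map_zero[OF MM.abelian_group_T abelian_Mat matmul_additive] in
   \<open>auto simp: matmul_add matmul_act matmul_lac MM.act_T_closed MM.lac_closed\<close>)

lemma d_uni_eq: "d_uni a = MM.pt (mat 1) a \<ominus>\<^bsub>MM.T\<^esub> MM.pt a (mat 1)"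
  by (simp add: d_uni_def)

lemma d_uni_closed: "d_uni a \<in> carrier Omega_uni" for a :: "complex^'n::finite^'n"
  using additive_map_minus[OF MM.abelian_group_T abelian_Mat matmul_additive, of "MM.pt (mat 1) a" "MM.pt a (mat 1)"]
  by (simp add: d_uni_eq matmul_pure Mat_minus)

lemma d_uni_T: "d_uni a \<in> carrier MM.T" for a :: "complex^'n::finite^'n"
  using d_uni_closed[of a] by simp

lemma d_uni_additive_T: "additive_map Mat MM.T (d_uni :: complex^'n::finite^'n \<Rightarrow> _)"
proof -
  have "additive_map Mat MM.T (MM.pt (mat 1))" "additive_map Mat MM.T (\<lambda>a. MM.pt a (mat 1))"
    using MM.pure_additive(1)[of "mat 1"] MM.pure_additive(2)[of "mat 1"] by (simp_all add: additive_map_def)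
  from additive_map_diff[OF MM.abelian_group_T this] show ?thesis
    by (simp only: d_uni_eq[abs_def])
qed

lemma d_uni_additive: "additive_map Mat Omega_uni (d_uni :: complex^'n::finite^'n \<Rightarrow> _)"
  using d_uni_closed additive_map_add[OF d_uni_additive_T] by (intro additive_mapI) simp_all

text \<open>Scalars pass across the tensor product over the complex numbers, so c \<otimes> 1 = 1
  \<otimes> c. This is why additivity and the Leibniz rule already make connections complex
  linear.\<close>

lemma d_uni_mat: "d_uni (mat c :: complex^'n::finite^'n) = \<zero>\<^bsub>MM.T\<^esub>"
  using MM.pure_balance[of "mat 1 :: complex^'n^'n" c "mat 1"] by (simp add: d_uni_eq MM.T.minus_eq MM.T.r_neg)

lemma lac_d_uni: "MM.lac a (d_uni b) = MM.pt a b \<ominus>\<^bsub>MM.T\<^esub> MM.pt (a ** b) (mat 1)" for a b :: "complex^'n::finite^'n"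
  using additive_map_minus[OF MM.abelian_group_T MM.abelian_group_T MM.lac_additive[of a], of "MM.pt (mat 1) b" "MM.pt b (mat 1)"]
  by (simp add: d_uni_eq MM.lac_pure)

lemma act_d_uni: "MM.act (d_uni a) b = MM.pt (mat 1) (a ** b) \<ominus>\<^bsub>MM.T\<^esub> MM.pt a b" for a b :: "complex^'n::finite^'n"
  using additive_map_minus[OF MM.abelian_group_T MM.abelian_group_T MM.act_additive[of b], of "MM.pt (mat 1) a" "MM.pt a (mat 1)"]
  by (simp add: d_uni_eq MM.act_pure)

lemma d_uni_mult: "d_uni (a ** b) = MM.lac a (d_uni b) \<oplus>\<^bsub>MM.T\<^esub> MM.act (d_uni a) b" for a b :: "complex^'n::finite^'n"
proof -
  have "x \<ominus>\<^bsub>MM.T\<^esub> z = (y \<ominus>\<^bsub>MM.T\<^esub> z) \<oplus>\<^bsub>MM.T\<^esub> (x \<ominus>\<^bsub>MM.T\<^esub> y)"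
    if "x \<in> carrier MM.T" "y \<in> carrier MM.T" "z \<in> carrier MM.T" for x y z :: "'n uniform"
    using that MM.T.l_neg[of y] MM.T.r_neg[of y] MM.T.r_neg1[of y "x"]
    by (simp add: MM.T.minus_eq MM.T.a_ac) (metis MM.T.a_inv_closed MM.T.a_lcomm MM.T.add.m_closed MM.T.r_neg MM.T.r_zero)
  then show ?thesis
    unfolding lac_d_uni act_d_uni by (simp add: d_uni_eq)
qed

lemma d_uni_scale: "d_uni (mat c ** a) = MM.lac (mat c) (d_uni a)" for a :: "complex^'n::finite^'n"
  using d_uni_mult[of "mat c" a] MM.act_additive[of a]
    additive_map_zero[OF MM.abelian_group_T MM.abelian_group_T MM.act_additive[of a]]
  by (simp add: d_uni_mat MM.lac_closed d_uni_T)

text \<open>The projection \<open>t \<mapsto> t - \<mu> t \<otimes> 1\<close> onto the universal one-forms sends \<open>a \<otimes> b\<close> to \<open>a \<d>b\<close>.\<close>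

definition uni_proj :: "'n::finite uniform \<Rightarrow> 'n uniform" where
  "uni_proj t = t \<ominus>\<^bsub>MM.T\<^esub> MM.pt (matmul t) (mat 1)"

lemma uni_proj_additive: "additive_map MM.T Omega_uni (uni_proj :: 'n::finite uniform \<Rightarrow> _)"
proof -
  have "additive_map Mat MM.T (\<lambda>a. MM.pt a (mat 1))"
    using MM.pure_additive(2)[of "mat 1"] by (simp add: additive_map_def)
  from additive_map_diff[OF MM.abelian_group_T additive_map_id additive_map_comp[OF matmul_additive this]]
  have *: "additive_map MM.T MM.T (uni_proj :: 'n uniform \<Rightarrow> _)" by (simp add: uni_proj_def[abs_def])
  have "matmul (uni_proj t) = 0" if "t \<in> carrier MM.T" for t :: "'n uniform"
    using additive_map_minus[OF MM.abelian_group_T abelian_Mat matmul_additive that, of "MM.pt (matmul t) (mat 1)"]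
    by (simp add: uni_proj_def Mat_minus matmul_pure)
  then show ?thesis using * by (simp add: additive_map_def Pi_iff)
qed

lemma uni_proj_pure: "uni_proj (MM.pt a b) = MM.lac a (d_uni b)" for a b :: "complex^'n::finite^'n"
  by (simp add: uni_proj_def lac_d_uni matmul_pure)

lemma uni_proj_Omega: "\<omega> \<in> carrier Omega_uni \<Longrightarrow> uni_proj \<omega> = \<omega>"
  using MM.pure_zero(2)[of "mat 1"] MM.T.r_neg[of "\<zero>\<^bsub>MM.T\<^esub>"] by (simp add: uni_proj_def MM.T.minus_eq)

text \<open>For the universal calculus the bimodule map \<sigma> is no extra choice: a right
  connection on a bimodule has exactly one, provided it commutes with scalar matrices. That proviso
  is \<open>nabE_scale\<close>.\<close>

locale universal_bimodule =
  fixes B :: "('b, 'y) ring_scheme" and \<Omega>B :: "('b, 'b, 'w) bimod" and dB :: "'b \<Rightarrow> 'w"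
    and E :: "(complex^'n::finite^'n, 'b, 'e) bimod" and nabE :: "'e \<Rightarrow> ('e, 'w) tens"
  assumes bi_E: "bimodule Mat B E" and conn_E: "right_connection B \<Omega>B dB E nabE"
    and dB_closed: "b \<in> carrier B \<Longrightarrow> dB b \<in> carrier \<Omega>B"
    and nabE_scale: "e \<in> carrier E \<Longrightarrow> nabE (lact E (mat c) e) = lact (btensor B E \<Omega>B) (mat c) (nabE e)"
begin

lemmas nabE = right_connectionD(3,5,6)[OF conn_E]
lemma bi_\<Omega>B: "bimodule B B \<Omega>B" by (rule right_connectionD(2)[OF conn_E])

sublocale OE: tensor_bimod Mat Omega_uni E B Mat by (rule tensor_bimodI[OF bimodule_Omega_uni bi_E])
sublocale EO: tensor_bimod B E \<Omega>B B Mat by (rule tensor_bimodI[OF bi_E bi_\<Omega>B])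

lemma lact_E: "e \<in> carrier E \<Longrightarrow> lact E a e \<in> carrier E"
  using OE.act_closed(2)[of e a] by simp

text \<open>The map a \<otimes> b to a \<nabla>(b e) lives on the whole tensor square and sends da =
  1 \<otimes> a - a \<otimes> 1 to \<nabla>(a e) - a \<nabla>(e). Restricted to the kernel of
  multiplication it is therefore the desired \<sigma>. Balance over the complex numbers is where
  \<open>nabE_scale\<close> enters.\<close>

lemma balanced_s:
  assumes e: "e \<in> carrier E"
  shows "balanced complex_ring Mat_left Mat_right EO.T (\<lambda>a b. EO.lac a (nabE (lact E b e)))"
proof (rule balancedI)
  show "additive_map Mat_right EO.T (\<lambda>b. EO.lac a (nabE (lact E b e)))" for a
  proof -
    have "additive_map Mat EO.T (\<lambda>b. EO.lac a (nabE (lact E b e)))"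
      by (rule additive_map_comp[OF additive_map_comp[OF left_modD(5)[OF OE.left_N e] nabE(1)] EO.lac_additive]) simp
    then show ?thesis by (simp add: additive_map_def)
  qed
  show "additive_map Mat_left EO.T (\<lambda>a. EO.lac a (nabE (lact E b e)))" for b
    using EO.lac_additive_left[OF nabE(2)[OF lact_E[OF e]]] by (simp add: additive_map_def)
  show "EO.lac (ract Mat_left a c) (nabE (lact E b e)) = EO.lac a (nabE (lact E (lact Mat_right c b) e))" for a b c
    using EO.lac_mult[OF nabE(2)[OF lact_E[OF e]], of a "mat c" b] left_modD(6)[OF OE.left_N _ _ e, of "mat c" b]
      nabE_scale[OF lact_E[OF e]]
    by (simp add: mat_commute)
qed

definition "s e t = tensor_lift EO.T (\<lambda>a b. EO.lac a (nabE (lact E b e))) t"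

lemma s_additive: "e \<in> carrier E \<Longrightarrow> additive_map MM.T EO.T (s e)"
  unfolding s_def[abs_def] by (rule MM.lift_additive[OF EO.abelian_group_T balanced_s])

lemma s_pure: "e \<in> carrier E \<Longrightarrow> s e (MM.pt a b) = EO.lac a (nabE (lact E b e))"
  unfolding s_def by (rule MM.lift_pure[OF EO.abelian_group_T balanced_s]) simp_all

lemma s_closed: "e \<in> carrier E \<Longrightarrow> t \<in> carrier MM.T \<Longrightarrow> s e t \<in> carrier EO.T"
  by (rule additive_map_closed[OF s_additive])

lemma s_lac:
  assumes e: "e \<in> carrier E" and t: "t \<in> carrier MM.T"
  shows "s e (MM.lac a t) = EO.lac a (s e t)"
proof (rule MM.tensor_ext[OF t])
  show "additive_map MM.T EO.T (\<lambda>t. s e (MM.lac a t))"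
    by (rule additive_map_comp[OF MM.lac_additive s_additive[OF e]]) simp
  show "additive_map MM.T EO.T (\<lambda>t. EO.lac a (s e t))"
    by (rule additive_map_comp[OF s_additive[OF e] EO.lac_additive]) simp
  show "s e (MM.lac a (MM.pt m n)) = EO.lac a (s e (MM.pt m n))" for m n
    using EO.lac_mult[OF nabE(2)[OF lact_E[OF e]], of a m n] by (simp add: MM.lac_pure s_pure e)
qed

lemma s_balance:
  assumes e: "e \<in> carrier E" and t: "t \<in> carrier MM.T"
  shows "s e (MM.act t a) = s (lact E a e) t"
proof (rule MM.tensor_ext[OF t])
  show "additive_map MM.T EO.T (\<lambda>t. s e (MM.act t a))"
    by (rule additive_map_comp[OF MM.act_additive s_additive[OF e]]) simp
  show "additive_map MM.T EO.T (s (lact E a e))"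
    by (rule s_additive[OF lact_E[OF e]])
  show "s e (MM.act (MM.pt m n) a) = s (lact E a e) (MM.pt m n)" for m n
    using left_modD(6)[OF OE.left_N _ _ e, of n a] by (simp add: MM.act_pure s_pure e lact_E)
qed

lemma s_additive_left:
  assumes t: "t \<in> carrier MM.T"
  shows "additive_map E EO.T (\<lambda>e. s e t)"
proof (rule additive_mapI)
  fix x y assume x: "x \<in> carrier E" and y: "y \<in> carrier E"
  have xy: "x \<oplus>\<^bsub>E\<^esub> y \<in> carrier E" using x y by simp
  show "s (x \<oplus>\<^bsub>E\<^esub> y) t = s x t \<oplus>\<^bsub>EO.T\<^esub> s y t"
  proof (rule MM.tensor_ext[OF t s_additive[OF xy]
      additive_map_plus[OF EO.abelian_group_T s_additive[OF x] s_additive[OF y]]])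
    show "s (x \<oplus>\<^bsub>E\<^esub> y) (MM.pt m n) = s x (MM.pt m n) \<oplus>\<^bsub>EO.T\<^esub> s y (MM.pt m n)" for m n
      using additive_map_add[OF left_modD(4)[OF OE.left_N, of n] x y]
      by (simp add: s_pure x y xy lact_E additive_map_add[OF nabE(1)] nabE(2) EO.lac_add)
  qed
qed (rule s_closed[OF _ t])

text \<open>On the full tensor square \<open>s\<close> fails to be right linear in e, and the defect
  is the product of the tensor, applied to e, times db. It vanishes on the kernel of multiplication,
  which is exactly \<open>Omega_uni\<close>.\<close>

lemma s_act:
  assumes e: "e \<in> carrier E" and t: "t \<in> carrier MM.T" and b: "b \<in> carrier B"
  shows "s (ract E e b) t = EO.pt (lact E (matmul t) e) (dB b) \<oplus>\<^bsub>EO.T\<^esub> EO.act (s e t) b"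
proof -
  have eb: "ract E e b \<in> carrier E" using right_moduleD(3)[OF OE.right_N e b] .
  have db: "dB b \<in> carrier \<Omega>B" by (rule dB_closed[OF b])
  show ?thesis
  proof (rule MM.tensor_ext[OF t s_additive[OF eb]])
    show "additive_map MM.T EO.T (\<lambda>t. EO.pt (lact E (matmul t) e) (dB b) \<oplus>\<^bsub>EO.T\<^esub> EO.act (s e t) b)"
      by (rule additive_map_plus[OF EO.abelian_group_T
          additive_map_comp[OF additive_map_comp[OF matmul_additive left_modD(5)[OF OE.left_N e]] EO.pure_additive(2)[OF db]]
          additive_map_comp[OF s_additive[OF e] EO.act_additive[OF b]]])
    fix m n :: "complex^'n^'n"
    have "s (ract E e b) (MM.pt m n) = EO.lac m (nabE (ract E (lact E n e) b))"
      using bimoduleD(3)[OF bi_E _ b e, of n] by (simp add: s_pure eb)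
    also have "\<dots> = EO.lac m (EO.pt (lact E n e) (dB b)) \<oplus>\<^bsub>EO.T\<^esub> EO.lac m (EO.act (nabE (lact E n e)) b)"
      by (simp add: nabE lact_E e b db EO.lac_add EO.act_T_closed)
    also have "EO.lac m (EO.pt (lact E n e) (dB b)) = EO.pt (lact E (m ** n) e) (dB b)"
      using left_modD(6)[OF OE.left_N _ _ e, of m n] by (simp add: EO.lac_pure lact_E e db)
    also have "EO.lac m (EO.act (nabE (lact E n e)) b) = EO.act (s e (MM.pt m n)) b"
      by (simp add: s_pure e EO.lac_act nabE lact_E b)
    finally show "s (ract E e b) (MM.pt m n) =
        EO.pt (lact E (matmul (MM.pt m n)) e) (dB b) \<oplus>\<^bsub>EO.T\<^esub> EO.act (s e (MM.pt m n)) b"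
      by (simp add: matmul_pure)
  qed
qed

lemma balanced_sigma: "balanced Mat Omega_uni E EO.T (\<lambda>\<omega> e. s e \<omega>)"
proof (rule balancedI)
  show "additive_map Omega_uni EO.T (s e)" if "e \<in> carrier E" for e
    using s_additive[OF that] by (simp add: additive_map_def Pi_iff)
qed (simp_all add: s_additive_left s_balance)

definition "sig = restrict (tensor_lift EO.T (\<lambda>\<omega> e. s e \<omega>)) (carrier OE.T)"

lemma sig_additive: "additive_map OE.T EO.T sig"
  by (rule additive_map_cong[OF OE.abelian_group_T OE.lift_additive[OF EO.abelian_group_T balanced_sigma]])
     (simp add: sig_def)

lemma sig_pure: "\<omega> \<in> carrier Omega_uni \<Longrightarrow> e \<in> carrier E \<Longrightarrow> sig (OE.pt \<omega> e) = s e \<omega>"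
  using OE.lift_pure[OF EO.abelian_group_T balanced_sigma, of \<omega> e] OE.pure_closed[of \<omega> e] by (simp add: sig_def)

lemma sig_connection: "right_bimodule_connection Mat Omega_uni d_uni B \<Omega>B dB E nabE sig"
  unfolding right_bimodule_connection_def
proof (intro conjI ballI bi_E conn_E)
  show "sig \<in> bimodule_hom Mat B (btensor Mat Omega_uni E) (btensor B E \<Omega>B)"
    unfolding bimodule_hom_def
  proof (intro CollectI conjI ballI right_module_homI)
    show "additive_map (btensor Mat Omega_uni E) (btensor B E \<Omega>B) sig" by (simp add: sig_additive)
    show "sig \<in> extensional (carrier (btensor Mat Omega_uni E))" by (simp add: sig_def)
    fix x assume "x \<in> carrier (btensor Mat Omega_uni E)"
    then have x: "x \<in> carrier OE.T" by simp
    show "sig (ract (btensor Mat Omega_uni E) x b) = ract (btensor B E \<Omega>B) (sig x) b" if b: "b \<in> carrier B" for b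
      unfolding ract_btensor
    proof (rule OE.tensor_ext[OF x additive_map_comp[OF OE.act_additive[OF b] sig_additive]
        additive_map_comp[OF sig_additive EO.act_additive[OF b]]])
      fix \<omega> e assume \<omega>: "\<omega> \<in> carrier (Omega_uni :: (complex^'n^'n, complex^'n^'n, 'n uniform) bimod)" and e: "e \<in> carrier E"
      \<comment> \<open>A universal one-form has product 0, so the defect term of
        \<open>s_act\<close> is 0 \<otimes> db.\<close>
      have z: "lact E 0 e = \<zero>\<^bsub>E\<^esub>"
        using additive_map_zero[OF abelian_Mat OE.N.abelian_group_axioms left_modD(5)[OF OE.left_N e]] by simp
      have "sig (OE.act (OE.pt \<omega> e) b) = s (ract E e b) \<omega>"
        using \<omega> e b right_moduleD(3)[OF OE.right_N e b] OE.act_pure[OF \<omega> e b] sig_pure[OF \<omega>, of "ract E e b"] by simp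
      also have "\<dots> = EO.act (s e \<omega>) b"
        using \<omega> e b s_closed[OF e, of \<omega>] by (simp add: s_act z EO.pure_zero(2) dB_closed EO.act_T_closed)
      also have "s e \<omega> = sig (OE.pt \<omega> e)" by (rule sig_pure[OF \<omega> e, symmetric])
      finally show "sig (OE.act (OE.pt \<omega> e) b) = EO.act (sig (OE.pt \<omega> e)) b" .
    qed
    show "sig (OE.lac a x) = EO.lac a (sig x)" for a
    proof (rule OE.tensor_ext[OF x additive_map_comp[OF OE.lac_additive sig_additive]
        additive_map_comp[OF sig_additive EO.lac_additive]])
      fix \<omega> e assume \<omega>: "\<omega> \<in> carrier (Omega_uni :: (complex^'n^'n, complex^'n^'n, 'n uniform) bimod)" and e: "e \<in> carrier E"
      have c: "lact Omega_uni a \<omega> \<in> carrier Omega_uni"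
        using left_modD(3)[OF OE.left_M _ \<omega>, of a] by simp
      have "sig (OE.lac a (OE.pt \<omega> e)) = s e (lact Omega_uni a \<omega>)"
        using OE.lac_pure[OF \<omega> e, of a] sig_pure[OF c e] by simp
      then show "sig (OE.lac a (OE.pt \<omega> e)) = EO.lac a (sig (OE.pt \<omega> e))"
        using \<omega> sig_pure[OF \<omega> e] by (simp add: s_lac e)
    qed simp_all
  qed
  fix a :: "complex^'n^'n" and e assume e: "e \<in> carrier E"
  have 1: "lact E (mat 1) e = e" using left_modD(7)[OF OE.left_N e] by simp
  have "s e (d_uni a) = s e (MM.pt (mat 1) a) \<ominus>\<^bsub>EO.T\<^esub> s e (MM.pt a (mat 1))"
    unfolding d_uni_eq
    by (rule additive_map_minus[OF MM.abelian_group_T EO.abelian_group_T s_additive[OF e]]) simp_all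
  also have "\<dots> = nabE (lact E a e) \<ominus>\<^bsub>EO.T\<^esub> EO.lac a (nabE e)"
    using EO.lac_one[OF nabE(2)[OF lact_E[OF e]], of a] by (simp add: s_pure e 1)
  finally have "s e (d_uni a) \<oplus>\<^bsub>EO.T\<^esub> EO.lac a (nabE e) = nabE (lact E a e)"
    using nabE(2)[OF lact_E[OF e], of a] EO.lac_closed[OF nabE(2)[OF e], of a]
    by (simp add: EO.T.minus_eq EO.T.a_assoc EO.T.l_neg)
  then show "nabE (lact E a e) = sig (OE.pt (d_uni a) e) \<oplus>\<^bsub>btensor B E \<Omega>B\<^esub> EO.lac a (nabE e)"
    by (simp add: sig_pure[OF d_uni_closed e])
qed

text \<open>The defining equation of a bimodule connection fixes \<sigma> on db \<otimes> e, left
  linearity on a db \<otimes> e, and \<open>uni_proj\<close> shows that sums of a db exhaust the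
  universal one-forms.\<close>

lemma sig_unique:
  assumes "right_bimodule_connection Mat Omega_uni d_uni B \<Omega>B dB E nabE \<sigma>"
  shows "\<sigma> = sig"
proof -
  interpret C: bimodule_connection Mat Omega_uni d_uni B \<Omega>B dB E nabE \<sigma>
    using assms by (auto simp: bimodule_connection_def bimodule_Omega_uni d_uni_closed dB_closed simp del: Omega_uni_simps)
  interpret D: bimodule_connection Mat Omega_uni d_uni B \<Omega>B dB E nabE sig
    using sig_connection by (auto simp: bimodule_connection_def bimodule_Omega_uni d_uni_closed dB_closed simp del: Omega_uni_simps)
  have d: "\<sigma> (OE.pt (d_uni b) e) = sig (OE.pt (d_uni b) e)" if e: "e \<in> carrier E" for b e
  proof -
    have p: "OE.pt (d_uni b) e \<in> carrier OE.T" by (rule OE.pure_closed[OF d_uni_closed e])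
    have "\<sigma> (OE.pt (d_uni b) e) \<oplus>\<^bsub>EO.T\<^esub> EO.lac b (nabE e) = sig (OE.pt (d_uni b) e) \<oplus>\<^bsub>EO.T\<^esub> EO.lac b (nabE e)"
      using C.nabE_left[of b e] D.nabE_left[of b e] e by simp
    then show ?thesis
      using C.\<sigma>_closed[OF p] D.\<sigma>_closed[OF p] EO.lac_closed[OF nabE(2)[OF e], of b] by simp
  qed
  have pe: "\<sigma> (OE.pt \<omega> e) = sig (OE.pt \<omega> e)" if \<omega>: "\<omega> \<in> carrier Omega_uni" and e: "e \<in> carrier E" for \<omega> e
  proof -
    have add: "additive_map MM.T EO.T (\<lambda>t. f (OE.pt (uni_proj t) e))" if "additive_map OE.T EO.T f" for f
      by (rule additive_map_comp[OF additive_map_comp[OF uni_proj_additive OE.pure_additive(2)[OF e]] that])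
    have t: "\<omega> \<in> carrier MM.T" using \<omega> by simp
    have "\<sigma> (OE.pt (uni_proj \<omega>) e) = sig (OE.pt (uni_proj \<omega>) e)"
    proof (rule MM.tensor_ext[OF t add[OF C.\<sigma>_additive] add[OF D.\<sigma>_additive]])
      fix a b :: "complex^'n^'n"
      have p: "OE.pt (d_uni b) e \<in> carrier OE.T" by (rule OE.pure_closed[OF d_uni_closed e])
      \<comment> \<open>Composing with \<open>uni_proj\<close> moves the comparison to the full
        tensor square, where pure tensors are available; a \<otimes> b is sent to a db.\<close>
      have "OE.pt (uni_proj (MM.pt a b)) e = OE.lac a (OE.pt (d_uni b) e)"
        using OE.lac_pure[OF d_uni_closed e, of a b] by (simp add: uni_proj_pure)
      then show "\<sigma> (OE.pt (uni_proj (MM.pt a b)) e) = sig (OE.pt (uni_proj (MM.pt a b)) e)"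
        using C.\<sigma>_lac[OF p, of a] D.\<sigma>_lac[OF p, of a] d[OF e] by simp
    qed
    then show ?thesis by (simp only: uni_proj_Omega[OF \<omega>])
  qed
  show ?thesis
  proof (rule extensionalityI[of _ "carrier OE.T"])
    show "\<sigma> \<in> extensional (carrier OE.T)"
      using right_module_homD(1)[OF bimodule_homD(1)[OF C.\<sigma>_hom]] by simp
    show "sig \<in> extensional (carrier OE.T)" by (simp add: sig_def)
    show "\<sigma> x = sig x" if "x \<in> carrier OE.T" for x
      by (rule OE.tensor_ext[OF that C.\<sigma>_additive D.\<sigma>_additive pe])
  qed
qed

end

section \<open>The connection on \<open>E\<close>\<close>

lemma Col_Row_simps [simp]:
  "carrier Col = UNIV" "zero Col = 0" "add Col = (+)" "ract Col = (\<lambda>h c. c *s h)" "lact Col = (*v)"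
  "carrier Row = UNIV" "zero Row = 0" "add Row = (+)" "ract Row = (v*)" "lact Row = (*s)"
  by (simp_all add: Col_def Row_def)

lemma bimodule_Col: "bimodule Mat complex_ring (Col :: (complex^'n::finite^'n, complex, complex^'n) bimod)"
  unfolding bimodule_def
proof (intro conjI ballI)
  have ab: "abelian_group (Col :: (complex^'n^'n, complex, complex^'n) bimod)"
    by (rule abelian_group_UNIV) simp_all
  show "right_module complex_ring (Col :: (complex^'n^'n, complex, complex^'n) bimod)"
    by (rule right_moduleI)
       (auto simp: ab ring_complex_ring additive_map_def vec_eq_iff algebra_simps)
  show "left_mod Mat (Col :: (complex^'n^'n, complex, complex^'n) bimod)"
    by (rule left_modI)
       (auto simp: ab ring_Mat additive_map_def matrix_vector_mul_assoc algebra_simps)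
  show "ract Col (lact Col a e) b = lact Col a (ract Col e b)" for a b and e :: "complex^'n"
    by (simp add: vec_eq_iff matrix_vector_mult_def sum_distrib_left mult_ac)
qed

lemma bimodule_Row: "bimodule complex_ring Mat (Row :: (complex, complex^'n::finite^'n, complex^'n) bimod)"
  unfolding bimodule_def
proof (intro conjI ballI)
  have ab: "abelian_group (Row :: (complex, complex^'n^'n, complex^'n) bimod)"
    by (rule abelian_group_UNIV) simp_all
  show "right_module Mat (Row :: (complex, complex^'n^'n, complex^'n) bimod)"
    by (rule right_moduleI)
       (auto simp: ab ring_Mat additive_map_def vector_matrix_mul_assoc vector_matrix_left_distrib
         vector_matrix_mult_add_rdistrib)
  show "left_mod complex_ring (Row :: (complex, complex^'n^'n, complex^'n) bimod)"
    by (rule left_modI)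
       (auto simp: ab ring_complex_ring additive_map_def vec_eq_iff algebra_simps)
  show "ract Row (lact Row a e) b = lact Row a (ract Row e b)" for a b and e :: "complex^'n"
    by (simp add: vec_eq_iff vector_matrix_mult_def sum_distrib_left mult_ac)
qed

interpretation EM: tensor_bimod complex_ring "Col :: (complex^'n::finite^'n, complex, complex^'n) bimod"
    "Cinf_module (-1)" CP Mat
  by (rule tensor_bimodI[OF bimodule_Col bimodule_Cinf])

lemma E_tensor_eq: "E_tensor = EM.pt"
  by (simp add: E_tensor_def)

lemma E_mod_simps [simp]:
  "carrier E_mod = carrier EM.T" "zero E_mod = \<zero>\<^bsub>EM.T\<^esub>" "add E_mod = add EM.T"
  "ract E_mod = EM.act" "lact E_mod = EM.lac" "finsum E_mod f I = finsum EM.T f I"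
  by (simp_all add: E_mod_def flip: ract_btensor)

lemma additive_map_E_mod [simp]:
  "additive_map E_mod = (additive_map EM.T :: ('c, 'w) ring_scheme \<Rightarrow> _)"
  "additive_map G E_mod = additive_map G EM.T"
  by (simp_all add: additive_map_def fun_eq_iff)

lemma bimodule_E_mod: "bimodule Mat CP (E_mod :: (complex^'n::finite^'n, complex^'n \<Rightarrow> complex, 'n E_type) bimod)"
  unfolding E_mod_def by (rule EM.bimodule_T)

interpretation EO: tensor_bimod CP "E_mod :: (complex^'n::finite^'n, complex^'n \<Rightarrow> complex, 'n E_type) bimod" Omega1 CP Mat
  by (rule tensor_bimodI[OF bimodule_E_mod bimodule_Omega1])

lemma forms1_restrict: "\<omega> \<in> forms1 \<Longrightarrow> (\<lambda>v\<in>Sph. \<lambda>X. \<omega> v X) \<in> forms1"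
  using forms1D(1)[of \<omega>] by (simp add: extensional_restrict)

text \<open>This and the next variants speak about restricted abstractions on both sides, so that
  introduction rules can assemble a compound form such as \<open>Gamma\<close> or
  \<open>Theta\<close> term by term.\<close>

lemma forms1_add': "(\<lambda>v\<in>Sph. \<lambda>X. \<omega> v X) \<in> forms1 \<Longrightarrow> (\<lambda>v\<in>Sph. \<lambda>X. \<omega>' v X) \<in> forms1 \<Longrightarrow>
    (\<lambda>v\<in>Sph. \<lambda>X. \<omega> v X + \<omega>' v X) \<in> forms1"
  by (drule (1) forms1_add) (simp cong: restrict_cong)

lemma forms1_scale': "b \<in> Cinf 0 \<Longrightarrow> (\<lambda>v\<in>Sph. \<lambda>X. \<omega> v X) \<in> forms1 \<Longrightarrow> (\<lambda>v\<in>Sph. \<lambda>X. b v * \<omega> v X) \<in> forms1"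
  by (drule (1) forms1_scale) (simp cong: restrict_cong)

lemma forms1_const': "(\<lambda>v\<in>Sph. \<lambda>X. \<omega> v X) \<in> forms1 \<Longrightarrow> (\<lambda>v\<in>Sph. \<lambda>X. c * \<omega> v X) \<in> forms1"
  by (drule forms1_scale[OF Cinf_const[of c]]) (simp cong: restrict_cong)

lemma forms1_diff': "(\<lambda>v\<in>Sph. \<lambda>X. \<omega> v X) \<in> forms1 \<Longrightarrow> (\<lambda>v\<in>Sph. \<lambda>X. \<omega>' v X) \<in> forms1 \<Longrightarrow>
    (\<lambda>v\<in>Sph. \<lambda>X. \<omega> v X - \<omega>' v X) \<in> forms1"
  using forms1_add'[OF _ forms1_const'[of \<omega>' "-1"], of \<omega>] by simp

lemma forms1_sum': "finite I \<Longrightarrow> (\<And>i. i \<in> I \<Longrightarrow> (\<lambda>v\<in>Sph. \<lambda>X. \<omega> i v X) \<in> forms1) \<Longrightarrow>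
    (\<lambda>v\<in>Sph. \<lambda>X. \<Sum>i\<in>I. \<omega> i v X) \<in> forms1"
  using forms1_sum[of I "\<lambda>i. \<lambda>v\<in>Sph. \<lambda>X. \<omega> i v X"] by (simp cong: restrict_cong)

lemma Gamma_closed: "Gamma p q r s \<in> forms1"
proof -
  have "(\<lambda>v\<in>Sph. \<lambda>X. (if p = r then 1 else 0) * v_dvbar q s v X
     + Q q s v * (vbar_dv p r v X - v_dvbar r p v X)) \<in> forms1"
    by (intro forms1_add' forms1_const' forms1_scale' forms1_diff' forms1_restrict Cinf_Q vbar_dv_closed v_dvbar_forms1)
  moreover have "(\<lambda>v\<in>Sph. \<lambda>X. (if p = r then 1 else 0) * v_dvbar q s v X
     + Q q s v * (vbar_dv p r v X - v_dvbar r p v X)) = Gamma p q r s"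
    by (auto simp: fun_eq_iff Gamma_eq) (simp_all add: Gamma_def)
  ultimately show ?thesis by (simp only:)
qed

text \<open>
  On functions of weight \<open>-1\<close> the horizontal derivative \<open>f \<mapsto> \<Sum>\<^sub>j \<bar>v\<^sub>j \<d>(v\<^sub>j f)\<close> satisfies the
  Leibniz rule and sends \<open>\<bar>v\<^sub>j\<close> to the symbol \<open>\<d>\<bar>v\<^sub>j\<close>.  Multiplying by \<open>v\<^sub>q\<close> keeps everything in
  weight zero.
\<close>

definition Theta :: "'n \<Rightarrow> 'n \<Rightarrow> complex^'n \<Rightarrow> (complex^'n \<Rightarrow> complex) \<Rightarrow> 'n::finite form1" where
  "Theta p q h f = (\<lambda>v\<in>Sph. \<lambda>X. h $ p * (\<Sum>j\<in>UNIV. Q q j v * d0 (coord j f) v X)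
     + coord q f v * (\<Sum>i\<in>UNIV. h $ i * (vbar_dv p i v X - v_dvbar i p v X)))"

lemma Theta_closed: "f \<in> Cinf (-1) \<Longrightarrow> Theta p q h f \<in> forms1"
  unfolding Theta_def
  by (intro forms1_add' forms1_const' forms1_scale' forms1_sum' forms1_diff' forms1_restrict Cinf_Q vbar_dv_closed
      v_dvbar_forms1 d0_closed coord_closed finite)

lemma coord_add: "coord j (\<lambda>v\<in>Sph. f v + g v) = (\<lambda>v\<in>Sph. coord j f v + coord j g v)"
  by (auto simp: coord_def fun_eq_iff algebra_simps)

lemma coord_mult: "coord j (\<lambda>v\<in>Sph. f v * b v) = (\<lambda>v\<in>Sph. coord j f v * b v)"
  by (auto simp: coord_def fun_eq_iff algebra_simps)

lemma coord_scale: "coord j (\<lambda>v\<in>Sph. c * f v) = (\<lambda>v\<in>Sph. c * coord j f v)"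
  by (auto simp: coord_def fun_eq_iff algebra_simps)

lemma coord_vbar: "coord j (vbar k) = Q j k"
  by (auto simp: coord_def vbar_def Q_def fun_eq_iff)

lemma d0_scale: "f \<in> Cinf 0 \<Longrightarrow> v \<in> Sph \<Longrightarrow> d0 (\<lambda>v\<in>Sph. c * f v) v X = c * d0 f v X"
  using d0_mult[OF Cinf_const[of c], of f v X] d0_const[of v c X] by (simp cong: restrict_cong)

lemma Theta_additive: "additive_map (Cinf_module (-1)) Omega1 (Theta p q h)"
proof (rule additive_mapI)
  fix f g :: "complex^'a \<Rightarrow> complex" assume "f \<in> carrier (Cinf_module (- 1))" "g \<in> carrier (Cinf_module (- 1))"
  then show "Theta p q h (f \<oplus>\<^bsub>Cinf_module (- 1)\<^esub> g) = Theta p q h f \<oplus>\<^bsub>Omega1\<^esub> Theta p q h g"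
    by (auto simp: Theta_def fun_eq_iff coord_add d0_add coord_closed sum.distrib algebra_simps)
qed (simp add: Theta_closed)

lemma Theta_additive_left: "f \<in> Cinf (-1) \<Longrightarrow> additive_map Col Omega1 (\<lambda>h. Theta p q h f)"
  by (rule additive_mapI, simp add: Theta_closed)
     (auto simp: Theta_def fun_eq_iff sum.distrib sum_subtractf algebra_simps)

lemma Theta_balance: "f \<in> Cinf (-1) \<Longrightarrow> Theta p q (c *s h) f = Theta p q h (\<lambda>v\<in>Sph. c * f v)"
  by (auto simp: Theta_def fun_eq_iff coord_scale d0_scale coord_closed sum_distrib_left mult_ac)

lemma Q_coord_sum:
  assumes "v \<in> Sph"
  shows "(\<Sum>j\<in>UNIV. Q q j v * coord j f v) = coord q f v"
proof -
  have "(\<Sum>j\<in>UNIV. Q q j v * coord j f v) = (\<Sum>j\<in>UNIV. v $ j * cnj (v $ j)) * coord q f v"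
    using assms by (simp add: Q_def coord_def sum_distrib_left sum_distrib_right mult_ac)
  then show ?thesis by (simp add: sphere_sum[OF assms])
qed

text \<open>Differentiating (v_j f) b, the terms with db carry the sum over j of Q_qj v_j f, which
  collapses to v_q f. This is the coefficient of h \<otimes> f at the generator (p, q) in
  \<open>E_expansion\<close>, so the correction terms can be reassembled.\<close>

lemma Theta_Leibniz:
  assumes f: "f \<in> Cinf (-1)" and b: "b \<in> Cinf 0"
  shows "Theta p q h (\<lambda>v\<in>Sph. f v * b v) =
    ract Omega1 (Theta p q h f) b \<oplus>\<^bsub>Omega1\<^esub> lact Omega1 (\<lambda>v\<in>Sph. h $ p * coord q f v) (d0 b)"
proof -
  have eq: "(\<Sum>j\<in>UNIV. Q q j v * d0 (\<lambda>v\<in>Sph. coord j f v * b v) v X) =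
      (\<Sum>j\<in>UNIV. Q q j v * d0 (coord j f) v X) * b v + coord q f v * d0 b v X" if v: "v \<in> Sph" for v X
  proof -
    have "(\<Sum>j\<in>UNIV. Q q j v * d0 (\<lambda>v\<in>Sph. coord j f v * b v) v X) =
        (\<Sum>j\<in>UNIV. Q q j v * coord j f v) * d0 b v X + (\<Sum>j\<in>UNIV. Q q j v * d0 (coord j f) v X) * b v"
      by (simp add: d0_mult[OF coord_closed[OF f] b v] sum.distrib distrib_left sum_distrib_right mult.assoc)
    then show ?thesis by (simp add: Q_coord_sum[OF v])
  qed
  show ?thesis
    unfolding Theta_def coord_mult by (simp add: fun_eq_iff eq) (simp add: algebra_simps)
qed

text \<open>For f = vbar_k the functions v_j f are the Q_jk, and the sum of the Q_qj dQ_jk is v_q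
  times the symbol of vbar_k, by \<open>v_dvbar_Q\<close>.\<close>

lemma Theta_generator: "Theta p q (axis i 1) (vbar k) = Gamma p q i k"
proof -
  have "(\<Sum>j\<in>UNIV. axis i 1 $ j * F j) = F i" for F :: "'a \<Rightarrow> complex"
    by (simp add: axis_def if_distrib[of "\<lambda>x. x * _"] cong: if_cong)
  then show ?thesis
    by (auto simp: Theta_def fun_eq_iff coord_vbar Gamma_eq v_dvbar_Q[symmetric] axis_def) (auto simp: Gamma_def)
qed

abbreviation E_gen :: "'n \<Rightarrow> 'n \<Rightarrow> 'n::finite E_type" where
  "E_gen p q \<equiv> E_tensor (axis p 1) (vbar q)"

lemma E_gen_closed: "E_gen p q \<in> carrier EM.T"
  unfolding E_tensor_eq by (rule EM.pure_closed) (simp_all add: Cinf_vbar)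

text \<open>Combines the standard basis of columns with \<open>vbar_expansion\<close>. The
  coefficients are the ones produced by \<open>Theta_Leibniz\<close>; the expansion serves both the
  Leibniz rule and the uniqueness of the connection.\<close>

lemma E_expansion:
  fixes h :: "complex^'n::finite"
  assumes f: "f \<in> Cinf (-1)"
  shows "E_tensor h f = (\<Oplus>\<^bsub>EM.T\<^esub>p\<in>UNIV. \<Oplus>\<^bsub>EM.T\<^esub>q\<in>UNIV. EM.act (E_gen p q) (\<lambda>v\<in>Sph. h $ p * coord q f v))"
proof -
  have fin: "finsum Col g I = sum g I" if "finite I" for g :: "'n \<Rightarrow> complex^'n" and I
    using that by (induction I) (auto simp: abelian_monoid.finsum_insert[OF abelian_group.axioms(1)[OF EM.M.abelian_group_axioms]]
        abelian_monoid.finsum_empty[OF abelian_group.axioms(1)[OF EM.M.abelian_group_axioms]])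
  have "h = (\<Sum>p\<in>UNIV. h $ p *s axis p 1)"
    by (simp add: vec_eq_iff axis_def if_distrib[of "\<lambda>x. _ * x"] cong: if_cong)
  then have "E_tensor h f = EM.pt (finsum Col (\<lambda>p. h $ p *s axis p 1) UNIV) f"
    by (simp add: E_tensor_eq fin)
  also have "\<dots> = (\<Oplus>\<^bsub>EM.T\<^esub>p\<in>UNIV. EM.pt (h $ p *s axis p 1) f)"
    by (rule EM.pure_finsum_left) (simp_all add: f)
  also have "\<dots> = (\<Oplus>\<^bsub>EM.T\<^esub>p\<in>UNIV. \<Oplus>\<^bsub>EM.T\<^esub>q\<in>UNIV. EM.act (E_gen p q) (\<lambda>v\<in>Sph. h $ p * coord q f v))"
  proof (rule EM.T.finsum_cong')
    fix p :: 'n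
    let ?f = "\<lambda>v\<in>Sph. h $ p * f v"
    have g: "?f \<in> Cinf (-1)" by (rule Cinf_scale[OF f])
    have c: "ract (Cinf_module (-1)) (vbar q) (coord q ?f) \<in> Cinf (-1)" for q
      using Cinf_mult[OF Cinf_vbar coord_closed[OF g], of "-1" q q] by simp
    have "EM.pt (h $ p *s axis p 1) f = EM.pt (axis p 1) ?f"
      using EM.pure_balance[of "axis p 1" "h $ p" f] f by simp
    also have "\<dots> = EM.pt (axis p 1) (finsum (Cinf_module (-1)) (\<lambda>q. ract (Cinf_module (-1)) (vbar q) (coord q ?f)) UNIV)"
      by (rule arg_cong[OF vbar_expansion[OF g]])
    also have "\<dots> = (\<Oplus>\<^bsub>EM.T\<^esub>q\<in>UNIV. EM.pt (axis p 1) (ract (Cinf_module (-1)) (vbar q) (coord q ?f)))"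
      by (rule EM.pure_finsum_right) (use c in auto)
    also have "\<dots> = (\<Oplus>\<^bsub>EM.T\<^esub>q\<in>UNIV. EM.act (E_gen p q) (\<lambda>v\<in>Sph. h $ p * coord q f v))"
    proof (rule EM.T.finsum_cong')
      show "EM.pt (axis p 1) (ract (Cinf_module (-1)) (vbar q) (coord q ?f)) =
          EM.act (E_gen p q) (\<lambda>v\<in>Sph. h $ p * coord q f v)" for q
        using EM.act_pure[of "axis p 1" "vbar q" "coord q ?f"] coord_closed[OF g, of q]
        by (simp add: E_tensor_eq Cinf_vbar coord_scale)
      show "(\<lambda>q. EM.act (E_gen p q) (\<lambda>v\<in>Sph. h $ p * coord q f v)) \<in> UNIV \<rightarrow> carrier EM.T"
        using coord_closed[OF g] by (auto intro!: EM.act_T_closed E_gen_closed simp: coord_scale simp flip: coord_scale)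
    qed simp
    finally show "EM.pt (h $ p *s axis p 1) f = (\<Oplus>\<^bsub>EM.T\<^esub>q\<in>UNIV. EM.act (E_gen p q) (\<lambda>v\<in>Sph. h $ p * coord q f v))" .
  next
    show "(\<lambda>p. \<Oplus>\<^bsub>EM.T\<^esub>q\<in>UNIV. EM.act (E_gen p q) (\<lambda>v\<in>Sph. h $ p * coord q f v)) \<in> UNIV \<rightarrow> carrier EM.T"
      using Cinf_scale[OF coord_closed[OF f]]
      by (auto intro!: EM.T.finsum_closed EM.act_T_closed E_gen_closed)
  qed simp
  finally show ?thesis .
qed

section \<open>Existence and uniqueness of the connection on E\<close>

definition nabE_pure :: "complex^'n \<Rightarrow> (complex^'n \<Rightarrow> complex) \<Rightarrow> ('n::finite E_type, 'n form1) tens" where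
  "nabE_pure h f = (\<Oplus>\<^bsub>EO.T\<^esub>p\<in>UNIV. \<Oplus>\<^bsub>EO.T\<^esub>q\<in>UNIV. EO.pt (E_gen p q) (Theta p q h f))"

lemma E_gen_carrier: "E_gen p q \<in> carrier E_mod"
  using E_gen_closed by simp

lemma balanced_nabE_pure:
  "balanced complex_ring Col (Cinf_module (-1)) EO.T (nabE_pure :: complex^'n::finite \<Rightarrow> _)"
proof (rule balancedI)
  show "additive_map (Cinf_module (-1)) EO.T (nabE_pure h)" for h :: "complex^'n"
    unfolding nabE_pure_def[abs_def]
    by (rule additive_map_sum[OF EO.abelian_group_T additive_map_sum[OF EO.abelian_group_T
          additive_map_comp[OF Theta_additive EO.pure_additive(1)[OF E_gen_carrier]]]])
  show "additive_map Col EO.T (\<lambda>h :: complex^'n. nabE_pure h f)" if "f \<in> carrier (Cinf_module (- 1))" for f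
    unfolding nabE_pure_def[abs_def]
    by (rule additive_map_sum[OF EO.abelian_group_T additive_map_sum[OF EO.abelian_group_T
          additive_map_comp[OF Theta_additive_left EO.pure_additive(1)[OF E_gen_carrier]]]]) (use that in simp)
qed (simp add: nabE_pure_def Theta_balance)

definition nabE :: "'n::finite E_type \<Rightarrow> ('n E_type, 'n form1) tens" where
  "nabE = restrict (tensor_lift EO.T nabE_pure) (carrier EM.T)"

lemma nabE_additive: "additive_map EM.T EO.T nabE"
  by (rule additive_map_cong[OF EM.abelian_group_T EM.lift_additive[OF EO.abelian_group_T balanced_nabE_pure]])
     (simp add: nabE_def)

lemma nabE_tensor: "f \<in> Cinf (-1) \<Longrightarrow> nabE (E_tensor h f) = nabE_pure h f"
  using EM.lift_pure[OF EO.abelian_group_T balanced_nabE_pure, of h f]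
  by (simp add: nabE_def E_tensor_eq)

text \<open>Each generator contributes a term in db whose function coefficient is moved across the
  tensor product onto the generator; \<open>E_expansion\<close> then sums these to (h \<otimes> f)
  \<otimes> db.\<close>

lemma nabE_pure_mult:
  fixes h :: "complex^'n::finite"
  assumes f: "f \<in> Cinf (-1)" and b: "b \<in> Cinf 0"
  shows "nabE_pure h (\<lambda>v\<in>Sph. f v * b v) = EO.pt (E_tensor h f) (d0 b) \<oplus>\<^bsub>EO.T\<^esub> EO.act (nabE_pure h f) b"
proof -
  have b': "b \<in> carrier CP" using b by simp
  have db: "d0 b \<in> carrier Omega1" using d0_closed[OF b] by simp
  let ?c = "\<lambda>p q. \<lambda>v\<in>Sph. h $ p * coord q f v"
  have c: "?c p q \<in> carrier CP" for p q using Cinf_scale[OF coord_closed[OF f]] by simp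
  have Th: "Theta p q h f \<in> carrier Omega1" for p q using Theta_closed[OF f] by simp
  have R: "ract Omega1 (Theta p q h f) b \<in> carrier Omega1" for p q
    by (rule right_moduleD(3)[OF EO.right_N Th b'])
  have L: "lact Omega1 (?c p q) (d0 b) \<in> carrier Omega1" for p q
    by (rule left_modD(3)[OF EO.left_N c db])
  have ac: "EM.act (E_gen p q) (?c p q) \<in> carrier EM.T" for p q
    by (rule EM.act_T_closed[OF E_gen_closed c])
  have closed1: "EO.act (EO.pt (E_gen p q) (Theta p q h f)) b \<in> carrier EO.T" for p q
    by (rule EO.act_T_closed[OF EO.pure_closed[OF E_gen_carrier Th] b'])
  have closed2: "EO.pt (EM.act (E_gen p q) (?c p q)) (d0 b) \<in> carrier EO.T" for p q
    by (rule EO.pure_closed[OF _ db]) (simp add: ac)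
  have "EO.pt (E_gen p q) (Theta p q h (\<lambda>v\<in>Sph. f v * b v)) =
      EO.pt (EM.act (E_gen p q) (?c p q)) (d0 b) \<oplus>\<^bsub>EO.T\<^esub> EO.act (EO.pt (E_gen p q) (Theta p q h f)) b" for p q
  proof -
    have "EO.pt (E_gen p q) (Theta p q h (\<lambda>v\<in>Sph. f v * b v)) =
        EO.pt (E_gen p q) (ract Omega1 (Theta p q h f) b) \<oplus>\<^bsub>EO.T\<^esub> EO.pt (E_gen p q) (lact Omega1 (?c p q) (d0 b))"
      by (simp only: Theta_Leibniz[OF f b] EO.pure_add_right[OF E_gen_carrier R L])
    also have "EO.pt (E_gen p q) (ract Omega1 (Theta p q h f) b) = EO.act (EO.pt (E_gen p q) (Theta p q h f)) b"
      by (rule EO.act_pure[OF E_gen_carrier Th b', symmetric])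
    also have "EO.pt (E_gen p q) (lact Omega1 (?c p q) (d0 b)) = EO.pt (EM.act (E_gen p q) (?c p q)) (d0 b)"
      using EO.pure_balance[OF E_gen_carrier c db] by simp
    finally show ?thesis
      using EO.T.a_comm[OF closed1 closed2] by (simp only:)
  qed
  then have "nabE_pure h (\<lambda>v\<in>Sph. f v * b v) =
      (\<Oplus>\<^bsub>EO.T\<^esub>p\<in>UNIV. \<Oplus>\<^bsub>EO.T\<^esub>q\<in>UNIV. EO.pt (EM.act (E_gen p q) (?c p q)) (d0 b)
         \<oplus>\<^bsub>EO.T\<^esub> EO.act (EO.pt (E_gen p q) (Theta p q h f)) b)"
    by (simp only: nabE_pure_def)
  also have "\<dots> = (\<Oplus>\<^bsub>EO.T\<^esub>p\<in>UNIV. \<Oplus>\<^bsub>EO.T\<^esub>q\<in>UNIV. EO.pt (EM.act (E_gen p q) (?c p q)) (d0 b))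
      \<oplus>\<^bsub>EO.T\<^esub> (\<Oplus>\<^bsub>EO.T\<^esub>p\<in>UNIV. \<Oplus>\<^bsub>EO.T\<^esub>q\<in>UNIV. EO.act (EO.pt (E_gen p q) (Theta p q h f)) b)"
  proof -
    have "(\<Oplus>\<^bsub>EO.T\<^esub>q\<in>UNIV. EO.pt (EM.act (E_gen p q) (?c p q)) (d0 b)
         \<oplus>\<^bsub>EO.T\<^esub> EO.act (EO.pt (E_gen p q) (Theta p q h f)) b) =
      (\<Oplus>\<^bsub>EO.T\<^esub>q\<in>UNIV. EO.pt (EM.act (E_gen p q) (?c p q)) (d0 b))
      \<oplus>\<^bsub>EO.T\<^esub> (\<Oplus>\<^bsub>EO.T\<^esub>q\<in>UNIV. EO.act (EO.pt (E_gen p q) (Theta p q h f)) b)" for p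
      by (rule EO.T.finsum_addf) (use closed1 closed2 in blast)+
    then show ?thesis
      by (simp only:) (rule EO.T.finsum_addf, (use closed1 closed2 in \<open>blast intro: EO.T.finsum_closed\<close>)+)
  qed
  also have "(\<Oplus>\<^bsub>EO.T\<^esub>p\<in>UNIV. \<Oplus>\<^bsub>EO.T\<^esub>q\<in>UNIV. EO.pt (EM.act (E_gen p q) (?c p q)) (d0 b)) = EO.pt (E_tensor h f) (d0 b)"
  proof -
    have add: "additive_map EM.T EO.T (\<lambda>e. EO.pt e (d0 b))"
      using EO.pure_additive(2)[OF db] by simp
    show ?thesis
      unfolding E_expansion[OF f, of h]
      using ac by (simp add: additive_map_finsum[OF EM.abelian_group_T EO.abelian_group_T add] Pi_iff EM.T.finsum_closed)
  qed
  also have "(\<Oplus>\<^bsub>EO.T\<^esub>p\<in>UNIV. \<Oplus>\<^bsub>EO.T\<^esub>q\<in>UNIV. EO.act (EO.pt (E_gen p q) (Theta p q h f)) b) = EO.act (nabE_pure h f) b"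
    unfolding nabE_pure_def
    using EO.pure_closed[OF E_gen_carrier Th]
    by (simp add: additive_map_finsum[OF EO.abelian_group_T EO.abelian_group_T EO.act_additive[OF b']] Pi_iff EO.T.finsum_closed)
  finally show ?thesis .
qed

lemma right_connection_nabE: "right_connection CP Omega1 d0 E_mod (nabE :: 'n::finite E_type \<Rightarrow> _)"
proof (rule right_connectionI)
  fix t :: "'n E_type" and b :: "complex^'n \<Rightarrow> complex" assume "t \<in> carrier E_mod" and b: "b \<in> carrier CP"
  then have t: "t \<in> carrier EM.T" by simp
  have db: "d0 b \<in> carrier Omega1" using d0_closed b by simp
  have add: "additive_map EM.T EO.T (\<lambda>e. EO.pt e (d0 b))"
    using EO.pure_additive(2)[OF db] by simp
  show "nabE (ract E_mod t b) = EO.pt t (d0 b) \<oplus>\<^bsub>EO.T\<^esub> EO.act (nabE t) b"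
    unfolding E_mod_simps
  proof (rule EM.tensor_ext[OF t additive_map_comp[OF EM.act_additive[OF b] nabE_additive]
      additive_map_plus[OF EO.abelian_group_T add additive_map_comp[OF nabE_additive EO.act_additive[OF b]]]])
    fix h :: "complex^'n" and f :: "complex^'n \<Rightarrow> complex" assume "f \<in> carrier (Cinf_module (- 1))"
    then have f: "f \<in> Cinf (-1)" by simp
    have fb: "(\<lambda>v\<in>Sph. f v * b v) \<in> Cinf (-1)" by (rule Cinf_mult[OF f, of b 0]) (use b in simp_all)
    have "nabE (EM.act (EM.pt h f) b) = nabE_pure h (\<lambda>v\<in>Sph. f v * b v)"
      using EM.act_pure[of h f b] f b nabE_tensor[OF fb, of h] by (simp add: E_tensor_eq)
    then show "nabE (EM.act (EM.pt h f) b) = EO.pt (EM.pt h f) (d0 b) \<oplus>\<^bsub>EO.T\<^esub> EO.act (nabE (EM.pt h f)) b"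
      using nabE_pure_mult[OF f, of b h] nabE_tensor[OF f, of h] b by (simp add: E_tensor_eq)
  qed
qed (simp_all add: bimoduleD(1)[OF bimodule_E_mod] bimodule_Omega1 nabE_additive, simp add: nabE_def)

lemma right_connection_eq:
  assumes 1: "right_connection B \<Omega> d G nab" and 2: "right_connection B \<Omega> d G nab'"
    and "g \<in> carrier G" "b \<in> carrier B" "nab g = nab' g"
  shows "nab (ract G g b) = nab' (ract G g b)"
  using right_connectionD(6)[OF 1 assms(3,4)] right_connectionD(6)[OF 2 assms(3,4)] assms(5) by simp

lemma is_nabla_E_nabE: "is_nabla_E (nabE :: 'n::finite E_type \<Rightarrow> _)"
  unfolding is_nabla_E_def
  by (simp add: right_connection_nabE nabE_tensor Cinf_vbar nabE_pure_def Theta_generator)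

text \<open>The elements h_p \<otimes> vbar_q generate E as a right module, and the Leibniz rule
  propagates agreement from g to g b.\<close>

lemma is_nabla_E_unique:
  fixes nab :: "'n::finite E_type \<Rightarrow> _"
  assumes "is_nabla_E nab"
  shows "nab = nabE"
proof -
  note C = assms[unfolded is_nabla_E_def, THEN conjunct1]
  note C' = right_connection_nabE[where 'n = 'n]
  have gen: "nab (E_gen i j) = nabE (E_gen i j)" for i j
    using assms is_nabla_E_nabE[where 'n = 'n] by (simp add: is_nabla_E_def)
  have add: "additive_map EM.T EO.T nab"
    using right_connectionD(3)[OF C] by simp
  show ?thesis
  proof (rule extensionalityI[of _ "carrier EM.T"])
    show "nab \<in> extensional (carrier EM.T)" using right_connectionD(4)[OF C] by simp
    show "nabE \<in> extensional (carrier EM.T)" by (simp add: nabE_def)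
    fix x :: "'n E_type" assume x: "x \<in> carrier EM.T"
    show "nab x = nabE x"
    proof (rule EM.tensor_ext[OF x add nabE_additive])
      fix h :: "complex^'n" and f :: "complex^'n \<Rightarrow> complex" assume "f \<in> carrier (Cinf_module (- 1))"
      then have f: "f \<in> Cinf (-1)" by simp
      let ?c = "\<lambda>p q. \<lambda>v\<in>Sph. h $ p * coord q f v"
      have c: "?c p q \<in> carrier CP" for p q using Cinf_scale[OF coord_closed[OF f]] by simp
      have ac: "EM.act (E_gen p q) (?c p q) \<in> carrier EM.T" for p q
        by (rule EM.act_T_closed[OF E_gen_closed c])
      have eq: "nab (EM.act (E_gen p q) (?c p q)) = nabE (EM.act (E_gen p q) (?c p q))" for p q
        using right_connection_eq[OF C C' E_gen_carrier c gen] by simp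
      have exp: "g (EM.pt h f) = (\<Oplus>\<^bsub>EO.T\<^esub>p\<in>UNIV. \<Oplus>\<^bsub>EO.T\<^esub>q\<in>UNIV. g (EM.act (E_gen p q) (?c p q)))"
        if "additive_map EM.T EO.T g" for g
        unfolding E_tensor_eq[symmetric] E_expansion[OF f, of h]
        using ac by (simp add: additive_map_finsum[OF EM.abelian_group_T EO.abelian_group_T that] Pi_iff EM.T.finsum_closed)
      show "nab (EM.pt h f) = nabE (EM.pt h f)"
        unfolding exp[OF add] exp[OF nabE_additive] eq ..
    qed
  qed
qed

lemma nabla_E_eq: "nabla_E = nabE"
  unfolding nabla_E_def using is_nabla_E_nabE is_nabla_E_unique by (rule the_equality)

lemma is_nabla_E_nabla_E: "is_nabla_E nabla_E"
  unfolding nabla_E_eq by (rule is_nabla_E_nabE)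

text \<open>A scalar matrix acts on the left like a constant function on the right. With
  \<open>EO_scalar\<close> and the vanishing differential of constants, this turns the Leibniz rule
  into the scalar compatibility required by \<open>universal_bimodule\<close>.\<close>

lemma E_scalar:
  fixes e :: "'n::finite E_type"
  assumes e: "e \<in> carrier EM.T"
  shows "EM.lac (mat c) e = EM.act e (\<lambda>v\<in>Sph. c)"
proof (rule EM.tensor_ext[OF e])
  have c: "(\<lambda>v\<in>Sph. c) \<in> carrier CP" by (simp add: Cinf_const)
  show "additive_map EM.T EM.T (EM.lac (mat c :: complex^'n^'n))" by (rule EM.lac_additive) simp
  show "additive_map EM.T EM.T (\<lambda>e. EM.act e (\<lambda>v\<in>Sph. c))" by (rule EM.act_additive[OF c])
  fix h :: "complex^'n" and f :: "complex^'n \<Rightarrow> complex" assume f: "f \<in> carrier (Cinf_module (- 1))"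
  have "mat c *v h = c *s h"
    by (simp add: vec_eq_iff matrix_vector_mult_def mat_def if_distrib[of "\<lambda>x. x * _"] cong: if_cong)
  moreover have "(\<lambda>v\<in>Sph. c * f v) = (\<lambda>v\<in>Sph. f v * (\<lambda>v\<in>Sph. c) v)"
    by (auto simp: fun_eq_iff)
  ultimately show "EM.lac (mat c) (EM.pt h f) = EM.act (EM.pt h f) (\<lambda>v\<in>Sph. c)"
    using EM.lac_pure[of h f "mat c"] EM.act_pure[OF _ f c, of h] EM.pure_balance[of h c f] f by simp
qed

lemma EO_scalar:
  fixes t :: "('n::finite E_type, 'n form1) tens"
  assumes t: "t \<in> carrier EO.T"
  shows "EO.lac (mat c) t = EO.act t (\<lambda>v\<in>Sph. c)"
proof (rule EO.tensor_ext[OF t])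
  have c: "(\<lambda>v\<in>Sph. c) \<in> carrier CP" by (simp add: Cinf_const)
  show "additive_map EO.T EO.T (EO.lac (mat c :: complex^'n^'n))" by (rule EO.lac_additive) simp
  show "additive_map EO.T EO.T (\<lambda>e. EO.act e (\<lambda>v\<in>Sph. c))" by (rule EO.act_additive[OF c])
  fix e :: "'n E_type" and \<omega> :: "'n form1" assume e: "e \<in> carrier E_mod" and \<omega>: "\<omega> \<in> carrier Omega1"
  have "ract Omega1 \<omega> (\<lambda>v\<in>Sph. c) = lact Omega1 (\<lambda>v\<in>Sph. c) \<omega>"
    by (auto simp: fun_eq_iff)
  then show "EO.lac (mat c) (EO.pt e \<omega>) = EO.act (EO.pt e \<omega>) (\<lambda>v\<in>Sph. c)"
    using EO.lac_pure[OF e \<omega>, of "mat c"] EO.act_pure[OF e \<omega> c] EO.pure_balance[OF e c \<omega>] E_scalar[of e c] e by simp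
qed

interpretation UE: universal_bimodule CP Omega1 d0
  "E_mod :: (complex^'n::finite^'n, complex^'n \<Rightarrow> complex, 'n E_type) bimod" nabla_E
proof
  show conn: "right_connection CP Omega1 d0 E_mod (nabla_E :: 'n E_type \<Rightarrow> _)"
    unfolding nabla_E_eq by (rule right_connection_nabE)
  show "bimodule Mat CP (E_mod :: (complex^'n^'n, complex^'n \<Rightarrow> complex, 'n E_type) bimod)"
    by (rule bimodule_E_mod)
  show "d0 b \<in> carrier (Omega1 :: (complex^'n \<Rightarrow> complex, complex^'n \<Rightarrow> complex, 'n form1) bimod)" if "b \<in> carrier CP" for b :: "complex^'n \<Rightarrow> complex"
    using that d0_closed by simp
  fix e :: "'n E_type" and c assume e: "e \<in> carrier E_mod"
  have c: "(\<lambda>v\<in>Sph. c) \<in> carrier CP" by (simp add: Cinf_const)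
  have d: "d0 (\<lambda>v::complex^'n\<in>Sph. c) = \<zero>\<^bsub>Omega1\<^esub>"
    by (auto simp: fun_eq_iff d0_const) (simp add: d0_def)
  have "nabla_E (lact E_mod (mat c) e) = nabla_E (ract E_mod e (\<lambda>v\<in>Sph. c))"
    using E_scalar[of e c] e by simp
  also have "\<dots> = EO.act (nabla_E e) (\<lambda>v\<in>Sph. c)"
    unfolding right_connectionD(6)[OF conn e c] d EO.pure_zero(1)[OF e]
    by (rule EO.T.l_zero) (rule EO.act_T_closed[OF right_connectionD(5)[OF conn e] c])
  also have "\<dots> = lact (btensor CP E_mod Omega1) (mat c) (nabla_E e)"
    by (rule EO_scalar[OF right_connectionD(5)[OF conn e], symmetric])
  finally show "nabla_E (lact E_mod (mat c) e) = lact (btensor CP E_mod Omega1) (mat c) (nabla_E e)" .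
qed

lemma is_sigma_E_sigma_E: "is_sigma_E sigma_E"
  unfolding sigma_E_def is_sigma_E_def
  using UE.sig_connection UE.sig_unique by (rule theI)

section \<open>The functor from matrix modules to modules with connection\<close>

lemma left_moduleD:
  assumes "left_module A V"
  shows "ring A" "abelian_group V"
    "\<And>a v. a \<in> carrier A \<Longrightarrow> v \<in> carrier V \<Longrightarrow> a \<odot>\<^bsub>V\<^esub> v \<in> carrier V"
    "\<And>a. a \<in> carrier A \<Longrightarrow> additive_map V V (\<lambda>v. a \<odot>\<^bsub>V\<^esub> v)"
    "\<And>v. v \<in> carrier V \<Longrightarrow> additive_map A V (\<lambda>a. a \<odot>\<^bsub>V\<^esub> v)"
    "\<And>a b v. a \<in> carrier A \<Longrightarrow> b \<in> carrier A \<Longrightarrow> v \<in> carrier V \<Longrightarrow>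
       (a \<otimes>\<^bsub>A\<^esub> b) \<odot>\<^bsub>V\<^esub> v = a \<odot>\<^bsub>V\<^esub> (b \<odot>\<^bsub>V\<^esub> v)"
    "\<And>v. v \<in> carrier V \<Longrightarrow> \<one>\<^bsub>A\<^esub> \<odot>\<^bsub>V\<^esub> v = v"
  using assms by (auto simp: left_module_def additive_map_def)

lemma underlying_space_simps [simp]:
  "carrier (underlying_space V) = carrier V" "zero (underlying_space V) = zero V"
  "add (underlying_space V) = add V" "ract (underlying_space V) = (\<lambda>w c. mat c \<odot>\<^bsub>V\<^esub> w)"
  by (simp_all add: underlying_space_def)

lemma finsum_Row_Col:
  assumes "abelian_group G" "carrier G = (UNIV :: 'a::ab_group_add set)" "zero G = 0" "add G = (+)" "finite I"
  shows "finsum G g I = sum g I"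
proof -
  interpret abelian_group G by fact
  show ?thesis
    using assms(5) by (induction I) (simp_all add: finsum_insert assms)
qed

lemma matrix_unit_mult:
  "matrix_unit i j ** matrix_unit k l = (if j = k then matrix_unit i l else (0 :: complex^'n::finite^'n))"
  by (auto simp: vec_eq_iff matrix_unit_def matrix_matrix_mult_def if_distrib[of "\<lambda>x. x * _"] if_distrib[of "\<lambda>x. _ * x"]
      cong: if_cong)

lemma sum_matrix_unit: "(\<Sum>p\<in>UNIV. matrix_unit p p) = (mat 1 :: complex^'n::finite^'n)"
  by (auto simp: vec_eq_iff matrix_unit_def mat_def intro!: sum.neutral)

text \<open>The product h_p r, that is, the linear combination of the E_pi with coefficients r_i. It
  extends the formula with dE_pi from the basis rows r_i to all rows.\<close>

definition row_matrix :: "'n \<Rightarrow> complex^'n \<Rightarrow> complex^'n::finite^'n" where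
  "row_matrix p r = (\<chi> i j. if i = p then r $ j else 0)"

lemma row_matrix_add: "row_matrix p (r + r') = row_matrix p r + row_matrix p r'"
  by (simp add: row_matrix_def vec_eq_iff)

lemma row_matrix_scale: "row_matrix p (c *s r) = mat c ** row_matrix p r"
  by (simp add: row_matrix_def vec_eq_iff mat_mult_left)

lemma row_matrix_mult: "row_matrix p (r v* b) = row_matrix p r ** b"
  by (simp add: row_matrix_def vec_eq_iff vector_matrix_mult_def matrix_matrix_mult_def mult.commute)

lemma row_matrix_axis: "row_matrix p (axis i 1) = matrix_unit p i"
  by (auto simp: row_matrix_def vec_eq_iff matrix_unit_def axis_def)

lemma axis_row_matrix: "axis j 1 v* row_matrix p r = (if p = j then r else 0)"
  by (auto simp: row_matrix_def vec_eq_iff vector_matrix_mult_def axis_def if_distrib[of "\<lambda>x. x * _"] cong: if_cong)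

lemma axis_mat: "axis j 1 v* mat c = c *s axis j 1" for c :: complex
  by (auto simp: vec_eq_iff vector_matrix_mult_def axis_def mat_def if_distrib[of "\<lambda>x. x * _"] cong: if_cong)

section \<open>The connection on V \<otimes> Row\<close>

locale matrix_module =
  fixes V :: "(complex^'n::finite^'n, 'v) module"
  assumes V: "left_module Mat V"
begin

sublocale V: abelian_group V by (rule left_moduleD(2)[OF V])

lemma act_V: "w \<in> carrier V \<Longrightarrow> a \<odot>\<^bsub>V\<^esub> w \<in> carrier V"
  using left_moduleD(3)[OF V] by simp

lemma act_V_mult: "w \<in> carrier V \<Longrightarrow> a \<odot>\<^bsub>V\<^esub> (b \<odot>\<^bsub>V\<^esub> w) = (a ** b) \<odot>\<^bsub>V\<^esub> w"
  using left_moduleD(6)[OF V] by simp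

lemma act_V_additive: "additive_map V V (\<lambda>w. a \<odot>\<^bsub>V\<^esub> w)"
  using left_moduleD(4)[OF V] by simp

lemma act_V_additive_left: "w \<in> carrier V \<Longrightarrow> additive_map Mat V (\<lambda>a. a \<odot>\<^bsub>V\<^esub> w)"
  using left_moduleD(5)[OF V] by simp

lemma act_V_zero: "w \<in> carrier V \<Longrightarrow> 0 \<odot>\<^bsub>V\<^esub> w = \<zero>\<^bsub>V\<^esub>"
  using additive_map_zero[OF abelian_Mat V.abelian_group_axioms act_V_additive_left] by simp

lemma act_V_one: "w \<in> carrier V \<Longrightarrow> mat 1 \<odot>\<^bsub>V\<^esub> w = w"
  using left_moduleD(7)[OF V] by simp

lemma additive_map_us [simp]:
  "additive_map (underlying_space V) = (additive_map V :: ('c, 'w) ring_scheme \<Rightarrow> _)"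
  "additive_map G (underlying_space V) = additive_map G V"
  by (simp_all add: additive_map_def fun_eq_iff)

lemma right_us: "right_module complex_ring (underlying_space V)"
proof (rule right_moduleI)
  show "abelian_group (underlying_space V)"
    by (rule abelian_group_record_cong[OF V.abelian_group_axioms]) simp_all
  fix g assume "g \<in> carrier (underlying_space V)"
  then have g: "g \<in> carrier V" by simp
  show "additive_map complex_ring (underlying_space V) (ract (underlying_space V) g)"
    using act_V_additive_left[OF g] by (simp add: additive_map_def Pi_iff mat_mat)
  show "ract (underlying_space V) g (b \<otimes>\<^bsub>complex_ring\<^esub> c) = ract (underlying_space V) (ract (underlying_space V) g b) c" for b c
    using g by (simp add: act_V_mult mult.commute[of b c] mat_mat)
qed (simp_all add: ring_complex_ring act_V_additive act_V_one)

sublocale VR: tensor_right complex_ring "underlying_space V" "Row :: (complex, complex^'n^'n, complex^'n) bimod" Mat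
  by (rule tensor_rightI[OF right_us bimodule_Row])

lemma F_mod_simps [simp]:
  "carrier (F_mod V) = carrier VR.T" "zero (F_mod V) = \<zero>\<^bsub>VR.T\<^esub>" "add (F_mod V) = add VR.T"
  "ract (F_mod V) = VR.act"
  by (simp_all add: F_mod_def)

lemma additive_map_F_mod [simp]:
  "additive_map (F_mod V) = (additive_map VR.T :: ('c, 'w) ring_scheme \<Rightarrow> _)"
  "additive_map G (F_mod V) = additive_map G VR.T"
  by (simp_all add: additive_map_def fun_eq_iff)

lemma F_tensor_eq: "F_tensor V = VR.pt"
  by (simp add: F_tensor_def)

lemma right_F: "right_module Mat (F_mod V)"
  unfolding F_mod_def by (rule VR.right_module_T)

sublocale FO: tensor_right Mat "F_mod V" "Omega_uni :: (complex^'n^'n, complex^'n^'n, 'n uniform) bimod" Mat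
  by (rule tensor_rightI[OF right_F bimodule_Omega_uni])

abbreviation "fj w j p \<equiv> VR.pt (matrix_unit j p \<odot>\<^bsub>V\<^esub> w) (axis j 1)"

lemma fj_closed: "w \<in> carrier V \<Longrightarrow> fj w j p \<in> carrier (F_mod V)"
  by (simp add: VR.pure_closed act_V)

text \<open>The prescribed formula, made linear in the row through \<open>row_matrix\<close>; for r
  = r_i it returns dE_pi by \<open>row_matrix_axis\<close>.\<close>

definition "nabF_pure w r = (\<Oplus>\<^bsub>FO.T\<^esub>p\<in>UNIV. \<Oplus>\<^bsub>FO.T\<^esub>j\<in>UNIV. FO.pt (fj w j p) (d_uni (row_matrix p r)))"

lemma balanced_nabF_pure: "balanced complex_ring (underlying_space V) Row FO.T nabF_pure"
proof (rule balancedI)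
  fix w assume "w \<in> carrier (underlying_space V)"
  then have w: "w \<in> carrier V" by simp
  have "additive_map Row Omega_uni (\<lambda>r. d_uni (row_matrix p r))" for p :: 'n
    using additive_map_comp[OF _ d_uni_additive, of Row "row_matrix p"] by (simp add: additive_map_def row_matrix_add del: Omega_uni_simps)
  from additive_map_sum[OF FO.abelian_group_T additive_map_sum[OF FO.abelian_group_T
        additive_map_comp[OF this FO.pure_additive(1)[OF fj_closed[OF w]]]]]
  show "additive_map Row FO.T (nabF_pure w)"
    by (simp add: nabF_pure_def[abs_def])
next
  fix r :: "complex^'n"
  have "additive_map V (F_mod V) (\<lambda>w. fj w j p)" for j p
    using additive_map_comp[OF act_V_additive VR.pure_additive(2)[of "axis j 1", simplified]] by simp
  from additive_map_sum[OF FO.abelian_group_T additive_map_sum[OF FO.abelian_group_T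
        additive_map_comp[OF this FO.pure_additive(2)[OF d_uni_closed]]]]
  show "additive_map (underlying_space V) FO.T (\<lambda>w. nabF_pure w r)"
    by (simp add: nabF_pure_def[abs_def])
next
  fix w c and r :: "complex^'n" assume "w \<in> carrier (underlying_space V)"
  then have w: "w \<in> carrier V" by simp
  have "FO.pt (fj (mat c \<odot>\<^bsub>V\<^esub> w) j p) (d_uni (row_matrix p r)) = FO.pt (fj w j p) (d_uni (row_matrix p (c *s r)))" for j p
  proof -
    have "fj (mat c \<odot>\<^bsub>V\<^esub> w) j p = VR.pt (mat c \<odot>\<^bsub>V\<^esub> (matrix_unit j p \<odot>\<^bsub>V\<^esub> w)) (axis j 1)"
      by (simp add: act_V_mult w mat_commute)
    also have "\<dots> = VR.act (fj w j p) (mat c)"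
      using VR.pure_balance[of "matrix_unit j p \<odot>\<^bsub>V\<^esub> w" c "axis j 1"] VR.act_pure[of "matrix_unit j p \<odot>\<^bsub>V\<^esub> w" "axis j 1" "mat c"]
      by (simp add: act_V w axis_mat)
    finally show ?thesis
      using FO.pure_balance[OF fj_closed[OF w] _ d_uni_closed, of "mat c" j p "row_matrix p r"]
      by (simp add: row_matrix_scale d_uni_scale)
  qed
  then show "nabF_pure (ract (underlying_space V) w c) r = nabF_pure w (lact Row c r)"
    by (simp add: nabF_pure_def)
qed

definition "nabF = restrict (tensor_lift FO.T nabF_pure) (carrier VR.T)"

lemma nabF_additive: "additive_map VR.T FO.T nabF"
  by (rule additive_map_cong[OF VR.abelian_group_T VR.lift_additive[OF FO.abelian_group_T balanced_nabF_pure]])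
     (simp add: nabF_def)

lemma nabF_tensor: "w \<in> carrier V \<Longrightarrow> nabF (VR.pt w r) = nabF_pure w r"
  using VR.lift_pure[OF FO.abelian_group_T balanced_nabF_pure, of w r] VR.pure_closed[of w r]
  by (simp add: nabF_def)

text \<open>The row r_j times h_p r is r when j = p and 0 otherwise, so only the L_pp(w) \<otimes> r
  remain, and the E_pp sum to the identity. This identity is used twice: for the Leibniz rule of
  \<open>nabF\<close> and for the cancellation in \<open>nab_generator_JJ\<close>.\<close>

lemma sum_fj:
  assumes w: "w \<in> carrier V"
  shows "(\<Oplus>\<^bsub>VR.T\<^esub>p\<in>UNIV. \<Oplus>\<^bsub>VR.T\<^esub>j\<in>UNIV. VR.act (fj w j p) (row_matrix p r)) = VR.pt w r"
proof -
  have c: "VR.pt (matrix_unit p p \<odot>\<^bsub>V\<^esub> w) r \<in> carrier VR.T" for p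
    by (simp add: VR.pure_closed act_V w)
  have "(\<Oplus>\<^bsub>VR.T\<^esub>j\<in>UNIV. VR.act (fj w j p) (row_matrix p r)) = VR.pt (matrix_unit p p \<odot>\<^bsub>V\<^esub> w) r" for p
  proof -
    have "VR.act (fj w j p) (row_matrix p r) = (if p = j then VR.pt (matrix_unit j p \<odot>\<^bsub>V\<^esub> w) r else \<zero>\<^bsub>VR.T\<^esub>)" for j
      using VR.act_pure[of "matrix_unit j p \<odot>\<^bsub>V\<^esub> w" "axis j 1" "row_matrix p r"] VR.pure_zero(1)[of "matrix_unit j p \<odot>\<^bsub>V\<^esub> w"]
      by (simp add: act_V w axis_row_matrix)
    then show ?thesis
      using VR.T.add.finprod_singleton[of p UNIV "\<lambda>j. VR.pt (matrix_unit j p \<odot>\<^bsub>V\<^esub> w) r"]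
      by (simp add: VR.pure_closed act_V w)
  qed
  then have "(\<Oplus>\<^bsub>VR.T\<^esub>p\<in>UNIV. \<Oplus>\<^bsub>VR.T\<^esub>j\<in>UNIV. VR.act (fj w j p) (row_matrix p r)) = (\<Oplus>\<^bsub>VR.T\<^esub>p\<in>UNIV. VR.pt (matrix_unit p p \<odot>\<^bsub>V\<^esub> w) r)"
    by (simp only:)
  also have "\<dots> = VR.pt ((\<Sum>p\<in>UNIV. matrix_unit p p) \<odot>\<^bsub>V\<^esub> w) r"
  proof -
    have "additive_map Mat VR.T (\<lambda>a. VR.pt (a \<odot>\<^bsub>V\<^esub> w) r)"
      using additive_map_comp[OF act_V_additive_left[OF w] VR.pure_additive(2)[of r, simplified]] by simp
    from additive_map_finsum[OF abelian_Mat VR.abelian_group_T this, of "\<lambda>p. matrix_unit p p" UNIV]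
    show ?thesis by (simp add: finsum_Row_Col[OF abelian_Mat])
  qed
  finally show ?thesis by (simp add: sum_matrix_unit act_V_one w)
qed

text \<open>Since h_p (r b) = (h_p r) b, the Leibniz rule of the universal differential splits each
  summand in two; the parts with db are summed by \<open>sum_fj\<close> to (w \<otimes> r) \<otimes>
  db.\<close>

lemma right_connection_nabF: "right_connection Mat Omega_uni d_uni (F_mod V) nabF"
proof (rule right_connectionI)
  fix t and b :: "complex^'n^'n" assume "t \<in> carrier (F_mod V)"
  then have t: "t \<in> carrier VR.T" by simp
  have add: "additive_map VR.T FO.T (\<lambda>e. FO.pt e (d_uni b))"
    using FO.pure_additive(2)[OF d_uni_closed] by simp
  have ab: "additive_map VR.T VR.T (\<lambda>t. VR.act t b)" "additive_map FO.T FO.T (\<lambda>t. FO.act t b)"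
    using VR.act_additive[of b] FO.act_additive[of b] by simp_all
  show "nabF (ract (F_mod V) t b) = FO.pt t (d_uni b) \<oplus>\<^bsub>FO.T\<^esub> FO.act (nabF t) b"
    unfolding F_mod_simps
  proof (rule VR.tensor_ext[OF t additive_map_comp[OF ab(1) nabF_additive]
      additive_map_plus[OF FO.abelian_group_T add additive_map_comp[OF nabF_additive ab(2)]]])
    fix w and r :: "complex^'n" assume "w \<in> carrier (underlying_space V)"
    then have w: "w \<in> carrier V" by simp
    let ?A = "\<lambda>p j. FO.pt (VR.act (fj w j p) (row_matrix p r)) (d_uni b)"
    let ?B = "\<lambda>p j. FO.act (FO.pt (fj w j p) (d_uni (row_matrix p r))) b"
    have fr: "VR.act (fj w j p) (row_matrix p r) \<in> carrier VR.T" for p j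
      using fj_closed[OF w] VR.act_T_closed by simp
    have A: "?A p j \<in> carrier FO.T" for p j
      by (rule FO.pure_closed[OF _ d_uni_closed]) (simp add: fr)
    have B: "?B p j \<in> carrier FO.T" for p j
      by (rule FO.act_T_closed[OF FO.pure_closed[OF fj_closed[OF w] d_uni_closed]]) simp
    have "FO.pt (fj w j p) (d_uni (row_matrix p (r v* b))) = ?A p j \<oplus>\<^bsub>FO.T\<^esub> ?B p j" for p j
    proof -
      have c1: "lact Omega_uni (row_matrix p r) (d_uni b) \<in> carrier Omega_uni"
        by (rule left_modD(3)[OF FO.left_N _ d_uni_closed]) simp
      have c2: "ract Omega_uni (d_uni (row_matrix p r)) b \<in> carrier Omega_uni"
        by (rule right_moduleD(3)[OF FO.right_N d_uni_closed]) simp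
      have "FO.pt (fj w j p) (d_uni (row_matrix p (r v* b))) =
          FO.pt (fj w j p) (lact Omega_uni (row_matrix p r) (d_uni b) \<oplus>\<^bsub>Omega_uni\<^esub> ract Omega_uni (d_uni (row_matrix p r)) b)"
        by (simp add: row_matrix_mult d_uni_mult)
      also have "\<dots> = FO.pt (fj w j p) (lact Omega_uni (row_matrix p r) (d_uni b)) \<oplus>\<^bsub>FO.T\<^esub>
          FO.pt (fj w j p) (ract Omega_uni (d_uni (row_matrix p r)) b)"
        by (rule FO.pure_add_right[OF fj_closed[OF w] c1 c2])
      also have "FO.pt (fj w j p) (ract Omega_uni (d_uni (row_matrix p r)) b) = ?B p j"
        by (rule FO.act_pure[OF fj_closed[OF w] d_uni_closed, symmetric]) simp
      also have "FO.pt (fj w j p) (lact Omega_uni (row_matrix p r) (d_uni b)) = ?A p j"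
        using FO.pure_balance[OF fj_closed[OF w] _ d_uni_closed, of "row_matrix p r" j p b] by simp
      finally show ?thesis .
    qed
    then have "nabF (VR.act (VR.pt w r) b) = (\<Oplus>\<^bsub>FO.T\<^esub>p\<in>UNIV. \<Oplus>\<^bsub>FO.T\<^esub>j\<in>UNIV. ?A p j \<oplus>\<^bsub>FO.T\<^esub> ?B p j)"
      using VR.act_pure[of w r b] nabF_tensor[OF w, of "r v* b"] w by (simp add: nabF_pure_def)
    also have "\<dots> = (\<Oplus>\<^bsub>FO.T\<^esub>p\<in>UNIV. (\<Oplus>\<^bsub>FO.T\<^esub>j\<in>UNIV. ?A p j) \<oplus>\<^bsub>FO.T\<^esub> (\<Oplus>\<^bsub>FO.T\<^esub>j\<in>UNIV. ?B p j))"
      using A B by (simp add: FO.T.finsum_addf Pi_iff)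
    also have "\<dots> = (\<Oplus>\<^bsub>FO.T\<^esub>p\<in>UNIV. \<Oplus>\<^bsub>FO.T\<^esub>j\<in>UNIV. ?A p j) \<oplus>\<^bsub>FO.T\<^esub> (\<Oplus>\<^bsub>FO.T\<^esub>p\<in>UNIV. \<Oplus>\<^bsub>FO.T\<^esub>j\<in>UNIV. ?B p j)"
      using A B by (simp add: FO.T.finsum_addf Pi_iff FO.T.finsum_closed)
    also have "(\<Oplus>\<^bsub>FO.T\<^esub>p\<in>UNIV. \<Oplus>\<^bsub>FO.T\<^esub>j\<in>UNIV. ?A p j) = FO.pt (VR.pt w r) (d_uni b)"
      unfolding sum_fj[OF w, symmetric]
      using fr by (simp add: additive_map_finsum[OF VR.abelian_group_T FO.abelian_group_T add] Pi_iff VR.T.finsum_closed)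
    also have "(\<Oplus>\<^bsub>FO.T\<^esub>p\<in>UNIV. \<Oplus>\<^bsub>FO.T\<^esub>j\<in>UNIV. ?B p j) = FO.act (nabF (VR.pt w r)) b"
      unfolding nabF_tensor[OF w] nabF_pure_def
      using FO.pure_closed[OF fj_closed[OF w] d_uni_closed]
      by (simp add: additive_map_finsum[OF FO.abelian_group_T FO.abelian_group_T ab(2)] Pi_iff FO.T.finsum_closed)
    finally show "nabF (VR.act (VR.pt w r) b) = FO.pt (VR.pt w r) (d_uni b) \<oplus>\<^bsub>FO.T\<^esub> FO.act (nabF (VR.pt w r)) b" .
  qed
qed (simp_all add: right_F bimodule_Omega_uni nabF_additive, simp add: nabF_def)

lemma is_nabla_F_nabF: "is_nabla_F V nabF"
  unfolding is_nabla_F_def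
  by (simp add: right_connection_nabF F_tensor_eq nabF_tensor nabF_pure_def row_matrix_axis)

lemma VR_expansion:
  assumes w: "w \<in> carrier V"
  shows "VR.pt w r = (\<Oplus>\<^bsub>VR.T\<^esub>i\<in>UNIV. VR.pt (mat (r $ i) \<odot>\<^bsub>V\<^esub> w) (axis i 1))"
proof -
  have "r = (\<Sum>i\<in>UNIV. r $ i *s axis i 1)"
    by (simp add: vec_eq_iff axis_def if_distrib[of "\<lambda>x. _ * x"] cong: if_cong)
  then have "VR.pt w r = VR.pt w (finsum Row (\<lambda>i. r $ i *s axis i 1) UNIV)"
    by (simp add: finsum_Row_Col[OF VR.N.abelian_group_axioms])
  also have "\<dots> = (\<Oplus>\<^bsub>VR.T\<^esub>i\<in>UNIV. VR.pt w (r $ i *s axis i 1))"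
    by (rule VR.pure_finsum_right) (simp_all add: w)
  finally show ?thesis
    using VR.pure_balance[of w _ "axis _ 1"] w by simp
qed

text \<open>In \<open>VR_expansion\<close> the coefficients of the row are absorbed into w, so every
  w \<otimes> r is a sum of elements w' \<otimes> r_i on which the value is prescribed; additivity
  does the rest.\<close>

lemma is_nabla_F_unique:
  assumes "is_nabla_F V nab"
  shows "nab = nabF"
proof -
  note C = assms[unfolded is_nabla_F_def, THEN conjunct1]
  have gen: "nab (VR.pt w (axis i 1)) = nabF (VR.pt w (axis i 1))" if "w \<in> carrier V" for w i
    using assms is_nabla_F_nabF that by (simp add: is_nabla_F_def F_tensor_eq)
  have add: "additive_map VR.T FO.T nab"
    using right_connectionD(3)[OF C] by simp
  show ?thesis
  proof (rule extensionalityI[of _ "carrier VR.T"])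
    show "nab \<in> extensional (carrier VR.T)" using right_connectionD(4)[OF C] by simp
    show "nabF \<in> extensional (carrier VR.T)" by (simp add: nabF_def)
    fix x assume x: "x \<in> carrier VR.T"
    show "nab x = nabF x"
    proof (rule VR.tensor_ext[OF x add nabF_additive])
      fix w and r :: "complex^'n" assume "w \<in> carrier (underlying_space V)"
      then have w: "w \<in> carrier V" by simp
      have c: "(\<lambda>i. VR.pt (mat (r $ i) \<odot>\<^bsub>V\<^esub> w) (axis i 1)) \<in> UNIV \<rightarrow> carrier VR.T"
        by (simp add: VR.pure_closed act_V w)
      show "nab (VR.pt w r) = nabF (VR.pt w r)"
        unfolding VR_expansion[OF w, of r]
          additive_map_finsum[OF VR.abelian_group_T FO.abelian_group_T add c]
          additive_map_finsum[OF VR.abelian_group_T FO.abelian_group_T nabF_additive c]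
          gen[OF act_V[OF w]] ..
    qed
  qed
qed

lemma F_obj_eq: "F_obj V = (F_mod V, nabF)"
  unfolding F_obj_def using the_equality[of "is_nabla_F V", OF is_nabla_F_nabF is_nabla_F_unique] by simp

end

locale matrix_module_map = V: matrix_module V + W: matrix_module W
  for V W :: "(complex^'n::finite^'n, 'v) module" +
  fixes \<theta> :: "'v \<Rightarrow> 'v"
  assumes \<theta>: "\<theta> \<in> left_module_hom Mat V W"
begin

lemma \<theta>_closed: "w \<in> carrier V \<Longrightarrow> \<theta> w \<in> carrier W"
  and \<theta>_act: "w \<in> carrier V \<Longrightarrow> \<theta> (a \<odot>\<^bsub>V\<^esub> w) = a \<odot>\<^bsub>W\<^esub> \<theta> w"
  and \<theta>_hom: "\<theta> \<in> right_module_hom complex_ring (underlying_space V) (underlying_space W)"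
  using \<theta> by (auto simp: left_module_hom_def right_module_hom_def)

sublocale U: tensor_map complex_ring "underlying_space V" "Row :: (complex, complex^'n^'n, complex^'n) bimod" "underlying_space W" \<theta>
  by (rule tensor_mapI[OF V.right_us W.right_us bimoduleD(2)[OF bimodule_Row] \<theta>_hom])

lemma F_mor_eq: "F_mor V W \<theta> = U.Uid"
  by (simp add: F_mor_def)

lemma F_mor_hom: "F_mor V W \<theta> \<in> right_module_hom Mat (F_mod V) (F_mod W)"
  unfolding F_mor_eq F_mod_def by (rule U.Uid_hom[OF bimodule_Row])

sublocale UO: tensor_map Mat "F_mod V" "Omega_uni :: (complex^'n^'n, complex^'n^'n, 'n uniform) bimod" "F_mod W" "F_mor V W \<theta>"
  by (rule tensor_mapI[OF V.right_F W.right_F bimoduleD(2)[OF bimodule_Omega_uni] F_mor_hom])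

lemma F_mor_pure: "w \<in> carrier V \<Longrightarrow> F_mor V W \<theta> (V.VR.pt w r) = W.VR.pt (\<theta> w) r"
  using U.Uid_pure[of w r] by (simp add: F_mor_eq)

text \<open>The formula involves w only through the matrix units L_jp, and a module map commutes
  with those.\<close>

lemma nabF_nat:
  assumes t: "t \<in> carrier V.VR.T"
  shows "W.nabF (F_mor V W \<theta> t) = UO.Uid (V.nabF t)"
proof (rule V.VR.tensor_ext[OF t])
  show "additive_map V.VR.T W.FO.T (\<lambda>t. W.nabF (F_mor V W \<theta> t))"
    unfolding F_mor_eq by (rule additive_map_comp[OF U.Uid_additive W.nabF_additive])
  show "additive_map V.VR.T W.FO.T (\<lambda>t. UO.Uid (V.nabF t))"
    by (rule additive_map_comp[OF V.nabF_additive UO.Uid_additive])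
  fix w and r :: "complex^'n" assume "w \<in> carrier (underlying_space V)"
  then have w: "w \<in> carrier V" by simp
  have "UO.Uid (V.FO.pt (V.fj w j p) (d_uni (row_matrix p r))) = W.FO.pt (W.fj (\<theta> w) j p) (d_uni (row_matrix p r))" for j p
    using UO.Uid_pure[OF V.fj_closed[OF w] d_uni_closed] F_mor_pure[OF V.act_V[OF w]] by (simp add: \<theta>_act w)
  then show "W.nabF (F_mor V W \<theta> (V.VR.pt w r)) = UO.Uid (V.nabF (V.VR.pt w r))"
    using V.FO.pure_closed[OF V.fj_closed[OF w] d_uni_closed]
    by (simp add: F_mor_pure w W.nabF_tensor V.nabF_tensor \<theta>_closed V.nabF_pure_def W.nabF_pure_def
        additive_map_finsum[OF V.FO.abelian_group_T W.FO.abelian_group_T UO.Uid_additive] Pi_iff V.FO.T.finsum_closed)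
qed

end

lemma is_category_left_module: "is_category (left_module_category A)"
  unfolding is_category_def
proof (intro conjI ballI)
  fix X assume X: "X \<in> obj (left_module_category A)"
  then have X': "left_module A X" by (simp add: left_module_category_def)
  interpret X: abelian_group X by (rule left_moduleD(2)[OF X'])
  from X show "ident (left_module_category A) X \<in> mor (left_module_category A) X X"
    using left_moduleD(3)[OF X'] by (auto simp: left_module_category_def left_module_hom_def)
  fix Y f assume f: "f \<in> mor (left_module_category A) X Y"
  then show "cmp (left_module_category A) X f (ident (left_module_category A) X) = f"
    "cmp (left_module_category A) X (ident (left_module_category A) Y) f = f"
    by (auto simp: left_module_category_def left_module_hom_def fun_eq_iff compose_def PiE_def extensional_def)
  fix Z g assume g: "g \<in> mor (left_module_category A) Y Z"
  show "cmp (left_module_category A) X g f \<in> mor (left_module_category A) X Z"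
    using f g left_moduleD(3)[OF X'] by (auto simp: left_module_category_def left_module_hom_def compose_def PiE_def Pi_iff)
  fix W h assume "h \<in> mor (left_module_category A) Z W"
  show "cmp (left_module_category A) X h (cmp (left_module_category A) X g f) =
    cmp (left_module_category A) X (cmp (left_module_category A) Y h g) f"
    using f by (auto simp: left_module_category_def left_module_hom_def compose_def fun_eq_iff PiE_def)
qed

lemma left_module_category_simps [simp]:
  "obj (left_module_category A) = {V. left_module A V}" "mor (left_module_category A) = left_module_hom A"
  "ident (left_module_category A) V = restrict id (carrier V)"
  "cmp (left_module_category A) V T S = compose (carrier V) T S"
  by (simp_all add: left_module_category_def)

theorem F_functor:
  "is_functor (left_module_category Mat :: ((complex^'n::finite^'n, 'v) module, 'v \<Rightarrow> 'v) category)
    (connection_category Mat Omega_uni d_uni) F_obj F_mor"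
  unfolding is_functor_def
proof (intro conjI ballI is_category_left_module is_category_connection)
  fix V :: "(complex^'n^'n, 'v) module" assume "V \<in> obj (left_module_category Mat)"
  then interpret V: matrix_module V by unfold_locales simp
  show "F_obj V \<in> obj (connection_category Mat Omega_uni d_uni)"
    by (simp add: V.F_obj_eq connection_category_simps V.right_connection_nabF)
  show "F_mor V V (ident (left_module_category Mat) V) = ident (connection_category Mat Omega_uni d_uni) (F_obj V)"
  proof
    fix t
    show "F_mor V V (ident (left_module_category Mat) V) t = ident (connection_category Mat Omega_uni d_uni) (F_obj V) t"
      using map_tensor_id_id[OF V.right_us V.VR.left_N, of t]
      by (cases "t \<in> carrier V.VR.T") (simp_all add: F_mor_def V.F_obj_eq connection_category_simps, simp add: map_tensor_id_def)
  qed
  fix W \<theta> assume "W \<in> obj (left_module_category Mat)" and "\<theta> \<in> mor (left_module_category Mat) V W"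
  then interpret VW: matrix_module_map V W \<theta> by unfold_locales simp_all
  show "F_mor V W \<theta> \<in> mor (connection_category Mat Omega_uni d_uni) (F_obj V) (F_obj W)"
    using VW.F_mor_hom VW.nabF_nat by (simp add: V.F_obj_eq VW.W.F_obj_eq connection_category_simps)
  fix X \<eta> assume "X \<in> obj (left_module_category Mat)" and "\<eta> \<in> mor (left_module_category Mat) W X"
  then interpret WX: matrix_module_map W X \<eta> by unfold_locales simp_all
  show "F_mor V X (cmp (left_module_category Mat) V \<eta> \<theta>) =
      cmp (connection_category Mat Omega_uni d_uni) (F_obj V) (F_mor W X \<eta>) (F_mor V W \<theta>)"
  proof
    fix t
    show "F_mor V X (cmp (left_module_category Mat) V \<eta> \<theta>) t =
      cmp (connection_category Mat Omega_uni d_uni) (F_obj V) (F_mor W X \<eta>) (F_mor V W \<theta>) t"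
      using map_tensor_id_comp[OF V.right_us VW.W.right_us WX.W.right_us V.VR.left_N VW.\<theta>_hom WX.\<theta>_hom, of t]
      by (cases "t \<in> carrier V.VR.T")
         (simp_all add: F_mor_def V.F_obj_eq connection_category_simps compose_def, simp add: map_tensor_id_def)
  qed
qed

section \<open>Symmetry of second derivatives\<close>

text \<open>The classical argument by second differences and the mean value theorem. That theorem is
  about real functions, hence the real functional L, later the real and the imaginary part.\<close>

lemma symmetric_second_derivative_real:
  fixes f :: "complex^'n::finite \<Rightarrow> complex" and L :: "complex \<Rightarrow> real"
  assumes f: "smooth f" and v: "v \<noteq> 0" and L: "bounded_linear L" "\<And>z. \<bar>L z\<bar> \<le> cmod z"
  shows "L (frechet_derivative (\<lambda>u. frechet_derivative f (at u) X) (at v) Y) =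
    L (frechet_derivative (\<lambda>u. frechet_derivative f (at u) Y) (at v) X)"
proof (rule ccontr)
  define D where "D Z u = frechet_derivative f (at u) Z" for Z u
  define DD where "DD Z W u = frechet_derivative (D Z) (at u) W" for Z W u
  have sD: "smooth (D Z)" for Z unfolding D_def by (rule smooth_derivative[OF f])
  have sDD: "smooth (DD Z W)" for Z W unfolding DD_def by (rule smooth_derivative[OF sD])
  have cont: "continuous (at v) (DD Z W)" for Z W
    using smooth_differentiable[OF sDD v] by (rule differentiable_imp_continuous_within)
  have deriv: "((\<lambda>t. L (g (a + t *\<^sub>R Z))) has_real_derivative L (frechet_derivative g (at (a + s *\<^sub>R Z)) Z)) (at s)"
    if g: "smooth g" and a: "a + s *\<^sub>R Z \<noteq> 0" for g and a Z :: "complex^'n" and s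
  proof -
    have d: "g differentiable (at (a + s *\<^sub>R Z))" by (rule smooth_differentiable[OF g a])
    have "((\<lambda>t. a + t *\<^sub>R Z) has_derivative (\<lambda>t. t *\<^sub>R Z)) (at s)"
      by (auto intro!: derivative_eq_intros)
    then have "((\<lambda>t. g (a + t *\<^sub>R Z)) has_derivative (\<lambda>t. frechet_derivative g (at (a + s *\<^sub>R Z)) (t *\<^sub>R Z))) (at s)"
      by (rule has_derivative_compose) (use d in \<open>simp add: frechet_derivative_works\<close>)
    from bounded_linear.has_derivative[OF L(1) this]
    show ?thesis
      unfolding has_field_derivative_def
      by (simp add: linear_scale[OF frechet_derivative_linear_arg[OF d]] linear_scale[OF bounded_linear.linear[OF L(1)]] mult.commute[of _ "L _"])
  qed
  assume "L (frechet_derivative (\<lambda>u. frechet_derivative f (at u) X) (at v) Y) \<noteq>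
    L (frechet_derivative (\<lambda>u. frechet_derivative f (at u) Y) (at v) X)"
  then have ne: "L (DD X Y v) \<noteq> L (DD Y X v)" by (simp add: DD_def D_def[abs_def])
  \<comment> \<open>Half the supposed gap: two equal numbers cannot lie within e of two values that
    are 2 e apart.\<close>
  define e where "e = \<bar>L (DD X Y v) - L (DD Y X v)\<bar> / 2"
  have e: "e > 0" using ne by (simp add: e_def)
  obtain d1 where d1: "d1 > 0" "\<And>u. dist u v < d1 \<Longrightarrow> dist (DD X Y u) (DD X Y v) < e"
    using cont[of X Y] e unfolding continuous_at_eps_delta by blast
  obtain d2 where d2: "d2 > 0" "\<And>u. dist u v < d2 \<Longrightarrow> dist (DD Y X u) (DD Y X v) < e"
    using cont[of Y X] e unfolding continuous_at_eps_delta by blast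
  \<comment> \<open>The bound by |v| keeps the whole parallelogram away from the origin, where f
    need not be smooth.\<close>
  define d where "d = min (min d1 d2) (norm v)"
  have d: "d > 0" using d1(1) d2(1) v by (simp add: d_def)
  define h where "h = d / (2 * (norm X + norm Y + 1))"
  have p: "norm X + norm Y + 1 > 0" by (simp add: add_nonneg_pos)
  have h: "h > 0" using d p by (simp add: h_def)
  have half: "d / (2 * N) * N = d / 2" if "N > 0" for N :: real
    using that by simp
  have near: "dist (v + s *\<^sub>R X + t *\<^sub>R Y) v < d" if "0 \<le> s" "s \<le> h" "0 \<le> t" "t \<le> h" for s t
  proof -
    have "norm (s *\<^sub>R X + t *\<^sub>R Y) \<le> s * norm X + t * norm Y"
      using that norm_triangle_ineq[of "s *\<^sub>R X" "t *\<^sub>R Y"] by simp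
    also have "\<dots> \<le> h * norm X + h * norm Y"
      using that by (intro add_mono mult_right_mono) auto
    also have "\<dots> \<le> h * (norm X + norm Y + 1)" using h by (simp add: algebra_simps)
    also have "\<dots> = d / 2" unfolding h_def by (rule half[OF p])
    also have "\<dots> < d" using d by simp
    finally show ?thesis by (simp add: dist_norm add.assoc)
  qed
  have nz: "v + s *\<^sub>R X + t *\<^sub>R Y \<noteq> 0" if "0 \<le> s" "s \<le> h" "0 \<le> t" "t \<le> h" for s t
  proof
    assume "v + s *\<^sub>R X + t *\<^sub>R Y = 0"
    then have "s *\<^sub>R X + t *\<^sub>R Y = - v" by (simp add: add_eq_0_iff add.assoc)
    then have "norm (s *\<^sub>R X + t *\<^sub>R Y) = norm v" by simp
    then show False using near[OF that] by (simp add: d_def dist_norm add.assoc)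
  qed
  let ?G = "\<lambda>s t. L (f (v + s *\<^sub>R X + t *\<^sub>R Y))"
  \<comment> \<open>The same second difference is evaluated in two orders, first along X and then
    along Y, or conversely. Each order gives h^2 times one of the two mixed derivatives at some
    point of the parallelogram.\<close>
  let ?\<Delta> = "?G h h - ?G h 0 - (?G 0 h - ?G 0 0)"
  obtain s1 where s1: "0 < s1" "s1 < h"
    "?\<Delta> = h * (L (D X (v + s1 *\<^sub>R X + h *\<^sub>R Y)) - L (D X (v + s1 *\<^sub>R X)))"
  proof -
    have "((\<lambda>s. ?G s h - ?G s 0) has_real_derivative (L (D X (v + s *\<^sub>R X + h *\<^sub>R Y)) - L (D X (v + s *\<^sub>R X)))) (at s)"
      if "0 \<le> s" "s \<le> h" for s
    proof (rule DERIV_diff)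
      have 1: "v + h *\<^sub>R Y + s *\<^sub>R X \<noteq> 0" "v + s *\<^sub>R X \<noteq> 0"
        using nz[of s h] nz[of s 0] that h by (simp_all add: algebra_simps)
      show "((\<lambda>s. ?G s h) has_real_derivative L (D X (v + s *\<^sub>R X + h *\<^sub>R Y))) (at s)"
        using deriv[OF f 1(1)] by (simp add: D_def add.commute add.left_commute)
      show "((\<lambda>s. ?G s 0) has_real_derivative L (D X (v + s *\<^sub>R X))) (at s)"
        using deriv[OF f 1(2)] by (simp add: D_def)
    qed
    from MVT2[OF h this] that show thesis by (auto simp: algebra_simps)
  qed
  obtain t1 where t1: "0 < t1" "t1 < h"
    "L (D X (v + s1 *\<^sub>R X + h *\<^sub>R Y)) - L (D X (v + s1 *\<^sub>R X)) = h * L (DD X Y (v + s1 *\<^sub>R X + t1 *\<^sub>R Y))"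
  proof -
    have "((\<lambda>t. L (D X (v + s1 *\<^sub>R X + t *\<^sub>R Y))) has_real_derivative L (DD X Y (v + s1 *\<^sub>R X + t *\<^sub>R Y))) (at t)"
      if "0 \<le> t" "t \<le> h" for t
      unfolding DD_def by (rule deriv[OF sD nz]) (use that s1 in auto)
    from MVT2[OF h this] that show thesis by auto
  qed
  obtain t2 where t2: "0 < t2" "t2 < h"
    "?\<Delta> = h * (L (D Y (v + h *\<^sub>R X + t2 *\<^sub>R Y)) - L (D Y (v + t2 *\<^sub>R Y)))"
  proof -
    have "((\<lambda>t. ?G h t - ?G 0 t) has_real_derivative (L (D Y (v + h *\<^sub>R X + t *\<^sub>R Y)) - L (D Y (v + t *\<^sub>R Y)))) (at t)"
      if "0 \<le> t" "t \<le> h" for t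
    proof (rule DERIV_diff)
      have 1: "v + h *\<^sub>R X + t *\<^sub>R Y \<noteq> 0" "v + t *\<^sub>R Y \<noteq> 0"
        using nz[of h t] nz[of 0 t] that h by (simp_all add: algebra_simps)
      show "((\<lambda>t. ?G h t) has_real_derivative L (D Y (v + h *\<^sub>R X + t *\<^sub>R Y))) (at t)"
        using deriv[OF f 1(1)] by (simp add: D_def)
      show "((\<lambda>t. ?G 0 t) has_real_derivative L (D Y (v + t *\<^sub>R Y))) (at t)"
        using deriv[OF f 1(2)] by (simp add: D_def)
    qed
    from MVT2[OF h this] that show thesis by (auto simp: algebra_simps)
  qed
  obtain s2 where s2: "0 < s2" "s2 < h"
    "L (D Y (v + h *\<^sub>R X + t2 *\<^sub>R Y)) - L (D Y (v + t2 *\<^sub>R Y)) = h * L (DD Y X (v + s2 *\<^sub>R X + t2 *\<^sub>R Y))"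
  proof -
    have "((\<lambda>s. L (D Y (v + s *\<^sub>R X + t2 *\<^sub>R Y))) has_real_derivative L (DD Y X (v + s *\<^sub>R X + t2 *\<^sub>R Y))) (at s)"
      if "0 \<le> s" "s \<le> h" for s
    proof -
      have "v + t2 *\<^sub>R Y + s *\<^sub>R X \<noteq> 0" using nz[of s t2] that t2 by (simp add: algebra_simps)
      from deriv[OF sD this] show ?thesis by (simp add: DD_def add.commute add.left_commute)
    qed
    from MVT2[OF h this] that show thesis by (auto simp: algebra_simps)
  qed
  let ?p = "v + s1 *\<^sub>R X + t1 *\<^sub>R Y" and ?q = "v + s2 *\<^sub>R X + t2 *\<^sub>R Y"
  have "h * (h * L (DD X Y ?p)) = h * (h * L (DD Y X ?q))"
    using s1(3) t1(3) t2(3) s2(3) by simp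
  then have eq: "L (DD X Y ?p) = L (DD Y X ?q)" using h by simp
  have "dist (DD X Y ?p) (DD X Y v) < e" "dist (DD Y X ?q) (DD Y X v) < e"
    using near[of s1 t1] near[of s2 t2] s1 t1 s2 t2 by (auto intro!: d1(2) d2(2) simp: d_def)
  then have "\<bar>L (DD X Y ?p) - L (DD X Y v)\<bar> < e" "\<bar>L (DD Y X ?q) - L (DD Y X v)\<bar> < e"
    using L(2)[of "DD X Y ?p - DD X Y v"] L(2)[of "DD Y X ?q - DD Y X v"]
    by (auto simp: dist_norm linear_diff[OF bounded_linear.linear[OF L(1)]])
  then show False using eq by (simp add: e_def abs_if split: if_splits)
qed

lemma symmetric_second_derivative:
  fixes f :: "complex^'n::finite \<Rightarrow> complex"
  assumes "smooth f" "v \<noteq> 0"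
  shows "frechet_derivative (\<lambda>u. frechet_derivative f (at u) X) (at v) Y =
    frechet_derivative (\<lambda>u. frechet_derivative f (at u) Y) (at v) X"
  using symmetric_second_derivative_real[OF assms bounded_linear_Re abs_Re_le_cmod]
    symmetric_second_derivative_real[OF assms bounded_linear_Im abs_Im_le_cmod]
  by (simp add: complex_eq_iff)

text \<open>The pullback of d0 f to punctured space, evaluated on a constant vector Y, is the
  derivative of \<open>radial f\<close> along Y. So \<open>d1\<close> of it is the antisymmetrised
  second derivative.\<close>

lemma d1_d0:
  fixes f :: "complex^'n::finite \<Rightarrow> complex"
  assumes f: "f \<in> Cinf 0" and v: "v \<in> Sph"
  shows "d1 (d0 f) v X Y = 0"
proof -
  note df = radial_differentiable[OF f]
  have "ext_form (d0 f) Y u = frechet_derivative (radial f) (at u) Y" if u: "u \<noteq> 0" for u Y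
  proof -
    have r: "(1 / norm u) *\<^sub>R u \<noteq> 0" using u by simp
    have "frechet_derivative (radial f) (at u) Y = frechet_derivative (radial f) (at ((1 / norm u) *\<^sub>R u)) ((1 / norm u) *\<^sub>R Y)"
      unfolding scaleR_smult
      by (rule frechet_derivative_scale[OF _ u])
         (use u df[OF r] radial_invariant[OF f] in \<open>auto simp: scaleR_smult\<close>)
    then show ?thesis
      using normalize_Sph[OF u] by (simp add: ext_form_def radial_def[of "d0 f"]) (simp add: d0_def)
  qed
  then have "frechet_derivative (ext_form (d0 f) Y) (at v) = frechet_derivative (\<lambda>u. frechet_derivative (radial f) (at u) Y) (at v)" for Y
    by (intro frechet_derivative_cong_open(1)[OF open_punctured]) (use Sph_nonzero[OF v] in auto)
  then show ?thesis
    using symmetric_second_derivative[of "radial f" v Y X] CinfD(2)[OF f] Sph_nonzero[OF v]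
    by (simp add: d1_eq[OF v] smooth_on_sphere_iff)
qed

text \<open>In other words the (1,0)-part of a form contributes nothing of type (0,2).
  Multiplication by the imaginary unit is a constant map in the ambient coordinates, so it commutes
  with differentiation in the base point, and the averaging of \<open>proj01\<close> is already
  contained in that of \<open>proj02\<close>.\<close>

lemma dbar1_proj01:
  assumes \<omega>: "\<omega> \<in> forms1"
  shows "dbar1 (proj01 \<omega>) = dbar1 \<omega>"
proof -
  have ext: "ext_form (proj01 \<omega>) Y u = (ext_form \<omega> Y u + \<i> * ext_form \<omega> (\<i> *s Y) u) / 2" if "u \<noteq> 0" for u Y
    using normalize_Sph[OF that] by (simp add: ext_form_def radial_def proj01_def scaleR_smult mult.commute)
  have D: "frechet_derivative (ext_form (proj01 \<omega>) Y) (at v) X =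
      (frechet_derivative (ext_form \<omega> Y) (at v) X + \<i> * frechet_derivative (ext_form \<omega> (\<i> *s Y)) (at v) X) / 2"
    if v: "v \<in> Sph" for v X Y
  proof -
    note v0 = Sph_nonzero[OF v]
    note d = ext_form_differentiable[OF \<omega> v0]
    let ?g = "\<lambda>u. ext_form \<omega> Y u + \<i> * ext_form \<omega> (\<i> *s Y) u"
    have eq: "frechet_derivative (ext_form (proj01 \<omega>) Y) (at v) = frechet_derivative (\<lambda>u. (1/2) * ?g u) (at v)"
      by (rule frechet_derivative_cong_open(1)[OF open_punctured]) (use v0 ext in auto)
    have di: "(\<lambda>u. \<i> * ext_form \<omega> (\<i> *s Y) u) differentiable (at v)" using d by simp
    have g: "?g differentiable (at v)" using d by simp
    have "frechet_derivative (\<lambda>u. (1/2) * ?g u) (at v) X = (1/2) * frechet_derivative ?g (at v) X"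
      using frechet_derivative_mult[OF differentiable_const g, of "1/2" X] by simp
    also have "frechet_derivative ?g (at v) X = frechet_derivative (ext_form \<omega> Y) (at v) X
        + \<i> * frechet_derivative (ext_form \<omega> (\<i> *s Y)) (at v) X"
      using frechet_derivative_add[OF d[of Y] di, of X] frechet_derivative_mult[OF differentiable_const d, of \<i> "\<i> *s Y" X] by simp
    finally show ?thesis by (simp add: eq)
  qed
  have neg: "frechet_derivative (ext_form \<omega> (- Y)) (at v) X = - frechet_derivative (ext_form \<omega> Y) (at v) X"
    "frechet_derivative (ext_form \<omega> Y) (at v) (- X) = - frechet_derivative (ext_form \<omega> Y) (at v) X"
    if v: "v \<in> Sph" for v X Y
    using linear_neg[OF derivative_ext_form_linear[OF \<omega> Sph_nonzero[OF v]]]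
      linear_neg[OF frechet_derivative_linear_arg[OF ext_form_differentiable[OF \<omega> Sph_nonzero[OF v]]]] by auto
  show ?thesis
    by (auto simp: dbar1_def proj02_def fun_eq_iff d1_eq D neg field_simps)
qed

lemma dbar1_dbar0: "f \<in> Cinf 0 \<Longrightarrow> dbar1 (dbar0 f) = (\<lambda>v\<in>Sph. \<lambda>X Y. 0)"
  by (auto simp: dbar0_def dbar1_proj01[OF d0_closed] fun_eq_iff) (auto simp: dbar1_def proj02_def d1_d0)

section \<open>Functors between categories of connections\<close>

lemma functor_comp:
  assumes "is_functor C D Fo Fm" "is_functor D E Go Gm"
  shows "is_functor C E (\<lambda>X. Go (Fo X)) (\<lambda>X Y f. Gm (Fo X) (Fo Y) (Fm X Y f))"
  using assms by (simp add: is_functor_def)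

lemma functor_full_subcategory:
  assumes "is_functor C D Fo Fm" "is_category (D\<lparr>obj := P\<rparr>)" "\<And>X. X \<in> obj C \<Longrightarrow> Fo X \<in> P"
  shows "is_functor C (D\<lparr>obj := P\<rparr>) Fo Fm"
  using assms by (simp add: is_functor_def)

text \<open>Change of calculus along a bimodule map p: a connection for d becomes one for p after d.
  It is instantiated with the projection to (0,1)-forms.\<close>

locale calculus_map =
  fixes B :: "('b, 'x) ring_scheme" and \<Omega> :: "('b, 'b, 'w) bimod" and d :: "'b \<Rightarrow> 'w"
    and \<Omega>' :: "('b, 'b, 'w') bimod" and p :: "'w \<Rightarrow> 'w'"
  assumes bi: "bimodule B B \<Omega>" and bi': "bimodule B B \<Omega>'"
    and d_closed: "b \<in> carrier B \<Longrightarrow> d b \<in> carrier \<Omega>"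
    and p_additive: "additive_map \<Omega> \<Omega>' p"
    and p_lact: "b \<in> carrier B \<Longrightarrow> \<omega> \<in> carrier \<Omega> \<Longrightarrow> p (lact \<Omega> b \<omega>) = lact \<Omega>' b (p \<omega>)"
    and p_ract: "b \<in> carrier B \<Longrightarrow> \<omega> \<in> carrier \<Omega> \<Longrightarrow> p (ract \<Omega> \<omega> b) = ract \<Omega>' (p \<omega>) b"

locale calculus_push = calculus_map B \<Omega> d \<Omega>' p
  for B :: "('b, 'x) ring_scheme" and \<Omega> :: "('b, 'b, 'w) bimod" and d :: "'b \<Rightarrow> 'w"
    and \<Omega>' :: "('b, 'b, 'w') bimod" and p :: "'w \<Rightarrow> 'w'" +
  fixes G :: "('b, 'g) rmod"
  assumes right_G: "right_module B G"
begin

sublocale S: tensor_right B G \<Omega> B by (rule tensor_rightI[OF right_G bi])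
sublocale S': tensor_right B G \<Omega>' B by (rule tensor_rightI[OF right_G bi'])

definition "push t = tensor_lift S'.T (\<lambda>g \<xi>. S'.pt g (p \<xi>)) t"

lemma p_closed: "\<omega> \<in> carrier \<Omega> \<Longrightarrow> p \<omega> \<in> carrier \<Omega>'"
  by (rule additive_map_closed[OF p_additive])

lemma balanced_push: "balanced B G \<Omega> S'.T (\<lambda>g \<xi>. S'.pt g (p \<xi>))"
proof (rule balancedI)
  show "additive_map \<Omega> S'.T (\<lambda>\<xi>. S'.pt g (p \<xi>))" if "g \<in> carrier G" for g
    by (rule additive_map_comp[OF p_additive S'.pure_additive(1)[OF that]])
  show "additive_map G S'.T (\<lambda>g. S'.pt g (p \<xi>))" if "\<xi> \<in> carrier \<Omega>" for \<xi>
    by (rule S'.pure_additive(2)[OF p_closed[OF that]])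
qed (simp add: p_lact S'.pure_balance p_closed)

lemma push_additive: "additive_map S.T S'.T push"
  unfolding push_def[abs_def] by (rule S.lift_additive[OF S'.abelian_group_T balanced_push])

lemma push_pure: "g \<in> carrier G \<Longrightarrow> \<xi> \<in> carrier \<Omega> \<Longrightarrow> push (S.pt g \<xi>) = S'.pt g (p \<xi>)"
  unfolding push_def by (rule S.lift_pure[OF S'.abelian_group_T balanced_push])

lemma push_act:
  assumes t: "t \<in> carrier S.T" and b: "b \<in> carrier B"
  shows "push (S.act t b) = S'.act (push t) b"
  by (rule S.tensor_ext[OF t additive_map_comp[OF S.act_additive[OF b] push_additive]
        additive_map_comp[OF push_additive S'.act_additive[OF b]]])
     (simp add: S.act_pure S'.act_pure push_pure p_closed p_ract b right_moduleD(3)[OF S.right_N])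

lemma push_connection:
  assumes c: "right_connection B \<Omega> d G nab"
  shows "right_connection B \<Omega>' (\<lambda>b. p (d b)) G (\<lambda>g\<in>carrier G. push (nab g))"
proof (rule right_connectionI)
  note c = right_connectionD[OF c]
  show "additive_map G S'.T (\<lambda>g\<in>carrier G. push (nab g))"
    by (rule additive_map_cong[OF S.M.abelian_group_axioms additive_map_comp[OF c(3) push_additive]]) simp
  fix g b assume g: "g \<in> carrier G" and b: "b \<in> carrier B"
  then show "(\<lambda>g\<in>carrier G. push (nab g)) (ract G g b) =
      S'.pt g (p (d b)) \<oplus>\<^bsub>S'.T\<^esub> S'.act ((\<lambda>g\<in>carrier G. push (nab g)) g) b"
    by (simp add: c(5,6) right_moduleD(3)[OF right_G] additive_map_add[OF push_additive] d_closed push_pure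
        push_act S.act_T_closed)
qed (simp_all add: right_G bi')

end

lemma push_nat:
  assumes X: "calculus_push B \<Omega> d \<Omega>' p G" and Y: "calculus_push B \<Omega> d \<Omega>' p H" and T: "T \<in> right_module_hom B G H"
    and t: "t \<in> carrier (tensor_group B G \<Omega>)"
  shows "map_tensor_id B G H \<Omega>' T (calculus_push.push B \<Omega>' p G t) =
    calculus_push.push B \<Omega>' p H (map_tensor_id B G H \<Omega> T t)"
proof -
  interpret X: calculus_push B \<Omega> d \<Omega>' p G by fact
  interpret Y: calculus_push B \<Omega> d \<Omega>' p H by fact
  interpret T: tensor_map B G \<Omega> H T by (rule tensor_mapI[OF X.right_G Y.right_G bimoduleD(2)[OF X.bi] T])
  interpret T': tensor_map B G \<Omega>' H T by (rule tensor_mapI[OF X.right_G Y.right_G bimoduleD(2)[OF X.bi'] T])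
  show ?thesis
    by (rule X.S.tensor_ext[OF t additive_map_comp[OF X.push_additive T'.Uid_additive]
          additive_map_comp[OF T.Uid_additive Y.push_additive]])
       (simp add: X.push_pure Y.push_pure T.Uid_pure T'.Uid_pure X.p_closed right_module_homD(3)[OF T])
qed

interpretation dbar: calculus_map CP "Omega1 :: (complex^'n::finite \<Rightarrow> complex, complex^'n \<Rightarrow> complex, 'n form1) bimod"
  d0 Omega01 proj01
proof
  show "additive_map (Omega1 :: (complex^'n \<Rightarrow> complex, complex^'n \<Rightarrow> complex, 'n form1) bimod) Omega01 proj01"
    by (rule additive_mapI, simp add: proj01_closed) (auto simp: fun_eq_iff proj01_def field_simps)
qed (auto simp: bimodule_Omega1 bimodule_Omega01 d0_closed proj01_def fun_eq_iff field_simps)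

lemma dbar0_abs: "dbar0 = (\<lambda>b. proj01 (d0 b))"
  by (simp add: dbar0_def fun_eq_iff)

lemma dbar_functor:
  "is_functor (connection_category CP Omega1 d0 ::
      ((complex^'n::finite \<Rightarrow> complex, 'g) rmod \<times> ('g \<Rightarrow> ('g, 'n form1) tens), 'g \<Rightarrow> 'g) category)
    (connection_category CP Omega01 dbar0) dbar_part (\<lambda>X Y f. f)"
proof -
  let ?C = "connection_category CP Omega1 d0 ::
      ((complex^'n \<Rightarrow> complex, 'g) rmod \<times> ('g \<Rightarrow> ('g, 'n form1) tens), 'g \<Rightarrow> 'g) category"
  have push: "calculus_push CP Omega1 d0 Omega01 proj01 G" if "right_connection CP Omega1 d0 G nab"
    for G :: "(complex^'n \<Rightarrow> complex, 'g) rmod" and nab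
    using right_connectionD(1)[OF that] dbar.calculus_map_axioms by (simp add: calculus_push_def calculus_push_axioms_def)
  have dp: "dbar_part (G, nab) = (G, \<lambda>g\<in>carrier G. calculus_push.push CP Omega01 proj01 G (nab g))"
    if "right_connection CP Omega1 d0 G nab" for G :: "(complex^'n \<Rightarrow> complex, 'g) rmod" and nab
    by (simp add: dbar_part_def calculus_push.push_def[OF push[OF that]])
  show ?thesis
    unfolding is_functor_def
  proof (intro conjI ballI is_category_connection)
    fix X assume "X \<in> obj ?C"
    then obtain G nab where X: "X = (G, nab)" and c: "right_connection CP Omega1 d0 G nab"
      by (auto simp: connection_category_simps)
    show "dbar_part X \<in> obj (connection_category CP Omega01 dbar0)"
      using calculus_push.push_connection[OF push[OF c] c] by (simp add: X dp[OF c] connection_category_simps dbar0_abs)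
    show "ident ?C X = ident (connection_category CP Omega01 dbar0) (dbar_part X)"
      by (simp add: X dp[OF c] connection_category_simps)
    fix Y assume "Y \<in> obj ?C"
    then obtain H nab' where Y: "Y = (H, nab')" and c': "right_connection CP Omega1 d0 H nab'"
      by (auto simp: connection_category_simps)
    fix T assume "T \<in> mor ?C X Y"
    then have T: "T \<in> right_module_hom CP G H"
      "\<And>g. g \<in> carrier G \<Longrightarrow> nab' (T g) = map_tensor_id CP G H Omega1 T (nab g)"
      by (auto simp: X Y connection_category_simps)
    show "T \<in> mor (connection_category CP Omega01 dbar0) (dbar_part X) (dbar_part Y)"
      using T right_module_homD(3)[OF T(1)] push_nat[OF push[OF c] push[OF c'] T(1) right_connectionD(5)[OF c]]
      by (simp add: X Y dp[OF c] dp[OF c'] connection_category_simps)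
    fix Z g
    show "cmp ?C X g T = cmp (connection_category CP Omega01 dbar0) (dbar_part X) g T"
      by (simp add: X dp[OF c] connection_category_simps)
  qed
qed


section \<open>Transport of a connection along an isomorphism\<close>

locale transport =
  fixes B :: "('b, 'x) ring_scheme" and \<Omega> :: "('b, 'b, 'w) bimod" and d :: "'b \<Rightarrow> 'w"
    and G :: "('b, 'g) rmod" and nab :: "'g \<Rightarrow> ('g, 'w) tens" and H :: "('b, 'h) rmod" and T :: "'g \<Rightarrow> 'h"
  assumes conn: "right_connection B \<Omega> d G nab" and right_H: "right_module B H"
    and d_closed: "b \<in> carrier B \<Longrightarrow> d b \<in> carrier \<Omega>"
    and hom_T: "T \<in> right_module_hom B G H" and bij_T: "bij_betw T (carrier G) (carrier H)"
begin

lemmas c = right_connectionD[OF conn]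

sublocale G: abelian_group G by (rule right_moduleD(2)[OF c(1)])
sublocale H: abelian_group H by (rule right_moduleD(2)[OF right_H])
sublocale G\<Omega>: tensor_right B G \<Omega> B by (rule tensor_rightI[OF c(1,2)])
sublocale H\<Omega>: tensor_right B H \<Omega> B by (rule tensor_rightI[OF right_H c(2)])
sublocale TM: tensor_map B G \<Omega> H T by (rule tensor_mapI[OF c(1) right_H bimoduleD(2)[OF c(2)] hom_T])

definition "Tinv = restrict (inv_into (carrier G) T) (carrier H)"

lemma Tinv_closed: "x \<in> carrier H \<Longrightarrow> Tinv x \<in> carrier G"
  using bij_T by (simp add: Tinv_def bij_betw_def inv_into_into)

lemma T_Tinv: "x \<in> carrier H \<Longrightarrow> T (Tinv x) = x"
  using bij_T by (simp add: Tinv_def bij_betw_def f_inv_into_f)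

lemma Tinv_T: "g \<in> carrier G \<Longrightarrow> Tinv (T g) = g"
  using bij_T right_module_homD(3)[OF hom_T] by (simp add: Tinv_def bij_betw_def inv_into_f_f)

lemma Tinv_eqI: "g \<in> carrier G \<Longrightarrow> T g = x \<Longrightarrow> Tinv x = g"
  using Tinv_T by auto

lemma Tinv_hom: "Tinv \<in> right_module_hom B H G"
proof (rule right_module_homI)
  show "additive_map H G Tinv"
    by (rule additive_mapI)
       (auto intro!: Tinv_eqI simp: Tinv_closed T_Tinv additive_map_add[OF right_module_homD(2)[OF hom_T]])
  show "Tinv (ract H x b) = ract G (Tinv x) b" if "x \<in> carrier H" "b \<in> carrier B" for x b
    using that by (auto intro!: Tinv_eqI simp: Tinv_closed T_Tinv right_module_homD(4)[OF hom_T] right_moduleD(3)[OF c(1)])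
qed (simp add: Tinv_def)

definition "nabT = (\<lambda>x\<in>carrier H. TM.Uid (nab (Tinv x)))"

lemma nabT_T: "g \<in> carrier G \<Longrightarrow> nabT (T g) = TM.Uid (nab g)"
  using right_module_homD(3)[OF hom_T] by (simp add: nabT_def Tinv_T)

lemma conn_nabT: "right_connection B \<Omega> d H nabT"
proof (rule right_connectionI)
  show "additive_map H H\<Omega>.T nabT"
    by (rule additive_map_cong[OF H.abelian_group_axioms
          additive_map_comp[OF additive_map_comp[OF right_module_homD(2)[OF Tinv_hom] c(3)] TM.Uid_additive]])
       (simp add: nabT_def)
  fix x b assume x: "x \<in> carrier H" and b: "b \<in> carrier B"
  have g: "Tinv x \<in> carrier G" by (rule Tinv_closed[OF x])
  have "nabT (ract H x b) = TM.Uid (nab (ract G (Tinv x) b))"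
    using x b by (simp add: nabT_def right_moduleD(3)[OF right_H] right_module_homD(4)[OF Tinv_hom])
  also have "\<dots> = TM.Uid (G\<Omega>.pt (Tinv x) (d b)) \<oplus>\<^bsub>H\<Omega>.T\<^esub> TM.Uid (G\<Omega>.act (nab (Tinv x)) b)"
    using g b by (simp add: c(5,6) additive_map_add[OF TM.Uid_additive] d_closed G\<Omega>.act_T_closed)
  also have "TM.Uid (G\<Omega>.act (nab (Tinv x)) b) = H\<Omega>.act (nabT x) b"
    using right_module_homD(4)[OF TM.Uid_hom[OF c(2)], of "nab (Tinv x)" b] g b x by (simp add: c(5) nabT_def)
  also have "TM.Uid (G\<Omega>.pt (Tinv x) (d b)) = H\<Omega>.pt x (d b)"
    using g b x by (simp add: TM.Uid_pure d_closed T_Tinv)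
  finally show "nabT (ract H x b) = H\<Omega>.pt x (d b) \<oplus>\<^bsub>H\<Omega>.T\<^esub> H\<Omega>.act (nabT x) b" .
qed (simp_all add: right_H c(2), simp add: nabT_def)

lemma iso_T: "connection_iso B \<Omega> (G, nab) (H, nabT) T"
  by (simp add: connection_iso_def hom_T bij_T nabT_T)

text \<open>The inverse of the isomorphism is again compatible with the connections. This direction
  is needed to carry vanishing curvature from H back to G.\<close>

lemma nab_Tinv:
  assumes x: "x \<in> carrier H"
  shows "nab (Tinv x) = map_tensor_id B H G \<Omega> Tinv (nabT x)"
proof -
  have t: "nab (Tinv x) \<in> carrier G\<Omega>.T" using c(5) Tinv_closed[OF x] .
  have "map_tensor_id B H G \<Omega> Tinv (nabT x) = map_tensor_id B H G \<Omega> Tinv (TM.Uid (nab (Tinv x)))"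
    using x by (simp add: nabT_def)
  also have "\<dots> = map_tensor_id B G G \<Omega> (compose (carrier G) Tinv T) (nab (Tinv x))"
    by (rule map_tensor_id_comp[OF c(1) right_H c(1) bimoduleD(2)[OF c(2)] hom_T Tinv_hom t, symmetric])
  also have "compose (carrier G) Tinv T = restrict id (carrier G)"
    by (auto simp: compose_def Tinv_T fun_eq_iff)
  also have "map_tensor_id B G G \<Omega> (restrict id (carrier G)) (nab (Tinv x)) = nab (Tinv x)"
    by (rule map_tensor_id_id[OF c(1) bimoduleD(2)[OF c(2)] t])
  finally show ?thesis by simp
qed

end


section \<open>Curvature\<close>

lemma wedge_props:
  "wedge (\<eta> \<oplus>\<^bsub>Omega01\<^esub> \<eta>') \<xi> = wedge \<eta> \<xi> \<oplus>\<^bsub>Omega02\<^esub> wedge \<eta>' \<xi>"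
  "wedge \<xi> (\<eta> \<oplus>\<^bsub>Omega01\<^esub> \<eta>') = wedge \<xi> \<eta> \<oplus>\<^bsub>Omega02\<^esub> wedge \<xi> \<eta>'"
  "wedge (lact Omega01 b \<eta>) \<xi> = lact Omega02 b (wedge \<eta> \<xi>)"
  "wedge (ract Omega01 \<eta> b) \<xi> = wedge \<eta> (lact Omega01 b \<xi>)"
  "wedge \<eta> (ract Omega01 \<xi> b) = ract Omega02 (wedge \<eta> \<xi>) b"
  by (auto simp: wedge_def fun_eq_iff algebra_simps)

text \<open>The third rule is the graded Leibniz rule with the scalar on the right; its minus sign
  is avoided by placing the wedge term on the other side.\<close>

lemma dbar1_props:
  "\<xi> \<in> forms01 \<Longrightarrow> \<xi>' \<in> forms01 \<Longrightarrow> dbar1 (\<xi> \<oplus>\<^bsub>Omega01\<^esub> \<xi>') = dbar1 \<xi> \<oplus>\<^bsub>Omega02\<^esub> dbar1 \<xi>'"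
  "\<xi> \<in> forms01 \<Longrightarrow> b \<in> Cinf 0 \<Longrightarrow> dbar1 (lact Omega01 b \<xi>) = wedge (dbar0 b) \<xi> \<oplus>\<^bsub>Omega02\<^esub> lact Omega02 b (dbar1 \<xi>)"
  "\<xi> \<in> forms01 \<Longrightarrow> b \<in> Cinf 0 \<Longrightarrow>
    dbar1 (ract Omega01 \<xi> b) \<oplus>\<^bsub>Omega02\<^esub> wedge \<xi> (dbar0 b) = ract Omega02 (dbar1 \<xi>) b"
proof -
  show 1: "dbar1 (lact Omega01 b \<xi>) = wedge (dbar0 b) \<xi> \<oplus>\<^bsub>Omega02\<^esub> lact Omega02 b (dbar1 \<xi>)"
    if "\<xi> \<in> forms01" "b \<in> Cinf 0"
    using dbar1_scale[OF that(2,1)] by (auto simp: fun_eq_iff)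
  have e: "ract Omega01 \<xi> b = lact Omega01 b \<xi>" by (auto simp: fun_eq_iff)
  show "dbar1 (ract Omega01 \<xi> b) \<oplus>\<^bsub>Omega02\<^esub> wedge \<xi> (dbar0 b) = ract Omega02 (dbar1 \<xi>) b"
    if "\<xi> \<in> forms01" "b \<in> Cinf 0"
    unfolding e 1[OF that] by (auto simp: fun_eq_iff wedge_def)
qed (simp add: dbar1_add forms01D(1))

locale dbar_connection =
  fixes G :: "(complex^'n::finite \<Rightarrow> complex, 'g) rmod" and nab :: "'g \<Rightarrow> ('g, 'n form1) tens"
  assumes conn: "right_connection CP Omega01 dbar0 G nab"
begin

lemmas c = right_connectionD[OF conn]

sublocale G1: tensor_right CP G "Omega01 :: (complex^'n \<Rightarrow> complex, complex^'n \<Rightarrow> complex, 'n form1) bimod" CP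
  by (rule tensor_rightI[OF c(1,2)])
sublocale G2: tensor_right CP G "Omega02 :: (complex^'n \<Rightarrow> complex, complex^'n \<Rightarrow> complex, 'n form2) bimod" CP
  by (rule tensor_rightI[OF c(1) bimodule_Omega02])

lemma wedge_additive: "\<xi> \<in> forms01 \<Longrightarrow> additive_map (Omega01 :: (complex^'n \<Rightarrow> complex, complex^'n \<Rightarrow> complex, 'n form1) bimod) Omega02 (\<lambda>\<eta>. wedge \<eta> \<xi>)"
  by (rule additive_mapI, simp add: wedge_closed) (rule wedge_props)

lemma dbar1_additive: "additive_map (Omega01 :: (complex^'n \<Rightarrow> complex, complex^'n \<Rightarrow> complex, 'n form1) bimod) Omega02 dbar1"
  by (rule additive_mapI, simp add: dbar1_closed forms01D(1)) (rule dbar1_props, simp_all)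

text \<open>The term nab \<and> id of the curvature with the second factor \<xi> fixed.\<close>

definition "wed \<xi> t = tensor_lift G2.T (\<lambda>g \<eta>. G2.pt g (wedge \<eta> \<xi>)) t"

lemma balanced_wed:
  assumes \<xi>: "\<xi> \<in> forms01"
  shows "balanced CP G Omega01 G2.T (\<lambda>g \<eta>. G2.pt g (wedge \<eta> \<xi>))"
proof (rule balancedI)
  show "additive_map Omega01 G2.T (\<lambda>\<eta>. G2.pt g (wedge \<eta> \<xi>))" if "g \<in> carrier G" for g
    by (rule additive_map_comp[OF wedge_additive[OF \<xi>] G2.pure_additive(1)[OF that]])
  show "additive_map G G2.T (\<lambda>g. G2.pt g (wedge \<eta> \<xi>))" if "\<eta> \<in> carrier Omega01" for \<eta>
    by (rule G2.pure_additive(2)) (use that \<xi> in \<open>simp add: wedge_closed\<close>)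
  show "G2.pt (ract G g b) (wedge \<eta> \<xi>) = G2.pt g (wedge (lact Omega01 b \<eta>) \<xi>)"
    if "g \<in> carrier G" "b \<in> carrier CP" "\<eta> \<in> carrier Omega01" for g b \<eta>
    unfolding wedge_props by (rule G2.pure_balance) (use that \<xi> in \<open>simp_all add: wedge_closed\<close>)
qed

lemma wed_additive: "\<xi> \<in> forms01 \<Longrightarrow> additive_map G1.T G2.T (wed \<xi>)"
  unfolding wed_def[abs_def] by (rule G1.lift_additive[OF G2.abelian_group_T balanced_wed])

lemma wed_closed: "\<xi> \<in> forms01 \<Longrightarrow> t \<in> carrier G1.T \<Longrightarrow> wed \<xi> t \<in> carrier G2.T"
  by (rule additive_map_closed[OF wed_additive])

lemma wed_pure: "\<xi> \<in> forms01 \<Longrightarrow> g \<in> carrier G \<Longrightarrow> \<eta> \<in> forms01 \<Longrightarrow> wed \<xi> (G1.pt g \<eta>) = G2.pt g (wedge \<eta> \<xi>)"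
  unfolding wed_def by (rule G1.lift_pure[OF G2.abelian_group_T balanced_wed]) simp_all

lemma lact_closed: "b \<in> Cinf 0 \<Longrightarrow> \<xi> \<in> forms01 \<Longrightarrow> lact Omega01 b \<xi> \<in> forms01"
  for b :: "complex^'n \<Rightarrow> complex"
  using left_modD(3)[OF G1.left_N, of b \<xi>] by simp

lemma ract_closed: "b \<in> Cinf 0 \<Longrightarrow> \<xi> \<in> forms01 \<Longrightarrow> ract Omega01 \<xi> b \<in> forms01"
  for b :: "complex^'n \<Rightarrow> complex"
  using right_moduleD(3)[OF G1.right_N, of \<xi> b] by simp

lemma wed_act:
  assumes \<xi>: "\<xi> \<in> forms01" and t: "t \<in> carrier G1.T" and b: "b \<in> Cinf 0"
  shows "wed \<xi> (G1.act t b) = wed (lact Omega01 b \<xi>) t"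
proof (rule G1.tensor_ext[OF t])
  show "additive_map G1.T G2.T (\<lambda>t. wed \<xi> (G1.act t b))"
    by (rule additive_map_comp[OF G1.act_additive wed_additive[OF \<xi>]]) (simp add: b)
  show "additive_map G1.T G2.T (wed (lact Omega01 b \<xi>))" by (rule wed_additive[OF lact_closed[OF b \<xi>]])
  fix g and \<eta> :: "'n form1" assume g: "g \<in> carrier G" and \<eta>: "\<eta> \<in> carrier Omega01"
  show "wed \<xi> (G1.act (G1.pt g \<eta>) b) = wed (lact Omega01 b \<xi>) (G1.pt g \<eta>)"
  proof -
    have b': "b \<in> carrier CP" and \<eta>': "\<eta> \<in> forms01" using b \<eta> by simp_all
    show ?thesis
      unfolding G1.act_pure[OF g \<eta> b'] wed_pure[OF \<xi> g ract_closed[OF b \<eta>']]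
        wed_pure[OF lact_closed[OF b \<xi>] g \<eta>'] wedge_props(4) ..
  qed
qed

lemma act_wed:
  assumes \<xi>: "\<xi> \<in> forms01" and t: "t \<in> carrier G1.T" and b: "b \<in> Cinf 0"
  shows "G2.act (wed \<xi> t) b = wed (ract Omega01 \<xi> b) t"
proof (rule G1.tensor_ext[OF t])
  show "additive_map G1.T G2.T (\<lambda>t. G2.act (wed \<xi> t) b)"
    by (rule additive_map_comp[OF wed_additive[OF \<xi>] G2.act_additive]) (simp add: b)
  show "additive_map G1.T G2.T (wed (ract Omega01 \<xi> b))" by (rule wed_additive[OF ract_closed[OF b \<xi>]])
  fix g and \<eta> :: "'n form1" assume g: "g \<in> carrier G" and \<eta>: "\<eta> \<in> carrier Omega01"
  show "G2.act (wed \<xi> (G1.pt g \<eta>)) b = wed (ract Omega01 \<xi> b) (G1.pt g \<eta>)"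
  proof -
    have b': "b \<in> carrier CP" and \<eta>': "\<eta> \<in> forms01" using b \<eta> by simp_all
    have w: "wedge \<eta> \<xi> \<in> carrier Omega02" using wedge_closed[OF \<eta>' \<xi>] by simp
    show ?thesis
      unfolding wed_pure[OF \<xi> g \<eta>'] wed_pure[OF ract_closed[OF b \<xi>] g \<eta>'] wedge_props(5)
      by (rule G2.act_pure[OF g w b'])
  qed
qed

lemma wed_additive_left:
  assumes t: "t \<in> carrier G1.T"
  shows "additive_map Omega01 G2.T (\<lambda>\<xi>. wed \<xi> t)"
proof (rule additive_mapI)
  fix \<xi> \<xi>' :: "'n form1" assume "\<xi> \<in> carrier Omega01" "\<xi>' \<in> carrier Omega01"
  then have x: "\<xi> \<in> forms01" "\<xi>' \<in> forms01" by simp_all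
  have s: "\<xi> \<oplus>\<^bsub>Omega01\<^esub> \<xi>' \<in> forms01" using x G1.N.a_closed by simp
  show "wed (\<xi> \<oplus>\<^bsub>Omega01\<^esub> \<xi>') t = wed \<xi> t \<oplus>\<^bsub>G2.T\<^esub> wed \<xi>' t"
  proof (rule G1.tensor_ext[OF t wed_additive[OF s]
        additive_map_plus[OF G2.abelian_group_T wed_additive[OF x(1)] wed_additive[OF x(2)]]])
    fix g and \<eta> :: "'n form1" assume g: "g \<in> carrier G" and "\<eta> \<in> carrier Omega01"
    then have \<eta>: "\<eta> \<in> forms01" by simp
    show "wed (\<xi> \<oplus>\<^bsub>Omega01\<^esub> \<xi>') (G1.pt g \<eta>) = wed \<xi> (G1.pt g \<eta>) \<oplus>\<^bsub>G2.T\<^esub> wed \<xi>' (G1.pt g \<eta>)"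
      unfolding wed_pure[OF s g \<eta>] wed_pure[OF x(1) g \<eta>] wed_pure[OF x(2) g \<eta>] wedge_props(2)
      by (rule G2.pure_add_right[OF g]) (use x \<eta> in \<open>simp_all add: wedge_closed\<close>)
  qed
qed (simp add: wed_closed t)

definition "K2 g \<xi> = G2.pt g (dbar1 \<xi>) \<oplus>\<^bsub>G2.T\<^esub> wed \<xi> (nab g)"

lemma curvature_eq: "curvature G nab g = tensor_lift G2.T K2 (nab g)"
  by (simp add: curvature_def K2_def[abs_def] wed_def)

text \<open>As with \<open>phi\<close>, the two summands balance only together: the Leibniz term of
  the connection on g b, wedged with \<xi>, equals the Leibniz term of the Dolbeault operator on b
  \<xi>.\<close>

lemma balanced_K2: "balanced CP G Omega01 G2.T K2"
proof (rule balancedI)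
  show "additive_map Omega01 G2.T (K2 g)" if g: "g \<in> carrier G" for g
    unfolding K2_def[abs_def]
    by (rule additive_map_plus[OF G2.abelian_group_T
          additive_map_comp[OF dbar1_additive G2.pure_additive(1)[OF g]] wed_additive_left[OF c(5)[OF g]]])
  show "additive_map G G2.T (\<lambda>g. K2 g \<xi>)" if "\<xi> \<in> carrier Omega01" for \<xi>
  proof -
    have \<xi>: "\<xi> \<in> forms01" using that by simp
    have "dbar1 \<xi> \<in> carrier Omega02" using \<xi> by (simp add: dbar1_closed forms01D(1))
    from additive_map_plus[OF G2.abelian_group_T G2.pure_additive(2)[OF this] additive_map_comp[OF c(3) wed_additive[OF \<xi>]]]
    show ?thesis by (simp add: K2_def[abs_def])
  qed
  fix g and b :: "complex^'n \<Rightarrow> complex" and \<xi> :: "'n form1" assume g: "g \<in> carrier G" and b': "b \<in> carrier CP" and "\<xi> \<in> carrier Omega01"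
  then have \<xi>: "\<xi> \<in> forms01" and b: "b \<in> Cinf 0" by simp_all
  have d: "dbar0 b \<in> forms01" by (rule dbar0_closed[OF b])
  have w: "wedge (dbar0 b) \<xi> \<in> carrier Omega02" using wedge_closed[OF d \<xi>] by simp
  have x: "dbar1 \<xi> \<in> carrier Omega02" using \<xi> by (simp add: dbar1_closed forms01D(1))
  have l: "lact Omega02 b (dbar1 \<xi>) \<in> carrier Omega02" by (rule left_modD(3)[OF G2.left_N b' x])
  let ?w = "wed (lact Omega01 b \<xi>) (nab g)"
  have cw: "?w \<in> carrier G2.T" by (rule wed_closed[OF lact_closed[OF b \<xi>] c(5)[OF g]])
  have "K2 (ract G g b) \<xi> = G2.pt (ract G g b) (dbar1 \<xi>) \<oplus>\<^bsub>G2.T\<^esub> wed \<xi> (G1.pt g (dbar0 b) \<oplus>\<^bsub>G1.T\<^esub> G1.act (nab g) b)"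
    by (simp only: K2_def c(6)[OF g b'])
  also have "wed \<xi> (G1.pt g (dbar0 b) \<oplus>\<^bsub>G1.T\<^esub> G1.act (nab g) b) = G2.pt g (wedge (dbar0 b) \<xi>) \<oplus>\<^bsub>G2.T\<^esub> ?w"
    using additive_map_add[OF wed_additive[OF \<xi>] G1.pure_closed[OF g, of "dbar0 b"] G1.act_T_closed[OF c(5)[OF g] b']] d
    by (simp add: wed_pure \<xi> g wed_act c(5) b del: Omega_simps(5,8,9,10,13,14,15))
  also have "G2.pt (ract G g b) (dbar1 \<xi>) = G2.pt g (lact Omega02 b (dbar1 \<xi>))"
    by (rule G2.pure_balance[OF g b' x])
  also have "G2.pt g (lact Omega02 b (dbar1 \<xi>)) \<oplus>\<^bsub>G2.T\<^esub> (G2.pt g (wedge (dbar0 b) \<xi>) \<oplus>\<^bsub>G2.T\<^esub> ?w) =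
      G2.pt g (wedge (dbar0 b) \<xi>) \<oplus>\<^bsub>G2.T\<^esub> G2.pt g (lact Omega02 b (dbar1 \<xi>)) \<oplus>\<^bsub>G2.T\<^esub> ?w"
    using G2.pure_closed[OF g w] G2.pure_closed[OF g l] cw
    by (simp only: G2.T.a_ac G2.T.a_closed)
  also have "G2.pt g (wedge (dbar0 b) \<xi>) \<oplus>\<^bsub>G2.T\<^esub> G2.pt g (lact Omega02 b (dbar1 \<xi>)) = G2.pt g (dbar1 (lact Omega01 b \<xi>))"
    by (simp only: dbar1_props(2)[OF \<xi> b] G2.pure_add_right[OF g w l])
  finally show "K2 (ract G g b) \<xi> = K2 g (lact Omega01 b \<xi>)" by (simp only: K2_def)
qed

lemma lift_K2_additive: "additive_map G1.T G2.T (tensor_lift G2.T K2)"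
  by (rule G1.lift_additive[OF G2.abelian_group_T balanced_K2])

lemma lift_K2_pure: "g \<in> carrier G \<Longrightarrow> \<xi> \<in> forms01 \<Longrightarrow> tensor_lift G2.T K2 (G1.pt g \<xi>) = K2 g \<xi>"
  by (rule G1.lift_pure[OF G2.abelian_group_T balanced_K2]) simp_all

lemma curvature_additive: "additive_map G G2.T (curvature G nab)"
  unfolding curvature_eq[abs_def] by (rule additive_map_comp[OF c(3) lift_K2_additive])

text \<open>The lift of \<open>K2\<close> is not linear over functions. Its defect is t wedged with
  the Dolbeault differential of b; stating it additively avoids negatives.\<close>

lemma lift_K2_act:
  assumes t: "t \<in> carrier G1.T" and b: "b \<in> Cinf 0"
  shows "tensor_lift G2.T K2 (G1.act t b) \<oplus>\<^bsub>G2.T\<^esub> wed (dbar0 b) t = G2.act (tensor_lift G2.T K2 t) b"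
proof (rule G1.tensor_ext[OF t])
  have b': "b \<in> carrier CP" using b by simp
  have d: "dbar0 b \<in> forms01" by (rule dbar0_closed[OF b])
  show "additive_map G1.T G2.T (\<lambda>t. tensor_lift G2.T K2 (G1.act t b) \<oplus>\<^bsub>G2.T\<^esub> wed (dbar0 b) t)"
    by (rule additive_map_plus[OF G2.abelian_group_T additive_map_comp[OF G1.act_additive[OF b'] lift_K2_additive] wed_additive[OF d]])
  show "additive_map G1.T G2.T (\<lambda>t. G2.act (tensor_lift G2.T K2 t) b)"
    by (rule additive_map_comp[OF lift_K2_additive G2.act_additive[OF b']])
  fix g and \<xi> :: "'n form1" assume g: "g \<in> carrier G" and \<xi>': "\<xi> \<in> carrier Omega01"
  then have \<xi>: "\<xi> \<in> forms01" by simp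
  have x: "dbar1 \<xi> \<in> carrier Omega02" using \<xi> by (simp add: dbar1_closed forms01D(1))
  have r: "ract Omega01 \<xi> b \<in> forms01" by (rule ract_closed[OF b \<xi>])
  have y: "dbar1 (ract Omega01 \<xi> b) \<in> carrier Omega02" using r by (simp add: dbar1_closed forms01D(1) del: Omega_simps(9))
  have w: "wedge \<xi> (dbar0 b) \<in> carrier Omega02" using wedge_closed[OF \<xi> d] by simp
  let ?w = "wed (ract Omega01 \<xi> b) (nab g)"
  have cw: "?w \<in> carrier G2.T" by (rule wed_closed[OF r c(5)[OF g]])
  have "tensor_lift G2.T K2 (G1.act (G1.pt g \<xi>) b) \<oplus>\<^bsub>G2.T\<^esub> wed (dbar0 b) (G1.pt g \<xi>) =
      (G2.pt g (dbar1 (ract Omega01 \<xi> b)) \<oplus>\<^bsub>G2.T\<^esub> ?w) \<oplus>\<^bsub>G2.T\<^esub> G2.pt g (wedge \<xi> (dbar0 b))"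
    by (simp only: G1.act_pure[OF g \<xi>' b'] lift_K2_pure[OF g r] K2_def wed_pure[OF d g \<xi>])
  also have "\<dots> = G2.pt g (dbar1 (ract Omega01 \<xi> b)) \<oplus>\<^bsub>G2.T\<^esub> G2.pt g (wedge \<xi> (dbar0 b)) \<oplus>\<^bsub>G2.T\<^esub> ?w"
    using G2.pure_closed[OF g y] G2.pure_closed[OF g w] cw by (simp only: G2.T.a_ac G2.T.a_closed)
  also have "G2.pt g (dbar1 (ract Omega01 \<xi> b)) \<oplus>\<^bsub>G2.T\<^esub> G2.pt g (wedge \<xi> (dbar0 b)) = G2.pt g (ract Omega02 (dbar1 \<xi>) b)"
    by (simp only: G2.pure_add_right[OF g y w, symmetric] dbar1_props(3)[OF \<xi> b])
  also have "\<dots> = G2.act (G2.pt g (dbar1 \<xi>)) b"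
    by (rule G2.act_pure[OF g x b', symmetric])
  also have "?w = G2.act (wed \<xi> (nab g)) b"
    by (rule act_wed[OF \<xi> c(5)[OF g] b, symmetric])
  also have "G2.act (G2.pt g (dbar1 \<xi>)) b \<oplus>\<^bsub>G2.T\<^esub> G2.act (wed \<xi> (nab g)) b = G2.act (K2 g \<xi>) b"
    unfolding K2_def by (rule G2.act_add[symmetric]) (simp_all add: g x wed_closed \<xi> c(5) b G2.pure_closed dbar1_closed forms01D(1))
  finally show "tensor_lift G2.T K2 (G1.act (G1.pt g \<xi>) b) \<oplus>\<^bsub>G2.T\<^esub> wed (dbar0 b) (G1.pt g \<xi>) =
      G2.act (tensor_lift G2.T K2 (G1.pt g \<xi>)) b"
    by (simp only: lift_K2_pure[OF g \<xi>])
qed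

text \<open>The Leibniz term of the connection enters \<open>K2\<close> in two ways. One summand
  carries the second Dolbeault derivative of b and vanishes by \<open>dbar1_dbar0\<close>; the other
  is exactly the defect recorded in \<open>lift_K2_act\<close>.\<close>

lemma curvature_act:
  assumes g: "g \<in> carrier G" and b: "b \<in> Cinf 0"
  shows "curvature G nab (ract G g b) = G2.act (curvature G nab g) b"
proof -
  have b': "b \<in> carrier CP" using b by simp
  have d: "dbar0 b \<in> forms01" by (rule dbar0_closed[OF b])
  have w: "wed (dbar0 b) (nab g) \<in> carrier G2.T" by (rule wed_closed[OF d c(5)[OF g]])
  have l: "tensor_lift G2.T K2 (G1.act (nab g) b) \<in> carrier G2.T"
    by (rule additive_map_closed[OF lift_K2_additive G1.act_T_closed[OF c(5)[OF g] b']])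
  have "K2 g (dbar0 b) = wed (dbar0 b) (nab g)"
  proof -
    have "dbar1 (dbar0 b) = \<zero>\<^bsub>Omega02\<^esub>" using dbar1_dbar0[OF b] by simp
    then show ?thesis using G2.pure_zero(1)[OF g] w by (simp only: K2_def G2.T.l_zero)
  qed
  then have "curvature G nab (ract G g b) = wed (dbar0 b) (nab g) \<oplus>\<^bsub>G2.T\<^esub> tensor_lift G2.T K2 (G1.act (nab g) b)"
    using additive_map_add[OF lift_K2_additive G1.pure_closed[OF g, of "dbar0 b"] G1.act_T_closed[OF c(5)[OF g] b']] d
    by (simp add: curvature_eq c(6)[OF g b'] lift_K2_pure[OF g d])
  also have "\<dots> = tensor_lift G2.T K2 (G1.act (nab g) b) \<oplus>\<^bsub>G2.T\<^esub> wed (dbar0 b) (nab g)"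
    by (rule G2.T.a_comm[OF w l])
  finally show ?thesis
    by (simp only: lift_K2_act[OF c(5)[OF g] b] curvature_eq)
qed

end

text \<open>Each ingredient, \<open>wed\<close>, \<open>K2\<close> and its lift, commutes with T
  \<otimes> id because T acts only on the module factor and all differentiation of forms acts on the
  other.\<close>

lemma curvature_nat:
  assumes X: "dbar_connection G nab" and Y: "dbar_connection H nab'" and T: "T \<in> right_module_hom CP G H"
    and nat: "\<And>g. g \<in> carrier G \<Longrightarrow> nab' (T g) = map_tensor_id CP G H Omega01 T (nab g)" and g: "g \<in> carrier G"
  shows "curvature H nab' (T g) = map_tensor_id CP G H Omega02 T (curvature G nab g)"
proof -
  interpret X: dbar_connection G nab by fact
  interpret Y: dbar_connection H nab' by fact
  interpret T1: tensor_map CP G Omega01 H T by (rule tensor_mapI[OF X.c(1) Y.c(1) bimoduleD(2)[OF bimodule_Omega01] T])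
  interpret T2: tensor_map CP G Omega02 H T by (rule tensor_mapI[OF X.c(1) Y.c(1) bimoduleD(2)[OF bimodule_Omega02] T])
  note Tc = right_module_homD(3)[OF T]
  have wed: "Y.wed \<xi> (T1.Uid t) = T2.Uid (X.wed \<xi> t)" if \<xi>: "\<xi> \<in> forms01" and t: "t \<in> carrier X.G1.T" for \<xi> t
    by (rule X.G1.tensor_ext[OF t additive_map_comp[OF T1.Uid_additive Y.wed_additive[OF \<xi>]]
          additive_map_comp[OF X.wed_additive[OF \<xi>] T2.Uid_additive]])
       (simp add: T1.Uid_pure T2.Uid_pure X.wed_pure Y.wed_pure \<xi> Tc wedge_closed)
  have K: "Y.K2 (T h) \<xi> = T2.Uid (X.K2 h \<xi>)" if h: "h \<in> carrier G" and \<xi>: "\<xi> \<in> forms01" for h \<xi>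
  proof -
    have x: "dbar1 \<xi> \<in> carrier Omega02" using \<xi> by (simp add: dbar1_closed forms01D(1))
    show ?thesis
      unfolding X.K2_def Y.K2_def nat[OF h] wed[OF \<xi> X.c(5)[OF h]]
        additive_map_add[OF T2.Uid_additive X.G2.pure_closed[OF h x] X.wed_closed[OF \<xi> X.c(5)[OF h]]] T2.Uid_pure[OF h x] ..
  qed
  have "tensor_lift Y.G2.T Y.K2 (T1.Uid t) = T2.Uid (tensor_lift X.G2.T X.K2 t)" if t: "t \<in> carrier X.G1.T" for t
    by (rule X.G1.tensor_ext[OF t additive_map_comp[OF T1.Uid_additive Y.lift_K2_additive]
          additive_map_comp[OF X.lift_K2_additive T2.Uid_additive]])
       (simp add: T1.Uid_pure X.lift_K2_pure Y.lift_K2_pure Tc K)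
  then show ?thesis
    by (simp add: X.curvature_eq Y.curvature_eq nat[OF g] X.c(5)[OF g])
qed

section \<open>The composite functor\<close>

lemma additive_map_neg: "abelian_group G \<Longrightarrow> additive_map G G (\<lambda>x. \<ominus>\<^bsub>G\<^esub> x)"
proof (rule additive_mapI)
  assume "abelian_group G"
  then interpret abelian_group G .
  show "\<ominus>\<^bsub>G\<^esub> (x \<oplus>\<^bsub>G\<^esub> y) = \<ominus>\<^bsub>G\<^esub> x \<oplus>\<^bsub>G\<^esub> \<ominus>\<^bsub>G\<^esub> y" if "x \<in> carrier G" "y \<in> carrier G" for x y
    using that by (rule minus_add)
qed (rule abelian_group.a_inv_closed)

context abelian_group
begin

lemma finsum_diff:
  assumes "f \<in> I \<rightarrow> carrier G" "g \<in> I \<rightarrow> carrier G"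
  shows "finsum G (\<lambda>i. f i \<ominus>\<^bsub>G\<^esub> g i) I = finsum G f I \<ominus>\<^bsub>G\<^esub> finsum G g I"
proof -
  have "finsum G (\<lambda>i. \<ominus>\<^bsub>G\<^esub> g i) I = \<ominus>\<^bsub>G\<^esub> finsum G g I"
    by (rule additive_map_finsum[OF abelian_group_axioms abelian_group_axioms additive_map_neg[OF abelian_group_axioms] assms(2), symmetric])
  then show ?thesis
    using finsum_addf[OF assms(1), of "\<lambda>i. \<ominus>\<^bsub>G\<^esub> g i"] assms by (simp add: minus_eq Pi_iff)
qed

lemma finsum_swap:
  assumes "finite I" "\<And>i j. i \<in> I \<Longrightarrow> j \<in> J \<Longrightarrow> f i j \<in> carrier G"
  shows "(\<Oplus>\<^bsub>G\<^esub>i\<in>I. \<Oplus>\<^bsub>G\<^esub>j\<in>J. f i j) = (\<Oplus>\<^bsub>G\<^esub>j\<in>J. \<Oplus>\<^bsub>G\<^esub>i\<in>I. f i j)"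
  using assms
proof (induction I)
  case (insert x I)
  have c: "(\<lambda>j. f x j) \<in> J \<rightarrow> carrier G" "(\<lambda>j. \<Oplus>\<^bsub>G\<^esub>i\<in>I. f i j) \<in> J \<rightarrow> carrier G"
    "(\<lambda>i. \<Oplus>\<^bsub>G\<^esub>j\<in>J. f i j) \<in> I \<rightarrow> carrier G" "(\<Oplus>\<^bsub>G\<^esub>j\<in>J. f x j) \<in> carrier G"
    using insert.prems by (auto intro!: finsum_closed)
  have "(\<Oplus>\<^bsub>G\<^esub>j\<in>J. \<Oplus>\<^bsub>G\<^esub>i\<in>insert x I. f i j) = (\<Oplus>\<^bsub>G\<^esub>j\<in>J. f x j \<oplus>\<^bsub>G\<^esub> (\<Oplus>\<^bsub>G\<^esub>i\<in>I. f i j))"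
    by (rule finsum_cong') (use insert c in \<open>auto simp: Pi_iff intro!: finsum_insert\<close>)
  then show ?case
    using insert c by (simp add: finsum_addf)
qed simp

lemma finsum_delta:
  assumes "finite I" "k \<in> I" "\<And>i. i \<in> I \<Longrightarrow> f i \<in> carrier G"
  shows "(\<Oplus>\<^bsub>G\<^esub>i\<in>I. if k = i then f i else \<zero>\<^bsub>G\<^esub>) = f k"
  using add.finprod_singleton[of k I f] assms by (simp add: Pi_iff)

end

text \<open>The matrix product of a row with a column, bilinear without conjugation. It names the
  scalar occurring in \<open>identification\<close>.\<close>

definition rdot :: "complex^'n \<Rightarrow> complex^'n \<Rightarrow> complex" where
  "rdot r h = (\<Sum>i\<in>UNIV. r $ i * h $ i)"

lemma rdot_add: "rdot (r + r') h = rdot r h + rdot r' h" "rdot r (h + h') = rdot r h + rdot r h'"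
  by (simp_all add: rdot_def sum.distrib algebra_simps)

lemma rdot_scale: "rdot (c *s r) h = c * rdot r h" "rdot r (c *s h) = c * rdot r h"
  by (simp_all add: rdot_def sum_distrib_left algebra_simps)

lemma rdot_matrix: "rdot (r v* a) h = rdot r (a *v h)"
  unfolding rdot_def vector_matrix_mult_def matrix_vector_mult_def
  by (simp add: sum_distrib_left sum_distrib_right mult_ac) (rule sum.swap)

lemma rdot_axis: "rdot (axis i 1) (axis j 1) = (if i = j then 1 else 0)"
  by (auto simp: rdot_def axis_def if_distrib[of "\<lambda>x. x * _"] cong: if_cong)

lemma row_matrix_vector: "row_matrix i r *v h = rdot r h *s axis i 1"
  by (auto simp: vec_eq_iff row_matrix_def matrix_vector_mult_def rdot_def axis_def)

lemma mat_vector: "mat c *v h = c *s h" for h :: "complex^'n::finite"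
  by (simp add: vec_eq_iff matrix_vector_mult_def mat_def if_distrib[of "\<lambda>x. x * _"] cong: if_cong)

lemma matrix_unit_vector: "matrix_unit p i *v axis i 1 = axis p (1::complex)"
  by (auto simp: vec_eq_iff matrix_unit_def matrix_vector_mult_def axis_def if_distrib[of "\<lambda>x. _ * x"] cong: if_cong)

interpretation BC: bimodule_connection Mat Omega_uni d_uni CP Omega1 d0
  "E_mod :: (complex^'n::finite^'n, complex^'n \<Rightarrow> complex, 'n E_type) bimod" nabla_E sigma_E
proof
  show "right_bimodule_connection Mat Omega_uni d_uni CP Omega1 d0
      (E_mod :: (complex^'n^'n, complex^'n \<Rightarrow> complex, 'n E_type) bimod) nabla_E sigma_E"
    using is_sigma_E_sigma_E by (simp add: is_sigma_E_def)
  show "d_uni a \<in> carrier Omega_uni" for a :: "complex^'n^'n" by (rule d_uni_closed)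
  show "d0 b \<in> carrier (Omega1 :: (complex^'n \<Rightarrow> complex, complex^'n \<Rightarrow> complex, 'n form1) bimod)" if "b \<in> carrier CP" for b :: "complex^'n \<Rightarrow> complex"
    using that by (simp add: d0_closed)
qed (rule bimodule_Omega_uni)

section \<open>The identification of F \<otimes> E with V \<otimes> C_-1\<close>

context matrix_module
begin

sublocale VC: tensor_right complex_ring "underlying_space V"
    "Cinf_module (-1) :: (complex, complex^'n \<Rightarrow> complex, complex^'n \<Rightarrow> complex) bimod" CP
  by (rule tensor_rightI[OF right_us bimodule_Cinf])

lemma VC_mod_simps [simp]:
  "carrier (VC_mod V) = carrier VC.T" "zero (VC_mod V) = \<zero>\<^bsub>VC.T\<^esub>" "add (VC_mod V) = add VC.T"
  "ract (VC_mod V) = VC.act" "tensor_lift (VC_mod V) = tensor_lift VC.T"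
  by (simp_all add: VC_mod_def)

lemma additive_map_VC_mod [simp]:
  "additive_map (VC_mod V) = (additive_map VC.T :: ('c, 'w) ring_scheme \<Rightarrow> _)"
  "additive_map G (VC_mod V) = additive_map G VC.T"
  by (simp_all add: additive_map_def fun_eq_iff)

lemma VC_tensor_eq: "VC_tensor V = VC.pt"
  by (simp add: VC_tensor_def)

lemma right_VC: "right_module CP (VC_mod V)"
  unfolding VC_mod_def by (rule VC.right_module_T)

sublocale CT: connection_tensor Mat Omega_uni d_uni CP Omega1 d0
    "E_mod :: (complex^'n^'n, complex^'n \<Rightarrow> complex, 'n E_type) bimod" nabla_E sigma_E "F_mod V" nabF
  by unfold_locales (rule right_connection_nabF)

text \<open>\<open>id1\<close> and \<open>id2\<close> are the inner stages of the nested lifts in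
  \<open>identification\<close>; each must be shown balanced before the next lift is
  meaningful.\<close>

definition "id1 w r e = tensor_lift VC.T (\<lambda>h f. VC.pt (mat (rdot r h) \<odot>\<^bsub>V\<^esub> w) f) e"
definition "id2 x e = tensor_lift VC.T (\<lambda>w r. id1 w r e) x"

lemma pt_scale: "w \<in> carrier V \<Longrightarrow> f \<in> Cinf (-1) \<Longrightarrow> VC.pt (mat c \<odot>\<^bsub>V\<^esub> w) f = VC.pt w (\<lambda>v\<in>Sph. c * f v)"
  using VC.pure_balance[of w c f] by simp

lemma act_V_mat_additive: "w \<in> carrier V \<Longrightarrow> additive_map complex_ring V (\<lambda>c. mat c \<odot>\<^bsub>V\<^esub> w)"
  using right_moduleD(5)[OF right_us, of w] by simp

lemma balanced_id1:
  assumes w: "w \<in> carrier V"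
  shows "balanced complex_ring Col (Cinf_module (-1)) VC.T (\<lambda>h f. VC.pt (mat (rdot r h) \<odot>\<^bsub>V\<^esub> w) f)"
proof (rule balancedI)
  show "additive_map (Cinf_module (-1)) VC.T (VC.pt (mat (rdot r h) \<odot>\<^bsub>V\<^esub> w))" for h
    by (rule VC.pure_additive(1)) (simp add: act_V w)
  fix f assume f: "f \<in> carrier (Cinf_module (-1) :: (complex, complex^'n \<Rightarrow> complex, complex^'n \<Rightarrow> complex) bimod)"
  have "additive_map Col complex_ring (rdot r)" by (simp add: additive_map_def rdot_add)
  from additive_map_comp[OF additive_map_comp[OF this act_V_mat_additive[OF w]] VC.pure_additive(2)[OF f, simplified]]
  show "additive_map Col VC.T (\<lambda>h. VC.pt (mat (rdot r h) \<odot>\<^bsub>V\<^esub> w) f)" .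
  show "VC.pt (mat (rdot r (ract Col h c)) \<odot>\<^bsub>V\<^esub> w) f = VC.pt (mat (rdot r h) \<odot>\<^bsub>V\<^esub> w) (lact (Cinf_module (-1)) c f)" for h c
    using pt_scale[OF act_V[OF w], of f c "mat (rdot r h)"] f by (simp add: act_V_mult w rdot_scale mat_mat)
qed

lemma id1_additive: "w \<in> carrier V \<Longrightarrow> additive_map EM.T VC.T (id1 w r)"
  unfolding id1_def[abs_def] by (rule EM.lift_additive[OF VC.abelian_group_T balanced_id1])

lemma id1_pure: "w \<in> carrier V \<Longrightarrow> f \<in> Cinf (-1) \<Longrightarrow> id1 w r (EM.pt h f) = VC.pt (mat (rdot r h) \<odot>\<^bsub>V\<^esub> w) f"
  unfolding id1_def by (rule EM.lift_pure[OF VC.abelian_group_T balanced_id1]) simp_all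

lemma id1_closed: "w \<in> carrier V \<Longrightarrow> e \<in> carrier EM.T \<Longrightarrow> id1 w r e \<in> carrier VC.T"
  by (rule additive_map_closed[OF id1_additive])

lemma balanced_id2:
  fixes e :: "'n E_type"
  assumes e: "e \<in> carrier EM.T"
  shows "balanced complex_ring (underlying_space V) Row VC.T (\<lambda>w r. id1 w r e)"
proof (rule balancedI)
  fix w assume "w \<in> carrier (underlying_space V)"
  then have w: "w \<in> carrier V" by simp
  show "additive_map Row VC.T (\<lambda>r. id1 w r e)"
  proof (rule additive_mapI)
    fix r r' :: "complex^'n"
    have "id1 w (r + r') e = id1 w r e \<oplus>\<^bsub>VC.T\<^esub> id1 w r' e"
    proof (rule EM.tensor_ext[OF e id1_additive[OF w]
          additive_map_plus[OF VC.abelian_group_T id1_additive[OF w] id1_additive[OF w]]])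
      fix h :: "complex^'n" and f :: "complex^'n \<Rightarrow> complex" assume f: "f \<in> carrier (Cinf_module (-1))"
      show "id1 w (r + r') (EM.pt h f) = id1 w r (EM.pt h f) \<oplus>\<^bsub>VC.T\<^esub> id1 w r' (EM.pt h f)"
        using additive_map_add[OF act_V_mat_additive[OF w], of "rdot r h" "rdot r' h"] VC.pure_add_left[OF _ _ f] f
        by (simp add: id1_pure w rdot_add act_V)
    qed
    then show "id1 w (r \<oplus>\<^bsub>Row\<^esub> r') e = id1 w r e \<oplus>\<^bsub>VC.T\<^esub> id1 w r' e" by simp
  qed (simp add: id1_closed w e)
  fix c and r :: "complex^'n"
  have cw: "mat c \<odot>\<^bsub>V\<^esub> w \<in> carrier V" by (rule act_V[OF w])
  have "id1 (mat c \<odot>\<^bsub>V\<^esub> w) r e = id1 w (c *s r) e"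
    by (rule EM.tensor_ext[OF e id1_additive[OF cw] id1_additive[OF w]])
       (simp add: id1_pure cw w act_V_mult rdot_scale mult.commute[of c] flip: mat_mat)
  then show "id1 (ract (underlying_space V) w c) r e = id1 w (lact Row c r) e" by simp
next
  fix r :: "complex^'n"
  show "additive_map (underlying_space V) VC.T (\<lambda>w. id1 w r e)"
    unfolding additive_map_us
  proof (rule additive_mapI)
    fix w w' assume w: "w \<in> carrier V" and w': "w' \<in> carrier V"
    have s: "w \<oplus>\<^bsub>V\<^esub> w' \<in> carrier V" using w w' by simp
    show "id1 (w \<oplus>\<^bsub>V\<^esub> w') r e = id1 w r e \<oplus>\<^bsub>VC.T\<^esub> id1 w' r e"
    proof (rule EM.tensor_ext[OF e id1_additive[OF s]
          additive_map_plus[OF VC.abelian_group_T id1_additive[OF w] id1_additive[OF w']]])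
      fix h :: "complex^'n" and f :: "complex^'n \<Rightarrow> complex" assume f: "f \<in> carrier (Cinf_module (-1))"
      show "id1 (w \<oplus>\<^bsub>V\<^esub> w') r (EM.pt h f) = id1 w r (EM.pt h f) \<oplus>\<^bsub>VC.T\<^esub> id1 w' r (EM.pt h f)"
        using VC.pure_add_left[OF _ _ f, of "mat (rdot r h) \<odot>\<^bsub>V\<^esub> w" "mat (rdot r h) \<odot>\<^bsub>V\<^esub> w'"] f
        by (simp add: id1_pure w w' s act_V additive_map_add[OF act_V_additive])
    qed
  qed (simp add: id1_closed e)
qed

lemma id2_additive: "e \<in> carrier EM.T \<Longrightarrow> additive_map VR.T VC.T (\<lambda>x. id2 x e)"
  unfolding id2_def[abs_def] by (rule VR.lift_additive[OF VC.abelian_group_T balanced_id2])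

lemma id2_pure: "e \<in> carrier EM.T \<Longrightarrow> w \<in> carrier V \<Longrightarrow> id2 (VR.pt w r) e = id1 w r e"
  unfolding id2_def by (rule VR.lift_pure[OF VC.abelian_group_T balanced_id2]) simp_all

lemma id2_closed: "e \<in> carrier EM.T \<Longrightarrow> x \<in> carrier VR.T \<Longrightarrow> id2 x e \<in> carrier VC.T"
  by (rule additive_map_closed[OF id2_additive])

lemma id2_additive_right:
  assumes x: "x \<in> carrier VR.T"
  shows "additive_map EM.T VC.T (id2 x)"
proof (rule additive_mapI)
  fix e e' :: "'n E_type" assume e: "e \<in> carrier EM.T" and e': "e' \<in> carrier EM.T"
  have s: "e \<oplus>\<^bsub>EM.T\<^esub> e' \<in> carrier EM.T" using e e' by simp
  show "id2 x (e \<oplus>\<^bsub>EM.T\<^esub> e') = id2 x e \<oplus>\<^bsub>VC.T\<^esub> id2 x e'"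
    by (rule VR.tensor_ext[OF x id2_additive[OF s]
          additive_map_plus[OF VC.abelian_group_T id2_additive[OF e] id2_additive[OF e']]])
       (simp add: id2_pure e e' s additive_map_add[OF id1_additive])
qed (simp add: id2_closed x)

lemma balanced_id3: "balanced Mat (F_mod V) E_mod VC.T id2"
proof (rule balancedI)
  fix x and a :: "complex^'n^'n" and e :: "'n E_type" assume "x \<in> carrier (F_mod V)" and "e \<in> carrier E_mod"
  then have x: "x \<in> carrier VR.T" and e: "e \<in> carrier EM.T" by simp_all
  have ae: "EM.lac a e \<in> carrier EM.T" using EM.lac_closed[OF e, of a] by simp
  have aa: "additive_map VR.T VR.T (\<lambda>x. VR.act x a)" using VR.act_additive[of a] by simp
  have al: "additive_map EM.T EM.T (EM.lac a)" using EM.lac_additive[of a] by simp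
  have "id2 (VR.act x a) e = id2 x (EM.lac a e)"
  proof (rule VR.tensor_ext[OF x additive_map_comp[OF aa id2_additive[OF e]] id2_additive[OF ae]])
    fix w and r :: "complex^'n" assume "w \<in> carrier (underlying_space V)"
    then have w: "w \<in> carrier V" by simp
    have "id1 w (r v* a) e = id1 w r (EM.lac a e)"
    proof (rule EM.tensor_ext[OF e id1_additive[OF w] additive_map_comp[OF al id1_additive[OF w]]])
      fix h :: "complex^'n" and f :: "complex^'n \<Rightarrow> complex" assume f: "f \<in> carrier (Cinf_module (-1))"
      show "id1 w (r v* a) (EM.pt h f) = id1 w r (EM.lac a (EM.pt h f))"
        using EM.lac_pure[of h f a] f by (simp add: id1_pure w rdot_matrix)
    qed
    then show "id2 (VR.act (VR.pt w r) a) e = id2 (VR.pt w r) (EM.lac a e)"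
      using VR.act_pure[of w r a] w by (simp add: id2_pure e ae)
  qed
  then show "id2 (ract (F_mod V) x a) e = id2 x (lact E_mod a e)" by simp
qed (simp_all add: id2_additive id2_additive_right)

lemma identification_eq: "t \<in> carrier CT.FE.T \<Longrightarrow> identification V t = tensor_lift VC.T id2 t"
  by (simp add: identification_def VC_tensor_eq id2_def[abs_def] id1_def rdot_def[abs_def])

lemma identification_additive: "additive_map CT.FE.T VC.T (identification V)"
  by (rule additive_map_cong[OF CT.FE.abelian_group_T CT.FE.lift_additive[OF VC.abelian_group_T balanced_id3] identification_eq])

lemma identification_pure: "x \<in> carrier (F_mod V) \<Longrightarrow> e \<in> carrier E_mod \<Longrightarrow> identification V (CT.FE.pt x e) = id2 x e"
  using CT.FE.lift_pure[OF VC.abelian_group_T balanced_id3, of x e] CT.FE.pure_closed[of x e] identification_eq[of "CT.FE.pt x e"] by simp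

lemma identification_tensor:
  assumes w: "w \<in> carrier V" and f: "f \<in> Cinf (-1)"
  shows "identification V (CT.FE.pt (VR.pt w r) (EM.pt h f)) = VC.pt (mat (rdot r h) \<odot>\<^bsub>V\<^esub> w) f"
proof -
  have e: "EM.pt h f \<in> carrier EM.T" by (rule EM.pure_closed) (simp_all add: f)
  show ?thesis
    using identification_pure[of "VR.pt w r" "EM.pt h f"] VR.pure_closed[of w r] e
    by (simp add: w id2_pure id1_pure f)
qed

lemma identification_hom: "identification V \<in> right_module_hom CP (rtensor Mat (F_mod V) E_mod) (VC_mod V)"
proof (rule right_module_homI)
  show "identification V \<in> extensional (carrier (rtensor Mat (F_mod V) E_mod))"
    by (simp add: identification_def)
  show "additive_map (rtensor Mat (F_mod V) E_mod) (VC_mod V) (identification V)"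
    by (simp add: identification_additive)
  fix t and b :: "complex^'n \<Rightarrow> complex" assume "t \<in> carrier (rtensor Mat (F_mod V) E_mod)" and b: "b \<in> carrier CP"
  then have t: "t \<in> carrier CT.FE.T" by simp
  have "identification V (CT.FE.act t b) = VC.act (identification V t) b"
  proof (rule CT.FE.tensor_ext[OF t additive_map_comp[OF CT.FE.act_additive[OF b] identification_additive]
        additive_map_comp[OF identification_additive VC.act_additive[OF b]]])
    fix x and e :: "'n E_type" assume x': "x \<in> carrier (F_mod V)" and e': "e \<in> carrier E_mod"
    then have x: "x \<in> carrier VR.T" and e: "e \<in> carrier EM.T" by simp_all
    have eb: "EM.act e b \<in> carrier EM.T" by (rule EM.act_T_closed[OF e b])
    have "id2 x (EM.act e b) = VC.act (id2 x e) b"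
    proof (rule VR.tensor_ext[OF x id2_additive[OF eb] additive_map_comp[OF id2_additive[OF e] VC.act_additive[OF b]]])
      fix w and r :: "complex^'n" assume "w \<in> carrier (underlying_space V)"
      then have w: "w \<in> carrier V" by simp
      have "id1 w r (EM.act e b) = VC.act (id1 w r e) b"
      proof (rule EM.tensor_ext[OF e additive_map_comp[OF EM.act_additive[OF b] id1_additive[OF w]]
            additive_map_comp[OF id1_additive[OF w] VC.act_additive[OF b]]])
        fix h :: "complex^'n" and f :: "complex^'n \<Rightarrow> complex" assume f: "f \<in> carrier (Cinf_module (-1))"
        have fb: "(\<lambda>v\<in>Sph. f v * b v) \<in> Cinf (-1)" by (rule Cinf_mult[of f "-1" b 0]) (use f b in simp_all)
        show "id1 w r (EM.act (EM.pt h f) b) = VC.act (id1 w r (EM.pt h f)) b"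
          using EM.act_pure[OF _ f b, of h] VC.act_pure[OF _ f b, of "mat (rdot r h) \<odot>\<^bsub>V\<^esub> w"] f id1_pure[OF w fb, of r h]
          by (simp add: id1_pure w act_V)
      qed
      then show "id2 (VR.pt w r) (EM.act e b) = VC.act (id2 (VR.pt w r) e) b"
        by (simp add: id2_pure w e eb)
    qed
    then show "identification V (CT.FE.act (CT.FE.pt x e) b) = VC.act (identification V (CT.FE.pt x e)) b"
      using CT.FE.act_pure[OF x' e' b] identification_pure[OF x' e'] identification_pure[OF x', of "EM.act e b"] eb by simp
  qed
  then show "identification V (ract (rtensor Mat (F_mod V) E_mod) t b) = ract (VC_mod V) (identification V t) b" by simp
qed

text \<open>Inserts r_i \<otimes> h_i, which pairs to 1. Any index i yields the inverse.\<close>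

definition "ident_inv i y = tensor_lift CT.FE.T (\<lambda>w f. CT.FE.pt (VR.pt w (axis i 1)) (EM.pt (axis i 1) f)) y"

lemma pure_scale:
  assumes w: "w \<in> carrier V" and f: "f \<in> Cinf (-1)"
  shows "CT.FE.pt (VR.pt (mat c \<odot>\<^bsub>V\<^esub> w) (axis i 1)) (EM.pt (axis i 1) f) =
    CT.FE.pt (VR.pt w (axis i 1)) (EM.pt (c *s axis i 1) f)"
proof -
  have x: "VR.pt w (axis i 1) \<in> carrier (F_mod V)" using VR.pure_closed[of w "axis i 1"] w by simp
  have e: "EM.pt (axis i 1) f \<in> carrier E_mod" using EM.pure_closed[of "axis i 1" f] f by simp
  have "VR.pt (mat c \<odot>\<^bsub>V\<^esub> w) (axis i 1) = VR.act (VR.pt w (axis i 1)) (mat c)"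
    using VR.pure_balance[of w c "axis i 1"] VR.act_pure[of w "axis i 1" "mat c"] w by (simp add: axis_mat)
  then show ?thesis
    using CT.FE.pure_balance[OF x _ e, of "mat c"] EM.lac_pure[of "axis i 1" f "mat c"] f by (simp add: mat_vector)
qed

lemma balanced_ident_inv:
  "balanced complex_ring (underlying_space V) (Cinf_module (-1)) CT.FE.T
     (\<lambda>w f. CT.FE.pt (VR.pt w (axis i 1)) (EM.pt (axis i 1) f))"
proof (rule balancedI)
  show "additive_map (Cinf_module (-1)) CT.FE.T (\<lambda>f. CT.FE.pt (VR.pt w (axis i 1)) (EM.pt (axis i 1) f))"
    if "w \<in> carrier (underlying_space V)" for w
    using additive_map_comp[OF EM.pure_additive(1)[of "axis i 1"], of CT.FE.T "CT.FE.pt (VR.pt w (axis i 1))"]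
      CT.FE.pure_additive(1)[of "VR.pt w (axis i 1)"] VR.pure_closed[of w "axis i 1"] that by simp
  fix f :: "complex^'n \<Rightarrow> complex" assume "f \<in> carrier (Cinf_module (-1))"
  then have f: "f \<in> Cinf (-1)" by simp
  show "additive_map (underlying_space V) CT.FE.T (\<lambda>w. CT.FE.pt (VR.pt w (axis i 1)) (EM.pt (axis i 1) f))"
    using additive_map_comp[OF VR.pure_additive(2)[of "axis i 1"], of CT.FE.T "\<lambda>x. CT.FE.pt x (EM.pt (axis i 1) f)"]
      CT.FE.pure_additive(2)[of "EM.pt (axis i 1) f"] EM.pure_closed[of "axis i 1" f] f by simp
  show "CT.FE.pt (VR.pt (ract (underlying_space V) w c) (axis i 1)) (EM.pt (axis i 1) f) =
      CT.FE.pt (VR.pt w (axis i 1)) (EM.pt (axis i 1) (lact (Cinf_module (-1)) c f))"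
    if "w \<in> carrier (underlying_space V)" for w c
    using that pure_scale[OF _ f, of w c i] EM.pure_balance[of "axis i 1" c f] f by simp
qed

lemma ident_inv_additive: "additive_map VC.T CT.FE.T (ident_inv i)"
  unfolding ident_inv_def[abs_def] by (rule VC.lift_additive[OF CT.FE.abelian_group_T balanced_ident_inv])

lemma ident_inv_pure: "w \<in> carrier V \<Longrightarrow> f \<in> Cinf (-1) \<Longrightarrow>
    ident_inv i (VC.pt w f) = CT.FE.pt (VR.pt w (axis i 1)) (EM.pt (axis i 1) f)"
  unfolding ident_inv_def by (rule VC.lift_pure[OF CT.FE.abelian_group_T balanced_ident_inv]) simp_all

lemma ident_inv_left: "y \<in> carrier VC.T \<Longrightarrow> identification V (ident_inv i y) = y"
  by (rule VC.tensor_ext[OF _ additive_map_comp[OF ident_inv_additive identification_additive] additive_map_id])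
     (simp_all add: ident_inv_pure identification_tensor rdot_axis act_V_one)

text \<open>The contracted scalar can be recovered: (r h) h_i = (h_i r) h, and the matrix h_i r
  moves across the tensor product over matrices, where r_i (h_i r) = r restores the row.\<close>

lemma ident_inv_right:
  assumes t: "t \<in> carrier CT.FE.T"
  shows "ident_inv i (identification V t) = t"
proof (rule CT.FE.tensor_ext[OF t additive_map_comp[OF identification_additive ident_inv_additive] additive_map_id])
  fix x and e :: "'n E_type" assume x': "x \<in> carrier (F_mod V)" and e': "e \<in> carrier E_mod"
  then have x: "x \<in> carrier VR.T" and e: "e \<in> carrier EM.T" by simp_all
  have "ident_inv i (id2 x e) = CT.FE.pt x e"
  proof (rule VR.tensor_ext[OF x additive_map_comp[OF id2_additive[OF e] ident_inv_additive]])
    show "additive_map VR.T CT.FE.T (\<lambda>x. CT.FE.pt x e)" using CT.FE.pure_additive(2)[OF e'] by simp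
    fix w and r :: "complex^'n" assume "w \<in> carrier (underlying_space V)"
    then have w: "w \<in> carrier V" by simp
    have wr: "VR.pt w r \<in> carrier (F_mod V)" for r using VR.pure_closed[of w r] w by simp
    have "ident_inv i (id1 w r e) = CT.FE.pt (VR.pt w r) e"
    proof (rule EM.tensor_ext[OF e additive_map_comp[OF id1_additive[OF w] ident_inv_additive]])
      show "additive_map EM.T CT.FE.T (CT.FE.pt (VR.pt w r))" using CT.FE.pure_additive(1)[OF wr] by simp
      fix h :: "complex^'n" and f :: "complex^'n \<Rightarrow> complex" assume "f \<in> carrier (Cinf_module (-1))"
      then have f: "f \<in> Cinf (-1)" by simp
      have ef: "EM.pt h f \<in> carrier E_mod" using EM.pure_closed[of h f] f by simp
      have "ident_inv i (id1 w r (EM.pt h f)) = CT.FE.pt (VR.pt w (axis i 1)) (EM.pt (rdot r h *s axis i 1) f)"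
        by (simp only: id1_pure[OF w f] ident_inv_pure[OF act_V[OF w] f] pure_scale[OF w f])
      also have "EM.pt (rdot r h *s axis i 1) f = EM.lac (row_matrix i r) (EM.pt h f)"
        using EM.lac_pure[of h f "row_matrix i r"] f by (simp add: row_matrix_vector)
      also have "CT.FE.pt (VR.pt w (axis i 1)) \<dots> = CT.FE.pt (VR.act (VR.pt w (axis i 1)) (row_matrix i r)) (EM.pt h f)"
        using CT.FE.pure_balance[OF wr _ ef, of "row_matrix i r"] by simp
      also have "VR.act (VR.pt w (axis i 1)) (row_matrix i r) = VR.pt w r"
        using VR.act_pure[of w "axis i 1" "row_matrix i r"] w by (simp add: axis_row_matrix)
      finally show "ident_inv i (id1 w r (EM.pt h f)) = CT.FE.pt (VR.pt w r) (EM.pt h f)" .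
    qed
    then show "ident_inv i (id2 (VR.pt w r) e) = CT.FE.pt (VR.pt w r) e" by (simp add: id2_pure e w)
  qed
  then show "ident_inv i (identification V (CT.FE.pt x e)) = CT.FE.pt x e"
    by (simp add: identification_pure x' e' del: F_mod_simps E_mod_simps)
qed

lemma identification_bij: "bij_betw (identification V) (carrier (rtensor Mat (F_mod V) E_mod)) (carrier (VC_mod V))"
  \<comment> \<open>\<open>undefined\<close> is merely some index; index types are nonempty.\<close>
  by (rule bij_betw_byWitness[of _ "ident_inv undefined"])
     (use additive_map_closed[OF ident_inv_additive] additive_map_closed[OF identification_additive] in
       \<open>auto simp: ident_inv_left ident_inv_right\<close>)

end

lemma abelian_Omega01: "abelian_group (Omega01 :: (complex^'n::finite \<Rightarrow> complex, complex^'n \<Rightarrow> complex, 'n form1) bimod)"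
  by (rule right_moduleD(2)[OF bimoduleD(1)[OF bimodule_Omega01]])

lemma add_eq_minus: "abelian_group G \<Longrightarrow> x \<in> carrier G \<Longrightarrow> y \<in> carrier G \<Longrightarrow> x \<oplus>\<^bsub>G\<^esub> y = z \<Longrightarrow> x = z \<ominus>\<^bsub>G\<^esub> y"
proof -
  assume "abelian_group G" and x: "x \<in> carrier G" "y \<in> carrier G" "x \<oplus>\<^bsub>G\<^esub> y = z"
  then interpret abelian_group G by simp
  show ?thesis using x by (auto simp: minus_eq a_assoc r_neg)
qed

lemma zero_forms01: "(\<lambda>v\<in>Sph. \<lambda>X. 0) \<in> (forms01 :: 'n::finite form1 set)"
  using abelian_monoid.zero_closed[OF abelian_group.axioms(1)[OF abelian_Omega01]] by simp

lemma proj01_Gamma: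
  fixes k q p j :: "'n::finite"
  shows "proj01 (Gamma k q p j) = (if k = p then v_dvbar q j else (\<lambda>v\<in>Sph. \<lambda>X. 0)) \<ominus>\<^bsub>Omega01\<^esub> lact Omega01 (Q q j) (v_dvbar p k)"
proof -
  let ?A = "if k = p then v_dvbar q j else (\<lambda>v\<in>Sph. \<lambda>X. 0)" and ?B = "lact Omega01 (Q q j) (v_dvbar p k)"
  have A: "?A \<in> carrier Omega01" by (simp add: v_dvbar_closed zero_forms01)
  have B: "?B \<in> carrier Omega01"
    by (rule left_modD(3)[OF bimoduleD(2)[OF bimodule_Omega01]]) (simp_all add: Cinf_Q v_dvbar_closed)
  have G: "proj01 (Gamma k q p j) \<in> carrier Omega01" using proj01_closed[OF Gamma_closed] by simp
  \<comment> \<open>Checked with the subtracted term moved to the left, since addition of forms is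
    pointwise by definition while subtraction in the record is not.\<close>
  have "proj01 (Gamma k q p j) \<oplus>\<^bsub>Omega01\<^esub> ?B = ?A"
  proof (intro ext)
    fix v X
    show "(proj01 (Gamma k q p j) \<oplus>\<^bsub>Omega01\<^esub> ?B) v X = ?A v X"
    proof (cases "v \<in> Sph")
      case True
      have "proj01 (Gamma k q p j) v X = (if k = p then 1 else 0) * proj01 (v_dvbar q j) v X
          + Q q j v * (proj01 (vbar_dv k p) v X - proj01 (v_dvbar p k) v X)"
        using True by (simp add: proj01_def Gamma_eq algebra_simps add_divide_distrib diff_divide_distrib)
      then show ?thesis
        using True by (simp add: proj01_v_dvbar proj01_vbar_dv)
    qed (simp add: v_dvbar_def)
  qed
  then show ?thesis
    using add_eq_minus[OF abelian_Omega01 G B] by simp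
qed

section \<open>The transported connection on generators\<close>

context matrix_module
begin

abbreviation "FE_mod \<equiv> rtensor Mat (F_mod V) (E_mod :: (complex^'n^'n, complex^'n \<Rightarrow> complex, 'n E_type) bimod)"

sublocale PU: calculus_push CP "Omega1 :: (complex^'n \<Rightarrow> complex, complex^'n \<Rightarrow> complex, 'n form1) bimod" d0 Omega01 proj01 FE_mod
  by unfold_locales (rule CT.FE.right_module_T)

definition "nabC = (\<lambda>g\<in>carrier FE_mod. PU.push (CT.nabFE g))"

lemma composite_obj_eq: "composite_obj V = (FE_mod, nabC)"
  unfolding composite_obj_def tensor_E_obj_def F_obj_eq CT.tensor_bimodule_obj_eq
  by (simp add: dbar_part_def nabC_def PU.push_def)

lemma conn_nabC: "right_connection CP Omega01 dbar0 FE_mod nabC"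
  unfolding nabC_def dbar0_abs by (rule PU.push_connection[OF CT.conn_FE])

sublocale TR: transport CP "Omega01 :: (complex^'n \<Rightarrow> complex, complex^'n \<Rightarrow> complex, 'n form1) bimod" dbar0 FE_mod nabC "VC_mod V" "identification V"
proof
  show "right_connection CP Omega01 dbar0 FE_mod nabC" by (rule conn_nabC)
  show "dbar0 b \<in> carrier (Omega01 :: (complex^'n \<Rightarrow> complex, complex^'n \<Rightarrow> complex, 'n form1) bimod)"
    if "b \<in> carrier CP" for b :: "complex^'n \<Rightarrow> complex"
    using that by (simp add: dbar0_closed)
qed (rule right_VC identification_hom identification_bij)+

abbreviation "TO \<equiv> tensor_group CP (VC_mod V) (Omega01 :: (complex^'n \<Rightarrow> complex, complex^'n \<Rightarrow> complex, 'n form1) bimod)"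
abbreviation "po \<equiv> pure_tensor CP (VC_mod V) (Omega01 :: (complex^'n \<Rightarrow> complex, complex^'n \<Rightarrow> complex, 'n form1) bimod)"

lemma abelian_TO: "abelian_group TO"
  by (rule TR.H\<Omega>.abelian_group_T)

text \<open>Projects the form factor to type (0,1) and applies the identification to the module
  factor, so that the connection can be evaluated directly in V \<otimes> C_-1.\<close>

definition "GG t = TR.TM.Uid (PU.push t)"

lemma GG_additive: "additive_map CT.FEO.T TO GG"
  unfolding GG_def[abs_def] by (rule additive_map_comp[OF PU.push_additive TR.TM.Uid_additive])

lemma GG_pure:
  assumes x: "x \<in> carrier (F_mod V)" and e: "e \<in> carrier E_mod" and \<xi>: "\<xi> \<in> carrier Omega1"
  shows "GG (CT.FEO.pt (CT.FE.pt x e) \<xi>) = po (id2 x e) (proj01 \<xi>)"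
proof -
  have p: "CT.FE.pt x e \<in> carrier FE_mod" using CT.FE.pure_closed[OF x e] by simp
  show ?thesis
    unfolding GG_def PU.push_pure[OF p \<xi>] TR.TM.Uid_pure[OF p PU.p_closed[OF \<xi>]] identification_pure[OF x e] ..
qed

text \<open>\<open>GG\<close> after reassociation, with the factor x of F separated. On e \<otimes>
  \<xi> it gives the identified element of x \<otimes> e tensored with the (0,1)-part of \<xi>, and
  it inherits balance over the matrices.\<close>

definition "JJ x t = GG (CT.assoc x t)"

lemma JJ_additive: "x \<in> carrier (F_mod V) \<Longrightarrow> additive_map EO.T TO (JJ x)"
  unfolding JJ_def[abs_def] by (rule additive_map_comp[OF CT.assoc_additive GG_additive])

lemma JJ_additive_left: "t \<in> carrier EO.T \<Longrightarrow> additive_map (F_mod V) TO (\<lambda>x. JJ x t)"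
proof -
  assume t: "t \<in> carrier EO.T"
  have "additive_map (F_mod V) CT.FEO.T (\<lambda>x. CT.assoc x t)"
    by (rule additive_mapI) (rule CT.assoc_closed[OF _ t] CT.assoc_add_left[OF _ _ t], assumption+)+
  from additive_map_comp[OF this GG_additive] show ?thesis by (simp add: JJ_def[abs_def])
qed

lemma JJ_closed: "x \<in> carrier (F_mod V) \<Longrightarrow> t \<in> carrier EO.T \<Longrightarrow> JJ x t \<in> carrier TO"
  by (rule additive_map_closed[OF JJ_additive])

lemma JJ_balance: "x \<in> carrier (F_mod V) \<Longrightarrow> t \<in> carrier EO.T \<Longrightarrow> JJ x (EO.lac a t) = JJ (VR.act x a) t"
  using CT.assoc_balance[of x a t] by (simp add: JJ_def)

lemma JJ_pure: "x \<in> carrier (F_mod V) \<Longrightarrow> e \<in> carrier E_mod \<Longrightarrow> \<xi> \<in> carrier Omega1 \<Longrightarrow>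
    JJ x (EO.pt e \<xi>) = po (id2 x e) (proj01 \<xi>)"
  by (simp only: JJ_def CT.assoc_pure GG_pure)

lemma nabE_closed: "e \<in> carrier E_mod \<Longrightarrow> nabla_E e \<in> carrier EO.T"
  by (rule BC.nabE(2))

lemma lac_unit_gen: "EM.lac (matrix_unit p i) (E_gen i j) = E_gen p j"
  using EM.lac_pure[of "axis i 1" "vbar j" "matrix_unit p i"] by (simp add: E_tensor_eq Cinf_vbar matrix_unit_vector)

text \<open>The defining equation of \<sigma> replaces it by a difference of two terms with the
  connection on E. One of them sums, by \<open>sum_fj\<close>, to the term that the tensor product
  connection adds anyway, and both disappear.\<close>

lemma nab_generator_JJ:
  assumes w: "w \<in> carrier V"
  shows "TR.nabT (VC.pt w (vbar j)) = (\<Oplus>\<^bsub>TO\<^esub>p\<in>UNIV. \<Oplus>\<^bsub>TO\<^esub>k\<in>UNIV. JJ (fj w k p) (nabla_E (E_gen p j)))"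
proof -
  \<comment> \<open>An auxiliary index used to represent w \<otimes> vbar_j as (w \<otimes> r_i)
    \<otimes> (h_i \<otimes> vbar_j). It drops out of the result.\<close>
  define i :: 'n where "i = undefined"
  let ?f = "VR.pt w (axis i 1)" and ?e = "E_gen i j"
  have f: "?f \<in> carrier (F_mod V)" using VR.pure_closed[of w "axis i 1"] w by simp
  have e: "E_gen p j \<in> carrier E_mod" for p by (rule E_gen_carrier)
  have n: "nabla_E (E_gen p j) \<in> carrier EO.T" for p by (rule nabE_closed[OF e])
  have fk: "fj w k p \<in> carrier (F_mod V)" for k p by (rule fj_closed[OF w])
  have x: "CT.FE.pt ?f ?e \<in> carrier CT.FE.T" by (rule CT.FE.pure_closed[OF f e])
  have id: "identification V (CT.FE.pt ?f ?e) = VC.pt w (vbar j)"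
    using identification_tensor[OF w Cinf_vbar, of "axis i 1" "axis i 1" j] w
    by (simp add: E_tensor_eq rdot_axis act_V_one)
  have "TR.nabT (VC.pt w (vbar j)) = GG (CT.nabFE (CT.FE.pt ?f ?e))"
    using TR.nabT_T[of "CT.FE.pt ?f ?e"] x by (simp add: id nabC_def GG_def)
  also have "CT.nabFE (CT.FE.pt ?f ?e) = CT.gg ?e (nabF ?f) \<oplus>\<^bsub>CT.FEO.T\<^esub> CT.assoc ?f (nabla_E ?e)"
    by (simp only: CT.nabFE_pure[OF f e] CT.phi_def)
  also have "GG \<dots> = GG (CT.gg ?e (nabF ?f)) \<oplus>\<^bsub>TO\<^esub> JJ ?f (nabla_E ?e)"
    unfolding JJ_def
    by (rule additive_map_add[OF GG_additive CT.gg_closed[OF e CT.nabF(2)[OF f]] CT.assoc_closed[OF f n]])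
  also have "GG (CT.gg ?e (nabF ?f)) = (\<Oplus>\<^bsub>TO\<^esub>p\<in>UNIV. \<Oplus>\<^bsub>TO\<^esub>k\<in>UNIV.
      JJ (fj w k p) (nabla_E (E_gen p j)) \<ominus>\<^bsub>TO\<^esub> JJ (VR.act (fj w k p) (row_matrix p (axis i 1))) (nabla_E ?e))"
  proof -
    have add: "additive_map FO.T TO (\<lambda>t. GG (CT.gg ?e t))"
      by (rule additive_map_comp[OF CT.gg_additive[OF e] GG_additive])
    have "GG (CT.gg ?e (FO.pt (fj w k p) (d_uni (matrix_unit p i)))) =
        JJ (fj w k p) (nabla_E (E_gen p j)) \<ominus>\<^bsub>TO\<^esub> JJ (VR.act (fj w k p) (row_matrix p (axis i 1))) (nabla_E ?e)" for p k
    proof -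
      let ?s = "sigma_E (pure_tensor Mat Omega_uni E_mod (d_uni (matrix_unit p i)) ?e)"
      have s: "?s \<in> carrier EO.T"
        by (rule BC.\<sigma>_closed[OF UE.OE.pure_closed[OF d_uni_closed e]])
      have l: "EO.lac (matrix_unit p i) (nabla_E ?e) \<in> carrier EO.T"
        using EO.lac_closed[OF n, of "matrix_unit p i"] by simp
      have a: "VR.act (fj w k p) (matrix_unit p i) \<in> carrier (F_mod V)"
        using VR.act_T_closed[of "fj w k p" "matrix_unit p i"] fk by simp
      \<comment> \<open>Uses E_pi h_i = h_p: the connection at h_p \<otimes> vbar_j is the
        connection of E_pi applied to h_i \<otimes> vbar_j.\<close>
      have "nabla_E (E_gen p j) = ?s \<oplus>\<^bsub>EO.T\<^esub> EO.lac (matrix_unit p i) (nabla_E ?e)"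
        using BC.nabE_left[OF _ e, of "matrix_unit p i" i] by (simp add: lac_unit_gen)
      then have "JJ (fj w k p) (nabla_E (E_gen p j)) =
          JJ (fj w k p) ?s \<oplus>\<^bsub>TO\<^esub> JJ (VR.act (fj w k p) (matrix_unit p i)) (nabla_E ?e)"
        using additive_map_add[OF JJ_additive[OF fk] s l] JJ_balance[OF fk n, of k p "matrix_unit p i"] by simp
      then have "JJ (fj w k p) ?s = JJ (fj w k p) (nabla_E (E_gen p j)) \<ominus>\<^bsub>TO\<^esub> JJ (VR.act (fj w k p) (matrix_unit p i)) (nabla_E ?e)"
        using add_eq_minus[OF abelian_TO JJ_closed[OF fk s] JJ_closed[OF a n]] by simp
      then show ?thesis
        by (simp only: CT.gg_pure[OF e fk d_uni_closed] CT.psi_def JJ_def row_matrix_axis)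
    qed
    then show ?thesis
      using FO.pure_closed[OF fk d_uni_closed] additive_map_closed[OF add FO.pure_closed[OF fk d_uni_closed]]
      by (simp add: nabF_tensor[OF w] nabF_pure_def row_matrix_axis
          additive_map_finsum[OF FO.abelian_group_T abelian_TO add] Pi_iff FO.T.finsum_closed)
  qed
  also have "\<dots> = (\<Oplus>\<^bsub>TO\<^esub>p\<in>UNIV. \<Oplus>\<^bsub>TO\<^esub>k\<in>UNIV. JJ (fj w k p) (nabla_E (E_gen p j))) \<ominus>\<^bsub>TO\<^esub>
      (\<Oplus>\<^bsub>TO\<^esub>p\<in>UNIV. \<Oplus>\<^bsub>TO\<^esub>k\<in>UNIV. JJ (VR.act (fj w k p) (row_matrix p (axis i 1))) (nabla_E ?e))"
  proof -
    have a: "VR.act (fj w k p) (row_matrix p (axis i 1)) \<in> carrier (F_mod V)" for k p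
      using VR.act_T_closed[of "fj w k p" "row_matrix p (axis i 1)"] fk by simp
    show ?thesis
      using JJ_closed[OF fk n] JJ_closed[OF a n] by (simp add: TR.H\<Omega>.T.finsum_diff Pi_iff TR.H\<Omega>.T.finsum_closed)
  qed
  \<comment> \<open>Here \<open>sum_fj\<close> with r = r_i reassembles w \<otimes> r_i, and the sum
    becomes the second half of the tensor product connection, with opposite sign.\<close>
  also have "(\<Oplus>\<^bsub>TO\<^esub>p\<in>UNIV. \<Oplus>\<^bsub>TO\<^esub>k\<in>UNIV. JJ (VR.act (fj w k p) (row_matrix p (axis i 1))) (nabla_E ?e)) = JJ ?f (nabla_E ?e)"
  proof -
    have a: "VR.act (fj w k p) (row_matrix p (axis i 1)) \<in> carrier VR.T" for k p
      using VR.act_T_closed[of "fj w k p" "row_matrix p (axis i 1)"] fk by simp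
    have add: "additive_map VR.T TO (\<lambda>x. JJ x (nabla_E ?e))" using JJ_additive_left[OF n] by simp
    show ?thesis
      unfolding sum_fj[OF w, of "axis i 1", symmetric]
      using a by (simp add: additive_map_finsum[OF VR.abelian_group_T abelian_TO add] Pi_iff VR.T.finsum_closed)
  qed
  finally show ?thesis
    using JJ_closed[OF f n] JJ_closed[OF fk n] by (simp add: TR.H\<Omega>.T.minus_eq TR.H\<Omega>.T.a_assoc TR.H\<Omega>.T.l_neg Pi_iff TR.H\<Omega>.T.finsum_closed)
qed

lemma VC_closed: "w \<in> carrier V \<Longrightarrow> f \<in> Cinf (-1) \<Longrightarrow> VC.pt w f \<in> carrier (VC_mod V)"
  using VC.pure_closed[of w f] by simp

text \<open>The functions Q_qj are moved from the form to the module factor, where the vbar_q Q_qj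
  sum to vbar_j by \<open>vbar_expansion\<close>.\<close>

lemma po_contract:
  assumes w: "w \<in> carrier V" and \<beta>: "\<beta> \<in> carrier Omega01"
  shows "(\<Oplus>\<^bsub>TO\<^esub>q\<in>UNIV. po (VC.pt w (vbar q)) (lact Omega01 (Q q j) \<beta>)) = po (VC.pt w (vbar j)) \<beta>"
proof -
  have Qc: "Q q j \<in> carrier CP" for q by (simp add: Cinf_Q)
  have c: "ract (Cinf_module (-1)) (vbar q) (Q q j) \<in> carrier (Cinf_module (-1))" for q
    using Cinf_mult[OF Cinf_vbar Cinf_Q, of "-1" q q j] by simp
  have "po (VC.pt w (vbar q)) (lact Omega01 (Q q j) \<beta>) = po (VC.pt w (ract (Cinf_module (-1)) (vbar q) (Q q j))) \<beta>" for q
  proof -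
    have "po (ract (VC_mod V) (VC.pt w (vbar q)) (Q q j)) \<beta> = po (VC.pt w (vbar q)) (lact Omega01 (Q q j) \<beta>)"
      by (rule TR.H\<Omega>.pure_balance[OF VC_closed[OF w Cinf_vbar] Qc \<beta>])
    moreover have "ract (VC_mod V) (VC.pt w (vbar q)) (Q q j) = VC.pt w (ract (Cinf_module (-1)) (vbar q) (Q q j))"
      using VC.act_pure[of w "vbar q" "Q q j"] w Cinf_vbar[of q] Cinf_Q[of q j] by simp
    ultimately show ?thesis by (simp only:)
  qed
  then have "(\<Oplus>\<^bsub>TO\<^esub>q\<in>UNIV. po (VC.pt w (vbar q)) (lact Omega01 (Q q j) \<beta>)) =
      (\<Oplus>\<^bsub>TO\<^esub>q\<in>UNIV. po (VC.pt w (ract (Cinf_module (-1)) (vbar q) (Q q j))) \<beta>)" by (simp only:)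
  also have "\<dots> = po (VC.pt w (finsum (Cinf_module (-1)) (\<lambda>q. ract (Cinf_module (-1)) (vbar q) (Q q j)) UNIV)) \<beta>"
  proof -
    have add: "additive_map (Cinf_module (-1)) TO (\<lambda>f. po (VC.pt w f) \<beta>)"
      using additive_map_comp[OF VC.pure_additive(1)[of w], of TO "\<lambda>x. po x \<beta>"] TR.H\<Omega>.pure_additive(2)[OF \<beta>] w by simp
    have cP: "(\<lambda>q. ract (Cinf_module (-1)) (vbar q) (Q q j)) \<in> UNIV \<rightarrow> carrier (Cinf_module (-1))"
      using c by (simp add: Pi_iff)
    show ?thesis
      by (rule additive_map_finsum[OF abelian_group_Cinf abelian_TO add cP, symmetric])
  qed
  also have "finsum (Cinf_module (-1)) (\<lambda>q. ract (Cinf_module (-1)) (vbar q) (Q q j)) UNIV = vbar j"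
    using vbar_expansion[OF Cinf_vbar[of j]] by (simp only: coord_vbar)
  finally show ?thesis .
qed

abbreviation "L p r w \<equiv> matrix_unit p r \<odot>\<^bsub>V\<^esub> w"

theorem nab_generator:
  assumes w: "w \<in> carrier V"
  shows "TR.nabT (VC.pt w (vbar j)) = (\<Oplus>\<^bsub>TO\<^esub>q\<in>UNIV. po (VC.pt w (vbar q)) (v_dvbar q j)) \<ominus>\<^bsub>TO\<^esub>
    (\<Oplus>\<^bsub>TO\<^esub>p\<in>UNIV. \<Oplus>\<^bsub>TO\<^esub>r\<in>UNIV. po (VC.pt (L p r w) (vbar j)) (v_dvbar r p))"
proof -
  have Lw: "L p r w \<in> carrier V" for p r by (rule act_V[OF w])
  have vc: "VC.pt (L p r w) (vbar q) \<in> carrier (VC_mod V)" for p r q by (rule VC_closed[OF Lw Cinf_vbar])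
  have \<beta>: "v_dvbar p q \<in> carrier Omega01" for p q :: 'n by (simp add: v_dvbar_closed)
  have l\<beta>: "lact Omega01 (Q q j) (v_dvbar p k) \<in> carrier Omega01" for p q k :: 'n
    by (rule left_modD(3)[OF bimoduleD(2)[OF bimodule_Omega01]]) (simp_all add: Cinf_Q v_dvbar_closed)
  have po: "po (VC.pt (L p r w) (vbar q)) (v_dvbar s t) \<in> carrier TO" for p r q s t
    by (rule TR.H\<Omega>.pure_closed[OF vc \<beta>])
  have NE: "is_nabla_E (nabla_E :: 'n E_type \<Rightarrow> ('n E_type, 'n form1) tens)" by (rule is_nabla_E_nabla_E)
  \<comment> \<open>The diagonal contribution of \<open>proj01_Gamma\<close>. Off the diagonal it is
    kept as zero, so that all sums run over the full index type until \<open>finsum_delta\<close>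
    collapses them.\<close>
  let ?A = "\<lambda>k p q. if p = k then po (VC.pt (L k p w) (vbar q)) (v_dvbar q j) else \<zero>\<^bsub>TO\<^esub>"
  have step: "JJ (fj w k p) (nabla_E (E_gen p j)) = (\<Oplus>\<^bsub>TO\<^esub>q\<in>UNIV. ?A k p q) \<ominus>\<^bsub>TO\<^esub> po (VC.pt (L k p w) (vbar j)) (v_dvbar p k)" for k p
  proof -
    have G: "Gamma p' q p j \<in> carrier Omega1" for p' q by (simp add: Gamma_closed)
    have g: "EO.pt (E_gen p' q) (Gamma p' q p j) \<in> carrier EO.T" for p' q
      by (rule EO.pure_closed[OF E_gen_carrier G])
    have "nabla_E (E_gen p j) = (\<Oplus>\<^bsub>EO.T\<^esub>p'\<in>UNIV. \<Oplus>\<^bsub>EO.T\<^esub>q\<in>UNIV. EO.pt (E_gen p' q) (Gamma p' q p j))"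
      using NE by (simp add: is_nabla_E_def)
    then have "JJ (fj w k p) (nabla_E (E_gen p j)) =
        (\<Oplus>\<^bsub>TO\<^esub>p'\<in>UNIV. \<Oplus>\<^bsub>TO\<^esub>q\<in>UNIV. JJ (fj w k p) (EO.pt (E_gen p' q) (Gamma p' q p j)))"
      using g by (simp add: additive_map_finsum[OF EO.abelian_group_T abelian_TO JJ_additive[OF fj_closed[OF w]]] Pi_iff EO.T.finsum_closed)
    also have "\<dots> = (\<Oplus>\<^bsub>TO\<^esub>q\<in>UNIV. \<Oplus>\<^bsub>TO\<^esub>p'\<in>UNIV. JJ (fj w k p) (EO.pt (E_gen p' q) (Gamma p' q p j)))"
      by (rule TR.H\<Omega>.T.finsum_swap) (simp_all only: finite JJ_closed[OF fj_closed[OF w] g])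
    also have "\<dots> = (\<Oplus>\<^bsub>TO\<^esub>q\<in>UNIV. po (VC.pt (L k p w) (vbar q)) (proj01 (Gamma k q p j)))"
    proof -
      have P: "proj01 (Gamma k q p j) \<in> carrier Omega01" for k q using proj01_closed[OF Gamma_closed] by simp
      have "JJ (fj w k p) (EO.pt (E_gen p' q) (Gamma p' q p j)) =
          (if k = p' then po (VC.pt (L k p w) (vbar q)) (proj01 (Gamma p' q p j)) else \<zero>\<^bsub>TO\<^esub>)" for p' q
      proof -
        \<comment> \<open>The row r_k pairs with h_p' to the Kronecker delta, so of the sum over p'
          only \<open>Gamma\<close> with first index k survives.\<close>
        have "id2 (fj w k p) (E_gen p' q) = (if k = p' then VC.pt (L k p w) (vbar q) else \<zero>\<^bsub>VC.T\<^esub>)"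
          using id2_pure[OF E_gen_closed Lw, of k p "axis k 1" p' q] id1_pure[OF Lw Cinf_vbar, of k p "axis k 1" "axis p' 1" q]
            VC.pure_zero(2)[of "vbar q"] act_V_zero[OF Lw, of k p]
          by (simp add: E_tensor_eq rdot_axis act_V_one Lw Cinf_vbar)
        then show ?thesis
          using JJ_pure[OF fj_closed[OF w] E_gen_carrier G, of k p p' q p' q] TR.H\<Omega>.pure_zero(2)[OF P, of p' q] by simp
      qed
      then show ?thesis
        using TR.H\<Omega>.pure_closed[OF vc P] by (simp add: TR.H\<Omega>.T.finsum_delta)
    qed
    also have "\<dots> = (\<Oplus>\<^bsub>TO\<^esub>q\<in>UNIV. ?A k p q \<ominus>\<^bsub>TO\<^esub> po (VC.pt (L k p w) (vbar q)) (lact Omega01 (Q q j) (v_dvbar p k)))"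
    proof -
      have "po (VC.pt (L k p w) (vbar q)) (proj01 (Gamma k q p j)) =
          ?A k p q \<ominus>\<^bsub>TO\<^esub> po (VC.pt (L k p w) (vbar q)) (lact Omega01 (Q q j) (v_dvbar p k))" for q
      proof -
        have z: "(if k = p then v_dvbar q j else (\<lambda>v\<in>Sph. \<lambda>X. 0)) \<in> carrier Omega01"
          by (simp add: v_dvbar_closed zero_forms01)
        have "po (VC.pt (L k p w) (vbar q)) (if k = p then v_dvbar q j else (\<lambda>v\<in>Sph. \<lambda>X. 0)) = ?A k p q"
          using TR.H\<Omega>.pure_zero(1)[OF vc, of k p q] by simp
        then show ?thesis
          unfolding proj01_Gamma additive_map_minus[OF abelian_Omega01 abelian_TO TR.H\<Omega>.pure_additive(1)[OF vc] z l\<beta>]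
          by (simp only:)
      qed
      then show ?thesis by (simp only:)
    qed
    also have "\<dots> = (\<Oplus>\<^bsub>TO\<^esub>q\<in>UNIV. ?A k p q) \<ominus>\<^bsub>TO\<^esub> (\<Oplus>\<^bsub>TO\<^esub>q\<in>UNIV. po (VC.pt (L k p w) (vbar q)) (lact Omega01 (Q q j) (v_dvbar p k)))"
      by (rule TR.H\<Omega>.T.finsum_diff) (use po TR.H\<Omega>.pure_closed[OF vc l\<beta>] in \<open>simp_all add: Pi_iff\<close>)
    finally show ?thesis by (simp only: po_contract[OF Lw \<beta>])
  qed
  have A: "?A k p q \<in> carrier TO" for k p q using po by simp
  have "TR.nabT (VC.pt w (vbar j)) = (\<Oplus>\<^bsub>TO\<^esub>p\<in>UNIV. \<Oplus>\<^bsub>TO\<^esub>k\<in>UNIV. \<Oplus>\<^bsub>TO\<^esub>q\<in>UNIV. ?A k p q) \<ominus>\<^bsub>TO\<^esub>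
      (\<Oplus>\<^bsub>TO\<^esub>p\<in>UNIV. \<Oplus>\<^bsub>TO\<^esub>k\<in>UNIV. po (VC.pt (L k p w) (vbar j)) (v_dvbar p k))"
    unfolding nab_generator_JJ[OF w] step
    using A po by (simp add: TR.H\<Omega>.T.finsum_diff Pi_iff TR.H\<Omega>.T.finsum_closed)
  \<comment> \<open>Exchanges the two sums and renames: the former k becomes p, the former p becomes
    r.\<close>
  also have "(\<Oplus>\<^bsub>TO\<^esub>p\<in>UNIV. \<Oplus>\<^bsub>TO\<^esub>k\<in>UNIV. po (VC.pt (L k p w) (vbar j)) (v_dvbar p k)) =
      (\<Oplus>\<^bsub>TO\<^esub>p\<in>UNIV. \<Oplus>\<^bsub>TO\<^esub>r\<in>UNIV. po (VC.pt (L p r w) (vbar j)) (v_dvbar r p))"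
    by (rule TR.H\<Omega>.T.finsum_swap) (simp_all only: finite po)
  also have "(\<Oplus>\<^bsub>TO\<^esub>p\<in>UNIV. \<Oplus>\<^bsub>TO\<^esub>k\<in>UNIV. \<Oplus>\<^bsub>TO\<^esub>q\<in>UNIV. ?A k p q) = (\<Oplus>\<^bsub>TO\<^esub>q\<in>UNIV. po (VC.pt w (vbar q)) (v_dvbar q j))"
  proof -
    have "(\<Oplus>\<^bsub>TO\<^esub>k\<in>UNIV. \<Oplus>\<^bsub>TO\<^esub>q\<in>UNIV. ?A k p q) = (\<Oplus>\<^bsub>TO\<^esub>q\<in>UNIV. po (VC.pt (L p p w) (vbar q)) (v_dvbar q j))" for p
    proof -
      have "(\<Oplus>\<^bsub>TO\<^esub>k\<in>UNIV. \<Oplus>\<^bsub>TO\<^esub>q\<in>UNIV. ?A k p q) = (\<Oplus>\<^bsub>TO\<^esub>q\<in>UNIV. \<Oplus>\<^bsub>TO\<^esub>k\<in>UNIV. ?A k p q)"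
        by (rule TR.H\<Omega>.T.finsum_swap) (simp_all only: finite A)
      then show ?thesis using po by (simp add: TR.H\<Omega>.T.finsum_delta)
    qed
    then have "(\<Oplus>\<^bsub>TO\<^esub>p\<in>UNIV. \<Oplus>\<^bsub>TO\<^esub>k\<in>UNIV. \<Oplus>\<^bsub>TO\<^esub>q\<in>UNIV. ?A k p q) =
        (\<Oplus>\<^bsub>TO\<^esub>p\<in>UNIV. \<Oplus>\<^bsub>TO\<^esub>q\<in>UNIV. po (VC.pt (L p p w) (vbar q)) (v_dvbar q j))" by (simp only:)
    also have "\<dots> = (\<Oplus>\<^bsub>TO\<^esub>q\<in>UNIV. \<Oplus>\<^bsub>TO\<^esub>p\<in>UNIV. po (VC.pt (L p p w) (vbar q)) (v_dvbar q j))"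
      by (rule TR.H\<Omega>.T.finsum_swap) (simp_all only: finite po)
    also have "\<dots> = (\<Oplus>\<^bsub>TO\<^esub>q\<in>UNIV. po (VC.pt w (vbar q)) (v_dvbar q j))"
    proof -
      \<comment> \<open>The diagonal terms carry L_pp(w), and the matrix units E_pp sum to the
        identity.\<close>
      have "(\<Oplus>\<^bsub>TO\<^esub>p\<in>UNIV. po (VC.pt (L p p w) (vbar q)) (v_dvbar q j)) = po (VC.pt w (vbar q)) (v_dvbar q j)" for q
      proof -
        have "additive_map Mat TO (\<lambda>a. po (VC.pt (a \<odot>\<^bsub>V\<^esub> w) (vbar q)) (v_dvbar q j))"
          using additive_map_comp[OF additive_map_comp[OF act_V_additive_left[OF w] VC.pure_additive(2)[of "vbar q", simplified, OF Cinf_vbar]], of TO "\<lambda>x. po x (v_dvbar q j)"]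
            TR.H\<Omega>.pure_additive(2)[OF \<beta>] by simp
        from additive_map_finsum[OF abelian_Mat abelian_TO this, of "\<lambda>p. matrix_unit p p" UNIV]
        show ?thesis by (simp add: finsum_Row_Col[OF abelian_Mat] sum_matrix_unit act_V_one w)
      qed
      then show ?thesis by (simp only:)
    qed
    finally show ?thesis .
  qed
  finally show ?thesis .
qed

end

section \<open>Vanishing of the curvature\<close>

lemma abelian_Omega02: "abelian_group (Omega02 :: (complex^'n::finite \<Rightarrow> complex, complex^'n \<Rightarrow> complex, 'n form2) bimod)"
  by (rule right_moduleD(2)[OF bimoduleD(1)[OF bimodule_Omega02]])

lemma finsum_Omega02:
  fixes f :: "'i \<Rightarrow> 'n::finite form2"
  assumes I: "finite I" and f: "\<And>i. f i \<in> forms02"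
  shows "finsum Omega02 f I = (\<lambda>v\<in>Sph. \<lambda>X Y. \<Sum>i\<in>I. f i v X Y)"
proof -
  interpret abelian_group "Omega02 :: (complex^'n \<Rightarrow> complex, complex^'n \<Rightarrow> complex, 'n form2) bimod"
    by (rule abelian_Omega02)
  show ?thesis
    using I f by (induction I) (auto simp: fun_eq_iff finsum_insert Pi_iff)
qed

lemma wedge_contract_finsum:
  "finsum Omega02 (\<lambda>k. wedge (v_dvbar r k) (v_dvbar k p)) UNIV = \<zero>\<^bsub>Omega02\<^esub>"
proof -
  have "finsum Omega02 (\<lambda>k. wedge (v_dvbar r k) (v_dvbar k p)) UNIV =
      (\<lambda>v\<in>Sph. \<lambda>X Y. \<Sum>k\<in>UNIV. wedge (v_dvbar r k) (v_dvbar k p) v X Y)"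
    by (rule finsum_Omega02) (simp_all add: wedge_closed v_dvbar_closed)
  also have "\<dots> = \<zero>\<^bsub>Omega02\<^esub>"
    by (simp add: wedge_contract fun_eq_iff)
  finally show ?thesis .
qed

lemma wedge_commute:
  fixes \<eta> \<xi> :: "'n::finite form1"
  assumes "\<eta> \<in> forms01" "\<xi> \<in> forms01"
  shows "wedge \<eta> \<xi> = \<ominus>\<^bsub>Omega02\<^esub> wedge \<xi> \<eta>"
proof -
  interpret abelian_group "Omega02 :: (complex^'n \<Rightarrow> complex, complex^'n \<Rightarrow> complex, 'n form2) bimod"
    by (rule abelian_Omega02)
  have "wedge \<eta> \<xi> \<oplus>\<^bsub>Omega02\<^esub> wedge \<xi> \<eta> = \<zero>\<^bsub>Omega02\<^esub>"
    by (auto simp: wedge_def fun_eq_iff)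
  then show ?thesis
    by (rule minus_equality[symmetric]) (simp_all add: wedge_closed assms)
qed

context matrix_module
begin

sublocale DB: dbar_connection "VC_mod V" TR.nabT
  by unfold_locales (rule TR.conn_nabT)

abbreviation "T2 \<equiv> tensor_group CP (VC_mod V) (Omega02 :: (complex^'n \<Rightarrow> complex, complex^'n \<Rightarrow> complex, 'n form2) bimod)"
abbreviation "p2 \<equiv> pure_tensor CP (VC_mod V) (Omega02 :: (complex^'n \<Rightarrow> complex, complex^'n \<Rightarrow> complex, 'n form2) bimod)"
abbreviation "gen w q \<equiv> VC.pt w (vbar q)"

lemma abelian_T2: "abelian_group T2"
  by (rule DB.G2.abelian_group_T)

lemma gen_closed: "w \<in> carrier V \<Longrightarrow> gen w q \<in> carrier (VC_mod V)"
  by (rule VC_closed[OF _ Cinf_vbar])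

text \<open>The forms \<open>v_dvbar s t\<close> are annihilated by \<open>dbar1\<close>, so only
  the wedge with the connection on the generator is left.\<close>

lemma K2_generator:
  assumes w: "w \<in> carrier V"
  shows "DB.K2 (gen w j) (v_dvbar s t) =
    (\<Oplus>\<^bsub>T2\<^esub>q\<in>UNIV. p2 (gen w q) (wedge (v_dvbar q j) (v_dvbar s t))) \<ominus>\<^bsub>T2\<^esub>
    (\<Oplus>\<^bsub>T2\<^esub>p\<in>UNIV. \<Oplus>\<^bsub>T2\<^esub>r\<in>UNIV. p2 (gen (L p r w) j) (wedge (v_dvbar r p) (v_dvbar s t)))"
proof -
  let ?\<beta> = "v_dvbar s t"
  have Lw: "L p r w \<in> carrier V" for p r by (rule act_V[OF w])
  have \<beta>: "v_dvbar p q \<in> carrier Omega01" for p q :: 'n by (simp add: v_dvbar_closed)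
  have po: "po (gen u q) (v_dvbar a b) \<in> carrier TO" if "u \<in> carrier V" for u q a b
    by (rule TR.H\<Omega>.pure_closed[OF gen_closed[OF that] \<beta>])
  note add = DB.wed_additive[OF v_dvbar_closed, of s t]
  have wed: "DB.wed ?\<beta> (po (gen u q) (v_dvbar a b)) = p2 (gen u q) (wedge (v_dvbar a b) ?\<beta>)" if "u \<in> carrier V" for u q a b
    by (rule DB.wed_pure[OF v_dvbar_closed gen_closed[OF that] v_dvbar_closed])
  let ?A = "\<Oplus>\<^bsub>TO\<^esub>q\<in>UNIV. po (gen w q) (v_dvbar q j)"
  let ?B = "\<Oplus>\<^bsub>TO\<^esub>p\<in>UNIV. \<Oplus>\<^bsub>TO\<^esub>r\<in>UNIV. po (gen (L p r w) j) (v_dvbar r p)"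
  have A: "?A \<in> carrier TO" using po[OF w] by (simp add: TR.H\<Omega>.T.finsum_closed Pi_iff)
  have B: "?B \<in> carrier TO" using po[OF Lw] by (simp add: TR.H\<Omega>.T.finsum_closed Pi_iff)
  have "p2 (gen w j) (dbar1 ?\<beta>) = \<zero>\<^bsub>T2\<^esub>"
    using DB.G2.pure_zero(1)[OF gen_closed[OF w]] by (simp add: dbar1_v_dvbar)
  moreover have W: "DB.wed ?\<beta> (TR.nabT (gen w j)) \<in> carrier T2"
    by (rule DB.wed_closed[OF v_dvbar_closed DB.c(5)[OF gen_closed[OF w]]])
  ultimately have "DB.K2 (gen w j) ?\<beta> = DB.wed ?\<beta> (TR.nabT (gen w j))"
    by (simp only: DB.K2_def DB.G2.T.l_zero)
  also have "\<dots> = DB.wed ?\<beta> ?A \<ominus>\<^bsub>T2\<^esub> DB.wed ?\<beta> ?B"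
    unfolding nab_generator[OF w] by (rule additive_map_minus[OF abelian_TO abelian_T2 add A B])
  also have "DB.wed ?\<beta> ?A = (\<Oplus>\<^bsub>T2\<^esub>q\<in>UNIV. p2 (gen w q) (wedge (v_dvbar q j) ?\<beta>))"
    using po[OF w] by (simp add: additive_map_finsum[OF abelian_TO abelian_T2 add] Pi_iff wed w)
  also have "DB.wed ?\<beta> ?B = (\<Oplus>\<^bsub>T2\<^esub>p\<in>UNIV. \<Oplus>\<^bsub>T2\<^esub>r\<in>UNIV. p2 (gen (L p r w) j) (wedge (v_dvbar r p) ?\<beta>))"
    using po[OF Lw] by (simp add: additive_map_finsum[OF abelian_TO abelian_T2 add] Pi_iff wed Lw TR.H\<Omega>.T.finsum_closed)
  finally show ?thesis .
qed

lemma curvature_generator: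
  assumes w: "w \<in> carrier V"
  shows "curvature (VC_mod V) TR.nabT (gen w j) = \<zero>\<^bsub>T2\<^esub>"
proof -
  let ?\<beta> = "v_dvbar :: 'n \<Rightarrow> 'n \<Rightarrow> 'n form1"
  let ?K = "tensor_lift T2 DB.K2"
  have Lw: "L p r w \<in> carrier V" for p r by (rule act_V[OF w])
  have \<beta>: "?\<beta> p q \<in> carrier Omega01" for p q by (simp add: v_dvbar_closed)
  have po: "po (gen u q) (?\<beta> a b) \<in> carrier TO" if "u \<in> carrier V" for u q a b
    by (rule TR.H\<Omega>.pure_closed[OF gen_closed[OF that] \<beta>])
  have wc: "wedge (?\<beta> a b) (?\<beta> c d) \<in> carrier Omega02" for a b c d
    by (simp add: wedge_closed v_dvbar_closed)
  have p2: "p2 (gen u q) (wedge (?\<beta> a b) (?\<beta> c d)) \<in> carrier T2" if "u \<in> carrier V" for u q a b c d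
    by (rule DB.G2.pure_closed[OF gen_closed[OF that] wc])
  have flip: "p2 (gen u q) (wedge (?\<beta> a b) (?\<beta> c d)) = \<ominus>\<^bsub>T2\<^esub> p2 (gen u q) (wedge (?\<beta> c d) (?\<beta> a b))"
    if "u \<in> carrier V" for u q a b c d
    unfolding wedge_commute[OF v_dvbar_closed v_dvbar_closed, of a b c d]
    by (rule additive_map_inv[OF abelian_Omega02 abelian_T2 DB.G2.pure_additive(1)[OF gen_closed[OF that]] wc])
  have contract: "(\<Oplus>\<^bsub>T2\<^esub>k\<in>UNIV. p2 (gen u q) (wedge (?\<beta> r k) (?\<beta> k p))) = \<zero>\<^bsub>T2\<^esub>" if "u \<in> carrier V" for u q r p
  proof -
    have "(\<Oplus>\<^bsub>T2\<^esub>k\<in>UNIV. p2 (gen u q) (wedge (?\<beta> r k) (?\<beta> k p))) =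
        p2 (gen u q) (finsum Omega02 (\<lambda>k. wedge (?\<beta> r k) (?\<beta> k p)) UNIV)"
      by (rule DB.G2.pure_finsum_right[OF gen_closed[OF that], symmetric]) (simp add: wedge_closed v_dvbar_closed)
    then show ?thesis
      by (simp only: wedge_contract_finsum DB.G2.pure_zero(1)[OF gen_closed[OF that]])
  qed
  have neg_sum: "(\<Oplus>\<^bsub>T2\<^esub>k\<in>I. \<ominus>\<^bsub>T2\<^esub> f k) = \<ominus>\<^bsub>T2\<^esub> (\<Oplus>\<^bsub>T2\<^esub>k\<in>I. f k)" if "\<And>k. f k \<in> carrier T2" for f and I :: "'n set"
    by (rule additive_map_finsum[OF abelian_T2 abelian_T2 additive_map_neg[OF abelian_T2], symmetric]) (simp add: that)
  have mz: "\<ominus>\<^bsub>T2\<^esub> \<zero>\<^bsub>T2\<^esub> = \<zero>\<^bsub>T2\<^esub>"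
    by (rule DB.G2.T.minus_equality) simp_all
  \<comment> \<open>The mixed term, one factor with L and one without. Each half of the connection
    formula produces it once, with the same sign, and the halves are subtracted.\<close>
  define X where "X = (\<Oplus>\<^bsub>T2\<^esub>q\<in>UNIV. \<Oplus>\<^bsub>T2\<^esub>p\<in>UNIV. \<Oplus>\<^bsub>T2\<^esub>r\<in>UNIV. p2 (gen (L p r w) q) (wedge (?\<beta> r p) (?\<beta> q j)))"
  have X: "X \<in> carrier T2" using p2[OF Lw] by (simp add: X_def DB.G2.T.finsum_closed Pi_iff)
  have S1: "(\<Oplus>\<^bsub>T2\<^esub>q\<in>UNIV. DB.K2 (gen w q) (?\<beta> q j)) = \<ominus>\<^bsub>T2\<^esub> X"
  proof -
    have "(\<Oplus>\<^bsub>T2\<^esub>q\<in>UNIV. DB.K2 (gen w q) (?\<beta> q j)) =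
        (\<Oplus>\<^bsub>T2\<^esub>q\<in>UNIV. \<Oplus>\<^bsub>T2\<^esub>k\<in>UNIV. p2 (gen w k) (wedge (?\<beta> k q) (?\<beta> q j))) \<ominus>\<^bsub>T2\<^esub> X"
      unfolding K2_generator[OF w] X_def
      by (rule DB.G2.T.finsum_diff) (use p2[OF w] p2[OF Lw] in \<open>simp_all add: DB.G2.T.finsum_closed Pi_iff\<close>)
    \<comment> \<open>The sums are exchanged to make the repeated index q innermost, as the
      contraction requires a fixed module element.\<close>
    also have "(\<Oplus>\<^bsub>T2\<^esub>q\<in>UNIV. \<Oplus>\<^bsub>T2\<^esub>k\<in>UNIV. p2 (gen w k) (wedge (?\<beta> k q) (?\<beta> q j))) =
        (\<Oplus>\<^bsub>T2\<^esub>k\<in>UNIV. \<Oplus>\<^bsub>T2\<^esub>q\<in>UNIV. p2 (gen w k) (wedge (?\<beta> k q) (?\<beta> q j)))"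
      by (rule DB.G2.T.finsum_swap) (simp_all only: finite p2[OF w])
    also have "\<dots> = \<zero>\<^bsub>T2\<^esub>"
      unfolding contract[OF w] by (rule DB.G2.T.finsum_zero)
    finally show ?thesis using X by (simp add: DB.G2.T.minus_eq)
  qed
  have S2: "(\<Oplus>\<^bsub>T2\<^esub>p\<in>UNIV. \<Oplus>\<^bsub>T2\<^esub>r\<in>UNIV. DB.K2 (gen (L p r w) j) (?\<beta> r p)) = \<ominus>\<^bsub>T2\<^esub> X"
  proof -
    let ?Y = "\<lambda>p r. \<Oplus>\<^bsub>T2\<^esub>p'\<in>UNIV. p2 (gen (L p' r w) j) (wedge (?\<beta> p p') (?\<beta> r p))"
    have Y: "?Y p r \<in> carrier T2" for p r using p2[OF Lw] by (simp add: DB.G2.T.finsum_closed Pi_iff)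
    have K: "DB.K2 (gen (L p r w) j) (?\<beta> r p) = (\<Oplus>\<^bsub>T2\<^esub>q\<in>UNIV. p2 (gen (L p r w) q) (wedge (?\<beta> q j) (?\<beta> r p))) \<ominus>\<^bsub>T2\<^esub> ?Y p r" for p r
    proof -
      \<comment> \<open>E_p'r' E_pr vanishes unless r' = p, and then it is E_p'r. The sum over r'
        thus collapses to the single term in \<open>?Y\<close>.\<close>
      have "p2 (gen (L p' r' (L p r w)) j) (wedge (?\<beta> r' p') (?\<beta> r p)) =
          (if p = r' then p2 (gen (L p' r w) j) (wedge (?\<beta> r' p') (?\<beta> r p)) else \<zero>\<^bsub>T2\<^esub>)" for p' r'
      proof (cases "p = r'")
        case True
        then show ?thesis by (simp add: act_V_mult[OF w] matrix_unit_mult)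
      next
        case False
        then have "gen (L p' r' (L p r w)) j = \<zero>\<^bsub>VC_mod V\<^esub>"
          using VC.pure_zero(2)[of "vbar j"] by (simp add: act_V_mult[OF w] matrix_unit_mult act_V_zero[OF w] Cinf_vbar)
        then show ?thesis using False DB.G2.pure_zero(2)[OF wc, of r' p' r p] by (simp only: if_False)
      qed
      then show ?thesis
        unfolding K2_generator[OF Lw]
        using p2[OF Lw] by (simp add: DB.G2.T.finsum_delta)
    qed
    have "(\<Oplus>\<^bsub>T2\<^esub>p\<in>UNIV. \<Oplus>\<^bsub>T2\<^esub>r\<in>UNIV. DB.K2 (gen (L p r w) j) (?\<beta> r p)) =
        (\<Oplus>\<^bsub>T2\<^esub>p\<in>UNIV. \<Oplus>\<^bsub>T2\<^esub>r\<in>UNIV. \<Oplus>\<^bsub>T2\<^esub>q\<in>UNIV. p2 (gen (L p r w) q) (wedge (?\<beta> q j) (?\<beta> r p))) \<ominus>\<^bsub>T2\<^esub>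
        (\<Oplus>\<^bsub>T2\<^esub>p\<in>UNIV. \<Oplus>\<^bsub>T2\<^esub>r\<in>UNIV. ?Y p r)"
      unfolding K using p2[OF Lw] Y by (simp add: DB.G2.T.finsum_diff DB.G2.T.finsum_closed Pi_iff)
    also have "(\<Oplus>\<^bsub>T2\<^esub>p\<in>UNIV. \<Oplus>\<^bsub>T2\<^esub>r\<in>UNIV. ?Y p r) = \<zero>\<^bsub>T2\<^esub>"
    proof -
      have "(\<Oplus>\<^bsub>T2\<^esub>p\<in>UNIV. \<Oplus>\<^bsub>T2\<^esub>r\<in>UNIV. ?Y p r) = (\<Oplus>\<^bsub>T2\<^esub>r\<in>UNIV. \<Oplus>\<^bsub>T2\<^esub>p\<in>UNIV. ?Y p r)"
        by (rule DB.G2.T.finsum_swap) (simp_all only: finite Y)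
      also have "\<dots> = (\<Oplus>\<^bsub>T2\<^esub>r\<in>(UNIV :: 'n set). \<zero>\<^bsub>T2\<^esub>)"
      proof -
        have "(\<Oplus>\<^bsub>T2\<^esub>p\<in>UNIV. ?Y p r) = \<zero>\<^bsub>T2\<^esub>" for r
        proof -
          have "(\<Oplus>\<^bsub>T2\<^esub>p\<in>UNIV. ?Y p r) = (\<Oplus>\<^bsub>T2\<^esub>p'\<in>UNIV. \<Oplus>\<^bsub>T2\<^esub>p\<in>UNIV. p2 (gen (L p' r w) j) (wedge (?\<beta> p p') (?\<beta> r p)))"
            by (rule DB.G2.T.finsum_swap) (simp_all only: finite p2[OF Lw])
          \<comment> \<open>As they stand the repeated index p sits at the outer ends of the wedge.
            Exchanging the factors brings it to the middle, where the contraction applies.\<close>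
          also have "\<dots> = (\<Oplus>\<^bsub>T2\<^esub>p'\<in>UNIV. \<ominus>\<^bsub>T2\<^esub> (\<Oplus>\<^bsub>T2\<^esub>p\<in>UNIV. p2 (gen (L p' r w) j) (wedge (?\<beta> r p) (?\<beta> p p'))))"
            unfolding flip[OF Lw, of _ r j _ _ r] neg_sum[OF p2[OF Lw]] ..
          also have "\<dots> = (\<Oplus>\<^bsub>T2\<^esub>p'\<in>(UNIV :: 'n set). \<zero>\<^bsub>T2\<^esub>)"
            by (simp only: contract[OF Lw] mz)
          finally show ?thesis by simp
        qed
        then show ?thesis by (simp only:)
      qed
      finally show ?thesis by simp
    qed
    also have "(\<Oplus>\<^bsub>T2\<^esub>p\<in>UNIV. \<Oplus>\<^bsub>T2\<^esub>r\<in>UNIV. \<Oplus>\<^bsub>T2\<^esub>q\<in>UNIV. p2 (gen (L p r w) q) (wedge (?\<beta> q j) (?\<beta> r p))) = \<ominus>\<^bsub>T2\<^esub> X"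
    proof -
      let ?Z = "\<lambda>q p r. p2 (gen (L p r w) q) (wedge (?\<beta> q j) (?\<beta> r p))"
      have "(\<Oplus>\<^bsub>T2\<^esub>r\<in>UNIV. \<Oplus>\<^bsub>T2\<^esub>q\<in>UNIV. ?Z q p r) = (\<Oplus>\<^bsub>T2\<^esub>q\<in>UNIV. \<Oplus>\<^bsub>T2\<^esub>r\<in>UNIV. ?Z q p r)" for p
        by (rule DB.G2.T.finsum_swap) (simp_all only: finite p2[OF Lw])
      then have "(\<Oplus>\<^bsub>T2\<^esub>p\<in>UNIV. \<Oplus>\<^bsub>T2\<^esub>r\<in>UNIV. \<Oplus>\<^bsub>T2\<^esub>q\<in>UNIV. ?Z q p r) = (\<Oplus>\<^bsub>T2\<^esub>p\<in>UNIV. \<Oplus>\<^bsub>T2\<^esub>q\<in>UNIV. \<Oplus>\<^bsub>T2\<^esub>r\<in>UNIV. ?Z q p r)"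
        by (simp only:)
      also have "\<dots> = (\<Oplus>\<^bsub>T2\<^esub>q\<in>UNIV. \<Oplus>\<^bsub>T2\<^esub>p\<in>UNIV. \<Oplus>\<^bsub>T2\<^esub>r\<in>UNIV. ?Z q p r)"
        by (rule DB.G2.T.finsum_swap) (use p2[OF Lw] in \<open>simp_all add: DB.G2.T.finsum_closed Pi_iff\<close>)
      also have "\<dots> = (\<Oplus>\<^bsub>T2\<^esub>q\<in>UNIV. \<Oplus>\<^bsub>T2\<^esub>p\<in>UNIV. \<Oplus>\<^bsub>T2\<^esub>r\<in>UNIV. \<ominus>\<^bsub>T2\<^esub> p2 (gen (L p r w) q) (wedge (?\<beta> r p) (?\<beta> q j)))"
      proof -
        have "?Z q p r = \<ominus>\<^bsub>T2\<^esub> p2 (gen (L p r w) q) (wedge (?\<beta> r p) (?\<beta> q j))" for q p r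
          by (rule flip[OF Lw])
        then show ?thesis by (simp only:)
      qed
      also have "\<dots> = \<ominus>\<^bsub>T2\<^esub> X"
        unfolding X_def using p2[OF Lw] by (simp add: neg_sum DB.G2.T.finsum_closed Pi_iff)
      finally show ?thesis .
    qed
    finally show ?thesis using X by (simp add: DB.G2.T.minus_eq)
  qed
  let ?A = "\<Oplus>\<^bsub>TO\<^esub>q\<in>UNIV. po (gen w q) (?\<beta> q j)"
  let ?B = "\<Oplus>\<^bsub>TO\<^esub>p\<in>UNIV. \<Oplus>\<^bsub>TO\<^esub>r\<in>UNIV. po (gen (L p r w) j) (?\<beta> r p)"
  have A: "?A \<in> carrier TO" using po[OF w] by (simp add: TR.H\<Omega>.T.finsum_closed Pi_iff)
  have B: "?B \<in> carrier TO" using po[OF Lw] by (simp add: TR.H\<Omega>.T.finsum_closed Pi_iff)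
  have "curvature (VC_mod V) TR.nabT (gen w j) = ?K ?A \<ominus>\<^bsub>T2\<^esub> ?K ?B"
    unfolding DB.curvature_eq nab_generator[OF w]
    by (rule additive_map_minus[OF abelian_TO abelian_T2 DB.lift_K2_additive A B])
  also have "?K ?A = (\<Oplus>\<^bsub>T2\<^esub>q\<in>UNIV. DB.K2 (gen w q) (?\<beta> q j))"
    using po[OF w] by (simp add: additive_map_finsum[OF abelian_TO abelian_T2 DB.lift_K2_additive] Pi_iff
        DB.lift_K2_pure[OF gen_closed[OF w] v_dvbar_closed])
  also have "?K ?B = (\<Oplus>\<^bsub>T2\<^esub>p\<in>UNIV. \<Oplus>\<^bsub>T2\<^esub>r\<in>UNIV. DB.K2 (gen (L p r w) j) (?\<beta> r p))"
    using po[OF Lw] by (simp add: additive_map_finsum[OF abelian_TO abelian_T2 DB.lift_K2_additive] Pi_iff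
        DB.lift_K2_pure[OF gen_closed[OF Lw] v_dvbar_closed] TR.H\<Omega>.T.finsum_closed)
  \<comment> \<open>Both halves equal -X, so their difference is zero.\<close>
  finally show ?thesis
    unfolding S1 S2 using X by (simp add: DB.G2.T.minus_eq DB.G2.T.l_neg)
qed

lemma curvature_VC:
  assumes x: "x \<in> carrier (VC_mod V)"
  shows "curvature (VC_mod V) TR.nabT x = \<zero>\<^bsub>T2\<^esub>"
proof -
  have zero: "additive_map VC.T T2 (\<lambda>x. \<zero>\<^bsub>T2\<^esub>)"
    by (rule additive_mapI) simp_all
  have add: "additive_map VC.T T2 (curvature (VC_mod V) TR.nabT)"
    using DB.curvature_additive by simp
  have x': "x \<in> carrier VC.T" using x by simp
  show ?thesis
  proof (rule VC.tensor_ext[OF x' add zero])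
    fix w f assume "w \<in> carrier (underlying_space V)"
      and "f \<in> carrier (Cinf_module (-1) :: (complex, complex^'n \<Rightarrow> complex, complex^'n \<Rightarrow> complex) bimod)"
    then have w: "w \<in> carrier V" and f: "f \<in> Cinf (-1)" by simp_all
    have w': "w \<in> carrier (underlying_space V)" using w by simp
    have c: "(\<lambda>j. ract (Cinf_module (-1)) (vbar j) (coord j f)) \<in> UNIV \<rightarrow> carrier (Cinf_module (-1))"
      using Cinf_mult[OF Cinf_vbar coord_closed[OF f], of "-1"] by simp
    have b: "coord j f \<in> carrier CP" for j using coord_closed[OF f] by simp
    have e: "VC.pt w (ract (Cinf_module (-1)) (vbar j) (coord j f)) = ract (VC_mod V) (gen w j) (coord j f)" for j
      using VC.act_pure[OF w', of "vbar j" "coord j f"] Cinf_vbar[of j] b[of j] by simp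
    have g: "ract (VC_mod V) (gen w j) (coord j f) \<in> carrier VC.T" for j
      using right_moduleD(3)[OF right_VC gen_closed[OF w] b] by simp
    have z: "curvature (VC_mod V) TR.nabT (ract (VC_mod V) (gen w j) (coord j f)) = \<zero>\<^bsub>T2\<^esub>" for j
      unfolding DB.curvature_act[OF gen_closed[OF w] coord_closed[OF f]] curvature_generator[OF w]
      by (rule additive_map_zero[OF abelian_T2 abelian_T2 DB.G2.act_additive[OF b]])
    have "VC.pt w f = VC.pt w (finsum (Cinf_module (-1)) (\<lambda>j. ract (Cinf_module (-1)) (vbar j) (coord j f)) UNIV)"
      using vbar_expansion[OF f] by simp
    also have "\<dots> = (\<Oplus>\<^bsub>VC.T\<^esub>j\<in>UNIV. ract (VC_mod V) (gen w j) (coord j f))"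
      unfolding VC.pure_finsum_right[OF w' c] e ..
    finally have "curvature (VC_mod V) TR.nabT (VC.pt w f) =
        (\<Oplus>\<^bsub>T2\<^esub>j\<in>UNIV. curvature (VC_mod V) TR.nabT (ract (VC_mod V) (gen w j) (coord j f)))"
      using additive_map_finsum[OF VC.abelian_group_T abelian_T2 add, of "\<lambda>j. ract (VC_mod V) (gen w j) (coord j f)" UNIV] g
      by (simp only: Pi_iff) blast
    then show "curvature (VC_mod V) TR.nabT (VC.pt w f) = \<zero>\<^bsub>T2\<^esub>"
      by (simp only: z DB.G2.T.finsum_zero)
  qed
qed

text \<open>Curvature was computed on V \<otimes> C_-1; \<open>curvature_nat\<close> is applied to
  the inverse of the identification, whose source is that module.\<close>

lemma curvature_FE:
  assumes g: "g \<in> carrier FE_mod"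
  shows "curvature FE_mod nabC g = \<zero>\<^bsub>rtensor CP FE_mod Omega02\<^esub>"
proof -
  have X: "dbar_connection FE_mod nabC" by (rule dbar_connection.intro[OF conn_nabC])
  interpret TM: tensor_map CP "VC_mod V" Omega02 FE_mod TR.Tinv
    by (rule tensor_mapI[OF right_VC TR.c(1) bimoduleD(2)[OF bimodule_Omega02] TR.Tinv_hom])
  have i: "identification V g \<in> carrier (VC_mod V)"
    by (rule right_module_homD(3)[OF identification_hom g])
  have "curvature FE_mod nabC g = curvature FE_mod nabC (TR.Tinv (identification V g))"
    by (simp only: TR.Tinv_T[OF g])
  also have "\<dots> = TM.Uid (curvature (VC_mod V) TR.nabT (identification V g))"
    by (rule curvature_nat[OF DB.dbar_connection_axioms X TR.Tinv_hom TR.nab_Tinv i])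
  also have "\<dots> = \<zero>\<^bsub>TM.M'.T\<^esub>"
    unfolding curvature_VC[OF i] by (rule additive_map_zero[OF abelian_T2 TM.M'.abelian_group_T TM.Uid_additive])
  finally show ?thesis by simp
qed

end

text \<open>\<theta> acts on the factor V only, and the identification changes that factor only by a
  scalar matrix, with which \<theta> commutes.\<close>

lemma (in matrix_module_map) identification_nat:
  assumes x: "x \<in> carrier (rtensor Mat (F_mod V) (E_mod :: (complex^'n^'n, complex^'n \<Rightarrow> complex, 'n E_type) bimod))"
  shows "identification W (composite_mor V W \<theta> x) = VC_mor V W \<theta> (identification V x)"
proof -
  interpret VCM: tensor_map complex_ring "underlying_space V"
      "Cinf_module (-1) :: (complex, complex^'n \<Rightarrow> complex, complex^'n \<Rightarrow> complex) bimod" "underlying_space W" \<theta>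
    by (rule tensor_mapI[OF V.right_us W.right_us bimoduleD(2)[OF bimodule_Cinf] \<theta>_hom])
  interpret FEM: tensor_map Mat "F_mod V" "E_mod :: (complex^'n^'n, complex^'n \<Rightarrow> complex, 'n E_type) bimod" "F_mod W" "F_mor V W \<theta>"
    by (rule tensor_mapI[OF V.right_F W.right_F bimoduleD(2)[OF BC.bi_E] F_mor_hom])
  have cm: "composite_mor V W \<theta> = FEM.Uid"
    by (simp add: composite_mor_def tensor_E_mor_def tensor_bimodule_mor_def V.F_obj_eq W.F_obj_eq fun_eq_iff)
  have x': "x \<in> carrier V.CT.FE.T" using x by simp
  have a1: "additive_map V.CT.FE.T W.VC.T (\<lambda>x. identification W (FEM.Uid x))"
    by (rule additive_map_comp[OF FEM.Uid_additive W.identification_additive])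
  have a2: "additive_map V.CT.FE.T W.VC.T (\<lambda>x. VCM.Uid (identification V x))"
    by (rule additive_map_comp[OF V.identification_additive VCM.Uid_additive])
  show ?thesis
    unfolding cm VC_mor_def
  proof (rule V.CT.FE.tensor_ext[OF x' a1 a2])
    fix f and e :: "'n E_type" assume f: "f \<in> carrier (F_mod V)" and e: "e \<in> carrier E_mod"
    have f': "f \<in> carrier V.VR.T" and e': "e \<in> carrier EM.T" using f e by simp_all
    have Ff: "F_mor V W \<theta> f \<in> carrier (F_mod W)" by (rule right_module_homD(3)[OF F_mor_hom f])
    have "W.id2 (F_mor V W \<theta> f) e = VCM.Uid (V.id2 f e)"
    proof (rule V.VR.tensor_ext[OF f' additive_map_comp[OF U.Uid_additive[folded F_mor_eq] W.id2_additive[OF e']]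
          additive_map_comp[OF V.id2_additive[OF e'] VCM.Uid_additive]])
      fix w and r :: "complex^'n" assume "w \<in> carrier (underlying_space V)"
      then have w: "w \<in> carrier V" by simp
      have "W.id1 (\<theta> w) r e = VCM.Uid (V.id1 w r e)"
      proof (rule EM.tensor_ext[OF e' W.id1_additive[OF \<theta>_closed[OF w]]
            additive_map_comp[OF V.id1_additive[OF w] VCM.Uid_additive]])
        fix h :: "complex^'n" and g :: "complex^'n \<Rightarrow> complex"
        assume g: "g \<in> carrier (Cinf_module (-1) :: (complex, complex^'n \<Rightarrow> complex, complex^'n \<Rightarrow> complex) bimod)"
        then show "W.id1 (\<theta> w) r (EM.pt h g) = VCM.Uid (V.id1 w r (EM.pt h g))"
          using VCM.Uid_pure[of "mat (rdot r h) \<odot>\<^bsub>V\<^esub> w" g]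
          by (simp add: W.id1_pure V.id1_pure w \<theta>_closed \<theta>_act V.act_V)
      qed
      then show "W.id2 (F_mor V W \<theta> (V.VR.pt w r)) e = VCM.Uid (V.id2 (V.VR.pt w r) e)"
        by (simp add: F_mor_pure w V.id2_pure[OF e'] W.id2_pure[OF e'] \<theta>_closed)
    qed
    then show "identification W (FEM.Uid (V.CT.FE.pt f e)) = VCM.Uid (identification V (V.CT.FE.pt f e))"
      by (simp only: FEM.Uid_pure[OF f e] V.identification_pure[OF f e] W.identification_pure[OF Ff e])
  qed
qed

text \<open>A composite of three functors: V to F, tensoring with E, and passage to the (0,1)-part.
  Holomorphic bundles form a full subcategory, so flatness has to be checked on objects
  alone.\<close>

theorem holomorphic_functor:
  "is_functor (left_module_category Mat :: ((complex^'n::finite^'n, 'v) module, 'v \<Rightarrow> 'v) category)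
    holomorphic_category composite_obj composite_mor"
  unfolding holomorphic_category_def
proof (rule functor_full_subcategory)
  have "is_functor (left_module_category Mat :: ((complex^'n^'n, 'v) module, 'v \<Rightarrow> 'v) category)
      (connection_category CP Omega01 dbar0) (\<lambda>V. dbar_part (tensor_E_obj (F_obj V)))
      (\<lambda>V W \<theta>. tensor_E_mor (F_obj V) (F_obj W) (F_mor V W \<theta>))"
    unfolding tensor_E_obj_def tensor_E_mor_def
    by (rule functor_comp[OF functor_comp[OF F_functor BC.tensor_bimodule_functor] dbar_functor])
  then show "is_functor (left_module_category Mat :: ((complex^'n^'n, 'v) module, 'v \<Rightarrow> 'v) category)
      (connection_category CP Omega01 dbar0) composite_obj composite_mor"
    by (simp add: composite_obj_def[abs_def] composite_mor_def[abs_def])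
next
  fix V :: "(complex^'n^'n, 'v) module" assume "V \<in> obj (left_module_category Mat)"
  then interpret matrix_module V by unfold_locales simp
  show "composite_obj V \<in> {(G, nab). right_connection CP Omega01 dbar0 G nab \<and>
      (\<forall>g\<in>carrier G. curvature G nab g = \<zero>\<^bsub>rtensor CP G Omega02\<^esub>)}"
    using conn_nabC curvature_FE by (simp only: composite_obj_eq mem_Collect_eq prod.case) blast
qed (rule is_category_connection_subcategory, auto)

text \<open>The clauses on \<open>is_nabla_E\<close>, \<open>is_sigma_E\<close> and
  \<open>is_nabla_F\<close> certify that the definite descriptions denote the intended data. The
  module V \<otimes> C_-1 is reached through the isomorphism \<open>identification\<close>, so the
  claim about objects is accompanied by an isomorphism of connections and by naturality in
  V.\<close>

theorem proposition6p6:
  shows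
   "is_nabla_E (nabla_E :: 'n::finite E_type \<Rightarrow> ('n E_type, 'n form1) tens) \<and>
    is_sigma_E (sigma_E :: ('n uniform, 'n E_type) tens \<Rightarrow> ('n E_type, 'n form1) tens) \<and>
    is_functor
      (left_module_category Mat :: ((complex^'n^'n, 'v) module, 'v \<Rightarrow> 'v) category)
      (connection_category Mat Omega_uni d_uni) F_obj F_mor \<and>
    (\<forall>V :: (complex^'n^'n, 'v) module. left_module Mat V \<longrightarrow> is_nabla_F V (snd (F_obj V))) \<and>
    is_functor
      (connection_category Mat Omega_uni d_uni ::
        ((complex^'n^'n, 'f) rmod \<times> ('f \<Rightarrow> ('f, 'n uniform) tens), 'f \<Rightarrow> 'f) category)
      (connection_category CP Omega1 d0) tensor_E_obj tensor_E_mor \<and>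
    is_functor
      (left_module_category Mat :: ((complex^'n^'n, 'v) module, 'v \<Rightarrow> 'v) category)
      holomorphic_category composite_obj composite_mor \<and>
    (\<forall>V :: (complex^'n^'n, 'v) module. left_module Mat V \<longrightarrow>
      (\<forall>w\<in>carrier V. \<forall>a i. \<forall>f\<in>Cinf (-1).
        identification V
          (pure_tensor Mat (F_mod V) E_mod (F_tensor V w (axis a 1)) (E_tensor (axis i 1) f)) =
        (if a = i then VC_tensor V w f else \<zero>\<^bsub>VC_mod V\<^esub>)) \<and>
      (\<exists>dbar_V.
        (VC_mod V, dbar_V) \<in> obj holomorphic_category \<and>
        connection_iso CP Omega01 (composite_obj V) (VC_mod V, dbar_V) (identification V) \<and>
        (\<forall>w\<in>carrier V. \<forall>j.
          dbar_V (VC_tensor V w (vbar j)) =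
            (\<Oplus>\<^bsub>rtensor CP (VC_mod V) Omega01\<^esub>q\<in>UNIV.
               pure_tensor CP (VC_mod V) Omega01 (VC_tensor V w (vbar q)) (v_dvbar q j))
            \<ominus>\<^bsub>rtensor CP (VC_mod V) Omega01\<^esub>
            (\<Oplus>\<^bsub>rtensor CP (VC_mod V) Omega01\<^esub>p\<in>UNIV. \<Oplus>\<^bsub>rtensor CP (VC_mod V) Omega01\<^esub>r\<in>UNIV.
               pure_tensor CP (VC_mod V) Omega01
                 (VC_tensor V (matrix_unit p r \<odot>\<^bsub>V\<^esub> w) (vbar j)) (v_dvbar r p))))) \<and>
    (\<forall>V W :: (complex^'n^'n, 'v) module. \<forall>\<theta>.
      left_module Mat V \<and> left_module Mat W \<and> \<theta> \<in> left_module_hom Mat V W \<longrightarrow>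
      (\<forall>x\<in>carrier (fst (composite_obj V)).
        identification W (composite_mor V W \<theta> x) = VC_mor V W \<theta> (identification V x)))"
proof (intro conjI allI impI)
  show "is_nabla_E (nabla_E :: 'n E_type \<Rightarrow> ('n E_type, 'n form1) tens)" by (rule is_nabla_E_nabla_E)
  show "is_sigma_E (sigma_E :: ('n uniform, 'n E_type) tens \<Rightarrow> ('n E_type, 'n form1) tens)" by (rule is_sigma_E_sigma_E)
  show "is_functor (left_module_category Mat :: ((complex^'n^'n, 'v) module, 'v \<Rightarrow> 'v) category)
      (connection_category Mat Omega_uni d_uni) F_obj F_mor" by (rule F_functor)
  show "is_functor (connection_category Mat Omega_uni d_uni ::
        ((complex^'n^'n, 'f) rmod \<times> ('f \<Rightarrow> ('f, 'n uniform) tens), 'f \<Rightarrow> 'f) category)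
      (connection_category CP Omega1 d0) tensor_E_obj tensor_E_mor"
    unfolding tensor_E_obj_def tensor_E_mor_def by (rule BC.tensor_bimodule_functor)
  show "is_functor (left_module_category Mat :: ((complex^'n^'n, 'v) module, 'v \<Rightarrow> 'v) category)
      holomorphic_category composite_obj composite_mor" by (rule holomorphic_functor)
next
  fix V :: "(complex^'n^'n, 'v) module" assume "left_module Mat V"
  then interpret matrix_module V by unfold_locales
  show "is_nabla_F V (snd (F_obj V))" by (simp add: F_obj_eq is_nabla_F_nabF)
  show "\<forall>w\<in>carrier V. \<forall>a i. \<forall>f\<in>Cinf (-1).
      identification V (pure_tensor Mat (F_mod V) E_mod (F_tensor V w (axis a 1)) (E_tensor (axis i 1) f)) =
      (if a = i then VC_tensor V w f else \<zero>\<^bsub>VC_mod V\<^esub>)"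
  proof (intro ballI allI)
    fix w a i and f :: "complex^'n \<Rightarrow> complex" assume w: "w \<in> carrier V" and f: "f \<in> Cinf (-1)"
    show "identification V (pure_tensor Mat (F_mod V) E_mod (F_tensor V w (axis a 1)) (E_tensor (axis i 1) f)) =
      (if a = i then VC_tensor V w f else \<zero>\<^bsub>VC_mod V\<^esub>)"
      using identification_tensor[OF w f, of "axis a 1" "axis i 1"] VC.pure_zero(2)[of f] f
      by (simp add: F_tensor_eq E_tensor_eq VC_tensor_eq rdot_axis act_V_one act_V_zero w)
  qed
  show "\<exists>dbar_V. (VC_mod V, dbar_V) \<in> obj holomorphic_category \<and>
      connection_iso CP Omega01 (composite_obj V) (VC_mod V, dbar_V) (identification V) \<and>
      (\<forall>w\<in>carrier V. \<forall>j. dbar_V (VC_tensor V w (vbar j)) =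
        (\<Oplus>\<^bsub>rtensor CP (VC_mod V) Omega01\<^esub>q\<in>UNIV.
           pure_tensor CP (VC_mod V) Omega01 (VC_tensor V w (vbar q)) (v_dvbar q j))
        \<ominus>\<^bsub>rtensor CP (VC_mod V) Omega01\<^esub>
        (\<Oplus>\<^bsub>rtensor CP (VC_mod V) Omega01\<^esub>p\<in>UNIV. \<Oplus>\<^bsub>rtensor CP (VC_mod V) Omega01\<^esub>r\<in>UNIV.
           pure_tensor CP (VC_mod V) Omega01
             (VC_tensor V (matrix_unit p r \<odot>\<^bsub>V\<^esub> w) (vbar j)) (v_dvbar r p)))"
  \<comment> \<open>The witness is the connection transported along the identification, which makes
    the latter an isomorphism of connections by construction.\<close>
  proof (intro exI[of _ TR.nabT] conjI ballI allI)
    show "(VC_mod V, TR.nabT) \<in> obj holomorphic_category"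
      using TR.conn_nabT curvature_VC by (simp add: holomorphic_category_def)
    show "connection_iso CP Omega01 (composite_obj V) (VC_mod V, TR.nabT) (identification V)"
      unfolding composite_obj_eq by (rule TR.iso_T)
  qed (simp add: VC_tensor_eq nab_generator)
next
  fix V W :: "(complex^'n^'n, 'v) module" and \<theta>
  assume "left_module Mat V \<and> left_module Mat W \<and> \<theta> \<in> left_module_hom Mat V W"
  then interpret matrix_module_map V W \<theta> by unfold_locales simp_all
  show "\<forall>x\<in>carrier (fst (composite_obj V)).
      identification W (composite_mor V W \<theta> x) = VC_mor V W \<theta> (identification V x)"
    using identification_nat by (simp only: V.composite_obj_eq fst_conv) blast
qed

end
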